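(* Let $\boldsymbol\eta\in\mathscr C^{0,\alpha}_g([0,T],\mathbb R^d)$, let $\beta\in(\frac14,\alpha]$, $\beta'\in(0,\beta]$ with $\alpha+\beta>\frac12$ and $\alpha+\beta+\beta'>1$, and let $(F,F')\in\mathscr D^{\beta,\beta'}_\eta L_\infty$ and $(f,f')\in\mathbf D_\eta^{\beta,\beta'}L_\infty$. Then for every $x\in\mathbb R^{d_X}$ the equation $$\phi_t(x)=x+\int_0^t(F_r\phi_r(x)+f_r)\,d\boldsymbol\eta_r$$ has a unique solution $\phi(x)$ in $\mathbf D_\eta^{\alpha,\beta}L_m$ for any $m\in[2,\infty)$, and the random mapping $x\mapsto\phi_t(x)$ is affine and invertible for all $t\in[0,T]$. In particular, there exist $$(A,A')\in\mathscr D_\eta^{\alpha,\beta}L_\infty,\qquad(\zeta,\zeta')\in\mathbf D_\eta^{\alpha,\beta}L_m,$$ such that $$\phi_t(x)=A_tx+\zeta_t\quad\text{and}\quad\phi_t^{-1}(x)=A_t^{-1}x-A_t^{-1}\zeta_t,$$ where $(A^{-1},A^{-1,\prime})\in\mathscr D_\eta^{\alpha,\beta}L_\infty$ and $\mathbb P$-a.s. $A_t^{-1}A_t=I_{d_X\times d_X}$ for all $t\in[0,T]$.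
   Context: Fix $T>0$, $\alpha\in(\frac13,\frac12)$, and a probability space $(\Omega,\mathcal F,\mathbb P)$ carrying a $d_W$-dimensional Brownian motion $W$; $(\mathcal F_t)$ is the $\mathbb P$-augmentation of its filtration. Write $\|\xi\|_p=\mathbb E[|\xi|^p]^{1/p}$ (and $\|\xi\|_\infty$ for the essential supremum), $\Delta=\{(s,t):0\le s<t\le T\}$, $\delta X_{s,t}=X_t-X_s$, $\mathbb E_s=\mathbb E[\cdot|\mathcal F_s]$. For a two-parameter process $A$ put $\|A\|_{\gamma,p}=\sup_{(s,t)\in\Delta}\|A_{s,t}\|_p/|t-s|^\gamma$ and $\|\mathbb E_\bullet A\|_{\gamma,p}=\sup_{(s,t)\in\Delta}\|\mathbb E_sA_{s,t}\|_p/|t-s|^\gamma$. Rough paths: an $\alpha$-Hölder rough path $\boldsymbol\eta=(\eta,\eta^{(2)})$ consists of continuous $\eta:[0,T]\to\mathbb R^d$, $\eta^{(2)}:\Delta\to\mathbb R^{d\times d}$ with $\sup|\delta\eta_{s,t}|/|t-s|^\alpha<\infty$, $\sup|\eta^{(2)}_{s,t}|/|t-s|^{2\alpha}<\infty$, $\eta^{(2)}_{s,t}-\eta^{(2)}_{s,u}-\eta^{(2)}_{u,t}=\delta\eta_{s,u}\otimes\delta\eta_{u,t}$. $\mathscr C^{0,\alpha}_g$ (geometric rough paths) is the completion of canonical lifts $(\eta,\int\delta\eta\otimes d\eta)$ of smooth paths under the $\alpha$-Hölder rough path metric. Controlled rough paths: $(Z,Z')\in\mathbf D_\eta^{\gamma,\gamma'}L_p$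 ($\gamma,\gamma'\in(0,\alpha]$) means that $Z$ ($V$-valued, $V$ Euclidean) and $Z'$ ($\mathcal L(\mathbb R^d;V)$-valued) are progressively measurable with $\|Z_0\|_p,\|Z_0'\|_p,\|\delta Z\|_{\gamma,p},\|\delta Z'\|_{\gamma',p},\|\mathbb E_\bullet R^Z\|_{\gamma+\gamma',p}<\infty$, where $R^Z_{s,t}=\delta Z_{s,t}-Z'_s\delta\eta_{s,t}$. If moreover $\|R^Z\|_{\gamma+\gamma',p}<\infty$, write $(Z,Z')\in\mathscr D^{\gamma,\gamma'}_\eta L_p$. For $\gamma'\le\gamma$, $\alpha+\gamma>\frac12$, $\alpha+\gamma+\gamma'>1$, the rough stochastic integral is $\int_0^tZ_r\,d\boldsymbol\eta_r=\lim_{|\Pi|\to0}\sum_{[u,v]\in\Pi}(Z_u\delta\eta_{u,v}+Z'_u\eta^{(2)}_{u,v})$ (limit in probability over partitions $\Pi$ of $[0,t]$). $F$ takes values in $\mathcal L(\mathbb R^{d_X};\mathcal L(\mathbb R^d;\mathbb R^{d_X}))$ and $f$ in $\mathcal L(\mathbb R^d;\mathbb R^{d_X})$. In the equation the controlled integrand is $(F\phi+f,\ F'\phi+F(F\phi+f)+f')$, required to belong to $\mathbf D_\eta^{\gamma,\gamma'}L_m$ for some $\gamma\in(0,\alpha]$, $\gamma'\in(0,\gamma]$ with $\alpha+\gamma>\frac12$, $\alpha+\gamma+\gamma'>1$; "$\phi(x)\in\mathbf D_\eta^{\alpha,\beta}L_m$" means $(\phi(x),F\phi(x)+f)\in\mathbf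 D_\eta^{\alpha,\beta}L_m$. *)

theory Defs
  imports "HOL-Probability.Probability"
begin

section \<open>Linear maps and tensors\<close>

text \<open>
  For a Euclidean space \<open>V\<close>, the space \<open>L(R^d; V)\<close> is represented by the Euclidean space
  \<open>V^d\<close>: the component \<open>z $ i\<close> is the image of the \<open>i\<close>-th unit vector. The Hilbert--Schmidt norm
  that it carries is equivalent to the operator norm. Iterating, an element \<open>z\<close> of
  \<open>L(R^d; L(R^d; V))\<close> has components \<open>z $ i $ j = z(e_i)(e_j)\<close>, and it acts on \<open>R^d \<otimes> R^d\<close> by
  \<open>e_i \<otimes> e_j \<mapsto> z(e_i)(e_j)\<close>.
\<close>

definition lin_app :: "'v::euclidean_space ^ 'd \<Rightarrow> real ^ 'd \<Rightarrow> 'v"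
  where "lin_app z x = (\<Sum>i\<in>UNIV. x $ i *\<^sub>R z $ i)"

definition bilin_app :: "'v::euclidean_space ^ 'd ^ 'd \<Rightarrow> real ^ 'd ^ 'd \<Rightarrow> 'v"
  where "bilin_app z B = (\<Sum>i\<in>UNIV. \<Sum>j\<in>UNIV. B $ i $ j *\<^sub>R z $ i $ j)"

definition tensor :: "real ^ 'd \<Rightarrow> real ^ 'd \<Rightarrow> real ^ 'd ^ 'd"
  where "tensor a b = (\<chi> i j. a $ i * b $ j)"

definition affine_map :: "('v::real_vector \<Rightarrow> 'w::real_vector) \<Rightarrow> bool"
  where "affine_map g \<longleftrightarrow> (\<exists>L c. linear L \<and> (\<forall>x. g x = L x + c))"

section \<open>Geometric rough paths\<close>

definition simplex2 :: "real \<Rightarrow> (real \<times> real) set"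
  where "simplex2 T = {(s, t). 0 \<le> s \<and> s < t \<and> t \<le> T}"

definition holder_norm :: "real \<Rightarrow> real \<Rightarrow> (real \<Rightarrow> real \<Rightarrow> 'v::real_normed_vector) \<Rightarrow> ennreal"
  where "holder_norm T \<gamma> A = (SUP (s, t) \<in> simplex2 T. ennreal (norm (A s t) / (t - s) powr \<gamma>))"

definition rough_path ::
  "real \<Rightarrow> real \<Rightarrow> (real \<Rightarrow> real ^ 'd) \<Rightarrow> (real \<Rightarrow> real \<Rightarrow> real ^ 'd ^ 'd) \<Rightarrow> bool"
  where "rough_path T \<alpha> \<eta> \<eta>2 \<longleftrightarrow>
    continuous_on {0..T} \<eta> \<and>
    continuous_on (simplex2 T) (\<lambda>(s, t). \<eta>2 s t) \<and>
    holder_norm T \<alpha> (\<lambda>s t. \<eta> t - \<eta> s) < \<infinity> \<and>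
    holder_norm T (2 * \<alpha>) \<eta>2 < \<infinity> \<and>
    (\<forall>s u t. 0 \<le> s \<and> s < u \<and> u < t \<and> t \<le> T \<longrightarrow>
      \<eta>2 s t - \<eta>2 s u - \<eta>2 u t = tensor (\<eta> u - \<eta> s) (\<eta> t - \<eta> u))"

definition rough_dist ::
  "real \<Rightarrow> real \<Rightarrow> (real \<Rightarrow> real ^ 'd) \<Rightarrow> (real \<Rightarrow> real \<Rightarrow> real ^ 'd ^ 'd) \<Rightarrow>
   (real \<Rightarrow> real ^ 'd) \<Rightarrow> (real \<Rightarrow> real \<Rightarrow> real ^ 'd ^ 'd) \<Rightarrow> ennreal"
  where "rough_dist T \<alpha> \<eta> \<eta>2 \<nu> \<nu>2 =
    ennreal (norm (\<eta> 0 - \<nu> 0)) +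
    holder_norm T \<alpha> (\<lambda>s t. (\<eta> t - \<eta> s) - (\<nu> t - \<nu> s)) +
    holder_norm T (2 * \<alpha>) (\<lambda>s t. \<eta>2 s t - \<nu>2 s t)"

definition smooth_path :: "real \<Rightarrow> (real \<Rightarrow> 'v::real_normed_vector) \<Rightarrow> bool"
  where "smooth_path T g \<longleftrightarrow> (\<exists>D :: nat \<Rightarrow> real \<Rightarrow> 'v.
    D 0 = g \<and>
    (\<forall>k. \<forall>t\<in>{0..T}. (D k has_vector_derivative D (Suc k) t) (at t within {0..T})))"

definition canonical_lift :: "real \<Rightarrow> (real \<Rightarrow> real ^ 'd) \<Rightarrow> real \<Rightarrow> real \<Rightarrow> real ^ 'd ^ 'd"
  where "canonical_lift T g s t =
    integral {s..t} (\<lambda>r. tensor (g r - g s) (vector_derivative g (at r within {0..T})))"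

text \<open>
  The space of \<open>\<alpha>\<close>-Hoelder rough paths is complete, so the completion of the canonical lifts is
  realised as their closure among rough paths.
\<close>

definition geometric_rough_path ::
  "real \<Rightarrow> real \<Rightarrow> (real \<Rightarrow> real ^ 'd) \<Rightarrow> (real \<Rightarrow> real \<Rightarrow> real ^ 'd ^ 'd) \<Rightarrow> bool"
  where "geometric_rough_path T \<alpha> \<eta> \<eta>2 \<longleftrightarrow>
    rough_path T \<alpha> \<eta> \<eta>2 \<and>
    (\<exists>g :: nat \<Rightarrow> real \<Rightarrow> real ^ 'd. (\<forall>k. smooth_path T (g k)) \<and>
      (\<lambda>k. rough_dist T \<alpha> \<eta> \<eta>2 (g k) (canonical_lift T (g k))) \<longlonglongrightarrow> 0)"

section \<open>Brownian filtration\<close>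

definition brownian_motion :: "'a measure \<Rightarrow> real \<Rightarrow> (real \<Rightarrow> 'a \<Rightarrow> real ^ 'w) \<Rightarrow> bool"
  where "brownian_motion M T W \<longleftrightarrow>
    prob_space M \<and>
    (\<forall>t\<in>{0..T}. W t \<in> borel_measurable M) \<and>
    (AE \<omega> in M. W 0 \<omega> = 0) \<and>
    (AE \<omega> in M. continuous_on {0..T} (\<lambda>t. W t \<omega>)) \<and>
    (\<forall>(s, t) \<in> simplex2 T.
      (\<forall>i. distributed M lborel (\<lambda>\<omega>. (W t \<omega> - W s \<omega>) $ i) (normal_density 0 (sqrt (t - s)))) \<and>
      prob_space.indep_vars M (\<lambda>_. borel) (\<lambda>i \<omega>. (W t \<omega> - W s \<omega>) $ i) UNIV) \<and>
    (\<forall>(n::nat) \<tau>. 0 \<le> \<tau> 0 \<and> (\<forall>k<n. \<tau> k < \<tau> (Suc k)) \<and> \<tau> n \<le> T \<longrightarrow>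
      prob_space.indep_vars M (\<lambda>_. borel) (\<lambda>k \<omega>. W (\<tau> (Suc k)) \<omega> - W (\<tau> k) \<omega>) {..<n})"

text \<open>
  When \<open>M\<close> is complete, as is usually assumed, \<open>null_sets M\<close> contains all subsets of null events;
  otherwise only the null events of \<open>M\<close> itself are adjoined, so that the result is always a
  sub-\<open>\<sigma>\<close>-algebra of \<open>M\<close>.
\<close>

definition augmented_filtration ::
  "'a measure \<Rightarrow> (real \<Rightarrow> 'a \<Rightarrow> 'v::topological_space) \<Rightarrow> real \<Rightarrow> 'a measure"
  where "augmented_filtration M W t = sigma (space M)
    ({W s -` B \<inter> space M | s B. s \<in> {0..t} \<and> B \<in> sets borel} \<union> null_sets M)"

definition progressive ::
  "real \<Rightarrow> (real \<Rightarrow> 'a measure) \<Rightarrow> (real \<Rightarrow> 'a \<Rightarrow> 'v::topological_space) \<Rightarrow> bool"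
  where "progressive T Fil X \<longleftrightarrow>
    (\<forall>t\<in>{0..T}. (\<lambda>(s, \<omega>). X s \<omega>) \<in> restrict_space borel {0..t} \<Otimes>\<^sub>M Fil t \<rightarrow>\<^sub>M borel)"

section \<open>Stochastic controlled rough paths\<close>

definition Lp_norm :: "'a measure \<Rightarrow> ennreal \<Rightarrow> ('a \<Rightarrow> 'v::real_normed_vector) \<Rightarrow> ennreal"
  where "Lp_norm M p \<xi> =
    (if p = \<infinity> then esssup M (\<lambda>\<omega>. ennreal (norm (\<xi> \<omega>)))
     else let I = (\<integral>\<^sup>+ \<omega>. ennreal (norm (\<xi> \<omega>) powr enn2real p) \<partial>M)
          in if I = \<infinity> then \<infinity> else ennreal (enn2real I powr (1 / enn2real p)))"

definition cond_expectation ::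
  "'a measure \<Rightarrow> 'a measure \<Rightarrow> ('a \<Rightarrow> 'v::euclidean_space) \<Rightarrow> 'a \<Rightarrow> 'v"
  where "cond_expectation M G X \<omega> = (\<Sum>b\<in>Basis. real_cond_exp M G (\<lambda>\<omega>. X \<omega> \<bullet> b) \<omega> *\<^sub>R b)"

definition two_param_norm ::
  "'a measure \<Rightarrow> real \<Rightarrow> real \<Rightarrow> ennreal \<Rightarrow> (real \<Rightarrow> real \<Rightarrow> 'a \<Rightarrow> 'v::real_normed_vector) \<Rightarrow> ennreal"
  where "two_param_norm M T \<gamma> p A =
    (SUP (s, t) \<in> simplex2 T. Lp_norm M p (A s t) / ennreal ((t - s) powr \<gamma>))"

definition incr :: "(real \<Rightarrow> 'a \<Rightarrow> 'v::real_vector) \<Rightarrow> real \<Rightarrow> real \<Rightarrow> 'a \<Rightarrow> 'v"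
  where "incr X s t \<omega> = X t \<omega> - X s \<omega>"

definition remainder ::
  "(real \<Rightarrow> real ^ 'd) \<Rightarrow> (real \<Rightarrow> 'a \<Rightarrow> 'v::euclidean_space) \<Rightarrow> (real \<Rightarrow> 'a \<Rightarrow> 'v ^ 'd) \<Rightarrow>
   real \<Rightarrow> real \<Rightarrow> 'a \<Rightarrow> 'v"
  where "remainder \<eta> Z Z' s t \<omega> = incr Z s t \<omega> - lin_app (Z' s \<omega>) (\<eta> t - \<eta> s)"

text \<open>
  \<open>controlled\<close> is the class written with a bold \<open>D\<close> in the literature, where only the conditional
  expectation of the remainder is controlled; \<open>strongly_controlled\<close> is the one with a script \<open>D\<close>.
\<close>

definition controlled ::
  "'a measure \<Rightarrow> (real \<Rightarrow> 'a measure) \<Rightarrow> real \<Rightarrow> (real \<Rightarrow> real ^ 'd) \<Rightarrow> real \<Rightarrow> real \<Rightarrow> ennreal \<Rightarrow>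
   (real \<Rightarrow> 'a \<Rightarrow> 'v::euclidean_space) \<Rightarrow> (real \<Rightarrow> 'a \<Rightarrow> 'v ^ 'd) \<Rightarrow> bool"
  where "controlled M Fil T \<eta> \<gamma> \<gamma>' p Z Z' \<longleftrightarrow>
    progressive T Fil Z \<and> progressive T Fil Z' \<and>
    Lp_norm M p (Z 0) < \<infinity> \<and> Lp_norm M p (Z' 0) < \<infinity> \<and>
    two_param_norm M T \<gamma> p (incr Z) < \<infinity> \<and>
    two_param_norm M T \<gamma>' p (incr Z') < \<infinity> \<and>
    two_param_norm M T (\<gamma> + \<gamma>') p
      (\<lambda>s t. cond_expectation M (Fil s) (remainder \<eta> Z Z' s t)) < \<infinity>"

definition strongly_controlled ::
  "'a measure \<Rightarrow> (real \<Rightarrow> 'a measure) \<Rightarrow> real \<Rightarrow> (real \<Rightarrow> real ^ 'd) \<Rightarrow> real \<Rightarrow> real \<Rightarrow> ennreal \<Rightarrow>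
   (real \<Rightarrow> 'a \<Rightarrow> 'v::euclidean_space) \<Rightarrow> (real \<Rightarrow> 'a \<Rightarrow> 'v ^ 'd) \<Rightarrow> bool"
  where "strongly_controlled M Fil T \<eta> \<gamma> \<gamma>' p Z Z' \<longleftrightarrow>
    controlled M Fil T \<eta> \<gamma> \<gamma>' p Z Z' \<and>
    two_param_norm M T (\<gamma> + \<gamma>') p (remainder \<eta> Z Z') < \<infinity>"

section \<open>Rough stochastic integral and linear rough equation\<close>

definition rough_sum ::
  "(real \<Rightarrow> real ^ 'd) \<Rightarrow> (real \<Rightarrow> real \<Rightarrow> real ^ 'd ^ 'd) \<Rightarrow>
   (real \<Rightarrow> 'a \<Rightarrow> 'v::euclidean_space ^ 'd) \<Rightarrow> (real \<Rightarrow> 'a \<Rightarrow> 'v ^ 'd ^ 'd) \<Rightarrow>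
   nat \<Rightarrow> (nat \<Rightarrow> real) \<Rightarrow> 'a \<Rightarrow> 'v"
  where "rough_sum \<eta> \<eta>2 Z Z' n \<tau> \<omega> =
    (\<Sum>k<n. lin_app (Z (\<tau> k) \<omega>) (\<eta> (\<tau> (Suc k)) - \<eta> (\<tau> k)) +
            bilin_app (Z' (\<tau> k) \<omega>) (\<eta>2 (\<tau> k) (\<tau> (Suc k))))"

text \<open>\<open>I\<close> is the limit in probability of the compensated sums over partitions of \<open>[0, t]\<close>.\<close>

definition has_rough_integral ::
  "'a measure \<Rightarrow> (real \<Rightarrow> real ^ 'd) \<Rightarrow> (real \<Rightarrow> real \<Rightarrow> real ^ 'd ^ 'd) \<Rightarrow>
   (real \<Rightarrow> 'a \<Rightarrow> 'v::euclidean_space ^ 'd) \<Rightarrow> (real \<Rightarrow> 'a \<Rightarrow> 'v ^ 'd ^ 'd) \<Rightarrow>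
   real \<Rightarrow> ('a \<Rightarrow> 'v) \<Rightarrow> bool"
  where "has_rough_integral M \<eta> \<eta>2 Z Z' t I \<longleftrightarrow>
    I \<in> borel_measurable M \<and>
    (\<forall>\<epsilon>>0. \<forall>\<theta>>0. \<exists>h>0. \<forall>n \<tau>.
      \<tau> 0 = 0 \<and> \<tau> n = t \<and> (\<forall>k<n. \<tau> k < \<tau> (Suc k) \<and> \<tau> (Suc k) - \<tau> k < h) \<longrightarrow>
      measure M {\<omega> \<in> space M. norm (rough_sum \<eta> \<eta>2 Z Z' n \<tau> \<omega> - I \<omega>) > \<epsilon>} < \<theta>)"

text \<open>The controlled integrand \<open>F \<phi> + f\<close> together with its derivative
  \<open>F' \<phi> + F (F \<phi> + f) + f'\<close>. Here \<open>F t \<omega> $ j $ i = F(e_j)(e_i)\<close> and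
  \<open>F' t \<omega> $ l $ j $ i = F'(e_l)(e_j)(e_i)\<close>.\<close>

definition integrand ::
  "(real \<Rightarrow> 'a \<Rightarrow> real ^ 'n ^ 'd ^ 'n) \<Rightarrow> (real \<Rightarrow> 'a \<Rightarrow> real ^ 'n ^ 'd) \<Rightarrow>
   (real \<Rightarrow> 'a \<Rightarrow> real ^ 'n) \<Rightarrow> real \<Rightarrow> 'a \<Rightarrow> real ^ 'n ^ 'd"
  where "integrand F f \<phi> t \<omega> = lin_app (F t \<omega>) (\<phi> t \<omega>) + f t \<omega>"

definition integrand_deriv ::
  "(real \<Rightarrow> 'a \<Rightarrow> real ^ 'n ^ 'd ^ 'n) \<Rightarrow> (real \<Rightarrow> 'a \<Rightarrow> real ^ 'n ^ 'd ^ 'n ^ 'd) \<Rightarrow>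
   (real \<Rightarrow> 'a \<Rightarrow> real ^ 'n ^ 'd) \<Rightarrow> (real \<Rightarrow> 'a \<Rightarrow> real ^ 'n ^ 'd ^ 'd) \<Rightarrow>
   (real \<Rightarrow> 'a \<Rightarrow> real ^ 'n) \<Rightarrow> real \<Rightarrow> 'a \<Rightarrow> real ^ 'n ^ 'd ^ 'd"
  where "integrand_deriv F F' f f' \<phi> t \<omega> =
    (\<chi> l. lin_app (F' t \<omega> $ l) (\<phi> t \<omega>) + lin_app (F t \<omega>) (integrand F f \<phi> t \<omega> $ l) + f' t \<omega> $ l)"

text \<open>The integral is only determined almost surely at each time; the equation is accordingly
  required to hold almost surely at each time.\<close>

definition solves_linear_eq ::
  "'a measure \<Rightarrow> (real \<Rightarrow> 'a measure) \<Rightarrow> real \<Rightarrow> real \<Rightarrow> real \<Rightarrow> real \<Rightarrow>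
   (real \<Rightarrow> real ^ 'd) \<Rightarrow> (real \<Rightarrow> real \<Rightarrow> real ^ 'd ^ 'd) \<Rightarrow>
   (real \<Rightarrow> 'a \<Rightarrow> real ^ 'n ^ 'd ^ 'n) \<Rightarrow> (real \<Rightarrow> 'a \<Rightarrow> real ^ 'n ^ 'd ^ 'n ^ 'd) \<Rightarrow>
   (real \<Rightarrow> 'a \<Rightarrow> real ^ 'n ^ 'd) \<Rightarrow> (real \<Rightarrow> 'a \<Rightarrow> real ^ 'n ^ 'd ^ 'd) \<Rightarrow>
   real ^ 'n \<Rightarrow> (real \<Rightarrow> 'a \<Rightarrow> real ^ 'n) \<Rightarrow> bool"
  where "solves_linear_eq M Fil T \<alpha> \<beta> m \<eta> \<eta>2 F F' f f' x \<phi> \<longleftrightarrow>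
    controlled M Fil T \<eta> \<alpha> \<beta> (ennreal m) \<phi> (integrand F f \<phi>) \<and>
    (\<exists>\<gamma> \<gamma>'. 0 < \<gamma> \<and> \<gamma> \<le> \<alpha> \<and> 0 < \<gamma>' \<and> \<gamma>' \<le> \<gamma> \<and> \<alpha> + \<gamma> > 1 / 2 \<and> \<alpha> + \<gamma> + \<gamma>' > 1 \<and>
      controlled M Fil T \<eta> \<gamma> \<gamma>' (ennreal m) (integrand F f \<phi>) (integrand_deriv F F' f f' \<phi>)) \<and>
    (\<forall>t\<in>{0..T}. \<exists>I.
      has_rough_integral M \<eta> \<eta>2 (integrand F f \<phi>) (integrand_deriv F F' f f' \<phi>) t I \<and>
      (AE \<omega> in M. \<phi> t \<omega> = x + I \<omega>))"

end

theory Submission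
  imports Defs
begin

text \<open>
  The equation is linear, so everything follows from its fundamental solution \<open>A\<close>. One Euler step
  of the homogeneous equation is multiplication by a matrix \<open>flow_matrix\<close>. By Chen's relation and the
  bounds on the remainder of \<open>F\<close>, the product of two consecutive steps differs from the joint step by
  order \<open>\<alpha> + \<beta> + \<beta>' > 1\<close> (\<open>flow_step_identity\<close>), so products over ever finer partitions converge
  (\<open>multiplicative_sewing\<close>). This is pathwise: bounds in \<open>L\<^sub>\<infinity>\<close> give a version of \<open>F\<close> with Hoelder
  paths (\<open>exists_regular_version\<close>), so \<open>A\<close> is bounded, Hoelder and invertible for every \<open>w\<close>, and its
  inverse \<open>B\<close> has the same bounds (\<open>exists_fundamental_solution\<close>).

  The remainder of \<open>f\<close> is small only in conditional expectation, so the inhomogeneous part needs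
  stochastic sewing. Write the solution as \<open>A x + A I\<close>. Then \<open>I\<close> has to be the sewing of the source
  increments transported back to time zero, \<open>B t *v src s t\<close>, whose defect is a linear function of the
  remainder of \<open>f\<close> up to order above one (\<open>defect_Xi\<close>). The sewing exists and has moments of all orders
  (\<open>vector_stochastic_sewing\<close>), and Kolmogorov's theorem makes it continuous
  (\<open>exists_transported_solution\<close>).

  Being a solution is the same as having a small \<open>local_error\<close>: of order above one half in the mean and
  of order above one after conditioning. A process with such an expansion is the limit of the
  compensated sums (\<open>has_rough_integral_of_expansion\<close>), and sewing gives the converse
  (\<open>expansion_of_rough_integral\<close>). Two such processes with the same initial value agree, since
  transporting their difference back by \<open>B\<close> yields a process whose increments are too small for it
  to move (\<open>uniqueness\<close>, \<open>zero_if_small_increments\<close>).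

  Moments enter only for even integer exponents. There the expansion of \<open>(a + b) ^ p\<close> to second order
  replaces the Burkholder inequality (\<open>mom_le_martingale_step\<close>), and other exponents follow by
  domination.
\<close>

definition mom_le :: "'a measure => nat => real => ('a => 'v::real_normed_vector) => bool" where
 "mom_le M p c X \<longleftrightarrow> X \<in> borel_measurable M & 0 <= c &
  (\<integral>\<^sup>+w. ennreal (norm (X w) ^ p) \<partial>M) <= ennreal (c ^ p)"

lemma mom_le_measurable: "mom_le M p c X ==> X \<in> borel_measurable M"
 and mom_le_nonneg: "mom_le M p c X ==> 0 <= c"
 by (auto simp: mom_le_def)

lemma mom_le_weaken:
 assumes "mom_le M p c X" "c <= d"
 shows "mom_le M p d X"
proof -
 have "ennreal (c ^ p) <= ennreal (d ^ p)"
  using assms by (intro ennreal_leI power_mono) (auto simp: mom_le_def)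
 then show ?thesis using assms unfolding mom_le_def by (meson order_trans)
qed

lemma mom_le_AE_bound:
 assumes X: "mom_le M p c X" and k: "0 <= k"
  and Y: "Y \<in> borel_measurable M" and AE: "AE w in M. norm (Y w) <= k * norm (X w)"
 shows "mom_le M p (k * c) Y"
proof -
 note [measurable] = mom_le_measurable[OF X] Y
 have "(\<integral>\<^sup>+w. ennreal (norm (Y w) ^ p) \<partial>M) <= (\<integral>\<^sup>+w. ennreal (k ^ p) * ennreal (norm (X w) ^ p) \<partial>M)"
 proof (rule nn_integral_mono_AE, use AE in eventually_elim)
  fix w assume "norm (Y w) <= k * norm (X w)"
  then have "norm (Y w) ^ p <= (k * norm (X w)) ^ p" by (intro power_mono) auto
  then show "ennreal (norm (Y w) ^ p) <= ennreal (k ^ p) * ennreal (norm (X w) ^ p)"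
   using k by (simp add: power_mult_distrib ennreal_mult[symmetric] ennreal_leI)
 qed
 also have "... = ennreal (k ^ p) * (\<integral>\<^sup>+w. ennreal (norm (X w) ^ p) \<partial>M)"
  by (rule nn_integral_cmult) measurable
 also have "... <= ennreal (k ^ p) * ennreal (c ^ p)"
  using X by (intro mult_left_mono) (auto simp: mom_le_def)
 also have "... = ennreal ((k * c) ^ p)"
  using k mom_le_nonneg[OF X] by (simp add: power_mult_distrib ennreal_mult)
 finally show ?thesis using k mom_le_nonneg[OF X] Y by (auto simp: mom_le_def)
qed

lemma mom_le_cong:
 assumes "mom_le M p c X" "Y \<in> borel_measurable M" "AE w in M. X w = Y w"
 shows "mom_le M p c Y"
proof -
 have "AE w in M. norm (Y w) <= 1 * norm (X w)"
  using assms(3) by eventually_elim simp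
 then show ?thesis using mom_le_AE_bound[OF assms(1), of 1 Y] assms(2) by simp
qed

lemma mom_le_0_AE:
 assumes "mom_le M p 0 X" "0 < p"
 shows "AE w in M. X w = 0"
proof -
 note [measurable] = mom_le_measurable[OF assms(1)]
 have "(\<integral>\<^sup>+w. ennreal (norm (X w) ^ p) \<partial>M) = 0"
  using assms by (simp add: mom_le_def zero_power)
 then have "AE w in M. ennreal (norm (X w) ^ p) = 0"
  by (subst (asm) nn_integral_0_iff_AE) auto
 then show ?thesis
 proof eventually_elim
  case (elim w)
  then have "norm (X w) ^ p <= 0" by (simp add: ennreal_eq_0_iff)
  then have "norm (X w) ^ p = 0" by (intro antisym) auto
  then show ?case by (simp only: power_eq_0_iff norm_eq_zero)
 qed
qed

lemma power_add_weighted_le: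
 fixes x y c d :: real
 assumes "even p" "0 < c" "0 < d"
 shows "(x + y) ^ p <= (c + d) ^ p * (c / (c + d) * (x / c) ^ p + d / (c + d) * (y / d) ^ p)"
proof -
 have "(d / (c + d) * (y / d) + (1 - d / (c + d)) * (x / c)) ^ p
   <= d / (c + d) * (y / d) ^ p + (1 - d / (c + d)) * (x / c) ^ p"
  using convex_onD[OF convex_power_even[OF assms(1)], of "d / (c + d)" "x / c" "y / d"] assms
  by (simp add: field_simps)
 also have *: "1 - d / (c + d) = c / (c + d)" using assms by (simp add: field_simps)
 also have "d / (c + d) * (y / d) + c / (c + d) * (x / c) = (x + y) / (c + d)"
  using assms by (simp add: add_divide_distrib)
 finally have "(x + y) ^ p / (c + d) ^ p <= c / (c + d) * (x / c) ^ p + d / (c + d) * (y / d) ^ p"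
  by (simp add: power_divide)
 then show ?thesis using assms by (simp add: field_simps)
qed

text \<open>Minkowski's inequality is the convexity of \<open>x ^ p\<close> applied to the normalised variables.\<close>

lemma mom_le_add:
 fixes X Y :: "'a => 'v::{real_normed_vector, second_countable_topology}"
 assumes X: "mom_le M p c X" and Y: "mom_le M p d Y" and p: "even p" "0 < p"
 shows "mom_le M p (c + d) (%w. X w + Y w)"
proof (cases "c = 0 \<or> d = 0")
 case True
 note [measurable] = mom_le_measurable[OF X] mom_le_measurable[OF Y]
 from True show ?thesis
 proof
  assume "c = 0"
  then have "AE w in M. Y w = X w + Y w" using mom_le_0_AE X p by fastforce
  then show ?thesis using \<open>c = 0\<close> by (auto intro!: mom_le_cong[OF Y])
 next
  assume "d = 0"
  then have "AE w in M. X w = X w + Y w" using mom_le_0_AE Y p by fastforce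
  then show ?thesis using \<open>d = 0\<close> by (auto intro!: mom_le_cong[OF X])
 qed
next
 case False
 note [measurable] = mom_le_measurable[OF X] mom_le_measurable[OF Y]
 have c: "0 < c" "0 < d" using False mom_le_nonneg[OF X] mom_le_nonneg[OF Y] by auto
 define a b where "a = (c + d) ^ p * (c / (c + d)) / c ^ p" "b = (c + d) ^ p * (d / (c + d)) / d ^ p"
 have ab: "0 <= a" "0 <= b" using c by (auto simp: a_b_def)
 have "(\<integral>\<^sup>+w. ennreal (norm (X w + Y w) ^ p) \<partial>M)
   <= (\<integral>\<^sup>+w. ennreal a * ennreal (norm (X w) ^ p) + ennreal b * ennreal (norm (Y w) ^ p) \<partial>M)"
 proof (rule nn_integral_mono)
  fix w
  have "norm (X w + Y w) ^ p <= (norm (X w) + norm (Y w)) ^ p"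
   by (intro power_mono norm_triangle_ineq) auto
  also have "... <= a * norm (X w) ^ p + b * norm (Y w) ^ p"
  proof -
   have "(c + d) ^ p * (c / (c + d) * (u / c ^ p) + d / (c + d) * (v / d ^ p)) = a * u + b * v" for u v
    unfolding a_b_def by (simp add: distrib_left)
   then show ?thesis
    using power_add_weighted_le[OF p(1) c, of "norm (X w)" "norm (Y w)"]
    by (simp add: power_divide)
  qed
  finally show "ennreal (norm (X w + Y w) ^ p)
   <= ennreal a * ennreal (norm (X w) ^ p) + ennreal b * ennreal (norm (Y w) ^ p)"
   using ab by (simp add: ennreal_mult[symmetric] ennreal_plus[symmetric] ennreal_leI del: ennreal_plus)
 qed
 also have "... = ennreal a * (\<integral>\<^sup>+w. ennreal (norm (X w) ^ p) \<partial>M) + ennreal b * (\<integral>\<^sup>+w. ennreal (norm (Y w) ^ p) \<partial>M)"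
  by (simp add: nn_integral_add nn_integral_cmult)
 also have "... <= ennreal a * ennreal (c ^ p) + ennreal b * ennreal (d ^ p)"
  using X Y by (intro add_mono mult_left_mono) (auto simp: mom_le_def)
 also have "... = ennreal (a * c ^ p + b * d ^ p)"
  using ab c by (simp add: ennreal_mult[symmetric] ennreal_plus[symmetric] del: ennreal_plus)
 also have "a * c ^ p + b * d ^ p = (c + d) ^ p * (c / (c + d) + d / (c + d))"
  using c unfolding a_b_def by (simp add: distrib_left)
 also have "c / (c + d) + d / (c + d) = 1" using c by (simp add: add_divide_distrib[symmetric])
 finally show ?thesis using c by (auto simp: mom_le_def)
qed

lemma mom_le_sum:
 fixes X :: "'i => 'a => 'v::{real_normed_vector, second_countable_topology}"
 assumes "finite I" "!!i. i \<in> I ==> mom_le M p (c i) (X i)" and p: "even p" "0 < p"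
 shows "mom_le M p (\<Sum>i\<in>I. c i) (%w. \<Sum>i\<in>I. X i w)"
 using assms(1,2)
proof (induction I rule: finite_induct)
 case empty then show ?case using p by (simp add: mom_le_def zero_power)
next
 case (insert i I)
 then show ?case using mom_le_add[OF _ _ p, of M "c i" "X i"] by simp
qed

lemma mom_le_uminus: "mom_le M p c (X :: 'a => 'v::{real_normed_vector, second_countable_topology}) ==> mom_le M p c (%w. - X w)"
 by (auto simp: mom_le_def)

lemma mom_le_diff:
 fixes X Y :: "'a => 'v::{real_normed_vector, second_countable_topology}"
 assumes X: "mom_le M p c X" and Y: "mom_le M p d Y" and p: "even p" "0 < p"
 shows "mom_le M p (c + d) (%w. X w - Y w)"
 using mom_le_add[OF X mom_le_uminus[OF Y] p] by simp

lemma mom_le_limit: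
 fixes X :: "nat => 'a => 'v::real_normed_vector"
 assumes X: "!!n. mom_le M p (c n) (X n)" and c: "c \<longlonglongrightarrow> d" and Y: "Y \<in> borel_measurable M"
  and lim: "AE w in M. (%n. X n w) \<longlonglongrightarrow> Y w"
 shows "mom_le M p d Y"
proof -
 have [measurable]: "X n \<in> borel_measurable M" for n using mom_le_measurable[OF X] .
 note Y[measurable]
 have "(\<integral>\<^sup>+w. ennreal (norm (Y w) ^ p) \<partial>M) = (\<integral>\<^sup>+w. liminf (%n. ennreal (norm (X n w) ^ p)) \<partial>M)"
 proof (rule nn_integral_cong_AE, use lim in eventually_elim)
  fix w assume "(%n. X n w) \<longlonglongrightarrow> Y w"
  then have "(%n. ennreal (norm (X n w) ^ p)) \<longlonglongrightarrow> ennreal (norm (Y w) ^ p)"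
   by (intro tendsto_intros)
  then show "ennreal (norm (Y w) ^ p) = liminf (%n. ennreal (norm (X n w) ^ p))"
   by (intro lim_imp_Liminf[symmetric]) auto
 qed
 also have "... <= liminf (%n. \<integral>\<^sup>+w. ennreal (norm (X n w) ^ p) \<partial>M)"
  by (rule nn_integral_liminf) measurable
 also have "... <= liminf (%n. ennreal (c n ^ p))"
  using X by (intro Liminf_mono always_eventually) (auto simp: mom_le_def)
 also have "... = ennreal (d ^ p)"
  by (intro lim_imp_Liminf tendsto_intros c) auto
 finally have "(\<integral>\<^sup>+w. ennreal (norm (Y w) ^ p) \<partial>M) <= ennreal (d ^ p)" .
 moreover have "0 <= d" using c mom_le_nonneg[OF X] by (intro LIMSEQ_le_const) auto
 ultimately show ?thesis by (auto simp: mom_le_def)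
qed

lemma power_le_add_one:
 fixes x c :: real
 assumes "0 <= x" "0 < c" "q <= p"
 shows "x ^ q <= c ^ q + c ^ q * (x / c) ^ p"
proof -
 define y where "y = x / c"
 have y: "0 <= y" "x = c * y" using assms by (auto simp: y_def)
 have "y ^ q <= 1 + y ^ p"
 proof (cases "y <= 1")
  case True then have "y ^ q <= 1" using y by (intro power_le_one) auto
  then show ?thesis using y by (smt (verit) zero_le_power)
 next
  case False then have "y ^ q <= y ^ p" using assms by (intro power_increasing) auto
  then show ?thesis by simp
 qed
 then have "c ^ q * y ^ q <= c ^ q * (1 + y ^ p)" using assms by (intro mult_left_mono) auto
 then show ?thesis using y assms by (simp add: power_mult_distrib distrib_left)
qed

context prob_space begin

lemma mom_le_bounded:
 assumes "X \<in> borel_measurable M" "0 <= c" "AE w in M. norm (X w) <= c"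
 shows "mom_le M p c X"
proof -
 have "(\<integral>\<^sup>+w. ennreal (norm (X w) ^ p) \<partial>M) <= (\<integral>\<^sup>+w. ennreal (c ^ p) \<partial>M)"
  by (rule nn_integral_mono_AE, use assms(3) in eventually_elim) (auto intro!: ennreal_leI power_mono)
 then show ?thesis using assms by (simp add: mom_le_def emeasure_space_1)
qed

text \<open>A cheap substitute for Jensen's inequality: the order of the moment may be lowered at the
 price of a factor.\<close>

lemma mom_le_lower:
 fixes X :: "'a => 'v::real_normed_vector"
 assumes X: "mom_le M p c X" and q: "0 < q" "q <= p"
 shows "mom_le M q (2 * c) X"
proof (cases "c = 0")
 case True
 note [measurable] = mom_le_measurable[OF X]
 have "AE w in M. X w = 0" using mom_le_0_AE[of M p X] X True q by simp
 then have "AE w in M. norm (X w) <= 0" by (auto elim!: eventually_mono)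
 then show ?thesis using True by (intro mom_le_bounded) auto
next
 case False
 note [measurable] = mom_le_measurable[OF X]
 have c: "0 < c" using False mom_le_nonneg[OF X] by simp
 have "(\<integral>\<^sup>+w. ennreal (norm (X w) ^ q) \<partial>M) <=
   (\<integral>\<^sup>+w. ennreal (c ^ q) + ennreal (c ^ q / c ^ p) * ennreal (norm (X w) ^ p) \<partial>M)"
 proof (rule nn_integral_mono)
  fix w
  have "norm (X w) ^ q <= c ^ q + c ^ q / c ^ p * norm (X w) ^ p"
   using power_le_add_one[OF _ c q(2), of "norm (X w)"] by (simp add: power_divide)
  then show "ennreal (norm (X w) ^ q) <= ennreal (c ^ q) + ennreal (c ^ q / c ^ p) * ennreal (norm (X w) ^ p)"
   using c by (simp add: ennreal_mult[symmetric] ennreal_plus[symmetric] ennreal_leI del: ennreal_plus)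
 qed
 also have "... = ennreal (c ^ q) + ennreal (c ^ q / c ^ p) * (\<integral>\<^sup>+w. ennreal (norm (X w) ^ p) \<partial>M)"
  by (simp add: nn_integral_add nn_integral_cmult emeasure_space_1)
 also have "... <= ennreal (c ^ q) + ennreal (c ^ q / c ^ p) * ennreal (c ^ p)"
  using X by (intro add_mono mult_left_mono) (auto simp: mom_le_def)
 also have "... = ennreal (2 * c ^ q)"
  using c by (simp add: ennreal_mult[symmetric] ennreal_plus[symmetric] del: ennreal_plus)
 also have "... <= ennreal ((2 * c) ^ q)"
 proof (rule ennreal_leI)
  have "(2::real) <= 2 ^ q" using q by (simp add: self_le_power)
  then show "2 * c ^ q <= (2 * c) ^ q" using c by (simp add: power_mult_distrib)
 qed
 finally show ?thesis using c by (auto simp: mom_le_def)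
qed

lemma mom_le_integrable_power:
 fixes X :: "'a => 'v::real_normed_vector"
 assumes "mom_le M p c X"
 shows "integrable M (%w. norm (X w) ^ p)" "(\<integral>w. norm (X w) ^ p \<partial>M) <= c ^ p"
proof -
 note [measurable] = mom_le_measurable[OF assms]
 show i: "integrable M (%w. norm (X w) ^ p)"
  by (rule integrableI_bounded)
   (use assms in "auto simp: mom_le_def intro: le_less_trans")
 show "(\<integral>w. norm (X w) ^ p \<partial>M) <= c ^ p"
  using assms nn_integral_eq_integral[OF i] mom_le_nonneg[OF assms]
  by (auto simp: mom_le_def)
qed

lemma mom_leI_integral:
 fixes X :: "'a => 'v::real_normed_vector"
 assumes "X \<in> borel_measurable M" "0 <= c" "integrable M (%w. norm (X w) ^ p)" "(\<integral>w. norm (X w) ^ p \<partial>M) <= c ^ p"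
 shows "mom_le M p c X"
 using assms nn_integral_eq_integral[OF assms(3)] by (auto simp: mom_le_def)

lemma mom_le_integrable:
 fixes X :: "'a => 'v::{banach, second_countable_topology}"
 assumes "mom_le M p c X" "0 < p"
 shows "integrable M X"
proof -
 have "integrable M (%w. norm (X w) ^ 1)"
  using mom_le_integrable_power(1)[OF mom_le_lower[OF assms(1), of 1]] assms by simp
 then show ?thesis using mom_le_measurable[OF assms(1)] by (simp add: integrable_norm_iff)
qed

text \<open>Norm-summable series converge almost surely, and their sums inherit the bound.\<close>

lemma mom_le_series:
 fixes X :: "nat => 'a => 'v::{banach, second_countable_topology}"
 assumes X: "!!n. mom_le M p (c n) (X n)" and c: "summable c" and p: "even p" "0 < p"
 shows "AE w in M. summable (%n. X n w)"
  and "mom_le M p (\<Sum>n. c n) (%w. \<Sum>n. X n w)"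
proof -
 have [measurable]: "X n \<in> borel_measurable M" for n using mom_le_measurable[OF X] .
 have c0: "0 <= c n" for n using mom_le_nonneg[OF X] .
 have 1: "(\<integral>\<^sup>+w. ennreal (norm (X n w)) \<partial>M) <= ennreal (2 * c n)" for n
  using mom_le_lower[OF X[of n], of 1] p by (simp add: mom_le_def)
 have "(\<integral>\<^sup>+w. (\<Sum>n. ennreal (norm (X n w))) \<partial>M) = (\<Sum>n. \<integral>\<^sup>+w. ennreal (norm (X n w)) \<partial>M)"
  by (rule nn_integral_suminf) measurable
 also have "... <= (\<Sum>n. ennreal (2 * c n))" using 1 by (intro suminf_le summableI) 
 also have "... < \<infinity>"
  unfolding infinity_ennreal_def less_top[symmetric]
  by (rule ennreal_suminf_neq_top[OF summable_mult[OF c]]) (use c0 in "simp")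
 finally have "AE w in M. (\<Sum>n. ennreal (norm (X n w))) \<noteq> \<infinity>"
  by (intro nn_integral_PInf_AE) auto
 then show AE: "AE w in M. summable (%n. X n w)"
 proof eventually_elim
  case (elim w)
  then have "summable (%n. norm (X n w))" by (intro summable_suminf_not_top) auto
  then show ?case by (rule summable_norm_cancel)
 qed
 have "mom_le M p (\<Sum>n. c n) (%w. \<Sum>i<n. X i w)" for n
  using mom_le_weaken[OF mom_le_sum[of "{..<n}" M p c X, OF _ X p]]
   sum_le_suminf[OF c, of "{..<n}"] c0 by auto
 then show "mom_le M p (\<Sum>n. c n) (%w. \<Sum>n. X n w)"
  by (rule mom_le_limit[OF _ tendsto_const]) (measurable, use AE in eventually_elim, rule summable_LIMSEQ)
qed

end

text \<open>For even \<open>p\<close>, the terms of the binomial expansion beyond the linear one are absorbed by the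
 square term and by \<open>b ^ p\<close>.\<close>

lemma power_add_le_two_terms:
 fixes a b :: real
 assumes "even p" "2 <= p"
 shows "(a + b) ^ p <= a ^ p + real p * a ^ (p - 1) * b + 2 ^ p * (a ^ (p - 2) * b\<^sup>2 + b ^ p)"
proof -
 obtain q where q: "p = Suc (Suc q)" using assms(2) by (metis Suc_le_D numeral_2_eq_2 Suc_le_mono)
 have "even q" using assms q by simp
 define w where "w = a ^ q * b\<^sup>2 + b ^ p"
 have w0: "0 <= w" using \<open>even q\<close> assms by (auto simp: w_def zero_le_even_power)
 have term_le: "a ^ k * b ^ (p - k) <= w" if "k <= q" for k
 proof (cases "\<bar>b\<bar> <= \<bar>a\<bar>")
  case True
  have "a ^ k * b ^ (p - k) <= \<bar>a\<bar> ^ k * \<bar>b\<bar> ^ (q - k + 2)"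
   using abs_ge_self[of "a ^ k * b ^ (p - k)"] that q by (simp add: abs_mult power_abs Suc_diff_le)
  also have "... = (\<bar>a\<bar> ^ k * \<bar>b\<bar> ^ (q - k)) * b\<^sup>2"
   by (simp only: power_add power2_abs mult.assoc)
  also have "... <= (\<bar>a\<bar> ^ k * \<bar>a\<bar> ^ (q - k)) * b\<^sup>2"
   using True by (intro mult_right_mono mult_left_mono power_mono) auto
  also have "... = a ^ q * b\<^sup>2"
   using that \<open>even q\<close> by (simp add: power_add[symmetric] power_even_abs)
  also have "... <= w" using assms by (simp add: w_def zero_le_even_power)
  finally show ?thesis .
 next
  case False
  have "a ^ k * b ^ (p - k) <= \<bar>a\<bar> ^ k * \<bar>b\<bar> ^ (p - k)"
   using abs_ge_self[of "a ^ k * b ^ (p - k)"] by (simp add: abs_mult power_abs)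
  also have "... <= \<bar>b\<bar> ^ k * \<bar>b\<bar> ^ (p - k)"
   using False by (intro mult_right_mono power_mono) auto
  also have "... = \<bar>b\<bar> ^ p" unfolding power_add[symmetric] using that q by simp
  also have "... = b ^ p" using assms by (simp add: power_even_abs)
  also have "... <= w" using \<open>even q\<close> by (simp add: w_def zero_le_even_power)
  finally show ?thesis .
 qed
 have "(a + b) ^ p = (\<Sum>k\<le>p. real (p choose k) * a ^ k * b ^ (p - k))"
  by (rule binomial_ring)
 also have "... = (\<Sum>k\<le>q. real (p choose k) * a ^ k * b ^ (p - k)) + real p * a ^ (p - 1) * b + a ^ p"
  using q by simp
 also have "(\<Sum>k\<le>q. real (p choose k) * a ^ k * b ^ (p - k)) <= (\<Sum>k\<le>q. real (p choose k) * w)"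
  using term_le by (intro sum_mono) (simp add: mult.assoc mult_left_mono)
 also have "... <= (\<Sum>k\<le>p. real (p choose k) * w)"
  using w0 q by (intro sum_mono2) auto
 also have "... = 2 ^ p * w"
  using choose_row_sum[of p] by (simp add: sum_distrib_right[symmetric] flip: of_nat_sum)
 finally show ?thesis using q by (simp add: w_def)
qed

lemma power_add_ge_terms:
 fixes u v :: real
 assumes "0 <= u" "0 <= v" "0 < k"
 shows "u ^ k + (u ^ (k - 1) * v + v ^ k) / 2 <= (u + v) ^ k"
proof -
 obtain j where k: "k = Suc j" using assms by (cases k) auto
 have "u ^ j <= (u + v) ^ j" "v ^ j <= (u + v) ^ j" using assms by (auto intro!: power_mono)
 then have "u * u ^ j + v * ((u ^ j + v ^ j) / 2) <= u * (u + v) ^ j + v * (u + v) ^ j"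
  using assms by (intro add_mono mult_left_mono) auto
 then show ?thesis using k by (simp add: algebra_simps)
qed

context prob_space begin


lemma sigma_finite_subalgebraI: "subalgebra M G ==> sigma_finite_subalgebra M G"
 by (intro finite_measure_subalgebra_is_sigma_finite finite_measure_subalgebra.intro
   finite_measure_subalgebra_axioms.intro finite_measure_axioms)

lemma mom_le_cond_exp:
 fixes X :: "'a => real"
 assumes G: "subalgebra M G" and X: "mom_le M p c X" and p: "even p" "0 < p"
 shows "mom_le M p c (real_cond_exp M G X)"
proof -
 interpret sigma_finite_subalgebra M G by (rule sigma_finite_subalgebraI[OF G])
 have iX: "integrable M X" by (rule mom_le_integrable[OF X p(2)])
 have iXp: "integrable M (%w. X w ^ p)"
  using mom_le_integrable_power(1)[OF X] p by (simp add: power_even_abs)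
 note * = iX AE_I2[OF UNIV_I] disjI2[OF disjI2[OF disjI2[OF refl]]] iXp convex_power_even[OF p(1)]
 have J: "AE w in M. real_cond_exp M G X w ^ p <= real_cond_exp M G (%w. X w ^ p) w"
  by (rule real_cond_exp_jensens_inequality(2)[OF *]) auto
 have i: "integrable M (%w. real_cond_exp M G X w ^ p)"
  by (rule integrable_convex_cond_exp[OF *]) auto
 show ?thesis
 proof (rule mom_leI_integral)
  show "integrable M (%w. norm (real_cond_exp M G X w) ^ p)"
   using i p by (simp add: power_even_abs)
  have "(\<integral>w. norm (real_cond_exp M G X w) ^ p \<partial>M) = (\<integral>w. real_cond_exp M G X w ^ p \<partial>M)"
   using p by (simp add: power_even_abs)
  also have "... <= (\<integral>w. real_cond_exp M G (%w. X w ^ p) w \<partial>M)"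
   by (rule integral_mono_AE[OF i real_cond_exp_int(1)[OF iXp] J])
  also have "... = (\<integral>w. X w ^ p \<partial>M)" by (rule real_cond_exp_int(2)[OF iXp])
  also have "... <= c ^ p" using mom_le_integrable_power(2)[OF X] p by (simp add: power_even_abs)
  finally show "(\<integral>w. norm (real_cond_exp M G X w) ^ p \<partial>M) <= c ^ p" .
 qed (use mom_le_nonneg[OF X] in auto)
qed

lemma cond_exp_abs_le:
 assumes G: "subalgebra M G" and X: "X \<in> borel_measurable M" "AE w in M. \<bar>X w\<bar> <= (c::real)"
 shows "AE w in M. \<bar>real_cond_exp M G X w\<bar> <= c"
proof -
 interpret sigma_finite_subalgebra M G by (rule sigma_finite_subalgebraI[OF G])
 have i: "integrable M X" by (rule integrable_const_bound[of _ c]) (use X in auto)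
 have "AE w in M. real_cond_exp M G X w <= c"
  by (rule real_cond_exp_le_c[OF i]) (use X(2) in eventually_elim, auto)
 moreover have "AE w in M. real_cond_exp M G X w \<ge> - c"
  by (rule real_cond_exp_ge_c[OF i]) (use X(2) in eventually_elim, auto)
 ultimately show ?thesis by eventually_elim auto
qed

text \<open>The second-order expansion of \<open>(a + b) ^ p\<close> replaces the Burkholder inequality: its linear term
 vanishes in expectation when \<open>D\<close> is a martingale difference.\<close>

lemma mom_le_martingale_step:
 fixes X D :: "'a => real"
 assumes X: "mom_le M p x X" and D: "mom_le M p y D" and p: "even p" "2 <= p"
  and orth: "(\<integral>w. X w ^ (p - 1) * D w \<partial>M) = 0"
 shows "mom_le M p (sqrt (x\<^sup>2 + 2 ^ (p + 2) * y\<^sup>2)) (%w. X w + D w)"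
proof (cases "x = 0 \<or> y = 0")
 case True
 have p0: "0 < p" using p by simp
 have xy: "0 <= x" "0 <= y" using X D mom_le_nonneg by auto
 have "x + y <= sqrt (x\<^sup>2 + 2 ^ (p + 2) * y\<^sup>2)"
 proof (rule real_le_rsqrt)
  have "y\<^sup>2 * 1 <= y\<^sup>2 * 2 ^ (p + 2)" by (intro mult_left_mono one_le_power) auto
  then show "(x + y)\<^sup>2 <= x\<^sup>2 + 2 ^ (p + 2) * y\<^sup>2"
   using True by (auto simp: power2_sum mult.commute)
 qed
 then show ?thesis using mom_le_weaken[OF mom_le_add[OF X D p(1) p0]] by simp
next
 case False
 have xy: "0 < x" "0 < y" using False mom_le_nonneg[OF X] mom_le_nonneg[OF D] by auto
 note [measurable] = mom_le_measurable[OF X] mom_le_measurable[OF D]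
 have iX: "integrable M (%w. X w ^ p)" "(\<integral>w. X w ^ p \<partial>M) <= x ^ p"
  and iD: "integrable M (%w. D w ^ p)" "(\<integral>w. D w ^ p \<partial>M) <= y ^ p"
  using mom_le_integrable_power[OF X] mom_le_integrable_power[OF D] p
  by (auto simp: power_even_abs)
 have pow: "u ^ j * v ^ (p - j) <= u ^ p + v ^ p" if "0 <= u" "0 <= v" "j <= p" for u v :: real and j
 proof (cases "u <= v")
  case True
  have "u ^ j * v ^ (p - j) <= v ^ j * v ^ (p - j)" using that True by (intro mult_right_mono power_mono) auto
  also have "... = v ^ p" using that by (simp add: power_add[symmetric])
  finally show ?thesis using that by (smt (verit) zero_le_power)
 next
  case False
  have "u ^ j * v ^ (p - j) <= u ^ j * u ^ (p - j)" using that False by (intro mult_left_mono power_mono) auto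
  also have "... = u ^ p" using that by (simp add: power_add[symmetric])
  finally show ?thesis using that by (smt (verit) zero_le_power)
 qed
 have iXD: "integrable M (%w. X w ^ (p - 1) * D w)"
 proof (rule Bochner_Integration.integrable_bound[OF Bochner_Integration.integrable_add[OF iX(1) iD(1)]])
  show "AE w in M. norm (X w ^ (p - 1) * D w) <= norm (X w ^ p + D w ^ p)"
  proof (rule AE_I2)
   fix w
   have "norm (X w ^ (p - 1) * D w) <= \<bar>X w\<bar> ^ p + \<bar>D w\<bar> ^ p"
    using pow[of "\<bar>X w\<bar>" "\<bar>D w\<bar>" "p - 1"] p by (simp add: abs_mult power_abs)
   then show "norm (X w ^ (p - 1) * D w) <= norm (X w ^ p + D w ^ p)"
    using p by (simp add: power_even_abs)
  qed
 qed measurable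
 define U where "U w = X w ^ p + real p * (X w ^ (p - 1) * D w)
  + 2 ^ p * (x ^ (p - 2) * y\<^sup>2 * (X w ^ p / x ^ p + D w ^ p / y ^ p) + D w ^ p)" for w
 have U: "(X w + D w) ^ p <= U w" for w
 proof -
  have "(\<bar>X w\<bar> / x) ^ (p - 2) * (\<bar>D w\<bar> / y) ^ (p - (p - 2)) <= (\<bar>X w\<bar> / x) ^ p + (\<bar>D w\<bar> / y) ^ p"
   using xy p by (intro pow) auto
  then have "X w ^ (p - 2) / x ^ (p - 2) * (D w)\<^sup>2 / y\<^sup>2 <= X w ^ p / x ^ p + D w ^ p / y ^ p"
   using p by (simp add: power_divide power_even_abs)
  then have "x ^ (p - 2) * y\<^sup>2 * (X w ^ (p - 2) / x ^ (p - 2) * (D w)\<^sup>2 / y\<^sup>2)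
    <= x ^ (p - 2) * y\<^sup>2 * (X w ^ p / x ^ p + D w ^ p / y ^ p)"
   using xy by (intro mult_left_mono) auto
  then have "X w ^ (p - 2) * (D w)\<^sup>2 <= x ^ (p - 2) * y\<^sup>2 * (X w ^ p / x ^ p + D w ^ p / y ^ p)"
   using xy by simp
  then have "2 ^ p * (X w ^ (p - 2) * (D w)\<^sup>2 + D w ^ p)
   <= 2 ^ p * (x ^ (p - 2) * y\<^sup>2 * (X w ^ p / x ^ p + D w ^ p / y ^ p) + D w ^ p)"
   by (intro mult_left_mono) auto
  then show ?thesis
   using power_add_le_two_terms[OF p, of "X w" "D w"] unfolding U_def mult.assoc by linarith
 qed
 have iU: "integrable M U"
  unfolding U_def using iX(1) iD(1) iXD by (intro Bochner_Integration.integrable_add integrable_mult_right integrable_divide_zero) auto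
 have iS: "integrable M (%w. (X w + D w) ^ p)"
  by (rule Bochner_Integration.integrable_bound[OF iU])
   (use U p in "auto simp: power_even_abs zero_le_even_power intro!: order_trans[OF U]")
 have "(\<integral>w. (X w + D w) ^ p \<partial>M) <= (\<integral>w. U w \<partial>M)"
  by (rule integral_mono[OF iS iU U])
 also have "... = (\<integral>w. X w ^ p \<partial>M) + real p * (\<integral>w. X w ^ (p - 1) * D w \<partial>M)
  + 2 ^ p * (x ^ (p - 2) * y\<^sup>2 * ((\<integral>w. X w ^ p \<partial>M) / x ^ p + (\<integral>w. D w ^ p \<partial>M) / y ^ p) + (\<integral>w. D w ^ p \<partial>M))"
  unfolding U_def using iX(1) iD(1) iXD by simp
 also have "... <= x ^ p + 0 + 2 ^ p * (x ^ (p - 2) * y\<^sup>2 * (1 + 1) + y ^ p)"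
  using iX(2) iD(2) xy orth
  by (intro add_mono mult_left_mono) auto
 also have "... <= (x\<^sup>2 + 2 ^ (p + 2) * y\<^sup>2) ^ (p div 2)"
 proof -
  obtain k where k: "p = 2 * k" "0 < k" using p by (elim evenE) auto
  define K :: real where "K = 2 ^ (p + 2)"
  have K: "K = 4 * 2 ^ p" by (simp add: K_def)
  have K1: "1 <= K" unfolding K_def by (rule one_le_power) simp
  have "K ^ 1 <= K ^ k" using k K1 by (intro power_increasing) auto
  then have "K * y ^ p <= K ^ k * (y\<^sup>2) ^ k"
   using xy k by (simp add: power_mult[symmetric] mult_right_mono)
  then have 1: "K * y ^ p <= (K * y\<^sup>2) ^ k" by (simp add: power_mult_distrib)
  have 2: "(x\<^sup>2) ^ (k - 1) = x ^ (p - 2)" using k by (simp add: power_mult[symmetric] right_diff_distrib')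
  have "x ^ p + 0 + 2 ^ p * (x ^ (p - 2) * y\<^sup>2 * (1 + 1) + y ^ p)
   <= x ^ p + (x ^ (p - 2) * (K * y\<^sup>2) + K * y ^ p) / 2"
   using xy unfolding K by (simp add: algebra_simps)
  also have "... <= (x\<^sup>2) ^ k + ((x\<^sup>2) ^ (k - 1) * (K * y\<^sup>2) + (K * y\<^sup>2) ^ k) / 2"
   using 1 2 k by (simp add: power_mult[symmetric])
  also have "... <= (x\<^sup>2 + K * y\<^sup>2) ^ k"
   using k K1 by (intro power_add_ge_terms) auto
  finally show ?thesis using k by (simp add: K_def)
 qed
 also have "... = sqrt (x\<^sup>2 + 2 ^ (p + 2) * y\<^sup>2) ^ p"
  using p by (elim evenE) (simp add: power_mult)
 finally have "(\<integral>w. (X w + D w) ^ p \<partial>M) <= sqrt (x\<^sup>2 + 2 ^ (p + 2) * y\<^sup>2) ^ p" .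
 then show ?thesis using iS p by (intro mom_leI_integral) (auto simp: power_even_abs)
qed

lemma subalgebra_mono_measurable:
 assumes "subalgebra M G" "subalgebra M H" "sets G \<subseteq> sets H" "X \<in> measurable G N"
 shows "X \<in> measurable H N"
 using assms by (auto simp: measurable_def subalgebra_def)

text \<open>Subtracting the conditional means leaves a martingale, whose moments add in squares; the
 conditional means themselves add in norm.\<close>

lemma mom_le_martingale_sum:
 fixes D :: "nat => 'a => real"
 assumes p: "even p" "2 <= p"
  and sub: "!!k. k <= n ==> subalgebra M (G k)" and mono: "!!k. k < n ==> sets (G k) \<subseteq> sets (G (Suc k))"
  and D: "!!k. k < n ==> D k \<in> borel_measurable (G (Suc k))"
  and c: "!!k. k < n ==> mom_le M p (c k) (D k)"
  and e: "!!k. k < n ==> mom_le M p (e k) (real_cond_exp M (G k) (D k))"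
 shows "mom_le M p ((\<Sum>k<n. e k) + sqrt (2 ^ (p + 2) * (\<Sum>k<n. (c k + e k)\<^sup>2))) (%w. \<Sum>k<n. D k w)"
proof -
 have p0: "0 < p" using p by simp
 define d where "d k w = D k w - real_cond_exp M (G k) (D k) w" for k w
 have mG: "X \<in> borel_measurable (G (Suc k))" if "X \<in> borel_measurable (G k)" "k < n" for X :: "'a => real" and k
  by (rule subalgebra_mono_measurable[OF sub[of k] sub[of "Suc k"] mono[of k] that(1)]) (use that(2) in auto)
 have md: "d k \<in> borel_measurable (G (Suc k))" if "k < n" for k
  unfolding d_def[abs_def]
  by (rule borel_measurable_diff[OF D[OF that] mG[OF borel_measurable_cond_exp that]])
 have "(%w. \<Sum>k<j. d k w) \<in> borel_measurable (G j) &
   mom_le M p (sqrt (2 ^ (p + 2) * (\<Sum>k<j. (c k + e k)\<^sup>2))) (%w. \<Sum>k<j. d k w)" if "j <= n" for j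
  using that
 proof (induction j)
  case 0 then show ?case using p0 by (simp add: mom_le_def zero_power)
 next
  case (Suc j)
  let ?S = "%w. \<Sum>k<j. d k w"
  have j: "j < n" "j <= n" using Suc by auto
  have IH: "?S \<in> borel_measurable (G j)"
   "mom_le M p (sqrt (2 ^ (p + 2) * (\<Sum>k<j. (c k + e k)\<^sup>2))) ?S" using Suc by auto
  interpret S: sigma_finite_subalgebra M "G j" by (rule sigma_finite_subalgebraI[OF sub[OF j(2)]])
  have dj: "mom_le M p (c j + e j) (d j)"
   unfolding d_def[abs_def] by (rule mom_le_diff[OF c[OF j(1)] e[OF j(1)] p(1) p0])
  note iD = mom_le_integrable[OF c[OF j(1)] p0] and ie = mom_le_integrable[OF e[OF j(1)] p0]
  have "AE w in M. real_cond_exp M (G j) (d j) w =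
    real_cond_exp M (G j) (D j) w - real_cond_exp M (G j) (real_cond_exp M (G j) (D j)) w"
   unfolding d_def[abs_def] by (rule S.real_cond_exp_diff[OF iD ie])
  moreover have "AE w in M. real_cond_exp M (G j) (real_cond_exp M (G j) (D j)) w = real_cond_exp M (G j) (D j) w"
   by (rule S.real_cond_exp_F_meas[OF ie]) simp
  ultimately have E0: "AE w in M. real_cond_exp M (G j) (d j) w = 0" by eventually_elim simp
  have "integrable M (%w. ?S w ^ (p - 1) * d j w)"
  proof (rule Bochner_Integration.integrable_bound)
   show "integrable M (%w. norm (?S w) ^ p + norm (d j w) ^ p)"
    by (intro Bochner_Integration.integrable_add mom_le_integrable_power(1)[OF IH(2)] mom_le_integrable_power(1)[OF dj])
   show "(%w. ?S w ^ (p - 1) * d j w) \<in> borel_measurable M"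
    using mom_le_measurable[OF IH(2)] mom_le_measurable[OF dj] by auto
   show "AE w in M. norm (?S w ^ (p - 1) * d j w) <= norm (norm (?S w) ^ p + norm (d j w) ^ p)"
   proof (rule AE_I2)
    fix w
    define u v where uv: "u = \<bar>?S w\<bar>" "v = \<bar>d j w\<bar>"
    have "u ^ (p - 1) * v <= max u v ^ (p - 1) * max u v"
     by (intro mult_mono power_mono) (auto simp: uv)
    also have "... = max u v ^ p" using p by (simp add: power_eq_if)
    also have "... <= u ^ p + v ^ p" by (auto simp: max_def uv)
    finally show "norm (?S w ^ (p - 1) * d j w) <= norm (norm (?S w) ^ p + norm (d j w) ^ p)"
     by (simp add: uv abs_mult power_abs)
   qed
  qed
  then have "(\<integral>w. ?S w ^ (p - 1) * d j w \<partial>M) = (\<integral>w. ?S w ^ (p - 1) * real_cond_exp M (G j) (d j) w \<partial>M)"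
   using IH(1) mom_le_measurable[OF dj] by (intro S.real_cond_exp_intg(2)[symmetric]) auto
  also have "... = (\<integral>w. 0 \<partial>M)"
   by (rule integral_cong_AE)
    (use mom_le_measurable[OF IH(2)] E0 in "auto elim!: eventually_mono")
  finally have orth: "(\<integral>w. ?S w ^ (p - 1) * d j w \<partial>M) = 0" by simp
  have "sqrt (2 ^ (p + 2) * (\<Sum>k<Suc j. (c k + e k)\<^sup>2)) =
   sqrt ((sqrt (2 ^ (p + 2) * (\<Sum>k<j. (c k + e k)\<^sup>2)))\<^sup>2 + 2 ^ (p + 2) * (c j + e j)\<^sup>2)"
   by (subst real_sqrt_pow2) (auto intro!: mult_nonneg_nonneg sum_nonneg simp: distrib_left)
  then have "mom_le M p (sqrt (2 ^ (p + 2) * (\<Sum>k<Suc j. (c k + e k)\<^sup>2))) (%w. \<Sum>k<Suc j. d k w)"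
   using mom_le_martingale_step[OF IH(2) dj p orth] by simp
  moreover have "(%w. \<Sum>k<Suc j. d k w) \<in> borel_measurable (G (Suc j))"
   using mG[OF IH(1) j(1)] md[OF j(1)] by simp
  ultimately show ?case by blast
 qed
 from this[OF order_refl] have 1: "mom_le M p (sqrt (2 ^ (p + 2) * (\<Sum>k<n. (c k + e k)\<^sup>2))) (%w. \<Sum>k<n. d k w)"
  by simp
 have 2: "mom_le M p (\<Sum>k<n. e k) (%w. \<Sum>k<n. real_cond_exp M (G k) (D k) w)"
  using e by (intro mom_le_sum p p0) auto
 show ?thesis using mom_le_add[OF 2 1 p(1) p0] by (simp add: d_def sum_subtractf)
qed

end

lemma mom_le_cong_weaken:
 assumes "mom_le M p c X" "AE w in M. Y w = X w" "Y \<in> borel_measurable M" "c <= d"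
 shows "mom_le M p d Y"
proof -
 have "AE w in M. X w = Y w" using assms(2) by eventually_elim simp
 then show ?thesis using mom_le_weaken[OF mom_le_cong[OF assms(1,3)] assms(4)] by blast
qed

locale filtered_prob_space = prob_space M for M :: "'a measure" +
 fixes Fil :: "real => 'a measure" and T :: real
 assumes T_pos: "0 < T"
  and Fil_subalgebra: "!!t. 0 <= t ==> t <= T ==> subalgebra M (Fil t)"
  and Fil_mono: "!!s t. 0 <= s ==> s <= t ==> t <= T ==> sets (Fil s) \<subseteq> sets (Fil t)"
  and Fil_null: "!!t. 0 <= t ==> t <= T ==> null_sets M \<subseteq> sets (Fil t)"
begin

abbreviation "CE s == cond_expectation M (Fil s)"
abbreviation "RCE s == real_cond_exp M (Fil s)"

lemma Fil_meas_mono: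
 "X \<in> measurable (Fil s) N ==> 0 <= s ==> s <= t ==> t <= T ==> X \<in> measurable (Fil t) N"
 by (rule subalgebra_mono_measurable[OF Fil_subalgebra Fil_subalgebra Fil_mono]) auto

lemma Fil_meas_M: "X \<in> measurable (Fil s) N ==> 0 <= s ==> s <= T ==> X \<in> measurable M N"
 by (rule measurable_from_subalg[OF Fil_subalgebra])

end

lemma sum_powr_le:
 fixes len :: "nat => real"
 assumes len: "!!k. k < n ==> 0 <= len k" "!!k. k < n ==> len k <= h"
  and L: "(\<Sum>k<n. len k) = L" and r: "1 <= r'" "r' <= r"
 shows "(\<Sum>k<n. len k powr r) <= L powr r' * h powr (r - r')"
proof -
 have L0: "0 <= L" using L len by (auto intro!: sum_nonneg)
 have "(\<Sum>k<n. len k powr r) <= (\<Sum>k<n. len k * (L powr (r' - 1) * h powr (r - r')))"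
 proof (rule sum_mono)
  fix k assume k: "k \<in> {..<n}"
  have "len k <= L" unfolding L[symmetric] using k len by (intro member_le_sum) auto
  then have "len k powr (r' - 1) * len k powr (r - r') <= L powr (r' - 1) * h powr (r - r')"
   using r len k by (intro mult_mono powr_mono2) auto
  moreover have "len k powr r = len k * (len k powr (r' - 1) * len k powr (r - r'))"
  proof (cases "len k = 0")
   case False
   then have "0 < len k" using len k by (simp add: less_le)
   then show ?thesis by (simp add: powr_add[symmetric] powr_mult_base)
  qed simp
  ultimately show "len k powr r <= len k * (L powr (r' - 1) * h powr (r - r'))"
   using len k by (simp add: mult_left_mono)
 qed
 also have "... = L * (L powr (r' - 1) * h powr (r - r'))" by (simp add: sum_distrib_right[symmetric] L)
 also have "... = L powr r' * h powr (r - r')" using L0 by (simp add: powr_mult_base)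
 finally show ?thesis .
qed

context filtered_prob_space begin

text \<open>The error of a sum over a partition: conditional increments of order above one add up to
 something small, and the martingale part does so already for orders above one half.\<close>

lemma mom_le_partition_sum:
 fixes D :: "nat => 'a => real"
 assumes p: "even p" "2 <= p" and ex: "1 / 2 <= a'" "a' <= a" "1 <= b'" "b' <= b" "a <= b" and C: "0 <= C"
  and tau: "0 <= tau 0" "tau n <= T" "!!k. k < n ==> tau k <= tau (Suc k)" "!!k. k < n ==> tau (Suc k) - tau k <= h"
  and D: "!!k. k < n ==> D k \<in> borel_measurable (Fil (tau (Suc k)))"
  and c: "!!k. k < n ==> mom_le M p (C * (tau (Suc k) - tau k) powr a) (D k)"
  and e: "!!k. k < n ==> mom_le M p (C * (tau (Suc k) - tau k) powr b) (real_cond_exp M (Fil (tau k)) (D k))"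
 shows "mom_le M p (C * (tau n - tau 0) powr b' * h powr (b - b') +
   sqrt (2 ^ (p + 2)) * (C * (1 + T powr (b - a))) * (tau n - tau 0) powr a' * h powr (a - a'))
  (%w. \<Sum>k<n. D k w)"
proof -
 define len where "len k = tau (Suc k) - tau k" for k
 have mono: "tau i <= tau j" if "i <= j" "j <= n" for i j
  using that by (induction rule: dec_induct) (auto intro: order_trans[OF _ tau(3)])
 have tauT: "0 <= tau k" "tau k <= T" if "k <= n" for k
  using mono[of 0 k] mono[of k n] tau(1,2) that by auto
 have len: "0 <= len k" "len k <= h" "len k <= T" if "k < n" for k
  using tau(3,4)[OF that] tauT[of k] tauT[of "Suc k"] that by (auto simp: len_def)
 have L: "(\<Sum>k<n. len k) = tau n - tau 0" unfolding len_def by (rule sum_lessThan_telescope)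
 have L0: "0 <= tau n - tau 0" using mono[of 0 n] by simp
 have 1: "mom_le M p ((\<Sum>k<n. C * len k powr b) + sqrt (2 ^ (p + 2) * (\<Sum>k<n. (C * len k powr a + C * len k powr b)\<^sup>2)))
   (%w. \<Sum>k<n. D k w)"
  using c e D unfolding len_def
  by (intro mom_le_martingale_sum[where G = "%k. Fil (tau k)"] p Fil_subalgebra Fil_mono tauT tau(3)) auto
 have 2: "(\<Sum>k<n. C * len k powr b) <= C * ((tau n - tau 0) powr b' * h powr (b - b'))"
  unfolding sum_distrib_left[symmetric] using C ex len
  by (intro mult_left_mono sum_powr_le L) auto
 define C2 where "C2 = C * (1 + T powr (b - a))"
 have C2: "0 <= C2" using C by (simp add: C2_def)
 have "(\<Sum>k<n. (C * len k powr a + C * len k powr b)\<^sup>2) <= (\<Sum>k<n. C2\<^sup>2 * len k powr (2 * a))"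
 proof (rule sum_mono)
  fix k assume k: "k \<in> {..<n}"
  have "len k powr b = len k powr a * len k powr (b - a)" by (simp add: powr_add[symmetric])
  also have "... <= len k powr a * T powr (b - a)"
   using len k ex by (intro mult_left_mono powr_mono2) auto
  finally have "C * len k powr a + C * len k powr b <= C2 * len k powr a"
   using C by (simp add: C2_def distrib_left distrib_right mult.assoc mult_left_mono mult.commute[of "T powr _"])
  then have "(C * len k powr a + C * len k powr b)\<^sup>2 <= (C2 * len k powr a)\<^sup>2"
   using C by (intro power_mono) auto
  also have "... = C2\<^sup>2 * len k powr (2 * a)"
   by (simp add: power_mult_distrib powr_add[symmetric] power2_eq_square[of "_ powr _"])
  finally show "(C * len k powr a + C * len k powr b)\<^sup>2 <= C2\<^sup>2 * len k powr (2 * a)" .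
 qed
 also have "... <= C2\<^sup>2 * ((tau n - tau 0) powr (2 * a') * h powr (2 * a - 2 * a'))"
  unfolding sum_distrib_left[symmetric] using ex len
  by (intro mult_left_mono sum_powr_le L) auto
 finally have "sqrt (2 ^ (p + 2) * (\<Sum>k<n. (C * len k powr a + C * len k powr b)\<^sup>2))
   <= sqrt (2 ^ (p + 2) * (C2\<^sup>2 * ((tau n - tau 0) powr (2 * a') * h powr (2 * a - 2 * a'))))"
  by (intro real_sqrt_le_mono mult_left_mono) auto
 also have "... = sqrt (2 ^ (p + 2)) * (C2 * ((tau n - tau 0) powr a' * h powr (a - a')))"
 proof -
  have "x powr (2 * r) = (x powr r)\<^sup>2" for x r :: real by (simp add: powr_add[symmetric] power2_eq_square)
  from this[of _ a'] this[of _ "a - a'"]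
  have "(tau n - tau 0) powr (2 * a') * h powr (2 * a - 2 * a') = ((tau n - tau 0) powr a' * h powr (a - a'))\<^sup>2"
   by (simp add: power_mult_distrib right_diff_distrib)
  then show ?thesis using C2 by (simp add: real_sqrt_mult)
 qed
 finally show ?thesis
  using 2 by (intro mom_le_weaken[OF 1]) (simp add: C2_def mult.assoc)
qed

end

section \<open>Dyadic sums\<close>

definition clip :: "real => real => real => real" where "clip s t x = max s (min t x)"

definition dyadic :: "real => nat => nat => real" where "dyadic T l k = real k * T / 2 ^ l"

definition defect :: "(real => real => 'a => 'v::ab_group_add) => real => real => real => 'a => 'v" where
 "defect \<Xi> s u t w = \<Xi> s t w - \<Xi> s u w - \<Xi> u t w"

definition dyadic_sum :: "real => (real => real => 'a => 'v::ab_group_add) => real => real => nat => 'a => 'v" where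
 "dyadic_sum T \<Xi> s t l w =
  (\<Sum>k<2 ^ l. \<Xi> (clip s t (dyadic T l k)) (clip s t (dyadic T l (Suc k))) w)"

text \<open>The limit of the dyadic sums over one fixed sequence of partitions of the whole interval, clipped
 to \<open>[s, t]\<close>. A common sequence makes additivity in \<open>(s, t)\<close> almost immediate.\<close>

definition sewing :: "real => (real => real => 'a => real) => real => real => 'a => real" where
 "sewing T \<Xi> s t w = lim (%l. dyadic_sum T \<Xi> s t l w)"

lemma dyadic_Suc_even: "dyadic T (Suc l) (2 * k) = dyadic T l k"
 by (simp add: dyadic_def)

lemma dyadic_mono: "0 <= T ==> j <= k ==> dyadic T l j <= dyadic T l k"
 by (simp add: dyadic_def divide_right_mono mult_right_mono)

lemma dyadic_step: "dyadic T l (Suc k) - dyadic T l k = T / 2 ^ l"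
 by (simp add: dyadic_def field_simps)

lemma dyadic_ends: "dyadic T l 0 = 0" "dyadic T l (2 ^ l) = T"
 by (simp_all add: dyadic_def)

lemma clip_mono: "x <= y ==> clip s t x <= clip s t y"
 by (auto simp: clip_def)

lemma clip_range: "s <= t ==> s <= clip s t x" "s <= t ==> clip s t x <= t"
 by (auto simp: clip_def)

lemma clip_lipschitz: "x <= y ==> clip s t y - clip s t x <= y - x"
 by (auto simp: clip_def)

lemma clip_dyadic_ends:
 assumes "0 <= s" "s <= t" "t <= T"
 shows "clip s t (dyadic T l 0) = s" "clip s t (dyadic T l (2 ^ l)) = t"
 using assms by (auto simp: dyadic_ends clip_def)

lemma sum_lessThan_double: "(\<Sum>k<2 * n. f k) = (\<Sum>k<n. f (2 * k) + f (Suc (2 * k)))" for f :: "nat => 'v::ab_group_add"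
 by (induction n) (auto simp: algebra_simps)

lemma dyadic_sum_Suc:
 "dyadic_sum T \<Xi> s t (Suc l) w - dyadic_sum T \<Xi> s t l w =
  (\<Sum>k<2 ^ l. - defect \<Xi> (clip s t (dyadic T l k)) (clip s t (dyadic T (Suc l) (Suc (2 * k)))) (clip s t (dyadic T l (Suc k))) w)"
proof -
 have *: "dyadic T (Suc l) (Suc (Suc (2 * k))) = dyadic T l (Suc k)" for k
  using dyadic_Suc_even[of T l "Suc k"] by simp
 show ?thesis
  unfolding dyadic_sum_def power_Suc sum_lessThan_double sum_subtractf[symmetric] defect_def dyadic_Suc_even *
  by (intro sum.cong) auto
qed

context filtered_prob_space begin

text \<open>Each refinement changes a dyadic sum by a sum of defects. Its martingale part is small because the
 defects are of order above one half, its predictable part because their conditional means are of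
 order above one. The changes are thus summable in \<open>L\<^sub>p\<close>. A power of the length of the interval is kept
 in each bound, so that summing all changes also estimates the difference from the germ.\<close>

theorem stochastic_sewing:
 fixes \<Xi> :: "real => real => 'a => real"
 assumes p: "even p" "2 <= p" and ex: "1 / 2 <= a'" "a' < a" "1 <= b'" "b' < b" "a <= b" "a' <= b'" and C: "0 <= C"
  and diag: "!!u w. \<Xi> u u w = 0"
  and meas: "!!s t. 0 <= s ==> s <= t ==> t <= T ==> \<Xi> s t \<in> borel_measurable (Fil t)"
  and defect: "!!s u t. 0 <= s ==> s < u ==> u < t ==> t <= T ==>
    mom_le M p (C * (t - s) powr a) (defect \<Xi> s u t)"
  and cdefect: "!!s u t. 0 <= s ==> s < u ==> u < t ==> t <= T ==>
    mom_le M p (C * (t - s) powr b) (RCE s (defect \<Xi> s u t))"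
 shows "!!s t. 0 <= s ==> s <= t ==> t <= T ==>
    AE w in M. (%l. dyadic_sum T \<Xi> s t l w) \<longlonglongrightarrow> sewing T \<Xi> s t w"
  and "!!s t. 0 <= s ==> s <= t ==> t <= T ==> sewing T \<Xi> s t \<in> borel_measurable (Fil t)"
  and "\<exists>K\<ge>0. \<forall>s t. 0 <= s --> s <= t --> t <= T -->
    mom_le M p (K * (t - s) powr a') (%w. sewing T \<Xi> s t w - \<Xi> s t w) &
    mom_le M p (K * (t - s) powr b') (RCE s (%w. sewing T \<Xi> s t w - \<Xi> s t w))"
  and "!!s u t. 0 <= s ==> s <= u ==> u <= t ==> t <= T ==>
    AE w in M. sewing T \<Xi> s t w = sewing T \<Xi> s u w + sewing T \<Xi> u t w"
proof -
 have p0: "0 < p" using p by simp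
 note [simp] = T_pos T_pos[THEN less_imp_le]
 have zero_def: "defect \<Xi> s u t w = 0" if "s = u \<or> u = t" for s u t w
  using that by (auto simp: defect_def diag)
 have defect': "mom_le M p (C * (t - s) powr a) (defect \<Xi> s u t)"
  "mom_le M p (C * (t - s) powr b) (RCE s (defect \<Xi> s u t))"
  if "0 <= s" "s <= u" "u <= t" "t <= T" for s u t
 proof -
  have "mom_le M p (C * (t - s) powr a) (defect \<Xi> s u t) &
   mom_le M p (C * (t - s) powr b) (RCE s (defect \<Xi> s u t))"
  proof (cases "s = u \<or> u = t")
   case True
   then have z: "defect \<Xi> s u t = (%w. 0)" using zero_def by (intro ext) auto
   have s: "subalgebra M (Fil s)" using that by (intro Fil_subalgebra) auto
   have "mom_le M p (C * (t - s) powr b) (%w. 0 :: real)" "mom_le M p (C * (t - s) powr a) (%w. 0 :: real)"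
    using C by (auto intro!: mom_le_bounded)
   then show ?thesis unfolding z by (auto intro!: mom_le_cond_exp[OF s _ p(1) p0])
  next
   case False then show ?thesis using that defect[of s u t] cdefect[of s u t] by auto
  qed
  then show "mom_le M p (C * (t - s) powr a) (defect \<Xi> s u t)"
   "mom_le M p (C * (t - s) powr b) (RCE s (defect \<Xi> s u t))" by auto
 qed
 have mdef: "defect \<Xi> s u t \<in> borel_measurable (Fil t)" if "0 <= s" "s <= u" "u <= t" "t <= T" for s u t
  unfolding defect_def[abs_def] using that
  by (intro borel_measurable_diff meas Fil_meas_mono[OF meas, of _ u t]) auto

 have clip_T: "0 <= clip s t x" "clip s t x <= T" if "0 <= s" "s <= t" "t <= T" for s t x
  using clip_range[of s t x] that by auto
 have msum: "dyadic_sum T \<Xi> s t l \<in> borel_measurable (Fil t)" if st: "0 <= s" "s <= t" "t <= T" for s t l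
  unfolding dyadic_sum_def[abs_def]
 proof (intro borel_measurable_sum)
  fix k
  show "\<Xi> (clip s t (dyadic T l k)) (clip s t (dyadic T l (Suc k))) \<in> borel_measurable (Fil t)"
   using st by (intro Fil_meas_mono[OF meas, of _ _ t] clip_T clip_mono dyadic_mono clip_range) auto
 qed
 then show sew_meas: "sewing T \<Xi> s t \<in> borel_measurable (Fil t)" if "0 <= s" "s <= t" "t <= T" for s t
  unfolding sewing_def[abs_def] using that by (intro borel_measurable_lim_metric) auto

 define Y where "Y s t l w = dyadic_sum T \<Xi> s t (Suc l) w - dyadic_sum T \<Xi> s t l w" for s t l w
 define h where "h l = T / 2 ^ l" for l :: nat
 define C' where "C' = sqrt (2 ^ (p + 2)) * (C * (1 + T powr (b - a)))"
 define c where "c s t l = C * (t - s) powr b' * h l powr (b - b') + C' * (t - s) powr a' * h l powr (a - a')" for s t l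
 define pt where "pt s t l k = clip s t (dyadic T l k)" for s t l k
 define md where "md s t l k = clip s t (dyadic T (Suc l) (Suc (2 * k)))" for s t l k
 have Y_eq: "Y s t l = (%w. \<Sum>k<2 ^ l. - defect \<Xi> (pt s t l k) (md s t l k) (pt s t l (Suc k)) w)" for s t l
  unfolding Y_def pt_def md_def dyadic_sum_Suc ..
 have order: "pt s t l k <= md s t l k" "md s t l k <= pt s t l (Suc k)" for s t l k
  unfolding pt_def md_def dyadic_Suc_even[of T l, symmetric]
  by (intro clip_mono dyadic_mono; simp)+
 have ptT: "0 <= pt s t l k" "pt s t l k <= T" "s <= pt s t l k" "pt s t l k <= t" if "0 <= s" "s <= t" "t <= T" for s t l k
  using that clip_T clip_range unfolding pt_def by auto
 have ptlen: "pt s t l (Suc k) - pt s t l k <= h l" "0 <= pt s t l (Suc k) - pt s t l k" for s t l k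
 proof -
  have "dyadic T l k <= dyadic T l (Suc k)" by (rule dyadic_mono) auto
  from clip_lipschitz[OF this, of s t] clip_mono[OF this, of s t]
  show "pt s t l (Suc k) - pt s t l k <= h l" "0 <= pt s t l (Suc k) - pt s t l k"
   using dyadic_step[of T l k] unfolding pt_def h_def by auto
 qed
 have ptends: "pt s t l 0 = s" "pt s t l (2 ^ l) = t" if "0 <= s" "s <= t" "t <= T" for s t l
  using clip_dyadic_ends[OF that] by (auto simp: pt_def)
 have ptsum: "(\<Sum>k<2 ^ l. pt s t l (Suc k) - pt s t l k) = t - s" if "0 <= s" "s <= t" "t <= T" for s t l
  using ptends[OF that] by (simp add: sum_lessThan_telescope)
 have nd: "mom_le M p (C * (t - s) powr a) (%w. - defect \<Xi> s u t w)"
  "mom_le M p (C * (t - s) powr b) (RCE s (%w. - defect \<Xi> s u t w))"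
  if st: "0 <= s" "s <= u" "u <= t" "t <= T" for s u t
 proof -
  show "mom_le M p (C * (t - s) powr a) (%w. - defect \<Xi> s u t w)"
   by (rule mom_le_uminus[OF defect'(1)[OF st]])
  interpret sigma_finite_subalgebra M "Fil s"
   by (rule sigma_finite_subalgebraI) (use st in "auto intro!: Fil_subalgebra")
  have "AE w in M. RCE s (%w. (-1) * defect \<Xi> s u t w) w = (-1) * RCE s (defect \<Xi> s u t) w"
   by (rule real_cond_exp_cmult[OF mom_le_integrable[OF defect'(1)[OF st] p0]])
  then show "mom_le M p (C * (t - s) powr b) (RCE s (%w. - defect \<Xi> s u t w))"
   by (intro mom_le_cong[OF mom_le_uminus[OF defect'(2)[OF st]]])
    (auto elim!: eventually_mono)
 qed
 have Y: "mom_le M p (c s t l) (Y s t l)" if st: "0 <= s" "s <= t" "t <= T" for s t l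
 proof -
  have "mom_le M p (C * (pt s t l (2^l) - pt s t l 0) powr b' * h l powr (b - b') +
   sqrt (2 ^ (p + 2)) * (C * (1 + T powr (b - a))) * (pt s t l (2^l) - pt s t l 0) powr a' * h l powr (a - a')) (Y s t l)"
   unfolding Y_eq
   using ex C ptT[OF st] order ptlen nd order_trans[OF order]
   by (intro mom_le_partition_sum p borel_measurable_uminus mdef) auto
  then show ?thesis by (simp add: ptends[OF st] c_def C'_def)
 qed
 have C'0: "0 <= C'" using C by (simp add: C'_def)
 have h_sums: "summable (%l. h l powr r)" if "0 < r" for r
 proof -
  have "h l powr r = T powr r * (2 powr (- r)) ^ l" for l
  proof -
   have "h l = T * 2 powr (- real l)" by (simp add: h_def powr_minus powr_realpow divide_inverse)
   then have "h l powr r = T powr r * 2 powr (- r * real l)"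
    by (simp add: powr_mult powr_powr mult.commute)
   also have "2 powr (- r * real l) = (2 powr (- r)) powr real l" by (simp only: powr_powr)
   also have "... = (2 powr (- r)) ^ l" by (rule powr_realpow) simp
   finally show ?thesis .
  qed
  moreover have "2 powr (- r) < (1::real)" using that by (simp add: powr_less_one)
  ultimately show ?thesis by (auto intro!: summable_mult summable_geometric)
 qed
 have c_sums: "summable (c s t)" for s t
  unfolding c_def[abs_def] using ex by (intro summable_add summable_mult h_sums) auto
 have sum_Y: "(\<Sum>i<l. Y s t i w) = dyadic_sum T \<Xi> s t l w - dyadic_sum T \<Xi> s t 0 w" for s t l w
  unfolding Y_def by (rule sum_lessThan_telescope)
 have dsum0: "dyadic_sum T \<Xi> s t 0 w = \<Xi> s t w" if "0 <= s" "s <= t" "t <= T" for s t w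
  using clip_dyadic_ends[OF that, of 0] by (simp add: dyadic_sum_def)
 have sumble: "AE w in M. summable (%l. Y s t l w)" if st: "0 <= s" "s <= t" "t <= T" for s t
  by (rule mom_le_series(1)[OF Y[OF st] c_sums p(1) p0])
 have conv: "AE w in M. (%l. dyadic_sum T \<Xi> s t l w) \<longlonglongrightarrow> sewing T \<Xi> s t w"
  if st: "0 <= s" "s <= t" "t <= T" for s t
  using sumble[OF st]
 proof eventually_elim
  case (elim w)
  then have "(%l. (\<Sum>i<l. Y s t i w) + \<Xi> s t w) \<longlonglongrightarrow> (\<Sum>l. Y s t l w) + \<Xi> s t w"
   by (intro tendsto_intros summable_LIMSEQ)
  then have "(%l. dyadic_sum T \<Xi> s t l w) \<longlonglongrightarrow> (\<Sum>l. Y s t l w) + \<Xi> s t w"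
   by (simp add: sum_Y dsum0[OF st])
  then show ?case unfolding sewing_def using convergent_LIMSEQ_iff convergentI by blast
 qed
 then show "AE w in M. (%l. dyadic_sum T \<Xi> s t l w) \<longlonglongrightarrow> sewing T \<Xi> s t w"
  if "0 <= s" "s <= t" "t <= T" for s t using that by blast

 have tail: "mom_le M p (\<Sum>l. c s t (l + n)) (%w. sewing T \<Xi> s t w - dyadic_sum T \<Xi> s t n w)"
  if st: "0 <= s" "s <= t" "t <= T" for s t n
 proof (rule mom_le_cong)
  show "mom_le M p (\<Sum>l. c s t (l + n)) (%w. \<Sum>l. Y s t (l + n) w)"
   using c_sums by (intro mom_le_series(2) Y st p p0 summable_ignore_initial_segment)
  show "(%w. sewing T \<Xi> s t w - dyadic_sum T \<Xi> s t n w) \<in> borel_measurable M"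
   using st by (intro borel_measurable_diff Fil_meas_M[OF sew_meas[OF st]] Fil_meas_M[OF msum[OF st]]) auto
  show "AE w in M. (\<Sum>l. Y s t (l + n) w) = sewing T \<Xi> s t w - dyadic_sum T \<Xi> s t n w"
   using sumble[OF st] conv[OF st]
  proof eventually_elim
   case (elim w)
   have "(%l. (\<Sum>i<l. Y s t i w) + \<Xi> s t w) \<longlonglongrightarrow> (\<Sum>l. Y s t l w) + \<Xi> s t w"
    using elim(1) by (intro tendsto_intros summable_LIMSEQ)
   then have "(\<Sum>l. Y s t l w) + \<Xi> s t w = sewing T \<Xi> s t w"
    using elim(2) by (intro LIMSEQ_unique[OF _ elim(2)]) (simp add: sum_Y dsum0[OF st])
   then show ?case using suminf_split_initial_segment[OF elim(1), of n] by (simp add: sum_Y dsum0[OF st])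
  qed
 qed
 have tail0: "(%n. \<Sum>l. c s t (l + n)) \<longlonglongrightarrow> 0" for s t
  using suminf_exist_split2[OF c_sums] by simp

 have EY: "mom_le M p (C * (t - s) powr b' * h l powr (b - b')) (RCE s (Y s t l))"
  if st: "0 <= s" "s <= t" "t <= T" for s t l
 proof -
  let ?D = "%k w. - defect \<Xi> (pt s t l k) (md s t l k) (pt s t l (Suc k)) w"
  have s: "subalgebra M (Fil s)" using st by (intro Fil_subalgebra) auto
  interpret sigma_finite_subalgebra M "Fil s" by (rule sigma_finite_subalgebraI[OF s])
  note D = nd[OF ptT(1)[OF st] order ptT(2)[OF st], of l]
  note iD = mom_le_integrable[OF D(1) p0]
  have eq: "AE w in M. RCE s (Y s t l) w = (\<Sum>k<2 ^ l. RCE s (?D k) w)"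
   unfolding Y_eq by (rule real_cond_exp_sum[OF iD])
  have mom: "mom_le M p (\<Sum>k<2 ^ l. C * (pt s t l (Suc k) - pt s t l k) powr b) (%w. \<Sum>k<2 ^ l. RCE s (?D k) w)"
  proof (intro mom_le_sum p p0)
   fix k
   have sk: "subalgebra M (Fil (pt s t l k))" using ptT[OF st] by (intro Fil_subalgebra) auto
   have "subalgebra (Fil (pt s t l k)) (Fil s)"
    using Fil_mono[of s "pt s t l k"] ptT[OF st] s sk st by (auto simp: subalgebra_def)
   then have "AE w in M. RCE s (real_cond_exp M (Fil (pt s t l k)) (?D k)) w = RCE s (?D k) w"
    by (rule real_cond_exp_nested_subalg[OF sk _ iD])
   then show "mom_le M p (C * (pt s t l (Suc k) - pt s t l k) powr b) (RCE s (?D k))"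
    by (intro mom_le_cong[OF mom_le_cond_exp[OF s D(2) p(1) p0]]) auto
  qed simp
  have le: "(\<Sum>k<2 ^ l. C * (pt s t l (Suc k) - pt s t l k) powr b) <= C * ((t - s) powr b' * h l powr (b - b'))"
   unfolding sum_distrib_left[symmetric] using C ex ptlen
   by (intro mult_left_mono sum_powr_le ptsum st) auto
  show ?thesis
   by (rule mom_le_cong_weaken[OF mom eq]) (use le in "simp_all add: mult.assoc")
 qed

 define S where "S r = (\<Sum>l. h l powr r)" for r
 define K where "K = C * S (b - b') * (1 + T powr (b' - a')) + C' * S (a - a')"
 have S0: "0 <= S r" if "0 < r" for r unfolding S_def using h_sums[OF that] by (intro suminf_nonneg) auto
 have "0 <= K" unfolding K_def using C C'0 S0 ex by (intro add_nonneg_nonneg mult_nonneg_nonneg) auto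
 moreover have "mom_le M p (K * (t - s) powr a') (%w. sewing T \<Xi> s t w - \<Xi> s t w)"
  if st: "0 <= s" "s <= t" "t <= T" for s t
 proof (rule mom_le_weaken)
  show "mom_le M p (\<Sum>l. c s t l) (%w. sewing T \<Xi> s t w - \<Xi> s t w)"
   using tail[OF st, of 0] by (simp add: dsum0[OF st])
  have "(\<Sum>l. c s t l) = C * (t - s) powr b' * S (b - b') + C' * (t - s) powr a' * S (a - a')"
   unfolding c_def S_def using h_sums ex
   by (subst suminf_add[symmetric]) (auto intro!: summable_mult simp: suminf_mult)
  then have eq: "(\<Sum>l. c s t l) = (C * S (b - b')) * (t - s) powr b' + C' * S (a - a') * (t - s) powr a'"
   by (simp only: mult_ac)
  have "(t - s) powr b' = (t - s) powr a' * (t - s) powr (b' - a')" by (simp add: powr_add[symmetric])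
  also have "... <= (t - s) powr a' * (1 + T powr (b' - a'))"
   using st ex by (intro mult_left_mono add_increasing powr_mono2) auto
  finally have "(C * S (b - b')) * (t - s) powr b' <= (C * S (b - b')) * ((t - s) powr a' * (1 + T powr (b' - a')))"
   using C S0[of "b - b'"] ex by (intro mult_left_mono) auto
  moreover have "(C * S (b - b')) * ((t - s) powr a' * (1 + T powr (b' - a'))) + C' * S (a - a') * (t - s) powr a' = K * (t - s) powr a'"
   unfolding K_def by (simp add: algebra_simps)
  ultimately show "(\<Sum>l. c s t l) <= K * (t - s) powr a'" unfolding eq by linarith
 qed
 moreover have "mom_le M p (K * (t - s) powr b') (RCE s (%w. sewing T \<Xi> s t w - \<Xi> s t w))"
  if st: "0 <= s" "s <= t" "t <= T" for s t
 proof -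
  have s: "subalgebra M (Fil s)" using st by (intro Fil_subalgebra) auto
  interpret sigma_finite_subalgebra M "Fil s" by (rule sigma_finite_subalgebraI[OF s])
  have "mom_le M p (C * (t - s) powr b' * S (b - b') + (\<Sum>l. c s t (l + n)))
    (RCE s (%w. sewing T \<Xi> s t w - \<Xi> s t w))" for n
  proof -
   note iY = mom_le_integrable[OF Y[OF st] p0] and it = mom_le_integrable[OF tail[OF st, of n] p0]
   have *: "(%w. sewing T \<Xi> s t w - \<Xi> s t w) = (%w. (\<Sum>l<n. Y s t l w) + (sewing T \<Xi> s t w - dyadic_sum T \<Xi> s t n w))"
    by (auto simp: sum_Y dsum0[OF st])
   have eq1: "AE w in M. RCE s (%w. sewing T \<Xi> s t w - \<Xi> s t w) w =
     RCE s (%w. \<Sum>l<n. Y s t l w) w +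
     RCE s (%w. sewing T \<Xi> s t w - dyadic_sum T \<Xi> s t n w) w"
    unfolding * by (intro real_cond_exp_add Bochner_Integration.integrable_sum iY it)
   have eq2: "AE w in M. RCE s (%w. \<Sum>l<n. Y s t l w) w = (\<Sum>l<n. RCE s (Y s t l) w)"
    by (rule real_cond_exp_sum[OF iY])
   have mom: "mom_le M p ((\<Sum>l<n. C * (t - s) powr b' * h l powr (b - b')) + (\<Sum>l. c s t (l + n)))
     (%w. (\<Sum>l<n. RCE s (Y s t l) w) + RCE s (%w. sewing T \<Xi> s t w - dyadic_sum T \<Xi> s t n w) w)"
    by (intro mom_le_add mom_le_sum p p0 EY st mom_le_cond_exp s tail) auto
   have le: "(\<Sum>l<n. C * (t - s) powr b' * h l powr (b - b')) <= C * (t - s) powr b' * S (b - b')"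
    unfolding sum_distrib_left[symmetric] S_def using C h_sums ex
    by (intro mult_left_mono sum_le_suminf) auto
   have eq: "AE w in M. RCE s (%w. sewing T \<Xi> s t w - \<Xi> s t w) w =
     (\<Sum>l<n. RCE s (Y s t l) w) +
     RCE s (%w. sewing T \<Xi> s t w - dyadic_sum T \<Xi> s t n w) w"
    using eq1 eq2 by eventually_elim simp
   show ?thesis
    by (rule mom_le_cong_weaken[OF mom eq]) (use le in simp_all)
  qed
  then have "mom_le M p (C * (t - s) powr b' * S (b - b') + 0) (RCE s (%w. sewing T \<Xi> s t w - \<Xi> s t w))"
   by (rule mom_le_limit[OF _ tendsto_add[OF tendsto_const tail0]]) auto
  moreover have "C * S (b - b') <= K"
   unfolding K_def using C C'0 S0[of "b - b'"] S0[of "a - a'"] ex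
   by (auto intro!: add_increasing2 mult_nonneg_nonneg simp: distrib_left)
  then have "C * (t - s) powr b' * S (b - b') <= K * (t - s) powr b'"
   using mult_right_mono[of "C * S (b - b')" K "(t - s) powr b'"] by (simp add: mult_ac)
  ultimately show ?thesis by (auto intro: mom_le_weaken)
 qed
 ultimately show "\<exists>K\<ge>0. \<forall>s t. 0 <= s --> s <= t --> t <= T -->
    mom_le M p (K * (t - s) powr a') (%w. sewing T \<Xi> s t w - \<Xi> s t w) &
    mom_le M p (K * (t - s) powr b') (RCE s (%w. sewing T \<Xi> s t w - \<Xi> s t w))"
  by blast

 fix s u t assume sut: "0 <= s" "s <= u" "u <= t" "t <= T"
 have st: "0 <= s" "s <= t" "t <= T" and su: "0 <= s" "s <= u" "u <= T" and ut: "0 <= u" "u <= t" "t <= T"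
  using sut by auto
 define E where "E l w = dyadic_sum T \<Xi> s t l w - dyadic_sum T \<Xi> s u l w - dyadic_sum T \<Xi> u t l w" for l w
 have E: "mom_le M p (C * h l powr a) (E l)" for l
 proof -
  \<comment> \<open>only the dyadic interval that contains u contributes\<close>
  let ?B = "%k. dyadic T l k < u & u < dyadic T l (Suc k)"
  let ?e = "%k w. if ?B k then defect \<Xi> (clip s t (dyadic T l k)) u (clip s t (dyadic T l (Suc k))) w else 0"
  have E_eq: "E l = (%w. \<Sum>k<2 ^ l. ?e k w)"
   unfolding E_def[abs_def] dyadic_sum_def sum_subtractf[symmetric]
  proof (intro ext sum.cong refl)
   fix w k
   show "\<Xi> (clip s t (dyadic T l k)) (clip s t (dyadic T l (Suc k))) w -
     \<Xi> (clip s u (dyadic T l k)) (clip s u (dyadic T l (Suc k))) w -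
     \<Xi> (clip u t (dyadic T l k)) (clip u t (dyadic T l (Suc k))) w = ?e k w"
   proof -
    consider "u <= dyadic T l k" | "dyadic T l (Suc k) <= u" | "?B k" by linarith
    then show ?thesis
    proof cases
     case 1
     then have "u <= dyadic T l (Suc k)" using dyadic_mono[of T k "Suc k" l] by simp
     then have "clip s u (dyadic T l k) = u" "clip s u (dyadic T l (Suc k)) = u"
      "clip u t (dyadic T l k) = clip s t (dyadic T l k)" "clip u t (dyadic T l (Suc k)) = clip s t (dyadic T l (Suc k))"
      using 1 sut by (auto simp: clip_def)
     then show ?thesis using 1 diag by simp
    next
     case 2
     then have "dyadic T l k <= u" using dyadic_mono[of T k "Suc k" l] by simp
     then have "clip u t (dyadic T l k) = u" "clip u t (dyadic T l (Suc k)) = u"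
      "clip s u (dyadic T l k) = clip s t (dyadic T l k)" "clip s u (dyadic T l (Suc k)) = clip s t (dyadic T l (Suc k))"
      using 2 sut by (auto simp: clip_def)
     then show ?thesis using 2 diag by simp
    next
     case 3
     then have "clip u t (dyadic T l k) = u" "clip s u (dyadic T l (Suc k)) = u"
      "clip s u (dyadic T l k) = clip s t (dyadic T l k)" "clip u t (dyadic T l (Suc k)) = clip s t (dyadic T l (Suc k))"
      using sut by (auto simp: clip_def)
     then show ?thesis using 3 by (simp add: defect_def)
    qed
   qed
  qed
  have mom: "mom_le M p (if ?B k then C * h l powr a else 0) (?e k)" for k
  proof (cases "?B k")
   case True
   have "mom_le M p (C * (clip s t (dyadic T l (Suc k)) - clip s t (dyadic T l k)) powr a)
    (defect \<Xi> (clip s t (dyadic T l k)) u (clip s t (dyadic T l (Suc k))))"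
    using True sut by (intro defect') (auto simp: clip_def)
   moreover have "C * (clip s t (dyadic T l (Suc k)) - clip s t (dyadic T l k)) powr a <= C * h l powr a"
    using C ex ptlen[of s t l k] unfolding pt_def by (intro mult_left_mono powr_mono2) auto
   ultimately show ?thesis using True by (auto intro: mom_le_weaken)
  next
   case False then show ?thesis by (auto intro: mom_le_bounded)
  qed
  have "(\<Sum>k<2 ^ l. if ?B k then C * h l powr a else 0) = (\<Sum>k\<in>{k\<in>{..<2 ^ l}. ?B k}. C * h l powr a)"
   by (rule sum.inter_filter[symmetric]) simp
  also have "... = real (card {k\<in>{..<2 ^ l}. ?B k}) * (C * h l powr a)" by simp
  also have "... <= 1 * (C * h l powr a)"
  proof (rule mult_right_mono)
   have "j = k" if "?B j" "?B k" for j k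
   proof (rule ccontr)
    assume "j \<noteq> k"
    then consider "Suc j <= k" | "Suc k <= j" by linarith
    then show False using that dyadic_mono[of T "Suc j" k l] dyadic_mono[of T "Suc k" j l] by cases auto
   qed
   then have "card {k\<in>{..<2 ^ l}. ?B k} <= Suc 0" by (subst card_le_Suc0_iff_eq) auto
   then show "real (card {k\<in>{..<2 ^ l}. ?B k}) <= 1" by simp
  qed (use C in simp)
  finally show ?thesis
   unfolding E_eq by (intro mom_le_weaken[OF mom_le_sum[OF _ mom p(1) p0]]) auto
 qed
 have "(%l. C * h l powr a) \<longlonglongrightarrow> C * 0"
  using h_sums[of a] ex by (intro tendsto_mult tendsto_const summable_LIMSEQ_zero) auto
 then have "mom_le M p (C * 0) (%w. sewing T \<Xi> s t w - sewing T \<Xi> s u w - sewing T \<Xi> u t w)"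
 proof (rule mom_le_limit[OF E])
  show "AE w in M. (%l. E l w) \<longlonglongrightarrow> sewing T \<Xi> s t w - sewing T \<Xi> s u w - sewing T \<Xi> u t w"
   using conv[OF st] conv[OF su] conv[OF ut] unfolding E_def
   by eventually_elim (intro tendsto_intros)
 qed (use sut in "auto intro!: borel_measurable_diff Fil_meas_M[OF sew_meas]")
 then have "AE w in M. sewing T \<Xi> s t w - sewing T \<Xi> s u w - sewing T \<Xi> u t w = 0"
  by (intro mom_le_0_AE[of M p]) (use p0 in auto)
 then show "AE w in M. sewing T \<Xi> s t w = sewing T \<Xi> s u w + sewing T \<Xi> u t w"
  by eventually_elim simp
qed

end


section \<open>Conditional expectations of vectors\<close>

context prob_space begin

lemma cond_expectation_inner:
 fixes X :: "'a => 'v::euclidean_space"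
 assumes "e \<in> Basis"
 shows "cond_expectation M G X w \<bullet> e = real_cond_exp M G (%w. X w \<bullet> e) w"
 using assms by (simp add: cond_expectation_def inner_sum_left_Basis)

lemma meas_cond_expectation: "cond_expectation M G X \<in> borel_measurable G"
 unfolding cond_expectation_def by measurable

text \<open>Linear functionals whose coefficients are bounded and measurable with respect to the smaller
 \<open>\<sigma>\<close>-algebra can be taken out of a conditional expectation.\<close>

lemma cond_exp_linear_functional:
 fixes X :: "'a => 'v::euclidean_space"
 assumes G: "subalgebra M G" and X: "integrable M X"
  and lin: "!!w. linear (l w)"
  and meas: "!!e. e \<in> Basis ==> (%w. l w e) \<in> borel_measurable G"
  and bd: "!!e w. e \<in> Basis ==> \<bar>l w e\<bar> <= (c::real)"
 shows "AE w in M. real_cond_exp M G (%w. l w (X w)) w = l w (cond_expectation M G X w)"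
proof -
 interpret sigma_finite_subalgebra M G by (rule sigma_finite_subalgebraI[OF G])
 have expand: "l w v = (\<Sum>e\<in>Basis. l w e * (v \<bullet> e))" for w and v :: 'v
 proof -
  have "l w v = l w (\<Sum>e\<in>Basis. (v \<bullet> e) *\<^sub>R e)" by (simp add: euclidean_representation)
  also have "... = (\<Sum>e\<in>Basis. (v \<bullet> e) * l w e)"
   using lin[of w] by (simp add: linear_sum linear_cmul)
  finally show ?thesis by (simp add: mult.commute)
 qed
 define h where "h e w = (if e \<in> Basis then l w e * (X w \<bullet> e) else 0)" for e :: 'v and w
 have mM: "(%w. l w e) \<in> borel_measurable M" if "e \<in> Basis" for e
  by (rule measurable_from_subalg[OF G meas[OF that]])
 have iX: "integrable M (%w. X w \<bullet> e)" for e using X by (rule integrable_inner_left)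
 have ih0: "integrable M (%w. l w e * (X w \<bullet> e))" if e: "e \<in> Basis" for e
 proof (rule Bochner_Integration.integrable_bound[OF integrable_mult_right[OF integrable_abs[OF iX[of e]], of c]])
  show "(%w. l w e * (X w \<bullet> e)) \<in> borel_measurable M" using mM[OF e] iX[of e] by auto
  show "AE w in M. norm (l w e * (X w \<bullet> e)) <= norm (c * \<bar>X w \<bullet> e\<bar>)"
  proof (rule AE_I2)
   fix w have "\<bar>l w e\<bar> <= \<bar>c\<bar>" using bd[OF e, of w] by linarith
   then show "norm (l w e * (X w \<bullet> e)) <= norm (c * \<bar>X w \<bullet> e\<bar>)"
    by (simp add: abs_mult mult_right_mono)
  qed
 qed
 have ih: "integrable M (h e)" for e
  unfolding h_def[abs_def] using ih0 by (cases "e \<in> Basis") auto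
 have A1: "AE w in M. real_cond_exp M G (%w. \<Sum>e\<in>Basis. h e w) w = (\<Sum>e\<in>Basis. real_cond_exp M G (h e) w)"
  by (rule real_cond_exp_sum[OF ih])
 have A2: "AE w in M. \<forall>e\<in>Basis. real_cond_exp M G (h e) w = l w e * real_cond_exp M G (%w. X w \<bullet> e) w"
 proof (rule AE_finite_allI[OF finite_Basis])
  fix e :: 'v assume e: "e \<in> Basis"
  then have "h e = (%w. l w e * (X w \<bullet> e))" by (simp add: h_def[abs_def])
  then show "AE w in M. real_cond_exp M G (h e) w = l w e * real_cond_exp M G (%w. X w \<bullet> e) w"
   using real_cond_exp_mult[OF meas[OF e] _ ih0[OF e]] iX[of e] by auto
 qed
 have eq: "(%w. l w (X w)) = (%w. \<Sum>e\<in>Basis. h e w)"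
  by (rule ext, subst expand) (simp add: h_def)
 show ?thesis unfolding eq using A1 A2
 proof eventually_elim
  case (elim w)
  have "l w (cond_expectation M G X w) = (\<Sum>e\<in>Basis. l w e * real_cond_exp M G (%w. X w \<bullet> e) w)"
   by (subst expand) (simp add: cond_expectation_inner)
  then show ?case using elim by simp
 qed
qed

lemma mom_le_euclidean:
 fixes X :: "'b => 'v::euclidean_space"
 assumes p: "even p" "0 < p" and X: "X \<in> borel_measurable N" and c: "!!b. b \<in> Basis ==> mom_le N p c (%w. X w \<bullet> b)"
 shows "mom_le N p (real DIM('v) * c) X"
proof -
 have 1: "mom_le N p (\<Sum>b\<in>(Basis::'v set). c) (%w. \<Sum>b\<in>Basis. \<bar>X w \<bullet> b\<bar>)"
 proof (rule mom_le_sum[OF finite_Basis _ p])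
  fix b :: 'v assume b: "b \<in> Basis"
  have "(%w. \<bar>X w \<bullet> b\<bar>) \<in> borel_measurable N" using mom_le_measurable[OF c[OF b]] by simp
  then show "mom_le N p c (%w. \<bar>X w \<bullet> b\<bar>)" using mom_le_AE_bound[OF c[OF b], of 1 "%w. \<bar>X w \<bullet> b\<bar>"] by simp
 qed
 have "AE w in N. norm (X w) <= 1 * norm (\<Sum>b\<in>Basis. \<bar>X w \<bullet> b\<bar>)"
 proof (rule AE_I2)
  fix w have "norm (X w) <= (\<Sum>b\<in>Basis. \<bar>X w \<bullet> b\<bar>)" by (rule norm_le_l1)
  then show "norm (X w) <= 1 * norm (\<Sum>b\<in>Basis. \<bar>X w \<bullet> b\<bar>)" by simp
 qed
 from mom_le_AE_bound[OF 1 _ X this] show ?thesis by simp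
qed

lemma mom_le_inner:
 fixes X :: "'b => 'v::euclidean_space"
 assumes X: "mom_le N p c X" and b: "b \<in> Basis"
 shows "mom_le N p c (%w. X w \<bullet> b)"
proof -
 have "(%w. X w \<bullet> b) \<in> borel_measurable N" using mom_le_measurable[OF X] by simp
 moreover have "AE w in N. norm (X w \<bullet> b) <= 1 * norm (X w)" using b by (auto intro!: AE_I2 simp: Basis_le_norm)
 ultimately show ?thesis using mom_le_AE_bound[OF X, of 1 "%w. X w \<bullet> b"] by simp
qed

lemma mom_le_cond_expectation:
 fixes X :: "'a => 'v::euclidean_space"
 assumes G: "subalgebra M G" and p: "even p" "0 < p" and X: "mom_le M p c X"
 shows "mom_le M p (real DIM('v) * c) (cond_expectation M G X)"
proof (rule mom_le_euclidean[OF p measurable_from_subalg[OF G meas_cond_expectation]])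
 fix b :: 'v assume b: "b \<in> Basis"
 show "mom_le M p c (%w. cond_expectation M G X w \<bullet> b)"
  unfolding cond_expectation_inner[OF b] by (rule mom_le_cond_exp[OF G mom_le_inner[OF X b] p])
qed

lemma cond_expectation_cong:
 fixes X Y :: "'a => 'v::euclidean_space"
 assumes G: "subalgebra M G" and eq: "AE w in M. X w = Y w" and m: "X \<in> borel_measurable M" "Y \<in> borel_measurable M"
 shows "AE w in M. cond_expectation M G X w = cond_expectation M G Y w"
proof -
 interpret sigma_finite_subalgebra M G by (rule sigma_finite_subalgebraI[OF G])
 have "AE w in M. \<forall>b\<in>Basis. real_cond_exp M G (%w. X w \<bullet> b) w = real_cond_exp M G (%w. Y w \<bullet> b) w"
 proof (rule AE_finite_allI[OF finite_Basis])
  fix b :: 'v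
  have "AE w in M. X w \<bullet> b = Y w \<bullet> b" using eq by eventually_elim simp
  then show "AE w in M. real_cond_exp M G (%w. X w \<bullet> b) w = real_cond_exp M G (%w. Y w \<bullet> b) w"
   by (rule real_cond_exp_cong) (use m in auto)
 qed
 then show ?thesis by eventually_elim (simp add: cond_expectation_def)
qed

lemma cond_expectation_add:
 fixes X Y :: "'a => 'v::euclidean_space"
 assumes G: "subalgebra M G" and i: "integrable M X" "integrable M Y"
 shows "AE w in M. cond_expectation M G (%w. X w + Y w) w = cond_expectation M G X w + cond_expectation M G Y w"
proof -
 interpret sigma_finite_subalgebra M G by (rule sigma_finite_subalgebraI[OF G])
 have "AE w in M. \<forall>b\<in>Basis. real_cond_exp M G (%w. (X w + Y w) \<bullet> b) w
   = real_cond_exp M G (%w. X w \<bullet> b) w + real_cond_exp M G (%w. Y w \<bullet> b) w"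
  unfolding inner_add_left
  by (intro AE_finite_allI finite_Basis real_cond_exp_add integrable_inner_left i)
 then show ?thesis by eventually_elim (simp add: cond_expectation_def scaleR_add_left sum.distrib)
qed

lemma cond_expectation_linear_map:
 fixes X :: "'a => 'v::euclidean_space" and L :: "'a => 'v => 'w::euclidean_space"
 assumes G: "subalgebra M G" and X: "integrable M X" and lin: "!!w. linear (L w)"
  and meas: "!!e. e \<in> Basis ==> (%w. L w e) \<in> borel_measurable G" and bd: "!!v w. norm (L w v) <= c * norm v"
 shows "AE w in M. cond_expectation M G (%w. L w (X w)) w = L w (cond_expectation M G X w)"
proof -
 have "AE w in M. \<forall>b\<in>Basis. real_cond_exp M G (%w. L w (X w) \<bullet> b) w = L w (cond_expectation M G X w) \<bullet> b"
 proof (rule AE_finite_allI[OF finite_Basis])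
  fix b :: 'w assume b: "b \<in> Basis"
  show "AE w in M. real_cond_exp M G (%w. L w (X w) \<bullet> b) w = L w (cond_expectation M G X w) \<bullet> b"
  proof (rule cond_exp_linear_functional[OF G X])
   show "linear (%v. L w v \<bullet> b)" for w
    using lin[of w] by (intro linearI) (auto simp: linear_add linear_cmul inner_add_left)
   show "(%w. L w e \<bullet> b) \<in> borel_measurable G" if "e \<in> Basis" for e using meas[OF that] by simp
   show "\<bar>L w e \<bullet> b\<bar> <= c" if "e \<in> Basis" for e w
    using Basis_le_norm[OF b, of "L w e"] bd[of w e] that by simp
  qed
 qed
 then show ?thesis
 proof eventually_elim
  case (elim w)
  have "L w (cond_expectation M G X w) = (\<Sum>b\<in>Basis. (L w (cond_expectation M G X w) \<bullet> b) *\<^sub>R b)"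
   by (rule euclidean_representation[symmetric])
  then show ?case using elim by (simp add: cond_expectation_def)
 qed
qed

lemma mom_le_cond_expectation_linear_map:
 fixes X :: "'a => 'v::euclidean_space" and L :: "'a => 'v => 'w::euclidean_space"
 assumes G: "subalgebra M G" and X: "integrable M X" and lin: "!!w. linear (L w)"
  and meas: "!!e. e \<in> Basis ==> (%w. L w e) \<in> borel_measurable G" and c: "0 <= c" and bd: "!!v w. norm (L w v) <= c * norm v"
  and mom: "mom_le M p k (cond_expectation M G X)"
 shows "mom_le M p (c * k) (cond_expectation M G (%w. L w (X w)))"
proof (rule mom_le_AE_bound[OF mom c measurable_from_subalg[OF G meas_cond_expectation]])
 have "AE w in M. cond_expectation M G (%w. L w (X w)) w = L w (cond_expectation M G X w)"
  by (rule cond_expectation_linear_map[OF G X lin meas bd])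
 then show "AE w in M. norm (cond_expectation M G (%w. L w (X w)) w) <= c * norm (cond_expectation M G X w)"
  by eventually_elim (simp add: bd)
qed

lemma mom_le_cond_expectation_add:
 fixes X Y :: "'a => 'v::euclidean_space"
 assumes G: "subalgebra M G" and p: "even p" "0 < p" and i: "integrable M X" "integrable M Y"
  and m: "mom_le M p c (cond_expectation M G X)" "mom_le M p d (cond_expectation M G Y)"
 shows "mom_le M p (c + d) (cond_expectation M G (%w. X w + Y w))"
 by (rule mom_le_cong_weaken[OF mom_le_add[OF m p] cond_expectation_add[OF G i]
   measurable_from_subalg[OF G meas_cond_expectation] order_refl])

end

section \<open>Stochastic sewing of vectors\<close>

context filtered_prob_space begin

text \<open>Componentwise, which reduces the estimates to scalar martingales.\<close>

definition vector_sewing :: "(real => real => 'a => 'v::euclidean_space) => real => real => 'a => 'v" where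
 "vector_sewing X s t w = (\<Sum>e\<in>Basis. sewing T (%s t w. X s t w \<bullet> e) s t w *\<^sub>R e)"

theorem vector_stochastic_sewing:
 fixes X :: "real => real => 'a => 'v::euclidean_space"
 assumes p: "even p" "2 <= p" and ex: "1 / 2 <= a'" "a' < a" "1 <= b'" "b' < b" "a <= b" "a' <= b'" and C: "0 <= C"
  and diag: "!!u w. X u u w = 0"
  and meas: "!!s t. 0 <= s ==> s <= t ==> t <= T ==> X s t \<in> borel_measurable (Fil t)"
  and defect: "!!s u t. 0 <= s ==> s < u ==> u < t ==> t <= T ==> mom_le M p (C * (t - s) powr a) (defect X s u t)"
  and cdefect: "!!s u t. 0 <= s ==> s < u ==> u < t ==> t <= T ==>
    mom_le M p (C * (t - s) powr b) (CE s (defect X s u t))"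
 shows "!!s t. 0 <= s ==> s <= t ==> t <= T ==> AE w in M. (%l. dyadic_sum T X s t l w) \<longlonglongrightarrow> vector_sewing X s t w"
  and "!!s t. 0 <= s ==> s <= t ==> t <= T ==> vector_sewing X s t \<in> borel_measurable (Fil t)"
  and "\<exists>K\<ge>0. \<forall>s t. 0 <= s --> s <= t --> t <= T -->
    mom_le M p (K * (t - s) powr a') (%w. vector_sewing X s t w - X s t w) &
    mom_le M p (K * (t - s) powr b') (CE s (%w. vector_sewing X s t w - X s t w))"
  and "!!s u t. 0 <= s ==> s <= u ==> u <= t ==> t <= T ==>
    AE w in M. vector_sewing X s t w = vector_sewing X s u w + vector_sewing X u t w"
proof -
 have p0: "0 < p" using p by simp
 define Y where "Y e s t w = X s t w \<bullet> e" for e :: 'v and s t w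
 have V: "vector_sewing X s t w = (\<Sum>e\<in>Basis. sewing T (Y e) s t w *\<^sub>R e)" for s t w
  unfolding vector_sewing_def Y_def[abs_def] ..
 have Vi: "vector_sewing X s t w \<bullet> e = sewing T (Y e) s t w" if "e \<in> Basis" for s t w e
  unfolding V using that by (simp add: inner_sum_left_Basis)
 have Yd: "defect (Y e) s u t = (%w. defect X s u t w \<bullet> e)" for e s u t
  by (auto simp: defect_def Y_def inner_diff_left)
 have Y0: "Y e u u w = 0" for e u w by (simp add: Y_def diag)
 have Ym: "Y e s t \<in> borel_measurable (Fil t)" if "0 <= s" "s <= t" "t <= T" for e s t
  unfolding Y_def[abs_def] using meas[OF that] by simp
 have Yb: "mom_le M p (C * (t - s) powr a) (defect (Y e) s u t)"
  "mom_le M p (C * (t - s) powr b) (RCE s (defect (Y e) s u t))"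
  if sut: "0 <= s" "s < u" "u < t" "t <= T" and e: "e \<in> Basis" for e s u t
  using mom_le_inner[OF defect[OF sut] e] mom_le_inner[OF cdefect[OF sut] e]
  unfolding Yd cond_expectation_inner[OF e] by auto
 note sew = stochastic_sewing[OF p ex C Y0 Ym Yb]
 show "AE w in M. (%l. dyadic_sum T X s t l w) \<longlonglongrightarrow> vector_sewing X s t w" if st: "0 <= s" "s <= t" "t <= T" for s t
 proof -
  have "AE w in M. \<forall>e\<in>Basis. (%l. dyadic_sum T (Y e) s t l w) \<longlonglongrightarrow> sewing T (Y e) s t w"
   by (rule AE_finite_allI[OF finite_Basis]) (rule sew(1), use st in auto)
  then show ?thesis
  proof eventually_elim
   case (elim w)
   have "dyadic_sum T (Y e) s t l w = dyadic_sum T X s t l w \<bullet> e" for e l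
    unfolding dyadic_sum_def Y_def inner_sum_left ..
   with elim have "(%l. \<Sum>e\<in>Basis. (dyadic_sum T X s t l w \<bullet> e) *\<^sub>R e) \<longlonglongrightarrow> vector_sewing X s t w"
    unfolding V by (intro tendsto_sum tendsto_scaleR tendsto_const) auto
   then show ?case by (simp add: euclidean_representation)
  qed
 qed
 show Vm: "vector_sewing X s t \<in> borel_measurable (Fil t)" if st: "0 <= s" "s <= t" "t <= T" for s t
  unfolding V[abs_def]
 proof (intro borel_measurable_sum borel_measurable_scaleR borel_measurable_const)
  fix e :: 'v assume "e \<in> Basis"
  then show "sewing T (Y e) s t \<in> borel_measurable (Fil t)" by (intro sew(2)) (use st in auto)
 qed
 show "AE w in M. vector_sewing X s t w = vector_sewing X s u w + vector_sewing X u t w"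
  if st: "0 <= s" "s <= u" "u <= t" "t <= T" for s u t
 proof -
  have "AE w in M. \<forall>e\<in>Basis. sewing T (Y e) s t w = sewing T (Y e) s u w + sewing T (Y e) u t w"
   by (rule AE_finite_allI[OF finite_Basis]) (rule sew(4), use st in auto)
  then show ?thesis
  proof eventually_elim
   case (elim w)
   show ?case unfolding V sum.distrib[symmetric] using elim by (intro sum.cong) (auto simp: scaleR_add_left)
  qed
 qed
 define P where "P e q \<longleftrightarrow> 0 <= q & (\<forall>s t. 0 <= s --> s <= t --> t <= T -->
    mom_le M p (q * (t - s) powr a') (%w. sewing T (Y e) s t w - Y e s t w) &
    mom_le M p (q * (t - s) powr b') (RCE s (%w. sewing T (Y e) s t w - Y e s t w)))" for e q
 have "\<exists>q. P e q" if "e \<in> Basis" for e unfolding P_def by (rule sew(3)) (use that in auto)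
 then obtain q where q: "!!e. e \<in> Basis ==> P e (q e)" by metis
 define q1 where "q1 = (\<Sum>e\<in>Basis. q e)"
 have q1: "q e <= q1" if "e \<in> Basis" for e
  unfolding q1_def using that q by (intro member_le_sum) (auto simp: P_def)
 have q10: "0 <= q1" unfolding q1_def using q by (intro sum_nonneg) (auto simp: P_def)
 show "\<exists>K\<ge>0. \<forall>s t. 0 <= s --> s <= t --> t <= T -->
    mom_le M p (K * (t - s) powr a') (%w. vector_sewing X s t w - X s t w) &
    mom_le M p (K * (t - s) powr b') (CE s (%w. vector_sewing X s t w - X s t w))"
 proof (rule exI[of _ "real DIM('v) * q1"], rule conjI, use q10 in simp, intro allI impI)
  fix s t assume st: "0 <= s" "s <= t" "t <= T"
  let ?D = "%w. vector_sewing X s t w - X s t w"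
  have Fs: "subalgebra M (Fil s)" using st by (intro Fil_subalgebra) auto
  have Dm: "?D \<in> borel_measurable M"
   using st by (intro borel_measurable_diff Fil_meas_M[OF Vm] Fil_meas_M[OF meas]) auto
  have eq: "(%w. ?D w \<bullet> e) = (%w. sewing T (Y e) s t w - Y e s t w)" if "e \<in> Basis" for e
   using that by (simp add: inner_diff_left Vi Y_def)
  have 1: "mom_le M p (q1 * (t - s) powr a') (%w. ?D w \<bullet> e)" if e: "e \<in> Basis" for e
   unfolding eq[OF e]
   by (rule mom_le_weaken[OF _ mult_right_mono[OF q1[OF e] powr_ge_zero]]) (use q[OF e] st in "simp add: P_def")
  have 2: "mom_le M p (q1 * (t - s) powr b') (%w. CE s ?D w \<bullet> e)" if e: "e \<in> Basis" for e
   unfolding cond_expectation_inner[OF e] eq[OF e]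
   by (rule mom_le_weaken[OF _ mult_right_mono[OF q1[OF e] powr_ge_zero]]) (use q[OF e] st in "simp add: P_def")
  show "mom_le M p (real DIM('v) * q1 * (t - s) powr a') ?D &
    mom_le M p (real DIM('v) * q1 * (t - s) powr b') (CE s ?D)"
   using mom_le_euclidean[OF p(1) p0 Dm 1]
    mom_le_euclidean[OF p(1) p0 measurable_from_subalg[OF Fs meas_cond_expectation] 2]
   by (simp add: mult.assoc)
 qed
qed

end

context filtered_prob_space begin

text \<open>If the increments of an adapted process are small enough in conditional mean and in mean
 square, then telescoping over ever finer partitions shows that the process does not move.\<close>

lemma zero_if_small_increments:
 fixes Y :: "real => 'a => real"
 assumes p: "even p" "2 <= p" and ex: "1 / 2 < a" "1 < b" "a <= b" and C: "0 <= C"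
  and meas: "!!t. 0 <= t ==> t <= T ==> Y t \<in> borel_measurable (Fil t)"
  and zero: "AE w in M. Y 0 w = 0"
  and inc: "!!s t. 0 <= s ==> s < t ==> t <= T ==> mom_le M p (C * (t - s) powr a) (%w. Y t w - Y s w)"
  and cinc: "!!s t. 0 <= s ==> s < t ==> t <= T ==>
    mom_le M p (C * (t - s) powr b) (RCE s (%w. Y t w - Y s w))"
  and t: "0 <= t" "t <= T"
 shows "AE w in M. Y t w = 0"
proof (cases "t = 0")
 case True then show ?thesis using zero by simp
next
 case False
 then have t0: "0 < t" using t by simp
 define h where "h n = t / real (Suc n)" for n
 define c where "c n = C * t powr 1 * h n powr (b - 1) +
  sqrt (2 ^ (p + 2)) * (C * (1 + T powr (b - a))) * t powr (1 / 2) * h n powr (a - 1 / 2)" for n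
 have c: "mom_le M p (c n) (%w. Y t w - Y 0 w)" for n
 proof -
  define tau where "tau k = real k * h n" for k
  have h0: "0 < h n" using t0 by (simp add: h_def)
  have taun: "tau (Suc n) = t" "tau 0 = 0" by (simp_all add: tau_def h_def)
  have taus: "tau (Suc k) - tau k = h n" for k by (simp add: tau_def algebra_simps)
  have tauT: "0 <= tau k" "tau k <= t" if "k <= Suc n" for k
  proof -
   show "0 <= tau k" using h0 by (simp add: tau_def)
   have "tau k <= tau (Suc n)" unfolding tau_def using that h0 by (intro mult_right_mono) auto
   then show "tau k <= t" using taun by simp
  qed
  have lt: "tau k < tau (Suc k)" for k using taus[of k] h0 by simp
  have "mom_le M p (C * (tau (Suc n) - tau 0) powr 1 * h n powr (b - 1) +
    sqrt (2 ^ (p + 2)) * (C * (1 + T powr (b - a))) * (tau (Suc n) - tau 0) powr (1 / 2) * h n powr (a - 1 / 2))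
   (%w. \<Sum>k<Suc n. Y (tau (Suc k)) w - Y (tau k) w)"
  proof (rule mom_le_partition_sum)
   fix k assume k: "k < Suc n"
   have T: "0 <= tau k" "tau k < tau (Suc k)" "tau (Suc k) <= T" "0 <= tau (Suc k)"
    using tauT[of k] tauT[of "Suc k"] lt[of k] k t by auto
   show "(%w. Y (tau (Suc k)) w - Y (tau k) w) \<in> borel_measurable (Fil (tau (Suc k)))"
    using T by (intro borel_measurable_diff meas Fil_meas_mono[OF meas, of "tau k"]) auto
   show "mom_le M p (C * (tau (Suc k) - tau k) powr a) (%w. Y (tau (Suc k)) w - Y (tau k) w)"
    "mom_le M p (C * (tau (Suc k) - tau k) powr b)
     (real_cond_exp M (Fil (tau k)) (%w. Y (tau (Suc k)) w - Y (tau k) w))"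
    using T inc cinc by auto
   show "tau k <= tau (Suc k)" "tau (Suc k) - tau k <= h n" using T taus by auto
  qed (use p ex C taun t in auto)
  then show ?thesis
   unfolding sum_lessThan_telescope[of "%k. Y (tau k) _"] taun c_def by simp
 qed
 have "h \<longlonglongrightarrow> 0" unfolding h_def[abs_def]
  by (rule LIMSEQ_Suc[OF lim_const_over_n])
 then have h: "(%n. h n powr r) \<longlonglongrightarrow> 0" if "0 < r" for r
  using tendsto_powr'[of h 0 sequentially "%_. r" r] that t0 by (auto simp: h_def)
 have "c \<longlonglongrightarrow> C * t powr 1 * 0 + sqrt (2 ^ (p + 2)) * (C * (1 + T powr (b - a))) * t powr (1 / 2) * 0"
  unfolding c_def[abs_def] using ex by (intro tendsto_intros h) auto
 then have "mom_le M p 0 (%w. Y t w - Y 0 w)"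
  using mom_le_limit[OF c _ mom_le_measurable[OF c]] by simp
 then have "AE w in M. Y t w - Y 0 w = 0" using p by (intro mom_le_0_AE) auto
 then show ?thesis using zero by eventually_elim simp
qed

section \<open>Continuous modifications and progressive measurability\<close>

definition dyadic_floor :: "nat => real => nat" where "dyadic_floor l t = nat \<lfloor>t * 2 ^ l / T\<rfloor>"

lemma dyadic_floor:
 assumes "0 <= t"
 shows "dyadic T l (dyadic_floor l t) <= t" "t < dyadic T l (Suc (dyadic_floor l t))"
proof -
 have 1: "real (dyadic_floor l t) <= t * 2 ^ l / T" "t * 2 ^ l / T < real (dyadic_floor l t) + 1"
  using assms T_pos by (auto simp: dyadic_floor_def)
 from 1(1) have "real (dyadic_floor l t) * T <= t * 2 ^ l" using T_pos by (simp add: field_simps)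
 then show "dyadic T l (dyadic_floor l t) <= t" by (simp add: dyadic_def field_simps)
 from 1(2) have "t * 2 ^ l < (real (dyadic_floor l t) + 1) * T" using T_pos by (simp add: field_simps)
 then show "t < dyadic T l (Suc (dyadic_floor l t))" by (simp add: dyadic_def field_simps)
qed

lemma dyadic_less_iff: "dyadic T l j < dyadic T l k \<longleftrightarrow> j < k"
 using T_pos by (simp add: dyadic_def field_simps)

lemma dyadic_floor_le: "0 <= t ==> t <= T ==> dyadic_floor l t <= 2 ^ l"
 using dyadic_floor(1)[of t l] dyadic_less_iff[of l "2 ^ l" "dyadic_floor l t"] by (simp add: dyadic_ends not_less[symmetric])

lemma dyadic_floor_Suc:
 assumes "0 <= t"
 shows "dyadic_floor (Suc l) t = 2 * dyadic_floor l t \<or> dyadic_floor (Suc l) t = Suc (2 * dyadic_floor l t)"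
proof -
 have "dyadic T (Suc l) (2 * dyadic_floor l t) < dyadic T (Suc l) (Suc (dyadic_floor (Suc l) t))"
  using dyadic_floor[OF assms, of l] dyadic_floor[OF assms, of "Suc l"] by (simp only: dyadic_Suc_even)
 then have "2 * dyadic_floor l t <= dyadic_floor (Suc l) t" by (simp add: dyadic_less_iff)
 moreover have "dyadic T (Suc l) (dyadic_floor (Suc l) t) < dyadic T (Suc l) (2 * Suc (dyadic_floor l t))"
  using dyadic_floor[OF assms, of l] dyadic_floor[OF assms, of "Suc l"] by (simp only: dyadic_Suc_even)
 then have "dyadic_floor (Suc l) t < 2 * Suc (dyadic_floor l t)" by (simp only: dyadic_less_iff)
 ultimately show ?thesis by auto
qed

lemma dyadic_floor_near:
 assumes "0 <= s" "s <= t" "t - s < T / 2 ^ l"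
 shows "dyadic_floor l t = dyadic_floor l s \<or> dyadic_floor l t = Suc (dyadic_floor l s)"
proof -
 have t: "0 <= t" using assms by simp
 have "dyadic T l (dyadic_floor l s) < dyadic T l (Suc (dyadic_floor l t))"
  using dyadic_floor[OF assms(1), of l] dyadic_floor[OF t, of l] assms by linarith
 then have "dyadic_floor l s <= dyadic_floor l t" by (simp add: dyadic_less_iff)
 moreover have "dyadic T l (dyadic_floor l t) < dyadic T l (Suc (Suc (dyadic_floor l s)))"
  using dyadic_floor[OF assms(1), of l] dyadic_floor[OF t, of l] assms dyadic_step[of T l "Suc (dyadic_floor l s)"] by linarith
 then have "dyadic_floor l t < Suc (Suc (dyadic_floor l s))" by (simp only: dyadic_less_iff)
 ultimately show ?thesis by auto
qed

text \<open>Kolmogorov's continuity theorem. The process is sampled at the dyadic point to the left of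
 \<open>t\<close>; the largest dyadic increment of level \<open>l\<close> has summable moments, which makes the samples
 converge uniformly.\<close>

theorem continuous_modification:
 fixes X :: "real => 'a => 'v::euclidean_space"
 assumes p: "even p" "2 <= p" and \<gamma>: "1 < real p * \<gamma>" and C: "0 <= C"
  and meas: "!!t. 0 <= t ==> t <= T ==> X t \<in> borel_measurable (Fil t)"
  and inc: "!!s t. 0 <= s ==> s < t ==> t <= T ==> mom_le M p (C * (t - s) powr \<gamma>) (%w. X t w - X s w)"
 obtains Y where "!!w. continuous_on {0..T} (%t. Y t w)"
  and "!!t. 0 <= t ==> t <= T ==> Y t \<in> borel_measurable (Fil t)"
  and "!!t. 0 <= t ==> t <= T ==> AE w in M. Y t w = X t w"
proof -
 have p0: "0 < p" using p by simp
 have \<gamma>0: "0 < \<gamma>" 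
 proof (rule ccontr)
  assume "\<not> 0 < \<gamma>"
  then have "real p * \<gamma> <= 0" by (intro mult_nonneg_nonpos) auto
  then show False using \<gamma> by simp
 qed
 note [simp] = T_pos T_pos[THEN less_imp_le]
 have mX[measurable]: "X t \<in> borel_measurable M" if "0 <= t" "t <= T" for t
  using Fil_meas_M[OF meas[OF that] that] .
 define d where "d l k w = norm (X (dyadic T l (Suc k)) w - X (dyadic T l k) w)" for l k w
 define Z where "Z l w = root p (\<Sum>k<2 ^ l. d l k w ^ p)" for l w
 have dT: "0 <= dyadic T l k" "k <= 2 ^ l ==> dyadic T l k <= T" for l k
  using dyadic_mono[of T 0 k l] dyadic_mono[of T k "2 ^ l" l] by (auto simp: dyadic_ends)
 have md: "d l k \<in> borel_measurable M" if "k < 2 ^ l" for l k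
 proof -
  have [measurable]: "X (dyadic T l (Suc k)) \<in> borel_measurable M" "X (dyadic T l k) \<in> borel_measurable M"
   using that dT(1) dT(2)[of k l] dT(2)[of "Suc k" l] by (auto intro!: mX)
  show ?thesis unfolding d_def[abs_def] by measurable
 qed
 have mS: "(%w. \<Sum>k<2 ^ l. d l k w ^ p) \<in> borel_measurable M" for l
  by (intro borel_measurable_sum borel_measurable_power md) auto
 have mZ: "Z l \<in> borel_measurable M" for l
  unfolding Z_def[abs_def] using mS by measurable
 define c where "c l = root p (2 ^ l) * (C * (T / 2 ^ l) powr \<gamma>)" for l :: nat
 have Z: "mom_le M p (c l) (Z l)" for l
 proof -
  have "(\<integral>\<^sup>+w. ennreal (norm (Z l w) ^ p) \<partial>M) = (\<integral>\<^sup>+w. (\<Sum>k<2 ^ l. ennreal (d l k w ^ p)) \<partial>M)"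
   using p0 by (intro nn_integral_cong) (simp add: Z_def sum_nonneg d_def sum_ennreal)
  also have "... = (\<Sum>k<2 ^ l. \<integral>\<^sup>+w. ennreal (d l k w ^ p) \<partial>M)"
   using md by (intro nn_integral_sum) auto
  also have "... <= (\<Sum>k<(2::nat) ^ l. ennreal ((C * (T / 2 ^ l) powr \<gamma>) ^ p))"
  proof (rule sum_mono)
   fix k assume "k \<in> {..<(2::nat) ^ l}"
   then have "mom_le M p (C * (dyadic T l (Suc k) - dyadic T l k) powr \<gamma>) (%w. X (dyadic T l (Suc k)) w - X (dyadic T l k) w)"
    using dT by (intro inc) (auto simp: dyadic_less_iff)
   then show "(\<integral>\<^sup>+w. ennreal (d l k w ^ p) \<partial>M) <= ennreal ((C * (T / 2 ^ l) powr \<gamma>) ^ p)"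
    unfolding dyadic_step by (simp add: mom_le_def d_def)
  qed
  also have "... = ennreal (2 ^ l) * ennreal ((C * (T / 2 ^ l) powr \<gamma>) ^ p)"
   using ennreal_power[of 2 l] by simp
  also have "... = ennreal (c l ^ p)"
   using p0 C by (simp add: c_def power_mult_distrib ennreal_mult[symmetric])
  finally show ?thesis using mZ C p0 by (simp add: mom_le_def c_def real_root_ge_zero)
 qed
 have "summable c"
 proof -
  have "c = (%l. C * T powr \<gamma> * (2 powr (1 / p - \<gamma>)) ^ l)"
  proof (rule ext)
   fix l
   have "root p (2 ^ l) = (2 ^ l) powr (1 / p)" using p0 by (simp add: root_powr_inverse)
   also have "... = 2 powr (l * (1 / p))" by (simp add: powr_realpow[symmetric] powr_powr)
   finally have 1: "root p (2 ^ l) = 2 powr (l * (1 / p))" .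
   have "T / 2 ^ l = T * 2 powr (- real l)" by (simp add: powr_minus powr_realpow divide_inverse)
   then have 2: "(T / 2 ^ l) powr \<gamma> = T powr \<gamma> * 2 powr (- real l * \<gamma>)" by (simp add: powr_mult powr_powr)
   have "2 powr (l * (1 / p)) * 2 powr (- real l * \<gamma>) = (2::real) powr ((1 / p - \<gamma>) * l)"
    unfolding powr_add[symmetric] by (simp add: algebra_simps)
   also have "... = (2 powr (1 / p - \<gamma>)) powr l" by (simp only: powr_powr)
   also have "... = (2 powr (1 / p - \<gamma>)) ^ l" by (rule powr_realpow) simp
   finally show "c l = C * T powr \<gamma> * (2 powr (1 / p - \<gamma>)) ^ l" unfolding c_def 1 2 by (simp add: mult_ac)
  qed
  moreover have "1 / p - \<gamma> < 0" using \<gamma> p0 by (simp add: field_simps)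
  then have "2 powr (1 / p - \<gamma>) < (1::real)" by (simp add: powr_less_one)
  ultimately show ?thesis by (auto intro!: summable_mult summable_geometric)
 qed
 then have "AE w in M. summable (%l. Z l w)" by (rule mom_le_series(1)[OF Z _ p(1) p0])
 then obtain N where "{w \<in> space M. \<not> summable (%l. Z l w)} \<subseteq> N" "emeasure M N = 0" "N \<in> sets M"
  by (rule AE_E)
 then have N: "N \<in> null_sets M" "{w \<in> space M. \<not> summable (%l. Z l w)} \<subseteq> N" by auto
 define A where "A = space M - N"
 have ZA: "summable (%l. Z l w)" if "w \<in> A" for w using that N by (auto simp: A_def)
 define XL where "XL l t w = X (dyadic T l (dyadic_floor l t)) w" for l t w
 define Y where "Y t w = (if w \<in> A then lim (%l. XL l t w) else 0)" for t w
 have dZ: "d l k w <= Z l w" if "k < 2 ^ l" for l k w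
 proof -
  have "d l k w ^ p <= (\<Sum>k<2 ^ l. d l k w ^ p)"
   using that by (intro member_le_sum) (auto simp: d_def)
  then have "root p (d l k w ^ p) <= Z l w" unfolding Z_def using p0 by simp
  then show ?thesis using p0 by (simp add: d_def real_root_power_cancel)
 qed
 have Z0: "0 <= Z l w" for l w
  unfolding Z_def using p0 by (auto intro!: sum_nonneg simp: d_def)
 have XL_Suc: "norm (XL (Suc l) t w - XL l t w) <= Z (Suc l) w" if t: "0 <= t" "t <= T" for l t w
  using dyadic_floor_Suc[OF t(1), of l]
 proof
  assume "dyadic_floor (Suc l) t = 2 * dyadic_floor l t"
  then show ?thesis using Z0 by (simp add: XL_def dyadic_Suc_even)
 next
  assume *: "dyadic_floor (Suc l) t = Suc (2 * dyadic_floor l t)"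
  then have "2 * dyadic_floor l t < 2 ^ Suc l" using dyadic_floor_le[OF t, of "Suc l"] by simp
  from dZ[OF this, of w] show ?thesis using * by (simp add: XL_def d_def dyadic_Suc_even)
 qed
 have Y: "(%l. XL l t w) \<longlonglongrightarrow> Y t w" and Yd: "norm (Y t w - XL l t w) <= (\<Sum>j. Z (Suc (j + l)) w)"
  if t: "0 <= t" "t <= T" and w: "w \<in> A" for t w l
 proof -
  have sZ: "summable (%j. Z (Suc (j + l)) w)" for l
   using ZA[OF w] summable_ignore_initial_segment[of "%l. Z l w" "Suc l"] by simp
  have sX: "summable (%j. norm (XL (Suc (j + l)) t w - XL (j + l) t w))" for l
   by (rule summable_comparison_test'[OF sZ[of l]]) (use XL_Suc t in simp)
  have "(%n. XL (n + l) t w - XL l t w) \<longlonglongrightarrow> (\<Sum>j. XL (Suc (j + l)) t w - XL (j + l) t w)" for l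
   using summable_LIMSEQ[OF summable_norm_cancel[OF sX[of l]]]
   by (simp add: sum_lessThan_telescope[of "%j. XL (j + l) t w", simplified])
  note lim = this
  from tendsto_add[OF lim[of 0] tendsto_const[of "XL 0 t w"]]
  have "convergent (%l. XL l t w)" by (auto simp: convergent_def)
  then show Y: "(%l. XL l t w) \<longlonglongrightarrow> Y t w"
   using w by (simp add: Y_def convergent_LIMSEQ_iff)
  then have "(%n. XL (n + l) t w - XL l t w) \<longlonglongrightarrow> Y t w - XL l t w"
   by (intro tendsto_diff tendsto_const LIMSEQ_ignore_initial_segment)
  then have "Y t w - XL l t w = (\<Sum>j. XL (Suc (j + l)) t w - XL (j + l) t w)"
   using lim LIMSEQ_unique by blast
  also have "norm ... <= (\<Sum>j. norm (XL (Suc (j + l)) t w - XL (j + l) t w))" by (rule summable_norm[OF sX])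
  also have "... <= (\<Sum>j. Z (Suc (j + l)) w)" by (intro suminf_le sX sZ XL_Suc t)
  finally show "norm (Y t w - XL l t w) <= (\<Sum>j. Z (Suc (j + l)) w)" .
 qed
 show ?thesis
 proof (rule that)
  fix w
  show "continuous_on {0..T} (%t. Y t w)"
  proof (cases "w \<in> A")
   case True
   define R where "R l = Z l w + 2 * (\<Sum>j. Z (Suc (j + l)) w)" for l
   have "R \<longlonglongrightarrow> 0 + 2 * 0"
   proof -
    have "summable (%j. Z (Suc j) w)" using ZA[OF True] summable_ignore_initial_segment[of "%l. Z l w" 1] by simp
    from tendsto_add[OF summable_LIMSEQ_zero[OF ZA[OF True]] tendsto_mult[OF tendsto_const[of 2] suminf_exist_split2[OF this]]]
    show ?thesis unfolding R_def[abs_def] by simp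
   qed
   then have R: "R \<longlonglongrightarrow> 0" by simp
   have near: "norm (Y t w - Y s w) <= R l" if st: "0 <= s" "s <= t" "t <= T" "t - s < T / 2 ^ l" for s t l
   proof -
    have sT: "s <= T" "0 <= t" using st by auto
    have "norm (XL l t w - XL l s w) <= Z l w"
     using dyadic_floor_near[OF st(1,2,4)]
    proof
     assume "dyadic_floor l t = dyadic_floor l s" then show ?thesis using Z0 by (simp add: XL_def)
    next
     assume *: "dyadic_floor l t = Suc (dyadic_floor l s)"
     then have "dyadic_floor l s < 2 ^ l" using dyadic_floor_le[OF sT(2) st(3), of l] by simp
     from dZ[OF this, of w] show ?thesis using * by (simp add: XL_def d_def)
    qed
    moreover have "norm (Y t w - Y s w) <= norm (Y t w - XL l t w) + norm (XL l t w - XL l s w) + norm (Y s w - XL l s w)"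
     using norm_triangle_ineq[of "Y t w - XL l t w" "XL l t w - XL l s w"]
      norm_triangle_ineq4[of "Y t w - XL l s w" "Y s w - XL l s w"] by simp
    ultimately show ?thesis
     using Yd[OF sT(2) st(3) True, of l] Yd[OF st(1) sT(1) True, of l] unfolding R_def by linarith
   qed
   show ?thesis
    unfolding continuous_on_iff
   proof (intro ballI allI impI)
    fix t e :: real assume t: "t \<in> {0..T}" and e: "0 < e"
    obtain l where l: "R l < e"
     using order_tendstoD(2)[OF R e] by (auto simp: eventually_sequentially)
    show "\<exists>d>0. \<forall>s\<in>{0..T}. dist s t < d --> dist (Y s w) (Y t w) < e"
    proof (intro exI[of _ "T / 2 ^ l"] conjI ballI impI)
     fix s assume s: "s \<in> {0..T}" "dist s t < T / 2 ^ l"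
     have "norm (Y s w - Y t w) <= R l"
     proof (cases "s <= t")
      case True then show ?thesis using near[of s t l] s t by (auto simp: dist_real_def norm_minus_commute)
     next
      case False then show ?thesis using near[of t s l] s t by (auto simp: dist_real_def)
     qed
     then show "dist (Y s w) (Y t w) < e" using l by (simp add: dist_norm)
    qed simp
   qed
  qed (simp add: Y_def)
 next
  fix t assume t: "0 <= t" "t <= T"
  have sp: "space (Fil t) = space M" using Fil_subalgebra[OF t] by (simp add: subalgebra_def)
  have "A \<in> sets (Fil t)" unfolding A_def sp[symmetric] using Fil_null[OF t] N by auto
  moreover have "(%w. lim (%l. XL l t w)) \<in> borel_measurable (Fil t)"
  proof (rule borel_measurable_lim_metric)
   fix l show "XL l t \<in> borel_measurable (Fil t)"
    unfolding XL_def[abs_def] using dT(1)[of l "dyadic_floor l t"] dyadic_floor(1)[OF t(1), of l] dyadic_floor_le[OF t] t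
    by (intro Fil_meas_mono[OF meas, of _ t]) auto
  qed
  ultimately show "Y t \<in> borel_measurable (Fil t)"
   unfolding Y_def[abs_def] by (intro measurable_If_set) auto
  then have mY: "Y t \<in> borel_measurable M" using Fil_meas_M t by blast
  have "mom_le M p 0 (%w. X t w - Y t w)"
  proof (rule mom_le_limit)
   fix l
   show "mom_le M p (C * (T / 2 ^ l) powr \<gamma>) (%w. X t w - XL l t w)"
   proof (cases "dyadic T l (dyadic_floor l t) = t")
    case True then show ?thesis using C by (auto simp: XL_def intro!: mom_le_bounded)
   next
    case False
    then have lt: "dyadic T l (dyadic_floor l t) < t" using dyadic_floor(1)[OF t(1), of l] by simp
    have "t - dyadic T l (dyadic_floor l t) <= T / 2 ^ l"
     using dyadic_floor(2)[OF t(1), of l] dyadic_step[of T l "dyadic_floor l t"] by linarith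
    then have "C * (t - dyadic T l (dyadic_floor l t)) powr \<gamma> <= C * (T / 2 ^ l) powr \<gamma>"
     using C \<gamma>0 lt by (intro mult_left_mono powr_mono2) auto
    then show ?thesis unfolding XL_def using lt dT t by (intro mom_le_weaken[OF inc]) auto
   qed
  next
   have "(%l. T * (1 / 2) ^ l) \<longlonglongrightarrow> T * 0" by (intro tendsto_intros LIMSEQ_realpow_zero) auto
   then have "(%l. T / 2 ^ l) \<longlonglongrightarrow> 0" by (simp add: power_divide)
   then have "(%l. (T / 2 ^ l) powr \<gamma>) \<longlonglongrightarrow> 0"
    using tendsto_powr'[of "%l. T / 2 ^ l" 0 sequentially "%_. \<gamma>" \<gamma>] \<gamma>0 by auto
   then show "(%l. C * (T / 2 ^ l) powr \<gamma>) \<longlonglongrightarrow> 0" by (rule tendsto_mult_right_zero)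
   show "(%w. X t w - Y t w) \<in> borel_measurable M" using mX[OF t] mY by simp
   have "AE w in M. w \<in> A" using AE_not_in[OF N(1)] AE_space by eventually_elim (simp add: A_def)
   then show "AE w in M. (%l. X t w - XL l t w) \<longlonglongrightarrow> X t w - Y t w"
    by eventually_elim (intro tendsto_intros Y t)
  qed
  then have "AE w in M. X t w - Y t w = 0" using p0 by (intro mom_le_0_AE)
  then show "AE w in M. Y t w = X t w" by eventually_elim simp
 qed
qed

lemma progressive_adapted:
 assumes "progressive T Fil X" "0 <= t" "t <= T"
 shows "X t \<in> borel_measurable (Fil t)"
proof -
 have "(%(s, w). X s w) \<in> restrict_space borel {0..t} \<Otimes>\<^sub>M Fil t \<rightarrow>\<^sub>M borel"
  using assms by (auto simp: progressive_def)
 moreover have "Pair t \<in> Fil t \<rightarrow>\<^sub>M restrict_space borel {0..t} \<Otimes>\<^sub>M Fil t"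
  using assms by (intro measurable_Pair1') (simp add: space_restrict_space)
 ultimately have "(%(s, w). X s w) \<circ> Pair t \<in> borel_measurable (Fil t)" by (intro measurable_comp)
 then show ?thesis by (simp add: comp_def)
qed

text \<open>A continuous process is the limit of step processes sampled to the left of the current time.\<close>

lemma continuous_adapted_progressive:
 fixes X :: "real => 'a => 'v::euclidean_space"
 assumes cont: "!!w. w \<in> space M ==> continuous_on {0..T} (%t. X t w)"
  and meas: "!!t. 0 <= t ==> t <= T ==> X t \<in> borel_measurable (Fil t)"
 shows "progressive T Fil X"
 unfolding progressive_def
proof
 fix t assume t: "t \<in> {0..T}"
 let ?P = "restrict_space borel {0..t} \<Otimes>\<^sub>M Fil t"
 define f where "f n = (%(s, w). X (min (real (nat \<lfloor>s * real (Suc n)\<rfloor>) / real (Suc n)) t) w)" for n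
 have sp: "space ?P = {0..t} \<times> space M"
  using Fil_subalgebra[of t] t by (simp add: space_pair_measure space_restrict_space subalgebra_def)
 show "(%(s, w). X s w) \<in> borel_measurable ?P"
 proof (rule borel_measurable_LIMSEQ_metric)
  fix n
  have fst: "fst \<in> borel_measurable ?P"
   using measurable_compose[OF measurable_fst measurable_restrict_space1[OF measurable_ident]] by simp
  have g: "(%x. nat \<lfloor>fst x * real (Suc n)\<rfloor>) \<in> ?P \<rightarrow>\<^sub>M count_space UNIV"
   using fst by measurable
  have "(%x. (%i x. X (min (real i / real (Suc n)) t) (snd x)) (nat \<lfloor>fst x * real (Suc n)\<rfloor>) x) \<in> borel_measurable ?P"
  proof (rule measurable_compose_countable[OF _ g])
   fix i :: nat
   have "X (min (real i / real (Suc n)) t) \<in> borel_measurable (Fil t)"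
    using t by (intro Fil_meas_mono[OF meas, of _ t]) auto
   from measurable_compose[OF measurable_snd this]
   show "(%x. X (min (real i / real (Suc n)) t) (snd x)) \<in> borel_measurable ?P" .
  qed
  then show "f n \<in> borel_measurable ?P" by (simp add: f_def case_prod_beta')
 next
  fix x assume "x \<in> space ?P"
  then obtain s w where x: "x = (s, w)" "s \<in> {0..t}" "w \<in> space M" unfolding sp by auto
  define r where "r n = min (real (nat \<lfloor>s * real (Suc n)\<rfloor>) / real (Suc n)) t" for n
  have r1: "s - 1 / real (Suc n) <= r n" "r n <= s" for n
  proof -
   define m where "m = real (Suc n)"
   define k where "k = real (nat \<lfloor>s * m\<rfloor>)"
   have m: "0 < m" by (simp add: m_def)
   then have k: "k <= s * m" "s * m - 1 <= k"
    using x(2) by (auto simp: k_def)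
   have "k / m <= s" using k(1) m by (simp add: field_simps)
   moreover have "(s * m - 1) / m <= k / m" using k(2) m by (intro divide_right_mono) auto
   then have "s - 1 / m <= k / m" using m by (simp add: diff_divide_distrib)
   ultimately have "real (nat \<lfloor>s * real (Suc n)\<rfloor>) / real (Suc n) <= s"
    "s - 1 / real (Suc n) <= real (nat \<lfloor>s * real (Suc n)\<rfloor>) / real (Suc n)"
    unfolding k_def m_def by auto
   then show "s - 1 / real (Suc n) <= r n" "r n <= s" using x(2) by (auto simp: r_def intro: order_trans[of _ s])
  qed
  have "(%n. s - 1 / real (Suc n)) \<longlonglongrightarrow> s - 0" by (intro tendsto_intros LIMSEQ_Suc[OF lim_const_over_n])
  then have "r \<longlonglongrightarrow> s"
   using tendsto_sandwich[of "%n. s - 1 / real (Suc n)" r sequentially "%_. s" s] r1 by auto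
  moreover have "r n \<in> {0..T}" for n using r1(2)[of n] x t by (auto simp: r_def)
  ultimately have "(%n. X (r n) w) \<longlonglongrightarrow> X s w"
   using cont[OF x(3)] x(2) t by (auto simp: continuous_on_sequentially comp_def)
  then show "(%n. f n x) \<longlonglongrightarrow> (case x of (s, w) => X s w)" by (simp add: f_def x(1) r_def)
 qed
qed

end

section \<open>Operator norm of matrices\<close>

definition opn :: "real ^ 'n ^ 'n => real" where "opn X = onorm ((*v) X)"

lemma opn_vec: "norm (X *v v) <= opn X * norm v"
 unfolding opn_def by (rule onorm) simp

lemma opn_leI: "0 <= c ==> (!!v. norm (X *v v) <= c * norm v) ==> opn X <= c"
 unfolding opn_def by (rule onorm_bound)

lemma opn_nonneg [simp]: "0 <= opn X"
 unfolding opn_def by (rule onorm_pos_le) simp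

lemma opn_mult: "opn (X ** Y) <= opn X * opn Y"
proof (rule opn_leI)
 fix v
 have "norm (X *v (Y *v v)) <= opn X * norm (Y *v v)" by (rule opn_vec)
 also have "... <= opn X * (opn Y * norm v)" by (intro mult_left_mono opn_vec) simp
 finally show "norm ((X ** Y) *v v) <= opn X * opn Y * norm v"
  by (simp add: matrix_vector_mul_assoc mult.assoc)
qed simp

lemma opn_add: "opn (X + Y) <= opn X + opn Y"
proof (rule opn_leI)
 fix v
 have "norm ((X + Y) *v v) <= norm (X *v v) + norm (Y *v v)"
  by (simp add: matrix_vector_mult_add_rdistrib norm_triangle_ineq)
 then show "norm ((X + Y) *v v) <= (opn X + opn Y) * norm v"
  using opn_vec[of X v] opn_vec[of Y v] by (simp add: distrib_right)
qed simp

lemma opn_minus: "opn (- X) = opn X"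
proof -
 have "(- X) *v v = - (X *v v)" for v
  using matrix_vector_mult_diff_rdistrib[of 0 X v] by simp
 then have "(*v) (- X) = (%v. - (X *v v))" by (rule ext)
 then show ?thesis unfolding opn_def using onorm_neg[of "(*v) X"] by simp
qed

lemma opn_diff: "opn (X - Y) <= opn X + opn Y"
 using opn_add[of X "- Y"] by (simp add: opn_minus)

lemma opn_id: "opn (mat 1 :: real ^ 'n ^ 'n) <= 1"
 by (rule opn_leI) auto

lemma opn_0 [simp]: "opn 0 = 0"
 using opn_leI[of 0 0] opn_nonneg[of 0] by (auto intro: antisym)

lemma norm_le_opn: "norm (X :: real ^ 'n ^ 'n) <= (real CARD('n))\<^sup>2 * opn X"
proof -
 have 1: "\<bar>X $ i $ j\<bar> <= opn X" for i j
  unfolding opn_def using matrix_component_le_onorm[of X i j] .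
 have "norm X <= (\<Sum>i\<in>UNIV. norm (X $ i))" by (simp add: norm_vec_def L2_set_le_sum)
 also have "... <= (\<Sum>i\<in>(UNIV::'n set). \<Sum>j\<in>(UNIV::'n set). opn X)"
  by (intro sum_mono order_trans[OF norm_le_l1_cart] sum_mono 1)
 also have "... = (real CARD('n))\<^sup>2 * opn X" by (simp add: power2_eq_square)
 finally show ?thesis .
qed

lemma mm_diff_left: "(X::real^'n^'n) ** (Y - Z) = X ** Y - X ** Z"
 and mm_diff_right: "(Y - Z) ** (X::real^'n^'n) = Y ** X - Z ** X"
 by (auto simp: matrix_eq matrix_vector_mul_assoc[symmetric] matrix_vector_mult_diff_rdistrib matrix_vector_mult_diff_distrib)

lemma opn_prod_diff: "opn (X ** Y - X' ** Y') <= opn X * opn (Y - Y') + opn (X - X') * opn Y'"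
proof -
 have "X ** Y - X' ** Y' = X ** (Y - Y') + (X - X') ** Y'"
  by (simp add: mm_diff_left mm_diff_right)
 then show ?thesis using opn_add order_trans[OF _ add_mono[OF opn_mult opn_mult]] by metis
qed

lemma opn_limit:
 assumes X: "X \<longlonglongrightarrow> (L :: real ^ 'n ^ 'n)" and c: "c \<longlonglongrightarrow> d" and le: "!!n. opn (X n) <= c n"
 shows "opn L <= d"
proof (rule opn_leI)
 show "0 <= d" using c by (rule LIMSEQ_le_const) (use le opn_nonneg order_trans in blast)
 fix v
 have "(%n. X n *v v) \<longlonglongrightarrow> L *v v"
  unfolding matrix_vector_mult_def by (intro tendsto_intros X)
 moreover have "(%n. c n * norm v) \<longlonglongrightarrow> d * norm v" by (intro tendsto_intros c)
 ultimately show "norm (L *v v) <= d * norm v"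
  by (intro LIMSEQ_le[OF tendsto_norm]) (auto intro!: order_trans[OF opn_vec] mult_right_mono le)
qed

section \<open>Multiplicative sewing\<close>

definition almost_flow :: "real => real => real => real => (real => real => real ^ 'n ^ 'n) => bool" where
 "almost_flow T C a b \<mu> \<longleftrightarrow>
  (\<forall>s. 0 <= s & s <= T --> \<mu> s s = mat 1) &
  (\<forall>s t. 0 <= s & s <= t & t <= T --> opn (\<mu> s t - mat 1) <= C * (t - s) powr a) &
  (\<forall>s u t. 0 <= s & s <= u & u <= t & t <= T --> opn (\<mu> u t ** \<mu> s u - \<mu> s t) <= C * (t - s) powr b)"

text \<open>The ordered product over the dyadic partition of \<open>[x, y]\<close> of depth \<open>n\<close>, clipped to \<open>[s, t]\<close>. The
 recursion on the two halves, instead of a product over indices, is what the inductive estimates follow.\<close>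

primrec tree_prod :: "(real => real => real ^ 'n ^ 'n) => real => real => nat => real => real => real ^ 'n ^ 'n" where
 "tree_prod \<mu> s t 0 x y = \<mu> (clip s t x) (clip s t y)"
| "tree_prod \<mu> s t (Suc n) x y = tree_prod \<mu> s t n ((x + y) / 2) y ** tree_prod \<mu> s t n x ((x + y) / 2)"

definition mult_sewing :: "real => (real => real => real ^ 'n ^ 'n) => real => real => real ^ 'n ^ 'n" where
 "mult_sewing T \<mu> s t = lim (%n. tree_prod \<mu> s t n 0 T)"

lemma tree_prod_cong:
 assumes "!!z. x <= z ==> z <= y ==> clip s t z = clip s' t' z" "x <= y"
 shows "tree_prod \<mu> s t n x y = tree_prod \<mu> s' t' n x y"
 using assms
proof (induction n arbitrary: x y)
 case (Suc n)
 have "tree_prod \<mu> s t n ((x + y) / 2) y = tree_prod \<mu> s' t' n ((x + y) / 2) y"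
  "tree_prod \<mu> s t n x ((x + y) / 2) = tree_prod \<mu> s' t' n x ((x + y) / 2)"
  using Suc.prems by (intro Suc.IH; auto simp: field_simps)+
 then show ?case by simp
qed simp

lemma tree_prod_degenerate:
 assumes "!!z. x <= z ==> z <= y ==> clip s t z = c" "x <= y" "\<mu> c c = mat 1"
 shows "tree_prod \<mu> s t n x y = mat 1"
 using assms
proof (induction n arbitrary: x y)
 case (Suc n)
 have "tree_prod \<mu> s t n ((x + y) / 2) y = mat 1" "tree_prod \<mu> s t n x ((x + y) / 2) = mat 1"
  using Suc.prems by (intro Suc.IH; auto simp: field_simps)+
 then show ?case by simp
qed simp

lemma powr_superadditive:
 fixes x y :: real
 assumes "0 <= x" "0 <= y" "1 <= r"
 shows "x powr r + y powr r <= (x + y) powr r"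
proof -
 have *: "z powr r <= z * (x + y) powr (r - 1)" if "0 <= z" "z <= x + y" for z
 proof -
  have "z powr r = z * z powr (r - 1)" using that by (cases "z = 0") (auto simp: powr_mult_base)
  also have "... <= z * (x + y) powr (r - 1)" using that assms by (intro mult_left_mono powr_mono2) auto
  finally show ?thesis .
 qed
 have "x powr r + y powr r <= (x + y) * (x + y) powr (r - 1)"
  using *[of x] *[of y] assms by (simp add: distrib_right)
 also have "... = (x + y) powr r" using assms by (simp add: powr_mult_base)
 finally show ?thesis .
qed

lemma exists_small_powr:
 fixes K C :: real
 assumes "0 < e1" "0 < e2" "0 < eps"
 obtains d where "0 < d" "K * d powr e1 + C * d powr e2 < eps"
proof -
 have "((%d. d powr e) \<longlongrightarrow> 0) (at_right (0::real))" if "0 < e" for e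
  using tendsto_powr'[of "%d. d" 0 "at_right 0" "%_. e" e] that
  by (auto simp: eventually_at_filter intro!: always_eventually)
 then have "((%d. K * d powr e1 + C * d powr e2) \<longlongrightarrow> K * 0 + C * 0) (at_right 0)"
  using assms by (intro tendsto_intros) auto
 then have "\<forall>\<^sub>F d in at_right 0. K * d powr e1 + C * d powr e2 < eps"
  using assms by (intro order_tendstoD(2)) auto
 then have "\<forall>\<^sub>F d in at_right 0. K * d powr e1 + C * d powr e2 < eps & 0 < d"
  by (intro eventually_conj eventually_at_right_less)
 then show ?thesis using that
  by (metis (no_types, lifting) eventually_happens' trivial_limit_at_right_real)
qed

locale almost_flows =
 fixes T C a b b' :: real
 assumes T0: "0 < T" and C0: "0 <= C" and a0: "0 < a" and b': "1 <= b'" "b' < b"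
begin

definition \<theta> where "\<theta> = b - b'"
definition r where "r = 2 powr (\<theta> / 2)"
definition q where "q = 2 powr (- \<theta> / 2)"

lemma q_r: "0 < q" "q < 1" "1 < r" "r * 2 powr (- \<theta>) = q" "0 < \<theta>"
 using b' by (auto simp: q_def r_def \<theta>_def powr_less_one powr_add[symmetric] diff_divide_distrib)

definition len where "len s t x y = clip s t y - clip s t x"

lemma len: "x <= y ==> 0 <= len s t x y" "x <= y ==> len s t x y <= y - x"
 using clip_mono[of x y s t] clip_lipschitz[of x y s t] by (auto simp: len_def)

lemma len_split: "len s t x m + len s t m y = len s t x y"
 by (simp add: len_def)

text \<open>The two halves of an interval contribute less than the whole; this gain makes all
 estimates below survive the recursion. The weight interpolates between the length of the clipped
 part, which has to be superadditive, and the length of the unclipped interval, which shrinks by a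
 factor at each bisection.\<close>

definition wt where "wt s t x y = len s t x y powr b' * (y - x) powr \<theta>"

lemma wt_halves:
 assumes "x <= y"
 shows "wt s t x ((x + y) / 2) + wt s t ((x + y) / 2) y <= 2 powr (- \<theta>) * wt s t x y"
proof -
 let ?m = "(x + y) / 2"
 have half: "?m - x = (y - x) / 2" "y - ?m = (y - x) / 2" by (auto simp: field_simps)
 have "wt s t x ?m + wt s t ?m y = (len s t x ?m powr b' + len s t ?m y powr b') * ((y - x) / 2) powr \<theta>"
  unfolding wt_def half distrib_right ..
 also have "... <= len s t x y powr b' * ((y - x) / 2) powr \<theta>"
  using assms b' powr_superadditive[of "len s t x ?m" "len s t ?m y" b'] len[of x ?m] len[of ?m y]
  by (intro mult_right_mono) (auto simp: len_split)
 also have "... = 2 powr (- \<theta>) * wt s t x y"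
  using assms by (simp add: wt_def powr_divide powr_minus field_simps)
 finally show ?thesis .
qed

lemma wt_bounds:
 assumes "x <= y"
 shows "0 <= wt s t x y" "len s t x y powr b <= wt s t x y" "wt s t x y <= (y - x) powr b"
proof -
 show "0 <= wt s t x y" by (simp add: wt_def)
 have "len s t x y powr b = len s t x y powr b' * len s t x y powr \<theta>" by (simp add: \<theta>_def powr_add[symmetric])
 also have "... <= wt s t x y" unfolding wt_def using len[OF assms] q_r by (intro mult_left_mono powr_mono2) auto
 finally show "len s t x y powr b <= wt s t x y" .
 have "wt s t x y <= (y - x) powr b' * (y - x) powr \<theta>"
  unfolding wt_def using len[OF assms] b' by (intro mult_right_mono powr_mono2) auto
 also have "... = (y - x) powr b" by (simp add: \<theta>_def powr_add[symmetric])
 finally show "wt s t x y <= (y - x) powr b" .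
qed

lemma clip_T:
 assumes "0 <= s" "s <= t" "t <= T"
 shows "0 <= clip s t x" "clip s t x <= T"
 using clip_range[of s t x] assms by auto

lemma flow_diag: "almost_flow T C a b \<mu> ==> 0 <= s ==> s <= T ==> \<mu> s s = mat 1"
 and flow_near: "almost_flow T C a b \<mu> ==> 0 <= s ==> s <= t ==> t <= T ==> opn (\<mu> s t - mat 1) <= C * (t - s) powr a"
 and flow_mult: "almost_flow T C a b \<mu> ==> 0 <= s ==> s <= u ==> u <= t ==> t <= T ==>
  opn (\<mu> u t ** \<mu> s u - \<mu> s t) <= C * (t - s) powr b"
 unfolding almost_flow_def by blast+

lemma flow_norm:
 fixes \<mu> :: "real => real => real ^ 'n ^ 'n"
 assumes "almost_flow T C a b \<mu>" "0 <= s" "s <= t" "t <= T"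
 shows "opn (\<mu> s t) <= 1 + C * (t - s) powr a"
 using opn_add[of "\<mu> s t - mat 1" "mat 1"] flow_near[OF assms] opn_id[where 'n = 'n] by simp

lemma flow_mult_clip:
 assumes "almost_flow T C a b \<mu>" "0 <= s" "s <= t" "t <= T" "x <= y"
 shows "opn (\<mu> (clip s t ((x + y) / 2)) (clip s t y) ** \<mu> (clip s t x) (clip s t ((x + y) / 2)) - \<mu> (clip s t x) (clip s t y))
  <= C * wt s t x y"
proof -
 have "opn (\<mu> (clip s t ((x + y) / 2)) (clip s t y) ** \<mu> (clip s t x) (clip s t ((x + y) / 2)) - \<mu> (clip s t x) (clip s t y))
  <= C * (clip s t y - clip s t x) powr b"
  using assms by (intro flow_mult clip_T clip_mono) auto
 also have "... <= C * wt s t x y"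
  using wt_bounds(2)[OF assms(5), of s t] C0 by (intro mult_left_mono) (auto simp: len_def)
 finally show ?thesis .
qed

definition flow_defect where
 "flow_defect \<mu> s u t n x y = opn (tree_prod \<mu> s t n x y - tree_prod \<mu> u t n x y ** tree_prod \<mu> s u n x y)"

lemma flow_defect_0:
 assumes \<mu>: "almost_flow T C a b \<mu>" and sut: "0 <= s" "s <= u" "u <= t" "t <= T" and xy: "x <= y"
 shows "flow_defect \<mu> s u t 0 x y <= C * (y - x) powr b"
proof -
 have d: "\<mu> u u = mat 1" using sut by (intro flow_diag[OF \<mu>]) auto
 consider "u <= x" | "y <= u" | "x < u" "u < y" by linarith
 then show ?thesis
 proof cases
  case 1
  then have "clip s u x = u" "clip s u y = u" "clip u t x = clip s t x" "clip u t y = clip s t y"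
   using sut xy by (auto simp: clip_def)
  then show ?thesis using C0 by (simp add: flow_defect_def d)
 next
  case 2
  then have "clip u t x = u" "clip u t y = u" "clip s u x = clip s t x" "clip s u y = clip s t y"
   using sut xy by (auto simp: clip_def)
  then show ?thesis using C0 by (simp add: flow_defect_def d)
 next
  case 3
  then have c: "clip u t x = u" "clip s u y = u" "clip s u x = clip s t x" "clip u t y = clip s t y" "clip s t x <= u" "u <= clip s t y"
   using sut xy by (auto simp: clip_def)
  have "opn (\<mu> u (clip s t y) ** \<mu> (clip s t x) u - \<mu> (clip s t x) (clip s t y)) <= C * (clip s t y - clip s t x) powr b"
   using sut c by (intro flow_mult \<mu> clip_T) auto
  also have "... <= C * (y - x) powr b"
   using len[OF xy, of s t] C0 b' by (intro mult_left_mono powr_mono2) (auto simp: len_def)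
  finally show ?thesis
   using opn_minus[of "\<mu> u (clip s t y) ** \<mu> (clip s t x) u - \<mu> (clip s t x) (clip s t y)"]
   by (simp add: flow_defect_def c)
 qed
qed

text \<open>Cutting an interval at \<open>u\<close> only affects the half that contains \<open>u\<close>.\<close>

lemma flow_defect_Suc:
 assumes \<mu>: "almost_flow T C a b \<mu>" and sut: "0 <= s" "s <= u" "u <= t" "t <= T" and xy: "x <= y"
  and e: "flow_defect \<mu> s u t n x ((x + y) / 2) <= e" "flow_defect \<mu> s u t n ((x + y) / 2) y <= e"
  and B: "opn (tree_prod \<mu> u t n ((x + y) / 2) y) <= B" "opn (tree_prod \<mu> s u n x ((x + y) / 2)) <= B"
 shows "flow_defect \<mu> s u t (Suc n) x y <= B * e"
proof -
 let ?m = "(x + y) / 2"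
 have d: "\<mu> u u = mat 1" using sut by (intro flow_diag[OF \<mu>]) auto
 have e0: "0 <= e" using e(1) opn_nonneg order_trans unfolding flow_defect_def by blast
 have m: "x <= ?m" "?m <= y" using xy by auto
 show ?thesis
 proof (cases "u <= ?m")
  case True
  have 1: "tree_prod \<mu> s u n ?m y = mat 1"
   by (rule tree_prod_degenerate[of _ _ s u u]) (use True sut d m in "auto simp: clip_def")
  have 2: "tree_prod \<mu> s t n ?m y = tree_prod \<mu> u t n ?m y"
   by (rule tree_prod_cong) (use True sut m in "auto simp: clip_def")
  have "flow_defect \<mu> s u t (Suc n) x y =
   opn (tree_prod \<mu> u t n ?m y ** (tree_prod \<mu> s t n x ?m - tree_prod \<mu> u t n x ?m ** tree_prod \<mu> s u n x ?m))"
   by (simp add: flow_defect_def 1 2 mm_diff_left matrix_mul_assoc)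
  also have "... <= B * e"
   using e(1) B(1) unfolding flow_defect_def
   by (intro order_trans[OF opn_mult] mult_mono order_trans[OF opn_nonneg B(1)]) auto
  finally show ?thesis .
 next
  case False
  have 1: "tree_prod \<mu> u t n x ?m = mat 1"
   by (rule tree_prod_degenerate[of _ _ u t u]) (use False sut d m in "auto simp: clip_def")
  have 2: "tree_prod \<mu> s t n x ?m = tree_prod \<mu> s u n x ?m"
   by (rule tree_prod_cong) (use False sut m in "auto simp: clip_def")
  have "flow_defect \<mu> s u t (Suc n) x y =
   opn ((tree_prod \<mu> s t n ?m y - tree_prod \<mu> u t n ?m y ** tree_prod \<mu> s u n ?m y) ** tree_prod \<mu> s u n x ?m)"
   by (simp add: flow_defect_def 1 2 mm_diff_right matrix_mul_assoc)
  also have "... <= e * B"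
   using e(2) B(2) e0 unfolding flow_defect_def
   by (intro order_trans[OF opn_mult] mult_mono) auto
  finally show ?thesis by (simp add: mult.commute)
 qed
qed

definition bounded_at where
 "bounded_at d B K (\<mu> :: real => real => real ^ 'n ^ 'n) \<longleftrightarrow>
  (\<forall>s u t n x y. 0 <= s --> s <= u --> u <= t --> t <= T --> x <= y --> y - x <= d -->
   opn (tree_prod \<mu> s t n x y) <= B &
   opn (tree_prod \<mu> s t (Suc n) x y - tree_prod \<mu> s t n x y) <= K * q ^ n * wt s t x y &
   flow_defect \<mu> s u t n x y <= K * q ^ n)"

lemma bounded_atD:
 assumes "bounded_at d B K \<mu>" "0 <= s" "s <= t" "t <= T" "x <= y" "y - x <= d"
 shows "opn (tree_prod \<mu> s t n x y) <= B"
  and "opn (tree_prod \<mu> s t (Suc n) x y - tree_prod \<mu> s t n x y) <= K * q ^ n * wt s t x y"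
  and "s <= u ==> u <= t ==> flow_defect \<mu> s u t n x y <= K * q ^ n"
 using assms unfolding bounded_at_def by blast+

text \<open>On short intervals the products stay bounded by an induction on the depth: the errors of all levels
 form a geometric series with ratio \<open>q\<close>.\<close>

lemma small_scale:
 "\<exists>d>0. \<exists>B\<ge>1. \<exists>K\<ge>0. \<forall>\<mu> :: real => real => real ^ 'n ^ 'n. almost_flow T C a b \<mu> --> bounded_at d B K \<mu>"
proof -
 define K where "K = C / (1 - q)"
 have K0: "0 <= K" using C0 q_r by (simp add: K_def)
 have Kq: "q * K + C = K" using q_r by (simp add: K_def field_simps)
 obtain d where d: "C * d powr a + K * d powr b < r - 1" "0 < d"
  using exists_small_powr[of a b "r - 1" C K] a0 b' q_r by auto
 define K' where "K' = max C (C * d powr b)"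
 have K': "C <= K'" "C * d powr b <= K'" "0 <= K'" using C0 by (auto simp: K'_def)
 show ?thesis
 proof (intro exI conjI allI impI)
  show "0 < d" "1 <= r" "0 <= K'" using d q_r K' by auto
  fix \<mu> :: "real => real => real ^ 'n ^ 'n" assume \<mu>: "almost_flow T C a b \<mu>"
  have near: "opn (tree_prod \<mu> s t n x y - \<mu> (clip s t x) (clip s t y)) <= K * wt s t x y & opn (tree_prod \<mu> s t n x y) <= r
    & opn (\<mu> (clip s t x) (clip s t y)) <= r"
   if st: "0 <= s" "s <= t" "t <= T" and "x <= y" "y - x <= d" for s t n x y
   using that(4,5)
  proof (induction n arbitrary: x y)
   case (0 x y)
   have "opn (\<mu> (clip s t x) (clip s t y)) <= 1 + C * (clip s t y - clip s t x) powr a"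
    using st 0 by (intro flow_norm[OF \<mu>] clip_T clip_mono) auto
   also have "... <= 1 + C * d powr a"
    using len[OF 0(1), of s t] 0 a0 C0 by (intro add_left_mono mult_left_mono powr_mono2) (auto simp: len_def)
   also have "... <= r" using d K0 by (smt (verit) mult_nonneg_nonneg powr_ge_zero)
   finally show ?case using K0 wt_bounds(1)[OF 0(1), of s t] by simp
  next
   case (Suc n x y)
   let ?m = "(x + y) / 2" let ?c = "clip s t"
   have m: "x <= ?m" "?m <= y" "?m - x <= d" "y - ?m <= d" using Suc.prems by (auto simp: field_simps)
   note L = Suc.IH[OF m(1,3)] and R = Suc.IH[OF m(2,4)]
   have \<mu>r: "opn (\<mu> (?c x) (?c y)) <= 1 + C * d powr a"
   proof -
    have "opn (\<mu> (?c x) (?c y)) <= 1 + C * (?c y - ?c x) powr a"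
     using st Suc.prems by (intro flow_norm[OF \<mu>] clip_T clip_mono) auto
    also have "... <= 1 + C * d powr a"
     using len[OF Suc.prems(1), of s t] Suc.prems a0 C0 by (intro add_left_mono mult_left_mono powr_mono2) (auto simp: len_def)
    finally show ?thesis .
   qed
   have "opn (tree_prod \<mu> s t (Suc n) x y - \<mu> (?c ?m) (?c y) ** \<mu> (?c x) (?c ?m))
    <= opn (tree_prod \<mu> s t n ?m y) * opn (tree_prod \<mu> s t n x ?m - \<mu> (?c x) (?c ?m))
     + opn (tree_prod \<mu> s t n ?m y - \<mu> (?c ?m) (?c y)) * opn (\<mu> (?c x) (?c ?m))"
    unfolding tree_prod.simps by (rule opn_prod_diff)
   also have "... <= r * (K * wt s t x ?m) + (K * wt s t ?m y) * r"
    using L R q_r K0 wt_bounds(1)[OF m(2), of s t] by (intro add_mono mult_mono) auto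
   also have "... = r * K * (wt s t x ?m + wt s t ?m y)" by (simp add: algebra_simps)
   also have "... <= r * K * (2 powr (- \<theta>) * wt s t x y)"
    using wt_halves[OF Suc.prems(1)] q_r K0 by (intro mult_left_mono) auto
   also have "... = q * K * wt s t x y" using q_r(4) by (metis mult.assoc mult.commute)
   finally have 1: "opn (tree_prod \<mu> s t (Suc n) x y - \<mu> (?c ?m) (?c y) ** \<mu> (?c x) (?c ?m)) <= q * K * wt s t x y" .
   have "opn (tree_prod \<mu> s t (Suc n) x y - \<mu> (?c x) (?c y)) <= q * K * wt s t x y + C * wt s t x y"
    using opn_add[of "tree_prod \<mu> s t (Suc n) x y - \<mu> (?c ?m) (?c y) ** \<mu> (?c x) (?c ?m)"
     "\<mu> (?c ?m) (?c y) ** \<mu> (?c x) (?c ?m) - \<mu> (?c x) (?c y)"] 1 flow_mult_clip[OF \<mu> st Suc.prems(1)]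
    by simp
   also have "... = K * wt s t x y" unfolding distrib_right[symmetric] Kq ..
   finally have 2: "opn (tree_prod \<mu> s t (Suc n) x y - \<mu> (?c x) (?c y)) <= K * wt s t x y" .
   have "wt s t x y <= d powr b"
    using wt_bounds(3)[OF Suc.prems(1), of s t] powr_mono2[of b "y - x" d] Suc.prems b' by linarith
   then have "K * wt s t x y <= K * d powr b" using K0 by (intro mult_left_mono)
   moreover have "opn (tree_prod \<mu> s t (Suc n) x y) <= opn (tree_prod \<mu> s t (Suc n) x y - \<mu> (?c x) (?c y)) + opn (\<mu> (?c x) (?c y))"
    using opn_add[of "tree_prod \<mu> s t (Suc n) x y - \<mu> (?c x) (?c y)" "\<mu> (?c x) (?c y)"] by simp
   moreover have "0 <= K * d powr b" using K0 by simp
   ultimately show ?case using 2 \<mu>r d by linarith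
  qed
  have cauchy: "opn (tree_prod \<mu> s t (Suc n) x y - tree_prod \<mu> s t n x y) <= C * q ^ n * wt s t x y"
   if st: "0 <= s" "s <= t" "t <= T" and "x <= y" "y - x <= d" for s t n x y
   using that(4,5)
  proof (induction n arbitrary: x y)
   case (0 x y) then show ?case using flow_mult_clip[OF \<mu> st 0(1)] by simp
  next
   case (Suc n x y)
   let ?m = "(x + y) / 2"
   have m: "x <= ?m" "?m <= y" "?m - x <= d" "y - ?m <= d" using Suc.prems by (auto simp: field_simps)
   have "opn (tree_prod \<mu> s t (Suc (Suc n)) x y - tree_prod \<mu> s t (Suc n) x y)
    <= opn (tree_prod \<mu> s t (Suc n) ?m y) * opn (tree_prod \<mu> s t (Suc n) x ?m - tree_prod \<mu> s t n x ?m)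
     + opn (tree_prod \<mu> s t (Suc n) ?m y - tree_prod \<mu> s t n ?m y) * opn (tree_prod \<mu> s t n x ?m)"
    unfolding tree_prod.simps(2)[of \<mu> s t "Suc n" x y] tree_prod.simps(2)[of \<mu> s t n x y] by (rule opn_prod_diff)
   also have "... <= r * (C * q ^ n * wt s t x ?m) + (C * q ^ n * wt s t ?m y) * r"
    using near[OF st m(1,3)] near[OF st m(2,4)] Suc.IH[OF m(1,3)] Suc.IH[OF m(2,4)] q_r C0 wt_bounds(1)[OF m(2), of s t]
    by (intro add_mono mult_mono) (auto simp del: tree_prod.simps)
   also have "... = r * C * q ^ n * (wt s t x ?m + wt s t ?m y)" by (simp add: algebra_simps)
   also have "... <= r * C * q ^ n * (2 powr (- \<theta>) * wt s t x y)"
    using wt_halves[OF Suc.prems(1)] q_r C0 by (intro mult_left_mono) auto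
   also have "... = (r * 2 powr (- \<theta>)) * (C * q ^ n * wt s t x y)" by (simp only: mult_ac)
   also have "... = C * q ^ Suc n * wt s t x y" unfolding q_r(4) by simp
   finally show ?case .
  qed
  have dfct: "flow_defect \<mu> s u t n x y <= C * q ^ n * (y - x) powr b"
   if sut: "0 <= s" "s <= u" "u <= t" "t <= T" and "x <= y" "y - x <= d" for s u t n x y
   using that(5,6)
  proof (induction n arbitrary: x y)
   case (0 x y) then show ?case using flow_defect_0[OF \<mu> sut 0(1)] by simp
  next
   case (Suc n x y)
   let ?m = "(x + y) / 2"
   have m: "x <= ?m" "?m <= y" "?m - x <= d" "y - ?m <= d" "?m - x = (y - x) / 2" "y - ?m = (y - x) / 2"
    using Suc.prems by (auto simp: field_simps)
   have ut: "0 <= u" "s <= T" "u <= T" using sut by auto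
   have "flow_defect \<mu> s u t (Suc n) x y <= r * (C * q ^ n * ((y - x) / 2) powr b)"
    using Suc.IH[OF m(1,3)] Suc.IH[OF m(2,4)] near[OF ut(1) sut(3,4) m(2,4)] near[OF sut(1,2) ut(3) m(1,3)]
    unfolding m(5,6) by (intro flow_defect_Suc[OF \<mu> sut Suc.prems(1)]) auto
   also have "((y - x) / 2) powr b = 2 powr (- b) * (y - x) powr b"
    using Suc.prems by (simp add: powr_divide powr_minus field_simps)
   also have "r * (C * q ^ n * (2 powr (- b) * (y - x) powr b)) <= r * (C * q ^ n * (2 powr (- \<theta>) * (y - x) powr b))"
    using q_r C0 b' by (intro mult_left_mono mult_right_mono) (auto simp: \<theta>_def)
   also have "... = (r * 2 powr (- \<theta>)) * (C * q ^ n * (y - x) powr b)" by (simp only: mult_ac)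
   also have "... = C * q ^ Suc n * (y - x) powr b" unfolding q_r(4) by simp
   finally show ?case .
  qed
  show "bounded_at d r K' \<mu>"
   unfolding bounded_at_def
  proof (intro allI impI conjI)
   fix s u t n x y assume *: "0 <= s" "s <= u" "u <= t" "t <= T" "x <= y" "y - x <= d"
   then have st: "0 <= s" "s <= t" "t <= T" by auto
   show "opn (tree_prod \<mu> s t n x y) <= r" using near[OF st *(5,6)] by simp
   have "C * q ^ n * wt s t x y <= K' * q ^ n * wt s t x y"
    using K' q_r wt_bounds(1)[OF *(5), of s t] by (intro mult_right_mono) auto
   then show "opn (tree_prod \<mu> s t (Suc n) x y - tree_prod \<mu> s t n x y) <= K' * q ^ n * wt s t x y"
    using cauchy[OF st *(5,6), of n] by linarith
   have "C * q ^ n * (y - x) powr b <= C * q ^ n * d powr b"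
    using * C0 q_r b' by (intro mult_left_mono powr_mono2) auto
   also have "... = (C * d powr b) * q ^ n" by simp
   also have "... <= K' * q ^ n" using K' q_r by (intro mult_right_mono) auto
   finally show "flow_defect \<mu> s u t n x y <= K' * q ^ n" using dfct[OF *, of n] by linarith
  qed
 qed
qed

text \<open>The products over two adjacent intervals are multiplied, at the price of larger constants; finitely
 many doublings reach the whole interval.\<close>

lemma double_scale:
 assumes d: "0 < d" and B: "1 <= B" and K: "0 <= K"
 shows "\<exists>B'\<ge>1. \<exists>K'\<ge>0. \<forall>\<mu> :: real => real => real ^ 'n ^ 'n. almost_flow T C a b \<mu> --> bounded_at d B K \<mu> --> bounded_at (2 * d) B' K' \<mu>"
proof -
 define B' where "B' = B * B + (1 + C * T powr a)"
 define K' where "K' = C + C * (2 * d) powr b + B * K / q"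
 have K': "0 <= K'" "C <= K'" "C * (2 * d) powr b <= K'" "B * K <= q * K'"
  using C0 B K q_r by (auto simp: K'_def field_simps intro!: add_nonneg_nonneg mult_nonneg_nonneg)
 show ?thesis
 proof (intro exI conjI allI impI)
  show "1 <= B'" "0 <= K'" using B C0 K' mult_mono[of 1 B 1 B] by (auto simp: B'_def intro!: add_increasing)
  fix \<mu> :: "real => real => real ^ 'n ^ 'n" assume \<mu>: "almost_flow T C a b \<mu>" and bd: "bounded_at d B K \<mu>"
  show "bounded_at (2 * d) B' K' \<mu>"
   unfolding bounded_at_def
  proof (intro allI impI)
   fix s u t n x y assume sut: "0 <= s" "s <= u" "u <= t" "t <= T" and xy: "x <= y" "y - x <= 2 * d"
   then have st: "0 <= s" "s <= t" "t <= T" and ut: "0 <= u" "u <= T" by auto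
   let ?m = "(x + y) / 2"
   have m: "x <= ?m" "?m <= y" "?m - x <= d" "y - ?m <= d" using xy by (auto simp: field_simps)
   note L = bounded_atD[OF bd st m(1,3)] and R = bounded_atD[OF bd st m(2,4)]
   have w: "wt s t x ?m + wt s t ?m y <= wt s t x y"
   proof -
    have "2 powr (- \<theta>) <= (1::real)" using q_r by (intro less_imp_le powr_less_one) auto
    then have "2 powr (- \<theta>) * wt s t x y <= 1 * wt s t x y"
     using wt_bounds(1)[OF xy(1), of s t] by (intro mult_right_mono)
    then show ?thesis using wt_halves[OF xy(1), of s t] by simp
   qed
   show "opn (tree_prod \<mu> s t n x y) <= B' &
    opn (tree_prod \<mu> s t (Suc n) x y - tree_prod \<mu> s t n x y) <= K' * q ^ n * wt s t x y &
    flow_defect \<mu> s u t n x y <= K' * q ^ n"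
   proof (cases n)
    case 0
    have "opn (\<mu> (clip s t x) (clip s t y)) <= 1 + C * (clip s t y - clip s t x) powr a"
     using st xy by (intro flow_norm[OF \<mu>] clip_T clip_mono) auto
    also have "... <= 1 + C * T powr a"
     using a0 C0 clip_mono[OF xy(1), of s t] clip_T[OF st, of x] clip_T[OF st, of y]
     by (intro add_left_mono mult_left_mono powr_mono2) auto
    also have "... <= B'" using B by (simp add: B'_def)
    finally have 1: "opn (tree_prod \<mu> s t n x y) <= B'" using 0 by simp
    have "C * wt s t x y <= K' * wt s t x y" using K' wt_bounds(1)[OF xy(1), of s t] by (intro mult_right_mono)
    then have 2: "opn (tree_prod \<mu> s t (Suc n) x y - tree_prod \<mu> s t n x y) <= K' * q ^ n * wt s t x y"
     using flow_mult_clip[OF \<mu> st xy(1)] 0 by simp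
    have "C * (y - x) powr b <= C * (2 * d) powr b"
     using xy C0 b' by (intro mult_left_mono powr_mono2) auto
    then have 3: "flow_defect \<mu> s u t n x y <= K' * q ^ n" using flow_defect_0[OF \<mu> sut xy(1)] 0 K' by simp
    show ?thesis using 1 2 3 by blast
   next
    case (Suc k)
    have "opn (tree_prod \<mu> s t n x y) <= opn (tree_prod \<mu> s t k ?m y) * opn (tree_prod \<mu> s t k x ?m)"
     unfolding Suc tree_prod.simps by (rule opn_mult)
    also have "... <= B * B" using L(1) R(1) B by (intro mult_mono) auto
    also have "... <= B'" using C0 by (simp add: B'_def)
    finally have 1: "opn (tree_prod \<mu> s t n x y) <= B'" .
    have "opn (tree_prod \<mu> s t (Suc n) x y - tree_prod \<mu> s t n x y)
    <= opn (tree_prod \<mu> s t (Suc k) ?m y) * opn (tree_prod \<mu> s t (Suc k) x ?m - tree_prod \<mu> s t k x ?m)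
     + opn (tree_prod \<mu> s t (Suc k) ?m y - tree_prod \<mu> s t k ?m y) * opn (tree_prod \<mu> s t k x ?m)"
     unfolding Suc tree_prod.simps(2)[of \<mu> s t "Suc k" x y] tree_prod.simps(2)[of \<mu> s t k x y] by (rule opn_prod_diff)
    also have "... <= B * (K * q ^ k * wt s t x ?m) + (K * q ^ k * wt s t ?m y) * B"
     using L(1)[of k] R(1)[of "Suc k"] L(2)[of k] R(2)[of k] B K q_r wt_bounds(1)[OF m(2), of s t]
     by (intro add_mono mult_mono) (auto simp del: tree_prod.simps)
    also have "... = B * K * q ^ k * (wt s t x ?m + wt s t ?m y)" by (simp add: algebra_simps)
    also have "... <= B * K * q ^ k * wt s t x y"
     using w B K q_r by (intro mult_left_mono) auto
    also have "... <= (q * K') * q ^ k * wt s t x y"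
     using K' q_r wt_bounds(1)[OF xy(1), of s t] by (intro mult_right_mono) auto
    also have "... = K' * q ^ n * wt s t x y" by (simp add: Suc)
    finally have 2: "opn (tree_prod \<mu> s t (Suc n) x y - tree_prod \<mu> s t n x y) <= K' * q ^ n * wt s t x y" .
    have "flow_defect \<mu> s u t n x y <= B * (K * q ^ k)"
     unfolding Suc
     using L(3)[OF sut(2,3)] R(3)[OF sut(2,3)] bounded_atD(1)[OF bd ut(1) sut(3,4) m(2,4)] bounded_atD(1)[OF bd sut(1,2) ut(2) m(1,3)]
     by (intro flow_defect_Suc[OF \<mu> sut xy(1)]) auto
    also have "... = (B * K) * q ^ k" by simp
    also have "... <= (q * K') * q ^ k" using K' q_r by (intro mult_right_mono) auto
    also have "... = K' * q ^ n" by (simp add: Suc)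
    finally have 3: "flow_defect \<mu> s u t n x y <= K' * q ^ n" .
    show ?thesis using 1 2 3 by blast
   qed
  qed
 qed
qed

lemma full_scale:
 "\<exists>B\<ge>1. \<exists>K\<ge>0. \<forall>\<mu> :: real => real => real ^ 'n ^ 'n. almost_flow T C a b \<mu> --> bounded_at T B K \<mu>"
proof -
 obtain d B0 K0 where d: "0 < d" "1 <= B0" "0 <= K0"
  "!!\<mu> :: real => real => real ^ 'n ^ 'n. almost_flow T C a b \<mu> ==> bounded_at d B0 K0 \<mu>"
  using small_scale[where 'n = 'n] by blast
 have scale: "\<exists>B\<ge>1. \<exists>K\<ge>0. \<forall>\<mu> :: real => real => real ^ 'n ^ 'n. almost_flow T C a b \<mu> --> bounded_at (2 ^ j * d) B K \<mu>" for j :: nat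
 proof (induction j)
  case 0 then show ?case using d by (intro exI[of _ B0] exI[of _ K0] conjI) auto
 next
  case (Suc j)
  then obtain B K where BK: "1 <= B" "0 <= K"
   "!!\<mu> :: real => real => real ^ 'n ^ 'n. almost_flow T C a b \<mu> ==> bounded_at (2 ^ j * d) B K \<mu>" by blast
  have "0 < 2 ^ j * d" using d by simp
  from double_scale[OF this BK(1,2), where 'n = 'n] obtain B' K' where B'K': "1 <= B'" "0 <= K'"
   "!!\<mu> :: real => real => real ^ 'n ^ 'n. almost_flow T C a b \<mu> ==> bounded_at (2 ^ j * d) B K \<mu> ==> bounded_at (2 * (2 ^ j * d)) B' K' \<mu>"
   by blast
  then show ?case using BK(3) by (intro exI[of _ B'] exI[of _ K'] conjI) (auto simp: mult.assoc)
 qed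
 obtain j where j: "T / d < 2 ^ j" using real_arch_pow[of 2 "T / d"] by auto
 then have "T <= 2 ^ j * d" using d by (simp add: field_simps)
 moreover have "bounded_at T B K \<mu>" if "bounded_at (2 ^ j * d) B K \<mu>" "T <= 2 ^ j * d" for B K and \<mu> :: "real => real => real ^ 'n ^ 'n"
  using that unfolding bounded_at_def by (meson order_trans)
 ultimately show ?thesis using scale[of j] by blast
qed

text \<open>Convergence is geometric in the depth. The lower bound makes the limit invertible: on short intervals
 it holds because the limit is within one half of the identity, and it passes to long intervals by
 multiplicativity.\<close>

theorem multiplicative_sewing:
 "\<exists>K>0. \<exists>\<kappa>>0. \<forall>\<mu> :: real => real => real ^ 'n ^ 'n. almost_flow T C a b \<mu> -->
  (\<forall>s t. 0 <= s --> s <= t --> t <= T -->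
   (%n. tree_prod \<mu> s t n 0 T) \<longlonglongrightarrow> mult_sewing T \<mu> s t &
   mult_sewing T \<mu> s s = mat 1 &
   opn (mult_sewing T \<mu> s t) <= K &
   opn (mult_sewing T \<mu> s t - \<mu> s t) <= K * (t - s) powr b' &
   (\<forall>u. s <= u --> u <= t --> mult_sewing T \<mu> s t = mult_sewing T \<mu> u t ** mult_sewing T \<mu> s u) &
   (\<forall>v. \<kappa> * norm v <= norm (mult_sewing T \<mu> s t *v v)))"
proof -
 obtain B K where BK: "1 <= B" "0 <= K" and
  bd: "!!\<mu> :: real => real => real ^ 'n ^ 'n. almost_flow T C a b \<mu> ==> bounded_at T B K \<mu>"
  using full_scale[where 'n = 'n] by blast
 define K' where "K' = B + K * T powr \<theta> / (1 - q)"
 have K': "1 <= K'" "K * T powr \<theta> / (1 - q) <= K'" "B <= K'" using BK q_r by (auto simp: K'_def intro!: add_increasing2)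
 obtain d where d: "0 < d" "K' * d powr b' + C * d powr a <= 1 / 2"
  using exists_small_powr[of b' a "1 / 2" K' C] a0 b' by (auto intro: less_imp_le)
 obtain N :: nat where N: "T / d < real N" using reals_Archimedean2 by blast
 show ?thesis
 proof (intro exI conjI allI impI)
  show "0 < K'" "0 < (1 / 2 :: real) ^ N" using K' by auto
  fix \<mu> :: "real => real => real ^ 'n ^ 'n" assume \<mu>: "almost_flow T C a b \<mu>"
  let ?U = "mult_sewing T \<mu>"
  note bdd = bounded_atD[OF bd[OF \<mu>] _ _ _ _ _, of _ _ 0 T]
  have lim: "(%n. tree_prod \<mu> s t n 0 T) \<longlonglongrightarrow> ?U s t & opn (?U s t - \<mu> s t) <= K' * (t - s) powr b'"
   if st: "0 <= s" "s <= t" "t <= T" for s t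
  proof -
   let ?Q = "%n. tree_prod \<mu> s t n 0 T"
   have cl: "clip s t 0 = s" "clip s t T = t" using st by (auto simp: clip_def)
   define w where "w = (t - s) powr b' * T powr \<theta>"
   have w: "wt s t 0 T = w" by (simp add: wt_def len_def cl w_def)
   have c: "opn (?Q (Suc n) - ?Q n) <= K * w * q ^ n" for n
    using bdd(2)[OF st, of n] T0 by (simp add: w mult_ac)
   have le: "norm (?Q (Suc n) - ?Q n) <= ((real CARD('n))\<^sup>2 * (K * w)) * q ^ n" for n
    using norm_le_opn[of "?Q (Suc n) - ?Q n"] mult_left_mono[OF c[of n] zero_le_power2[of "real CARD('n)"]] unfolding mult.assoc by linarith
   have "summable (%n. ?Q (Suc n) - ?Q n)"
    by (rule summable_comparison_test'[OF _ le]) (use q_r in "auto intro!: summable_mult summable_geometric")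
   then have "convergent (%n. \<Sum>i<n. ?Q (Suc i) - ?Q i)" by (simp add: summable_iff_convergent)
   then have "convergent (%n. ?Q n - ?Q 0)"
    unfolding sum_lessThan_telescope[of "%i. tree_prod \<mu> s t i 0 T"] .
   then have "convergent ?Q" by (simp add: convergent_diff_const_right_iff del: tree_prod.simps)
   then have lim: "?Q \<longlonglongrightarrow> ?U s t" by (simp add: mult_sewing_def convergent_LIMSEQ_iff)
   have "opn (?Q n - ?Q 0) <= (\<Sum>i<n. K * w * q ^ i)" for n
   proof (induction n)
    case (Suc n)
    then show ?case using opn_add[of "?Q (Suc n) - ?Q n" "?Q n - ?Q 0"] c[of n] by (simp del: tree_prod.simps)
   qed simp
   moreover have "(\<Sum>i<n. K * w * q ^ i) <= K * w / (1 - q)" for n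
   proof -
    have "(\<Sum>i<n. q ^ i) <= (\<Sum>i. q ^ i)" using q_r by (intro sum_le_suminf summable_geometric) auto
    then have "(\<Sum>i<n. q ^ i) <= 1 / (1 - q)" using q_r by (simp add: suminf_geometric)
    then have "K * w * (\<Sum>i<n. q ^ i) <= K * w * (1 / (1 - q))" using BK by (intro mult_left_mono) (auto simp: w_def)
    then show ?thesis by (simp add: sum_distrib_left)
   qed
   ultimately have "opn (?Q n - ?Q 0) <= K * w / (1 - q)" for n using order_trans by blast
   then have "opn (?U s t - ?Q 0) <= K * w / (1 - q)"
    by (intro opn_limit[OF tendsto_diff[OF lim tendsto_const] tendsto_const])
   also have "... = (K * T powr \<theta> / (1 - q)) * (t - s) powr b'" by (simp add: w_def)
   also have "... <= K' * (t - s) powr b'" using K' by (intro mult_right_mono) auto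
   finally show ?thesis using lim by (simp add: cl)
  qed
  have U1: "?U s s = mat 1" if "0 <= s" "s <= T" for s
  proof -
   have "opn (?U s s - mat 1) <= 0" using lim[of s s] that flow_diag[OF \<mu> that] by simp
   then have "norm (?U s s - mat 1) <= 0" using norm_le_opn[of "?U s s - mat 1"] opn_nonneg[of "?U s s - mat 1"] by (simp add: antisym)
   then show ?thesis by simp
  qed
  have mult: "?U s t = ?U u t ** ?U s u" if sut: "0 <= s" "s <= u" "u <= t" "t <= T" for s u t
  proof -
   have st: "0 <= s" "s <= t" "t <= T" and su: "0 <= s" "s <= u" "u <= T" and ut: "0 <= u" "u <= t" "t <= T"
    using sut by auto
   have "(%n. tree_prod \<mu> u t n 0 T ** tree_prod \<mu> s u n 0 T) \<longlonglongrightarrow> ?U u t ** ?U s u"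
    unfolding matrix_matrix_mult_def using lim[OF ut] lim[OF su] by (intro tendsto_intros) auto
   then have "(%n. tree_prod \<mu> s t n 0 T - tree_prod \<mu> u t n 0 T ** tree_prod \<mu> s u n 0 T) \<longlonglongrightarrow> ?U s t - ?U u t ** ?U s u"
    using lim[OF st] by (intro tendsto_diff) auto
   moreover have "(%n. K * q ^ n) \<longlonglongrightarrow> K * 0" using q_r by (intro tendsto_intros LIMSEQ_realpow_zero) auto
   moreover have "opn (tree_prod \<mu> s t n 0 T - tree_prod \<mu> u t n 0 T ** tree_prod \<mu> s u n 0 T) <= K * q ^ n" for n
    using bdd(3)[OF st _ _ sut(2,3), of n] T0 by (simp add: flow_defect_def)
   ultimately have "opn (?U s t - ?U u t ** ?U s u) <= K * 0" by (rule opn_limit)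
   then have "norm (?U s t - ?U u t ** ?U s u) <= 0"
    using norm_le_opn[of "?U s t - ?U u t ** ?U s u"] opn_nonneg[of "?U s t - ?U u t ** ?U s u"] by (simp add: antisym)
   then show ?thesis by simp
  qed
  have half: "norm v / 2 <= norm (?U s t *v v)" if st: "0 <= s" "s <= t" "t <= T" "t - s <= d" for s t v
  proof -
   have "opn (?U s t - mat 1) <= opn (?U s t - \<mu> s t) + opn (\<mu> s t - mat 1)"
    using opn_add[of "?U s t - \<mu> s t" "\<mu> s t - mat 1"] by simp
   also have "... <= K' * (t - s) powr b' + C * (t - s) powr a"
    using lim[OF st(1-3)] flow_near[OF \<mu> st(1-3)] by simp
   also have "... <= K' * d powr b' + C * d powr a"
    using K' C0 st b' a0 by (intro add_mono mult_left_mono powr_mono2) auto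
   also have "... <= 1 / 2" by (rule d)
   finally have "norm ((?U s t - mat 1) *v v) <= 1 / 2 * norm v"
    by (intro order_trans[OF opn_vec] mult_right_mono) auto
   then have "norm (?U s t *v v - v) <= norm v / 2" by (simp add: matrix_vector_mult_diff_rdistrib)
   then show ?thesis using norm_triangle_ineq2[of v "?U s t *v v"] by (simp add: norm_minus_commute)
  qed
  have lower: "(1 / 2) ^ k * norm v <= norm (?U s t *v v)" if st: "0 <= s" "s <= t" "t <= T" "t - s <= real k * d" for s t v k
   using st(2-)
  proof (induction k arbitrary: t)
   case 0
   then have "s = t" by simp
   then show ?case using U1 st 0 by simp
  next
   case (Suc k)
   define u where "u = max s (t - d)"
   have u: "s <= u" "u <= t" "u <= T" "t - u <= d" "u - s <= real k * d" "0 <= u"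
    using Suc.prems d st by (auto simp: u_def algebra_simps)
   have "(1 / 2) ^ Suc k * norm v <= norm (?U s u *v v) / 2" using Suc.IH[OF u(1,3,5)] by simp
   also have "... <= norm (?U u t *v (?U s u *v v))" by (rule half) (use u Suc.prems in auto)
   also have "?U u t *v (?U s u *v v) = ?U s t *v v"
    using mult[OF st(1) u(1,2) Suc.prems(2)] by (simp add: matrix_vector_mul_assoc)
   finally show ?case .
  qed
  fix s t assume st: "0 <= s" "s <= t" "t <= T"
  show "(%n. tree_prod \<mu> s t n 0 T) \<longlonglongrightarrow> ?U s t" "opn (?U s t - \<mu> s t) <= K' * (t - s) powr b'"
   using lim[OF st] by auto
  show "?U s s = mat 1" using st by (intro U1) auto
  have "opn (?U s t) <= B"
   by (rule opn_limit[OF conjunct1[OF lim[OF st]] tendsto_const]) (use bdd(1)[OF st] T0 in simp)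
  then show "opn (?U s t) <= K'" using K' by simp
  show "?U s t = ?U u t ** ?U s u" if "s <= u" "u <= t" for u using mult st that by blast
  show "(1 / 2) ^ N * norm v <= norm (?U s t *v v)" for v
  proof (rule lower[OF st])
   have "T < real N * d" using N d by (simp add: field_simps)
   then show "t - s <= real N * d" using st by linarith
  qed
 qed
qed

end

section \<open>Germs of controlled integrands\<close>

lemma norm_lin_app: "norm (lin_app z x) <= norm z * norm x"
proof -
 have "norm (lin_app z x) <= (\<Sum>i\<in>UNIV. \<bar>norm (z $ i)\<bar> * \<bar>x $ i\<bar>)"
  unfolding lin_app_def by (rule order_trans[OF norm_sum]) (simp add: mult.commute)
 also have "... <= L2_set (%i. norm (z $ i)) UNIV * L2_set (%i. x $ i) UNIV"
  by (rule L2_set_mult_ineq)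
 finally show ?thesis by (simp add: norm_vec_def L2_set_def)
qed

interpretation lin_app: bounded_bilinear "lin_app :: 'v::euclidean_space ^ 'd => real ^ 'd => 'v"
proof
 fix z z' :: "'v ^ 'd" and x x' :: "real ^ 'd" and r :: real
 show "lin_app (z + z') x = lin_app z x + lin_app z' x"
  "lin_app z (x + x') = lin_app z x + lin_app z x'"
  "lin_app (r *\<^sub>R z) x = r *\<^sub>R lin_app z x" "lin_app z (r *\<^sub>R x) = r *\<^sub>R lin_app z x"
  by (simp_all add: lin_app_def scaleR_add_right scaleR_add_left sum.distrib scaleR_sum_right mult.commute)
 show "\<exists>K. \<forall>(z :: 'v ^ 'd) x. norm (lin_app z x) <= norm z * norm x * K"
  by (intro exI[of _ 1] allI) (simp add: norm_lin_app)
qed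

lemma bilin_app_lin_app: "bilin_app z B = (\<Sum>i\<in>UNIV. lin_app (z $ i) (B $ i))"
 by (simp add: bilin_app_def lin_app_def)

lemma norm_bilin_app: "norm (bilin_app z B) <= norm z * norm B"
proof -
 have "norm (bilin_app z B) <= (\<Sum>i\<in>UNIV. \<bar>norm (z $ i)\<bar> * \<bar>norm (B $ i)\<bar>)"
  unfolding bilin_app_lin_app by (rule order_trans[OF norm_sum]) (auto intro!: sum_mono norm_lin_app)
 also have "... <= L2_set (%i. norm (z $ i)) UNIV * L2_set (%i. norm (B $ i)) UNIV"
  by (rule L2_set_mult_ineq)
 finally show ?thesis by (simp add: norm_vec_def)
qed

interpretation bilin_app: bounded_bilinear "bilin_app :: 'v::euclidean_space ^ 'd ^ 'd => real ^ 'd ^ 'd => 'v"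
proof
 fix z z' :: "'v ^ 'd ^ 'd" and x x' :: "real ^ 'd ^ 'd" and r :: real
 show "bilin_app (z + z') x = bilin_app z x + bilin_app z' x"
  "bilin_app z (x + x') = bilin_app z x + bilin_app z x'"
  "bilin_app (r *\<^sub>R z) x = r *\<^sub>R bilin_app z x" "bilin_app z (r *\<^sub>R x) = r *\<^sub>R bilin_app z x"
  by (simp_all add: bilin_app_def scaleR_add_right scaleR_add_left sum.distrib scaleR_sum_right mult.commute)
 show "\<exists>K. \<forall>(z :: 'v ^ 'd ^ 'd) x. norm (bilin_app z x) <= norm z * norm x * K"
  by (intro exI[of _ 1] allI) (simp add: norm_bilin_app)
qed

lemma bilin_app_tensor: "bilin_app z (tensor a b) = lin_app (lin_app z a) b"
proof -
 have "bilin_app z (tensor a b) = (\<Sum>j\<in>UNIV. \<Sum>i\<in>UNIV. (a $ i * b $ j) *\<^sub>R z $ i $ j)"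
  unfolding bilin_app_def tensor_def by (subst sum.swap) simp
 then show ?thesis by (simp add: lin_app_def scaleR_sum_right mult.commute)
qed

text \<open>The operators on \<open>L(R^d; V)\<close> and \<open>L(R^d; L(R^d; V))\<close> that occur in the second-order term of the
 equation.\<close>

definition left_mult :: "real ^ 'n ^ 'd ^ 'n => real ^ 'n ^ 'd => real ^ 'n ^ 'd ^ 'd" where
 "left_mult F f = (\<chi> l. lin_app F (f $ l))"

definition apply_deriv :: "real ^ 'n ^ 'd ^ 'n ^ 'd => real ^ 'n => real ^ 'n ^ 'd ^ 'd" where
 "apply_deriv F' v = (\<chi> l. lin_app (F' $ l) v)"

lemma norm_left_mult: "norm (left_mult F f) <= norm F * norm f"
proof -
 have "norm (left_mult F f) <= L2_set (%l. norm F * norm (f $ l)) UNIV"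
  unfolding left_mult_def norm_vec_def[of "\<chi> l. lin_app F (f $ l)"]
  by (intro L2_set_mono) (auto intro: norm_lin_app)
 also have "... = norm F * norm f" by (simp add: L2_set_right_distrib norm_vec_def)
 finally show ?thesis .
qed

lemma norm_apply_deriv: "norm (apply_deriv F' v) <= norm F' * norm v"
proof -
 have "norm (apply_deriv F' v) <= L2_set (%l. norm (F' $ l) * norm v) UNIV"
  unfolding apply_deriv_def norm_vec_def[of "\<chi> l. lin_app (F' $ l) v"]
  by (intro L2_set_mono) (auto intro: norm_lin_app)
 also have "... = norm F' * norm v" by (simp add: L2_set_left_distrib norm_vec_def)
 finally show ?thesis .
qed

lemma left_mult_linear:
 "left_mult (F + G) f = left_mult F f + left_mult G f" "left_mult (F - G) f = left_mult F f - left_mult G f"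
 "left_mult F (f + g) = left_mult F f + left_mult F g" "left_mult F (f - g) = left_mult F f - left_mult F g"
 "left_mult F (r *\<^sub>R f) = r *\<^sub>R left_mult F f"
 by (simp_all add: left_mult_def vec_eq_iff lin_app.add_left lin_app.diff_left lin_app.add_right lin_app.diff_right lin_app.scaleR_right)

lemma apply_deriv_linear:
 "apply_deriv (F + G) v = apply_deriv F v + apply_deriv G v" "apply_deriv (F - G) v = apply_deriv F v - apply_deriv G v"
 "apply_deriv F (v + w) = apply_deriv F v + apply_deriv F w" "apply_deriv F (v - w) = apply_deriv F v - apply_deriv F w"
 "apply_deriv F (r *\<^sub>R v) = r *\<^sub>R apply_deriv F v"
 by (simp_all add: apply_deriv_def vec_eq_iff lin_app.add_left lin_app.diff_left lin_app.add_right lin_app.diff_right lin_app.scaleR_right)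

lemma lin_app_left_mult: "lin_app (left_mult F f) a = lin_app F (lin_app f a)"
proof -
 have "lin_app F (lin_app f a) = (\<Sum>i\<in>UNIV. lin_app F (a $ i *\<^sub>R f $ i))"
  unfolding lin_app_def[of f] by (rule lin_app.sum_right)
 then show ?thesis by (simp add: left_mult_def lin_app_def[of "\<chi> l. lin_app F (f $ l)"] lin_app.scaleR_right)
qed

lemma lin_app_apply_deriv: "lin_app (apply_deriv F' v) a = lin_app (lin_app F' a) v"
proof -
 have "lin_app (lin_app F' a) v = (\<Sum>i\<in>UNIV. lin_app (a $ i *\<^sub>R F' $ i) v)"
  unfolding lin_app_def[of F'] by (rule lin_app.sum_left)
 then show ?thesis by (simp add: apply_deriv_def lin_app_def[of "\<chi> l. lin_app (F' $ l) v"] lin_app.scaleR_left)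
qed

definition germ :: "'v::euclidean_space ^ 'd => 'v ^ 'd ^ 'd => real ^ 'd => real ^ 'd ^ 'd => 'v" where
 "germ z z' a E = lin_app z a + bilin_app z' E"

definition second_order :: "real ^ 'n ^ 'd ^ 'n => real ^ 'n ^ 'd ^ 'n ^ 'd => real ^ 'n => real ^ 'n ^ 'd ^ 'd" where
 "second_order F F' v = apply_deriv F' v + left_mult F (lin_app F v)"

definition flow_step :: "real ^ 'n ^ 'd ^ 'n => real ^ 'n ^ 'd ^ 'n ^ 'd => real ^ 'd => real ^ 'd ^ 'd => real ^ 'n => real ^ 'n" where
 "flow_step F F' a E v = v + germ (lin_app F v) (second_order F F' v) a E"

definition source_step :: "real ^ 'n ^ 'd ^ 'n => real ^ 'n ^ 'd => real ^ 'n ^ 'd ^ 'd => real ^ 'd => real ^ 'd ^ 'd => real ^ 'n" where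
 "source_step F f f' a E = germ f (f' + left_mult F f) a E"

lemma second_order_linear:
 "second_order F F' (v + w) = second_order F F' v + second_order F F' w"
 "second_order F F' (r *\<^sub>R v) = r *\<^sub>R second_order F F' v"
 by (simp_all add: second_order_def apply_deriv_linear left_mult_linear lin_app.add_right lin_app.scaleR_right scaleR_add_right)

lemma linear_flow_step: "linear (flow_step F F' a E)"
 by (rule linearI) (simp_all add: flow_step_def germ_def second_order_linear lin_app.add_right lin_app.add_left
   lin_app.scaleR_right lin_app.scaleR_left bilin_app.add_left bilin_app.scaleR_left scaleR_add_right)

lemma germ_integrand:
 "germ (integrand F f \<phi> t w) (integrand_deriv F F' f f' \<phi> t w) a E =
  flow_step (F t w) (F' t w) a E (\<phi> t w) - \<phi> t w + source_step (F t w) (f t w) (f' t w) a E"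
proof -
 have "integrand_deriv F F' f f' \<phi> t w = second_order (F t w) (F' t w) (\<phi> t w) + (f' t w + left_mult (F t w) (f t w))"
  by (simp add: integrand_deriv_def second_order_def apply_deriv_def left_mult_def integrand_def vec_eq_iff lin_app.add_right)
 then show ?thesis
  by (simp add: germ_def flow_step_def source_step_def integrand_def lin_app.add_left bilin_app.add_left)
qed

text \<open>The basic cancellation: two consecutive steps differ from a single one by the remainder of
 \<open>f\<close> and by terms that are of order \<open>\<alpha> + \<beta> + \<beta>'\<close>. The terms of order \<open>2 * \<alpha>\<close> cancel by Chen's relation.
 Each term left contains one increment of order \<open>\<beta>\<close> or \<open>\<beta>'\<close> besides the second level, or three
 noise increments.\<close>

definition step_error where
 "step_error F F' f f' G G' g g' a b E E' =
  lin_app (lin_app (G - F) (lin_app f a)) b + lin_app (lin_app G (bilin_app (f' + left_mult F f) E)) b +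
  bilin_app (g' - f' + left_mult (G - F) g + left_mult F (g - f)) E' +
  bilin_app (second_order G G' (source_step F f f' a E)) E'"

lemma step_identity:
 assumes chen: "E'' = E + E' + tensor a b"
 shows "flow_step G G' b E' (source_step F f f' a E) + source_step G g g' b E' - source_step F f f' (a + b) E'' =
   lin_app (g - f - lin_app f' a) b + step_error F F' f f' G G' g g' a b E E'"
proof -
 have 1: "flow_step G G' b E' (source_step F f f' a E) = source_step F f f' a E
  + lin_app (lin_app G (lin_app f a)) b + lin_app (lin_app G (bilin_app (f' + left_mult F f) E)) b
  + bilin_app (second_order G G' (source_step F f f' a E)) E'"
  by (simp add: flow_step_def germ_def[of "lin_app G _"])
    (simp add: source_step_def germ_def lin_app.add_right lin_app.add_left)
 have 2: "source_step F f f' (a + b) E'' = source_step F f f' a E + lin_app f b + bilin_app (f' + left_mult F f) E'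
   + lin_app (lin_app f' a) b + lin_app (lin_app F (lin_app f a)) b"
  by (simp add: source_step_def germ_def chen lin_app.add_right bilin_app.add_right bilin_app_tensor lin_app.add_left lin_app_left_mult)
 have 3: "bilin_app (g' - f' + left_mult (G - F) g + left_mult F (g - f)) E' =
   bilin_app (g' + left_mult G g) E' - bilin_app (f' + left_mult F f) E'"
  unfolding bilin_app.diff_left[symmetric] by (simp add: left_mult_linear algebra_simps)
 have 4: "source_step G g g' b E' = lin_app g b + bilin_app (g' + left_mult G g) E'"
  by (simp add: source_step_def germ_def)
 show ?thesis unfolding 1 2 4 step_error_def 3
  by (simp add: lin_app.diff_left)
qed

lemma flow_step_source:
 "flow_step F F' a E v = v + source_step F (lin_app F v) (apply_deriv F' v) a E"
 by (simp add: flow_step_def source_step_def second_order_def)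

text \<open>The linear equation is the special case of the source \<open>F v\<close> with frozen \<open>v\<close>.\<close>

lemma flow_step_identity:
 assumes chen: "E'' = E + E' + tensor a b"
 shows "flow_step G G' b E' (flow_step F F' a E v) - flow_step F F' (a + b) E'' v =
   lin_app (lin_app (G - F - lin_app F' a) v) b +
   step_error F F' (lin_app F v) (apply_deriv F' v) G G' (lin_app G v) (apply_deriv G' v) a b E E'"
proof -
 have "flow_step G G' b E' (flow_step F F' a E v) = flow_step G G' b E' v + flow_step G G' b E' (source_step F (lin_app F v) (apply_deriv F' v) a E)"
  unfolding flow_step_source[of F F'] by (rule linear_add[OF linear_flow_step])
 then have "flow_step G G' b E' (flow_step F F' a E v) - flow_step F F' (a + b) E'' v =
  flow_step G G' b E' (source_step F (lin_app F v) (apply_deriv F' v) a E) + source_step G (lin_app G v) (apply_deriv G' v) b E'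
   - source_step F (lin_app F v) (apply_deriv F' v) (a + b) E''"
  by (simp add: flow_step_source[of G G' b E' v] flow_step_source[of F F' "a + b" E'' v])
 also have "... = lin_app (lin_app G v - lin_app F v - lin_app (apply_deriv F' v) a) b +
   step_error F F' (lin_app F v) (apply_deriv F' v) G G' (lin_app G v) (apply_deriv G' v) a b E E'"
  by (rule step_identity[OF chen])
 finally show ?thesis by (simp add: lin_app_apply_deriv lin_app.diff_left)
qed

lemma norm_germ: "norm (germ z z' a E) <= norm z * norm a + norm z' * norm E"
 unfolding germ_def by (rule order_trans[OF norm_triangle_ineq add_mono[OF norm_lin_app norm_bilin_app]])

lemma norm_second_order: "norm (second_order F F' v) <= (norm F' + norm F * norm F) * norm v"
proof -
 have "norm (second_order F F' v) <= norm F' * norm v + norm F * (norm F * norm v)"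
  unfolding second_order_def
  by (intro order_trans[OF norm_triangle_ineq add_mono[OF norm_apply_deriv order_trans[OF norm_left_mult]]] mult_left_mono norm_lin_app) auto
 then show ?thesis by (simp add: algebra_simps)
qed

lemma powr_le_powr_lower:
 fixes x T :: real
 assumes "0 <= x" "x <= T" "e <= e'" "e' <= e + 3"
 shows "x powr e' <= (1 + T) powr 3 * x powr e"
proof -
 have "x powr e' = x powr e * x powr (e' - e)" by (simp add: powr_add[symmetric])
 also have "... <= x powr e * (1 + T) powr (e' - e)" using assms by (intro mult_left_mono powr_mono2) auto
 also have "... <= x powr e * (1 + T) powr 3" using assms by (intro mult_left_mono powr_mono) auto
 finally show ?thesis by (simp only: mult.commute)
qed

lemma norm_step_error_le:
 assumes ex: "0 < \<beta>'" "\<beta>' <= \<beta>" "\<beta> <= \<alpha>" "\<alpha> <= 1" and C: "1 <= C" and N: "0 <= N" and x: "0 <= x" "x <= T"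
  and F: "norm F <= C" "norm G <= C" "norm G' <= C" "norm (G - F) <= C * x powr \<beta>"
  and f: "norm f <= C * N" "norm f' <= C * N" "norm g <= C * N"
   "norm (g - f) <= C * N * x powr \<beta>" "norm (g' - f') <= C * N * x powr \<beta>'"
  and a: "norm a <= C * x powr \<alpha>" "norm b <= C * x powr \<alpha>" "norm E <= C * x powr (2 * \<alpha>)" "norm E' <= C * x powr (2 * \<alpha>)"
 shows "norm (step_error F F' f f' G G' g g' a b E E') <= (20 * C ^ 6 * ((1 + T) powr 3) ^ 2) * N * x powr (\<alpha> + \<beta> + \<beta>')"
proof -
 define L where "L = (1 + T) powr 3"
 have L1: "1 <= L" unfolding L_def using x by (simp add: ge_one_powr_ge_zero)
 define X where "X = x powr (\<alpha> + \<beta> + \<beta>')"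
 have X0: "0 <= X" by (simp add: X_def)
 have C0: "0 <= C" "0 < C" using C by auto
 have Cp: "C ^ i <= C ^ j" if "i <= j" for i j using C that by (rule power_increasing[rotated])
 have pw: "x powr e' <= L * X" if "\<alpha> + \<beta> + \<beta>' <= e'" "e' <= \<alpha> + \<beta> + \<beta>' + 3" for e'
  unfolding L_def X_def using x that by (rule powr_le_powr_lower)
 define h where "h = f' + left_mult F f"
 have h: "norm h <= 2 * C\<^sup>2 * N"
 proof -
  have "norm h <= norm f' + norm F * norm f" unfolding h_def by (rule order_trans[OF norm_triangle_ineq add_left_mono[OF norm_left_mult]])
  also have "... <= C * N + C * (C * N)" using F f C0 N by (intro add_mono mult_mono) auto
  also have "... <= C\<^sup>2 * N + C * (C * N)" using Cp[of 1 2] N by (intro add_right_mono mult_right_mono) auto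
  finally show ?thesis by (simp add: power2_eq_square mult.assoc)
 qed
 have t1: "norm (lin_app (lin_app (G - F) (lin_app f a)) b) <= C ^ 6 * L ^ 2 * N * X"
 proof -
  have "norm (lin_app (lin_app (G - F) (lin_app f a)) b) <= norm (lin_app (G - F) (lin_app f a)) * norm b" by (rule norm_lin_app)
  also have "... <= (norm (G - F) * (norm f * norm a)) * norm b"
   by (intro mult_right_mono order_trans[OF norm_lin_app] mult_left_mono norm_lin_app) auto
  also have "... <= ((C * x powr \<beta>) * ((C * N) * (C * x powr \<alpha>))) * (C * x powr \<alpha>)"
   using F f a C0 N by (intro mult_mono) auto
  also have "... = C ^ 4 * N * (x powr \<beta> * x powr \<alpha> * x powr \<alpha>)" by (simp add: power4_eq_xxxx mult_ac)
  also have "x powr \<beta> * x powr \<alpha> * x powr \<alpha> = x powr (\<beta> + \<alpha> + \<alpha>)" by (simp only: powr_add)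
  also have "C ^ 4 * N * x powr (\<beta> + \<alpha> + \<alpha>) <= C ^ 4 * N * (L * X)"
   using ex C0 N by (intro mult_left_mono pw) auto
  also have "... = (C ^ 4 * L) * (N * X)" by simp
  also have "... <= (C ^ 6 * L ^ 2) * (N * X)"
   using Cp[of 4 6] L1 N X0 C0 by (intro mult_right_mono mult_mono) (auto simp: power2_eq_square mult_le_cancel_left1)
  finally show ?thesis by (simp add: mult.assoc)
 qed
 have t2: "norm (lin_app (lin_app G (bilin_app h E)) b) <= 2 * C ^ 6 * L ^ 2 * N * X"
 proof -
  have "norm (lin_app (lin_app G (bilin_app h E)) b) <= norm (lin_app G (bilin_app h E)) * norm b" by (rule norm_lin_app)
  also have "... <= (norm G * (norm h * norm E)) * norm b"
   by (intro mult_right_mono order_trans[OF norm_lin_app] mult_left_mono norm_bilin_app) auto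
  also have "... <= (C * ((2 * C\<^sup>2 * N) * (C * x powr (2 * \<alpha>)))) * (C * x powr \<alpha>)"
   using F h a C0 N by (intro mult_mono) auto
  also have "... = 2 * C ^ 5 * N * (x powr (2 * \<alpha>) * x powr \<alpha>)" by (simp add: eval_nat_numeral mult_ac)
  also have "x powr (2 * \<alpha>) * x powr \<alpha> = x powr (3 * \<alpha>)" by (simp add: powr_add[symmetric])
  also have "2 * C ^ 5 * N * x powr (3 * \<alpha>) <= 2 * C ^ 5 * N * (L * X)"
   using ex C0 N by (intro mult_left_mono pw) auto
  also have "... = (C ^ 5 * L) * (2 * N * X)" by simp
  also have "... <= (C ^ 6 * L ^ 2) * (2 * N * X)"
   using Cp[of 5 6] L1 N X0 C0 by (intro mult_right_mono mult_mono) (auto simp: power2_eq_square mult_le_cancel_left1)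
  finally show ?thesis by (simp add: mult_ac)
 qed
 have t3: "norm (bilin_app (g' - f' + left_mult (G - F) g + left_mult F (g - f)) E') <= 3 * C ^ 6 * L ^ 2 * N * X"
 proof -
  have "norm (g' - f' + left_mult (G - F) g + left_mult F (g - f)) <= norm (g' - f') + norm (G - F) * norm g + norm F * norm (g - f)"
   by (intro order_trans[OF norm_triangle_ineq] add_mono norm_left_mult order_refl)
  also have "... <= C * N * x powr \<beta>' + (C * x powr \<beta>) * (C * N) + C * (C * N * x powr \<beta>)"
   using F f C0 N by (intro add_mono mult_mono) auto
  finally have "norm (bilin_app (g' - f' + left_mult (G - F) g + left_mult F (g - f)) E')
   <= (C * N * x powr \<beta>' + (C * x powr \<beta>) * (C * N) + C * (C * N * x powr \<beta>)) * (C * x powr (2 * \<alpha>))"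
   using a C0 N by (intro order_trans[OF norm_bilin_app] mult_mono) auto
  also have "... = C\<^sup>2 * N * (x powr \<beta>' * x powr (2 * \<alpha>)) + 2 * C ^ 3 * N * (x powr \<beta> * x powr (2 * \<alpha>))"
   by (simp add: algebra_simps eval_nat_numeral)
  also have "... = C\<^sup>2 * N * x powr (\<beta>' + 2 * \<alpha>) + 2 * C ^ 3 * N * x powr (\<beta> + 2 * \<alpha>)"
   by (simp only: powr_add)
  also have "... <= C\<^sup>2 * N * (L * X) + 2 * C ^ 3 * N * (L * X)"
  proof (intro add_mono mult_left_mono)
   show "x powr (\<beta>' + 2 * \<alpha>) <= L * X" "x powr (\<beta> + 2 * \<alpha>) <= L * X"
    using ex by (auto intro!: pw)
  qed (use C0 N in auto)
  also have "... <= C ^ 3 * N * (L * X) + 2 * C ^ 3 * N * (L * X)"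
   using N L1 X0 Cp[of 2 3] by (intro add_right_mono mult_right_mono) auto
  also have "... = (C ^ 3 * L) * (3 * N * X)" by simp
  also have "... <= (C ^ 6 * L ^ 2) * (3 * N * X)"
   using Cp[of 3 6] L1 N X0 C0 by (intro mult_right_mono mult_mono) (auto simp: power2_eq_square mult_le_cancel_left1)
  finally show ?thesis by (simp add: mult_ac)
 qed
 have src: "norm (source_step F f f' a E) <= 3 * C ^ 3 * L * N * x powr \<alpha>"
 proof -
  have "norm (source_step F f f' a E) <= norm f * norm a + norm h * norm E"
   unfolding source_step_def h_def[symmetric] by (rule norm_germ)
  also have "... <= (C * N) * (C * x powr \<alpha>) + (2 * C\<^sup>2 * N) * (C * x powr (2 * \<alpha>))"
   using f h a C0 N by (intro add_mono mult_mono) auto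
  also have "... = C\<^sup>2 * N * x powr \<alpha> + 2 * C ^ 3 * N * x powr (2 * \<alpha>)" by (simp add: eval_nat_numeral mult_ac)
  also have "... <= C ^ 3 * N * (L * x powr \<alpha>) + 2 * C ^ 3 * N * (L * x powr \<alpha>)"
  proof (intro add_mono mult_mono)
   show "x powr (2 * \<alpha>) <= L * x powr \<alpha>" unfolding L_def using x ex by (intro powr_le_powr_lower) auto
   show "x powr \<alpha> <= L * x powr \<alpha>" using L1 by (simp add: mult_le_cancel_right1)
  qed (use N C0 L1 Cp[of 2 3] in auto)
  also have "... = 3 * C ^ 3 * L * N * x powr \<alpha>" by simp
  finally show ?thesis .
 qed
 have t4: "norm (bilin_app (second_order G G' (source_step F f f' a E)) E') <= 6 * C ^ 6 * L ^ 2 * N * X"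
 proof -
  have CC: "norm G' + norm G * norm G <= 2 * C\<^sup>2"
  proof -
   have "norm G' + norm G * norm G <= C + C * C" using F C0 by (intro add_mono mult_mono) auto
   also have "... <= C * C + C * C" using C by (simp add: mult_le_cancel_left1)
   finally show ?thesis by (simp add: power2_eq_square)
  qed
  have "norm (bilin_app (second_order G G' (source_step F f f' a E)) E') <= norm (second_order G G' (source_step F f f' a E)) * norm E'"
   by (rule norm_bilin_app)
  also have "... <= ((norm G' + norm G * norm G) * norm (source_step F f f' a E)) * norm E'"
   by (intro mult_right_mono norm_second_order) auto
  also have "... <= ((2 * C\<^sup>2) * (3 * C ^ 3 * L * N * x powr \<alpha>)) * (C * x powr (2 * \<alpha>))"
   using CC src a C0 L1 N by (intro mult_mono) auto
  also have "... = 6 * C ^ 6 * L * N * (x powr \<alpha> * x powr (2 * \<alpha>))" by (simp add: eval_nat_numeral mult_ac)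
  also have "x powr \<alpha> * x powr (2 * \<alpha>) = x powr (3 * \<alpha>)" by (simp add: powr_add[symmetric])
  also have "6 * C ^ 6 * L * N * x powr (3 * \<alpha>) <= 6 * C ^ 6 * L * N * (L * X)"
   using ex C0 N L1 by (intro mult_left_mono pw) auto
  finally show ?thesis by (simp add: power2_eq_square mult_ac)
 qed
 have "norm (step_error F F' f f' G G' g g' a b E E') <= C ^ 6 * L ^ 2 * N * X + 2 * C ^ 6 * L ^ 2 * N * X + 3 * C ^ 6 * L ^ 2 * N * X + 6 * C ^ 6 * L ^ 2 * N * X"
  unfolding step_error_def h_def[symmetric]
  by (intro order_trans[OF norm_triangle_ineq] add_mono t1 t2 t3 t4)
 also have "... = 12 * (C ^ 6 * L ^ 2 * N * X)" by simp
 also have "... <= 20 * (C ^ 6 * L ^ 2 * N * X)" using C0 L1 N X0 by (intro mult_right_mono) auto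
 finally show ?thesis by (simp add: L_def X_def mult_ac)
qed

definition flow_matrix :: "real ^ 'n ^ 'd ^ 'n => real ^ 'n ^ 'd ^ 'n ^ 'd => real ^ 'd => real ^ 'd ^ 'd => real ^ 'n ^ 'n" where
 "flow_matrix F F' a E = matrix (flow_step F F' a E)"

lemma flow_matrix_apply: "flow_matrix F F' a E *v v = flow_step F F' a E v"
 unfolding flow_matrix_def using matrix_vector_mul(2)[OF linear_flow_step, of F F' a E] by metis

lemma flow_matrix_0: "flow_matrix F F' 0 0 = mat 1"
 by (simp add: matrix_eq flow_matrix_apply flow_step_def germ_def lin_app.zero_right bilin_app.zero_right)

lemma continuous_flow_matrix: "continuous_on UNIV (%x. flow_matrix (fst x) (snd x) a E)"
 unfolding flow_matrix_def matrix_def flow_step_def germ_def second_order_def left_mult_def apply_deriv_def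
 by (intro continuous_intros lin_app.continuous_on bilin_app.continuous_on)

lemma meas_flow_matrix:
 fixes F :: "'a => real ^ 'n ^ 'd ^ 'n"
 assumes "F \<in> borel_measurable M" "F' \<in> borel_measurable M"
 shows "(%w. flow_matrix (F w) (F' w) a E) \<in> borel_measurable M"
 by (rule borel_measurable_continuous_Pair[OF assms continuous_flow_matrix])

lemma meas_matrix_mult:
 fixes X Y :: "'a => real ^ 'n ^ 'n"
 assumes "X \<in> borel_measurable M" "Y \<in> borel_measurable M"
 shows "(%w. X w ** Y w) \<in> borel_measurable M"
 by (rule borel_measurable_continuous_Pair[OF assms])
  (auto simp: matrix_matrix_mult_def intro!: continuous_intros)

lemma meas_matrix_vector_mult:
 fixes X :: "'a => real ^ 'n ^ 'n" and v :: "'a => real ^ 'n"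
 assumes "X \<in> borel_measurable M" "v \<in> borel_measurable M"
 shows "(%w. X w *v v w) \<in> borel_measurable M"
 by (rule borel_measurable_continuous_Pair[OF assms])
  (auto simp: matrix_vector_mult_def intro!: continuous_intros)

text \<open>Cramer's rule exhibits the inverse as a measurable function of the matrix.\<close>

definition cramer_inv :: "real ^ 'n ^ 'n => real ^ 'n ^ 'n" where
 "cramer_inv A = (\<chi> k j. det (\<chi> i l. if l = k then axis j 1 $ i else A $ i $ l) / det A)"

lemma cramer_inv:
 assumes "det A \<noteq> 0"
 shows "A ** cramer_inv A = mat 1" "cramer_inv A ** A = mat 1"
proof -
 have "A *v (cramer_inv A *v axis j 1) = axis j 1" for j
 proof -
  have "cramer_inv A *v axis j 1 = (\<chi> k. det (\<chi> i l. if l = k then axis j 1 $ i else A $ i $ l) / det A)"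
   by (simp add: matrix_vector_mult_basis column_def cramer_inv_def vec_eq_iff)
  then show ?thesis using cramer[OF assms] by blast
 qed
 then have "column j (A ** cramer_inv A) = column j (mat 1)" for j
  by (simp add: matrix_vector_mult_basis[symmetric] matrix_vector_mul_assoc)
 then show "A ** cramer_inv A = mat 1" by (simp add: column_def vec_eq_iff)
 then show "cramer_inv A ** A = mat 1" by (simp add: matrix_left_right_inverse)
qed

lemma meas_cramer_inv:
 fixes A :: "'a => real ^ 'n ^ 'n"
 assumes "A \<in> borel_measurable M"
 shows "(%w. cramer_inv (A w)) \<in> borel_measurable M"
proof -
 have nth: "(%w. A w $ i $ j) \<in> borel_measurable M" for i j
  by (rule borel_measurable_continuous_on[OF _ assms]) (intro continuous_intros)
 have det: "(%w. det (X w)) \<in> borel_measurable M"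
  if "!!i j. (%w. X w $ i $ j) \<in> borel_measurable M" for X :: "'a => real ^ 'n ^ 'n"
  unfolding det_def using that by measurable
 have "(%w. cramer_inv (A w) $ k $ j) \<in> borel_measurable M" for k j
 proof -
  have "(%w. (\<chi> i l. if l = k then axis j 1 $ i else A w $ i $ l) $ i $ l) \<in> borel_measurable M" for i l
   by (cases "l = k") (simp_all add: nth)
  from borel_measurable_divide[OF det[OF this] det[OF nth]] show ?thesis
   by (simp add: cramer_inv_def)
 qed
 then show ?thesis
  unfolding borel_measurable_euclidean_space[where 'c = "real ^ 'n ^ 'n"]
  by (auto simp: Basis_vec_def inner_axis)
qed

lemma det_nonzero_if_bounded_below:
 fixes A :: "real ^ 'n ^ 'n"
 assumes "0 < \<kappa>" "!!v. \<kappa> * norm v <= norm (A *v v)"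
 shows "det A \<noteq> 0"
proof -
 have "v = 0" if "A *v v = 0" for v
 proof -
  have "\<kappa> * norm v <= 0" using assms(2)[of v] that by simp
  then show ?thesis using assms(1) by (simp add: mult_le_0_iff)
 qed
 then have "\<exists>B. B ** A = mat 1" by (simp add: matrix_left_invertible_ker)
 then show ?thesis by (simp add: invertible_det_nz[symmetric] invertible_left_inverse)
qed

lemma opn_cramer_inv_le:
 assumes "0 < \<kappa>" "!!v. \<kappa> * norm v <= norm (A *v v)"
 shows "opn (cramer_inv A) <= 1 / \<kappa>"
proof (rule opn_leI)
 fix v
 have "\<kappa> * norm (cramer_inv A *v v) <= norm (A *v (cramer_inv A *v v))" by (rule assms(2))
 also have "A *v (cramer_inv A *v v) = v"
  using cramer_inv(1)[OF det_nonzero_if_bounded_below[OF assms]] by (simp add: matrix_vector_mul_assoc)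
 finally show "norm (cramer_inv A *v v) <= 1 / \<kappa> * norm v" using assms(1) by (simp add: field_simps)
qed (use assms in simp)

context filtered_prob_space begin

text \<open>An inequality between continuous quantities that holds almost surely for each pair of times holds
 almost surely for all pairs, by approximation with dyadic times.\<close>

lemma AE_all_times:
 fixes g :: "real => real => 'a => real"
 assumes AE: "!!s t. 0 <= s ==> s <= t ==> t <= T ==> AE w in M. g s t w <= 0"
  and cont: "!!w. continuous_on {0..T} (%t. g' t w :: 'b::topological_space)"
  and g: "!!w s t r r'. 0 <= s ==> s <= t ==> t <= T ==> r \<longlonglongrightarrow> s ==> r' \<longlonglongrightarrow> t ==>
   (!!l. 0 <= r l & r l <= r' l & r' l <= T) ==> (%l. g (r l) (r' l) w) \<longlonglongrightarrow> g s t w"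
 shows "AE w in M. \<forall>s t. 0 <= s --> s <= t --> t <= T --> g s t w <= 0"
proof -
 have "AE w in M. \<forall>l j k. j <= k --> k <= 2 ^ l --> g (dyadic T l j) (dyadic T l k) w <= 0"
  unfolding AE_all_countable
 proof (intro allI)
  fix l j k
  show "AE w in M. j <= k --> k <= 2 ^ l --> g (dyadic T l j) (dyadic T l k) w <= 0"
  proof (cases "j <= k & k <= 2 ^ l")
   case True
   then have "0 <= dyadic T l j" "dyadic T l j <= dyadic T l k" "dyadic T l k <= T"
    using T_pos dyadic_mono[of T 0 j l] dyadic_mono[of T j k l] dyadic_mono[of T k "2 ^ l" l] by (auto simp: dyadic_ends)
   from AE[OF this] show ?thesis by eventually_elim simp
  qed auto
 qed
 then show ?thesis
 proof (eventually_elim, intro allI impI)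
  fix w s t assume le: "\<forall>l j k. j <= k --> k <= 2 ^ l --> g (dyadic T l j) (dyadic T l k) w <= 0"
   and st: "0 <= s" "s <= t" "t <= T"
  define r where "r s l = dyadic T l (dyadic_floor l s)" for s l
  have r: "r s \<longlonglongrightarrow> s" if "0 <= s" for s
  proof (rule tendsto_sandwich[of "%l. s - T / 2 ^ l" _ _ "%_. s"])
   have "(%l. s - T * (1 / 2) ^ l) \<longlonglongrightarrow> s - T * 0" by (intro tendsto_intros LIMSEQ_realpow_zero) auto
   then show "(%l. s - T / 2 ^ l) \<longlonglongrightarrow> s" by (simp add: power_divide)
   show "\<forall>\<^sub>F l in sequentially. s - T / 2 ^ l <= r s l"
   proof (rule always_eventually, rule allI)
    fix l show "s - T / 2 ^ l <= r s l"
     using dyadic_floor(2)[OF that, of l] dyadic_step[of T l "dyadic_floor l s"] by (simp add: r_def)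
   qed
   show "\<forall>\<^sub>F l in sequentially. r s l <= s" using dyadic_floor(1)[OF that] by (simp add: r_def)
  qed auto
  have fl: "dyadic_floor l s <= dyadic_floor l t" for l
   unfolding dyadic_floor_def using st T_pos by (intro nat_mono floor_mono divide_right_mono mult_right_mono) auto
  have fT: "dyadic_floor l t <= 2 ^ l" for l using st by (intro dyadic_floor_le) auto
  have "(%l. g (r s l) (r t l) w) \<longlonglongrightarrow> g s t w"
  proof (rule g[OF st r[OF st(1)] r])
   fix l
   have "r t l <= T" using dyadic_floor(1)[of t l] st by (simp add: r_def)
   moreover have "0 <= r s l" using T_pos by (simp add: r_def dyadic_def)
   moreover have "r s l <= r t l" unfolding r_def using fl T_pos by (intro dyadic_mono) auto
   ultimately show "0 <= r s l & r s l <= r t l & r t l <= T" by simp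
  qed (use st in auto)
  then show "g s t w <= 0"
   by (rule LIMSEQ_le_const2) (use le fl fT in "auto simp: r_def")
 qed
qed

end

section \<open>The linear flow\<close>

text \<open>The coefficients of the homogeneous equation with all bounds collected in one constant. The second
 level \<open>e2\<close> is defined and satisfies Chen's relation also for degenerate triples of times.\<close>

locale rough_linear = filtered_prob_space M Fil T
 for M :: "'a measure" and Fil :: "real => 'a measure" and T :: real +
 fixes \<alpha> \<beta> \<beta>' C :: real and \<eta> :: "real => real ^ 'd" and e2 :: "real => real => real ^ 'd ^ 'd"
  and F :: "real => 'a => real ^ 'n ^ 'd ^ 'n" and F' :: "real => 'a => real ^ 'n ^ 'd ^ 'n ^ 'd"
 assumes ex: "0 < \<beta>'" "\<beta>' <= \<beta>" "\<beta> <= \<alpha>" "\<alpha> <= 1 / 2" "1 / 2 < \<alpha> + \<beta>" "1 < \<alpha> + \<beta> + \<beta>'" and C1: "1 <= C"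
  and eta: "!!s t. 0 <= s ==> s <= t ==> t <= T ==> norm (\<eta> t - \<eta> s) <= C * (t - s) powr \<alpha>"
  and e2: "!!s t. 0 <= s ==> s <= t ==> t <= T ==> norm (e2 s t) <= C * (t - s) powr (2 * \<alpha>)"
  and chen: "!!s u t. 0 <= s ==> s <= u ==> u <= t ==> t <= T ==>
   e2 s t = e2 s u + e2 u t + tensor (\<eta> u - \<eta> s) (\<eta> t - \<eta> u)"
  and F_meas: "!!t. 0 <= t ==> t <= T ==> F t \<in> borel_measurable (Fil t)"
   "!!t. 0 <= t ==> t <= T ==> F' t \<in> borel_measurable (Fil t)"
  and F_bound: "!!t. 0 <= t ==> t <= T ==> AE w in M. norm (F t w) <= C"
   "!!t. 0 <= t ==> t <= T ==> AE w in M. norm (F' t w) <= C"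
  and F_incr: "!!s t. 0 <= s ==> s <= t ==> t <= T ==> AE w in M. norm (F t w - F s w) <= C * (t - s) powr \<beta>"
   "!!s t. 0 <= s ==> s <= t ==> t <= T ==> AE w in M. norm (F' t w - F' s w) <= C * (t - s) powr \<beta>'"
  and F_rem: "!!s t. 0 <= s ==> s <= t ==> t <= T ==>
   AE w in M. norm (F t w - F s w - lin_app (F' s w) (\<eta> t - \<eta> s)) <= C * (t - s) powr (\<beta> + \<beta>')"
begin

definition KS where "KS = 21 * C ^ 6 * ((1 + T) powr 3) ^ 2"

lemma KS_pos: "0 < KS"
 using C1 T_pos by (simp add: KS_def)

lemma e2_diag: "0 <= t ==> t <= T ==> e2 t t = 0"
 using e2[of t t] by simp

lemma norm_flow_step_near:
 assumes st: "0 <= s" "s <= t" "t <= T" and G: "norm G <= C" "norm G' <= C"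
 shows "norm (flow_step G G' (\<eta> t - \<eta> s) (e2 s t) v - v) <= KS * (t - s) powr \<alpha> * norm v"
proof -
 define x L where "x = t - s" "L = (1 + T) powr 3"
 have x: "0 <= x" "x <= T" using st by (auto simp: x_L_def)
 have L1: "1 <= L" using T_pos by (simp add: x_L_def ge_one_powr_ge_zero)
 have C0: "0 <= C" using C1 by simp
 have CC: "norm G' + norm G * norm G <= C + C * C" using G C0 by (intro add_mono mult_mono) auto
 have "norm (flow_step G G' (\<eta> t - \<eta> s) (e2 s t) v - v) <= norm (lin_app G v) * norm (\<eta> t - \<eta> s) + norm (second_order G G' v) * norm (e2 s t)"
  unfolding flow_step_def using norm_germ by simp
 also have "... <= (C * norm v) * (C * x powr \<alpha>) + ((C + C * C) * norm v) * (C * x powr (2 * \<alpha>))"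
 proof (intro add_mono mult_mono)
  show "norm (lin_app G v) <= C * norm v"
   by (rule order_trans[OF norm_lin_app]) (use G in "auto intro: mult_right_mono")
  show "norm (second_order G G' v) <= (C + C * C) * norm v"
   by (rule order_trans[OF norm_second_order]) (use CC in "auto intro: mult_right_mono")
  show "norm (\<eta> t - \<eta> s) <= C * x powr \<alpha>" "norm (e2 s t) <= C * x powr (2 * \<alpha>)"
   using eta[OF st] e2[OF st] by (auto simp: x_L_def)
 qed (use C0 in auto)
 also have "... <= (C * norm v) * (C * (L * x powr \<alpha>)) + ((C + C * C) * norm v) * (C * (L * x powr \<alpha>))"
 proof (intro add_mono mult_left_mono)
  show "x powr (2 * \<alpha>) <= L * x powr \<alpha>" unfolding x_L_def(2) using x ex by (intro powr_le_powr_lower) auto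
  show "x powr \<alpha> <= L * x powr \<alpha>" using L1 by (simp add: mult_le_cancel_right1)
 qed (use C0 in auto)
 also have "... = (2 * C ^ 2 + C ^ 3) * L * (x powr \<alpha> * norm v)" by (simp add: algebra_simps eval_nat_numeral)
 also have "... <= KS * (x powr \<alpha> * norm v)"
 proof (rule mult_right_mono)
  have "C ^ 2 <= C ^ 6" "C ^ 3 <= C ^ 6" using C1 by (auto intro: power_increasing)
  moreover have "0 <= C ^ 6" using C0 by simp
  ultimately have "2 * C ^ 2 + C ^ 3 <= 21 * C ^ 6" by linarith
  moreover have "L <= L ^ 2" using L1 by (simp add: power2_eq_square mult_le_cancel_left1)
  ultimately have "(2 * C ^ 2 + C ^ 3) * L <= (21 * C ^ 6) * L ^ 2"
   using L1 C0 by (intro mult_mono) auto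
  then show "(2 * C ^ 2 + C ^ 3) * L <= KS" by (simp add: KS_def x_L_def)
 qed simp
 finally show ?thesis by (simp add: x_L_def mult.assoc)
qed

lemma norm_flow_step_mult:
 assumes sut: "0 <= s" "s <= u" "u <= t" "t <= T"
  and G: "norm G <= C" "norm H <= C" "norm G' <= C" "norm H' <= C" "norm (H - G) <= C * (u - s) powr \<beta>"
   "norm (H' - G') <= C * (u - s) powr \<beta>'" "norm (H - G - lin_app G' (\<eta> u - \<eta> s)) <= C * (u - s) powr (\<beta> + \<beta>')"
 shows "norm (flow_step H H' (\<eta> t - \<eta> u) (e2 u t) (flow_step G G' (\<eta> u - \<eta> s) (e2 s u) v) - flow_step G G' (\<eta> t - \<eta> s) (e2 s t) v)
  <= KS * (t - s) powr (\<alpha> + \<beta> + \<beta>') * norm v"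
proof -
 define x where "x = t - s"
 have x: "0 <= x" "x <= T" using sut by (auto simp: x_def)
 have C0: "0 <= C" "0 <= norm v" using C1 by simp_all
 have mono: "C * (u - s) powr e <= C * x powr e" "C * (t - u) powr e <= C * x powr e" if "0 < e" for e
  using sut that C0 by (auto simp: x_def intro!: mult_left_mono powr_mono2)
 have a: "norm (\<eta> u - \<eta> s) <= C * x powr \<alpha>" "norm (\<eta> t - \<eta> u) <= C * x powr \<alpha>"
   "norm (e2 s u) <= C * x powr (2 * \<alpha>)" "norm (e2 u t) <= C * x powr (2 * \<alpha>)"
  using eta[of s u] eta[of u t] e2[of s u] e2[of u t] sut ex mono[of \<alpha>] mono[of "2 * \<alpha>"] by auto
 have GG: "norm (H - G) <= C * x powr \<beta>" "norm (H' - G') <= C * x powr \<beta>'" "norm (H - G - lin_app G' (\<eta> u - \<eta> s)) <= C * x powr (\<beta> + \<beta>')"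
  using G mono[of \<beta>] mono[of \<beta>'] mono[of "\<beta> + \<beta>'"] ex by auto
 have id: "flow_step H H' (\<eta> t - \<eta> u) (e2 u t) (flow_step G G' (\<eta> u - \<eta> s) (e2 s u) v) - flow_step G G' (\<eta> t - \<eta> s) (e2 s t) v =
   lin_app (lin_app (H - G - lin_app G' (\<eta> u - \<eta> s)) v) (\<eta> t - \<eta> u) +
   step_error G G' (lin_app G v) (apply_deriv G' v) H H' (lin_app H v) (apply_deriv H' v) (\<eta> u - \<eta> s) (\<eta> t - \<eta> u) (e2 s u) (e2 u t)"
 proof -
  have "\<eta> u - \<eta> s + (\<eta> t - \<eta> u) = \<eta> t - \<eta> s" by simp
  then show ?thesis using flow_step_identity[OF chen[OF sut], of H H' G G' v] by simp
 qed
 have 1: "norm (step_error G G' (lin_app G v) (apply_deriv G' v) H H' (lin_app H v) (apply_deriv H' v) (\<eta> u - \<eta> s) (\<eta> t - \<eta> u) (e2 s u) (e2 u t))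
  <= (20 * C ^ 6 * ((1 + T) powr 3) ^ 2) * norm v * x powr (\<alpha> + \<beta> + \<beta>')"
 proof (rule norm_step_error_le)
  have *: "norm (lin_app H v - lin_app G v) <= norm (H - G) * norm v" "norm (apply_deriv H' v - apply_deriv G' v) <= norm (H' - G') * norm v"
   using norm_lin_app[of "H - G" v] norm_apply_deriv[of "H' - G'" v] by (auto simp: lin_app.diff_left apply_deriv_linear)
  show "norm (lin_app H v - lin_app G v) <= C * norm v * x powr \<beta>" "norm (apply_deriv H' v - apply_deriv G' v) <= C * norm v * x powr \<beta>'"
   using * mult_right_mono[OF GG(1) C0(2)] mult_right_mono[OF GG(2) C0(2)] by (auto simp: mult_ac intro: order_trans)
  show "norm (lin_app G v) <= C * norm v" "norm (lin_app H v) <= C * norm v" "norm (apply_deriv G' v) <= C * norm v"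
   using norm_lin_app[of G v] norm_lin_app[of H v] norm_apply_deriv[of G' v] mult_right_mono[OF G(1) C0(2)] mult_right_mono[OF G(2) C0(2)] mult_right_mono[OF G(3) C0(2)]
   by linarith+
 qed (use ex C1 C0 x G GG a in auto)
 have 2: "norm (lin_app (lin_app (H - G - lin_app G' (\<eta> u - \<eta> s)) v) (\<eta> t - \<eta> u)) <= C\<^sup>2 * norm v * x powr (\<alpha> + \<beta> + \<beta>')"
 proof -
  have "norm (lin_app (lin_app (H - G - lin_app G' (\<eta> u - \<eta> s)) v) (\<eta> t - \<eta> u)) <= (norm (H - G - lin_app G' (\<eta> u - \<eta> s)) * norm v) * norm (\<eta> t - \<eta> u)"
   by (intro order_trans[OF norm_lin_app] mult_right_mono norm_lin_app) auto
  also have "... <= ((C * x powr (\<beta> + \<beta>')) * norm v) * (C * x powr \<alpha>)"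
   using GG a C0 by (intro mult_mono) auto
  also have "... = C\<^sup>2 * norm v * (x powr (\<beta> + \<beta>') * x powr \<alpha>)" by (simp add: power2_eq_square)
  also have "x powr (\<beta> + \<beta>') * x powr \<alpha> = x powr (\<alpha> + \<beta> + \<beta>')" by (simp add: powr_add[symmetric] add_ac)
  finally show ?thesis .
 qed
 have "C\<^sup>2 <= C ^ 6 * ((1 + T) powr 3) ^ 2"
 proof -
  have "C ^ 2 <= C ^ 6" using C1 by (intro power_increasing) auto
  moreover have "1 <= ((1 + T) powr 3) ^ 2" using T_pos by (intro one_le_power) (simp add: ge_one_powr_ge_zero)
  ultimately show ?thesis using C0 mult_mono[of "C ^ 2" "C ^ 6" 1 "((1 + T) powr 3) ^ 2"] by simp
 qed
 then have "C\<^sup>2 * (norm v * x powr (\<alpha> + \<beta> + \<beta>')) <= C ^ 6 * ((1 + T) powr 3) ^ 2 * (norm v * x powr (\<alpha> + \<beta> + \<beta>'))"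
  by (intro mult_right_mono) auto
 then show ?thesis unfolding id
  using norm_triangle_le[OF add_mono[OF 2 1]] by (simp add: KS_def x_def algebra_simps)
qed

lemma almost_flow_flow_matrix:
 assumes G: "!!s. 0 <= s ==> s <= T ==> norm (G s) <= C" "!!s. 0 <= s ==> s <= T ==> norm (G' s) <= C"
  "!!s t. 0 <= s ==> s <= t ==> t <= T ==> norm (G t - G s) <= C * (t - s) powr \<beta>"
  "!!s t. 0 <= s ==> s <= t ==> t <= T ==> norm (G' t - G' s) <= C * (t - s) powr \<beta>'"
  "!!s t. 0 <= s ==> s <= t ==> t <= T ==> norm (G t - G s - lin_app (G' s) (\<eta> t - \<eta> s)) <= C * (t - s) powr (\<beta> + \<beta>')"
 shows "almost_flow T KS \<alpha> (\<alpha> + \<beta> + \<beta>') (%s t. flow_matrix (G s) (G' s) (\<eta> t - \<eta> s) (e2 s t))"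
 unfolding almost_flow_def
proof (intro conjI allI impI)
 fix s assume "0 <= s & s <= T"
 then show "flow_matrix (G s) (G' s) (\<eta> s - \<eta> s) (e2 s s) = mat 1" by (simp add: e2_diag flow_matrix_0)
next
 fix s t assume "0 <= s & s <= t & t <= T"
 then have st: "0 <= s" "s <= t" "t <= T" "s <= T" by auto
 show "opn (flow_matrix (G s) (G' s) (\<eta> t - \<eta> s) (e2 s t) - mat 1) <= KS * (t - s) powr \<alpha>"
  using norm_flow_step_near[OF st(1-3) G(1,2)[OF st(1,4)]] KS_pos
  by (intro opn_leI) (auto simp: matrix_vector_mult_diff_rdistrib flow_matrix_apply)
next
 fix s u t assume "0 <= s & s <= u & u <= t & t <= T"
 then have sut: "0 <= s" "s <= u" "u <= t" "t <= T" "s <= T" "u <= T" "0 <= u" by auto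
 show "opn (flow_matrix (G u) (G' u) (\<eta> t - \<eta> u) (e2 u t) ** flow_matrix (G s) (G' s) (\<eta> u - \<eta> s) (e2 s u) -
   flow_matrix (G s) (G' s) (\<eta> t - \<eta> s) (e2 s t)) <= KS * (t - s) powr (\<alpha> + \<beta> + \<beta>')"
  using norm_flow_step_mult[OF sut(1-4) G(1)[OF sut(1,5)] G(1)[OF sut(7,6)] G(2)[OF sut(1,5)] G(2)[OF sut(7,6)] G(3)[OF sut(1,2,6)] G(4)[OF sut(1,2,6)] G(5)[OF sut(1,2,6)]] KS_pos
  by (intro opn_leI) (auto simp: matrix_vector_mult_diff_rdistrib flow_matrix_apply matrix_vector_mul_assoc[symmetric])
qed

lemma eta_continuous: "continuous_on {0..T} \<eta>"
 unfolding continuous_on_sequentially comp_def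
proof (intro ballI allI impI, elim conjE)
 fix r t assume t: "t \<in> {0..T}" and r: "\<forall>n. r n \<in> {0..T}" "r \<longlonglongrightarrow> t"
 have "norm (\<eta> (r n) - \<eta> t) <= C * \<bar>r n - t\<bar> powr \<alpha>" for n
  using eta[of t "r n"] eta[of "r n" t] t r(1)[rule_format, of n]
  by (cases "t <= r n") (auto simp: norm_minus_commute abs_minus_commute)
 moreover have "(%n. C * \<bar>r n - t\<bar> powr \<alpha>) \<longlonglongrightarrow> 0"
 proof (rule tendsto_mult_right_zero)
  have "(%n. \<bar>r n - t\<bar>) \<longlonglongrightarrow> 0" using r(2) by (simp add: LIM_zero tendsto_rabs_zero)
  then show "(%n. \<bar>r n - t\<bar> powr \<alpha>) \<longlonglongrightarrow> 0"
   using tendsto_powr'[of "%n. \<bar>r n - t\<bar>" 0 sequentially "%_. \<alpha>" \<alpha>] ex by auto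
 qed
 ultimately have "(%n. \<eta> (r n) - \<eta> t) \<longlonglongrightarrow> 0"
  by (intro Lim_null_comparison[of "%n. \<eta> (r n) - \<eta> t"] always_eventually) auto
 then show "(%n. \<eta> (r n)) \<longlonglongrightarrow> \<eta> t" by (simp add: LIM_zero_cancel)
qed

text \<open>The increments of \<open>F\<close> and \<open>F'\<close> are bounded almost surely at each pair of times, so all moments are
 finite and Kolmogorov's theorem applies with a power \<open>N > 1 / \<beta>'\<close>. On the null event where the
 bounds fail, zero coefficients are used, so that the flow estimates hold for every \<open>w\<close>.\<close>

lemma exists_regular_version:
 obtains G :: "real => 'a => real ^ 'n ^ 'd ^ 'n" and G' :: "real => 'a => real ^ 'n ^ 'd ^ 'n ^ 'd" where
  "!!t. 0 <= t ==> t <= T ==> G t \<in> borel_measurable (Fil t)" "!!t. 0 <= t ==> t <= T ==> G' t \<in> borel_measurable (Fil t)"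
  "!!t. 0 <= t ==> t <= T ==> AE w in M. G t w = F t w & G' t w = F' t w"
  "!!w. almost_flow T KS \<alpha> (\<alpha> + \<beta> + \<beta>') (%s t. flow_matrix (G s w) (G' s w) (\<eta> t - \<eta> s) (e2 s t))"
proof -
 obtain N :: nat where N: "1 / \<beta>' < real N" using reals_Archimedean2 by blast
 have N0: "0 < N"
 proof (rule ccontr)
  assume "\<not> 0 < N"
  then have "1 / \<beta>' < 0" using N by simp
  then show False using ex by simp
 qed
 define p where "p = 2 * N"
 have p: "even p" "2 <= p" using N0 by (auto simp: p_def)
 have "1 < real N * \<beta>'" using N ex by (simp add: field_simps)
 moreover have "real N * \<beta>' <= real p * \<beta>'" "real N * \<beta>' <= real p * \<beta>"
  using ex by (auto simp: p_def intro!: mult_mono)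
 ultimately have p\<beta>: "1 < real p * \<beta>" "1 < real p * \<beta>'" by linarith+
 have C0: "0 <= C" using C1 by simp
 have mM: "F t \<in> borel_measurable M" "F' t \<in> borel_measurable M" if "0 <= t" "t <= T" for t
  using Fil_meas_M[OF F_meas(1)[OF that] that] Fil_meas_M[OF F_meas(2)[OF that] that] .
 obtain H where H: "!!w. continuous_on {0..T} (%t. H t w)"
  "!!t. 0 <= t ==> t <= T ==> H t \<in> borel_measurable (Fil t)" "!!t. 0 <= t ==> t <= T ==> AE w in M. H t w = F t w"
  by (rule continuous_modification[OF p p\<beta>(1) C0 F_meas(1) mom_le_bounded[OF _ _ F_incr(1)]])
   (use C0 mM in auto)
 obtain H' where H': "!!w. continuous_on {0..T} (%t. H' t w)"
  "!!t. 0 <= t ==> t <= T ==> H' t \<in> borel_measurable (Fil t)" "!!t. 0 <= t ==> t <= T ==> AE w in M. H' t w = F' t w"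
  by (rule continuous_modification[OF p p\<beta>(2) C0 F_meas(2) mom_le_bounded[OF _ _ F_incr(2)]])
   (use C0 mM in auto)
 have seq: "(%l. h (r l)) \<longlonglongrightarrow> h s" if "continuous_on {0..T} h" "r \<longlonglongrightarrow> s" "!!l. 0 <= r l & r l <= T" "0 <= s" "s <= T"
  for h :: "real => 'b::topological_space" and r s
  using that unfolding continuous_on_sequentially comp_def by auto
 have pw: "(%l. C * (r' l - r l) powr e) \<longlonglongrightarrow> C * (t - s) powr e" if "r \<longlonglongrightarrow> s" "r' \<longlonglongrightarrow> t" "!!l. 0 <= r l & r l <= r' l & r' l <= T" "0 < e" for r r' s t e
  using that by (intro tendsto_mult tendsto_const tendsto_powr' tendsto_diff) auto
 have "AE w in M. \<forall>s t. 0 <= s --> s <= t --> t <= T --> norm (H s w) - C <= 0"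
 proof (rule AE_all_times[where g' = H])
  fix s t assume "0 <= s" "s <= t" "t <= T"
  then have s: "0 <= s" "s <= T" by auto
  show "AE w in M. norm (H s w) - C <= 0" using H(3)[OF s] F_bound(1)[OF s] by eventually_elim simp
 next
  fix w s t and r r' :: "nat => real"
  assume *: "0 <= s" "s <= t" "t <= T" "r \<longlonglongrightarrow> s" "r' \<longlonglongrightarrow> t" "!!l. 0 <= r l & r l <= r' l & r' l <= T"
  show "(%l. norm (H (r l) w) - C) \<longlonglongrightarrow> norm (H s w) - C"
   using *(1-5) *(6) by (intro tendsto_intros seq[OF H(1)]) (auto intro: order_trans)
 qed (rule H(1))
 moreover have "AE w in M. \<forall>s t. 0 <= s --> s <= t --> t <= T --> norm (H' s w) - C <= 0"
 proof (rule AE_all_times[where g' = H])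
  fix s t assume "0 <= s" "s <= t" "t <= T"
  then have s: "0 <= s" "s <= T" by auto
  show "AE w in M. norm (H' s w) - C <= 0" using H'(3)[OF s] F_bound(2)[OF s] by eventually_elim simp
 next
  fix w s t and r r' :: "nat => real"
  assume *: "0 <= s" "s <= t" "t <= T" "r \<longlonglongrightarrow> s" "r' \<longlonglongrightarrow> t" "!!l. 0 <= r l & r l <= r' l & r' l <= T"
  show "(%l. norm (H' (r l) w) - C) \<longlonglongrightarrow> norm (H' s w) - C"
   using *(1-5) *(6) by (intro tendsto_intros seq[OF H'(1)]) (auto intro: order_trans)
 qed (rule H(1))
 moreover have "AE w in M. \<forall>s t. 0 <= s --> s <= t --> t <= T --> norm (H t w - H s w) - C * (t - s) powr \<beta> <= 0"
 proof (rule AE_all_times[where g' = H])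
  fix s t assume st: "0 <= s" "s <= t" "t <= T"
  then have s: "0 <= s" "s <= T" "0 <= t" by auto
  show "AE w in M. norm (H t w - H s w) - C * (t - s) powr \<beta> <= 0"
   using H(3)[OF s(1,2)] H(3)[OF s(3) st(3)] F_incr(1)[OF st] by eventually_elim simp
 next
  fix w s t and r r' :: "nat => real"
  assume *: "0 <= s" "s <= t" "t <= T" "r \<longlonglongrightarrow> s" "r' \<longlonglongrightarrow> t" "!!l. 0 <= r l & r l <= r' l & r' l <= T"
  show "(%l. norm (H (r' l) w - H (r l) w) - C * (r' l - r l) powr \<beta>) \<longlonglongrightarrow> norm (H t w - H s w) - C * (t - s) powr \<beta>"
   using *(1-5) *(6) ex by (intro tendsto_diff tendsto_norm pw seq[OF H(1)]) (auto intro: order_trans)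
 qed (rule H(1))
 moreover have "AE w in M. \<forall>s t. 0 <= s --> s <= t --> t <= T --> norm (H' t w - H' s w) - C * (t - s) powr \<beta>' <= 0"
 proof (rule AE_all_times[where g' = H])
  fix s t assume st: "0 <= s" "s <= t" "t <= T"
  then have s: "0 <= s" "s <= T" "0 <= t" by auto
  show "AE w in M. norm (H' t w - H' s w) - C * (t - s) powr \<beta>' <= 0"
   using H'(3)[OF s(1,2)] H'(3)[OF s(3) st(3)] F_incr(2)[OF st] by eventually_elim simp
 next
  fix w s t and r r' :: "nat => real"
  assume *: "0 <= s" "s <= t" "t <= T" "r \<longlonglongrightarrow> s" "r' \<longlonglongrightarrow> t" "!!l. 0 <= r l & r l <= r' l & r' l <= T"
  show "(%l. norm (H' (r' l) w - H' (r l) w) - C * (r' l - r l) powr \<beta>') \<longlonglongrightarrow> norm (H' t w - H' s w) - C * (t - s) powr \<beta>'"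
   using *(1-5) *(6) ex by (intro tendsto_diff tendsto_norm pw seq[OF H'(1)]) (auto intro: order_trans)
 qed (rule H(1))
 moreover have "AE w in M. \<forall>s t. 0 <= s --> s <= t --> t <= T -->
   norm (H t w - H s w - lin_app (H' s w) (\<eta> t - \<eta> s)) - C * (t - s) powr (\<beta> + \<beta>') <= 0"
 proof (rule AE_all_times[where g' = H])
  fix s t assume st: "0 <= s" "s <= t" "t <= T"
  then have s: "0 <= s" "s <= T" "0 <= t" by auto
  show "AE w in M. norm (H t w - H s w - lin_app (H' s w) (\<eta> t - \<eta> s)) - C * (t - s) powr (\<beta> + \<beta>') <= 0"
   using H(3)[OF s(1,2)] H(3)[OF s(3) st(3)] H'(3)[OF s(1,2)] F_rem[OF st] by eventually_elim simp
 next
  fix w s t and r r' :: "nat => real"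
  assume *: "0 <= s" "s <= t" "t <= T" "r \<longlonglongrightarrow> s" "r' \<longlonglongrightarrow> t" "!!l. 0 <= r l & r l <= r' l & r' l <= T"
  show "(%l. norm (H (r' l) w - H (r l) w - lin_app (H' (r l) w) (\<eta> (r' l) - \<eta> (r l))) - C * (r' l - r l) powr (\<beta> + \<beta>'))
    \<longlonglongrightarrow> norm (H t w - H s w - lin_app (H' s w) (\<eta> t - \<eta> s)) - C * (t - s) powr (\<beta> + \<beta>')"
   using *(1-5) *(6) ex by (intro tendsto_diff tendsto_norm pw lin_app.tendsto seq[OF H(1)] seq[OF H'(1)] seq[OF eta_continuous]) (auto intro: order_trans)
 qed (rule H(1))
 ultimately have "AE w in M. \<forall>s t. 0 <= s --> s <= t --> t <= T -->
   norm (H s w) <= C & norm (H' s w) <= C & norm (H t w - H s w) <= C * (t - s) powr \<beta> & norm (H' t w - H' s w) <= C * (t - s) powr \<beta>' &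
   norm (H t w - H s w - lin_app (H' s w) (\<eta> t - \<eta> s)) <= C * (t - s) powr (\<beta> + \<beta>')"
  by eventually_elim force
 then obtain N where N: "{w \<in> space M. \<not> (\<forall>s t. 0 <= s --> s <= t --> t <= T -->
   norm (H s w) <= C & norm (H' s w) <= C & norm (H t w - H s w) <= C * (t - s) powr \<beta> & norm (H' t w - H' s w) <= C * (t - s) powr \<beta>' &
   norm (H t w - H s w - lin_app (H' s w) (\<eta> t - \<eta> s)) <= C * (t - s) powr (\<beta> + \<beta>'))} \<subseteq> N" "emeasure M N = 0" "N \<in> sets M"
  by (rule AE_E)
 define A where "A = space M - N"
 define G where "G t w = (if w \<in> A then H t w else 0)" for t w
 define G' where "G' t w = (if w \<in> A then H' t w else 0)" for t w
 have AA: "AE w in M. w \<in> A" using AE_not_in[of N M] N AE_space by (auto simp: A_def null_sets_def)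
 have A: "A \<in> sets (Fil t)" if "0 <= t" "t <= T" for t
 proof -
  have sp: "space (Fil t) = space M" using Fil_subalgebra[OF that] by (simp add: subalgebra_def)
  show ?thesis unfolding A_def sp[symmetric] using Fil_null[OF that] N by (auto simp: null_sets_def)
 qed
 show ?thesis
 proof (rule that)
  fix t assume t: "0 <= t" "t <= T"
  show "G t \<in> borel_measurable (Fil t)" "G' t \<in> borel_measurable (Fil t)"
   unfolding G_def[abs_def] G'_def[abs_def] using A[OF t] H(2)[OF t] H'(2)[OF t]
   by (auto intro!: measurable_If_set)
  show "AE w in M. G t w = F t w & G' t w = F' t w"
   using AA H(3)[OF t] H'(3)[OF t] by eventually_elim (simp add: G_def G'_def)
 next
  fix w
  have good: "norm (G s w) <= C & norm (G' s w) <= C & norm (G t w - G s w) <= C * (t - s) powr \<beta> & norm (G' t w - G' s w) <= C * (t - s) powr \<beta>' &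
   norm (G t w - G s w - lin_app (G' s w) (\<eta> t - \<eta> s)) <= C * (t - s) powr (\<beta> + \<beta>')" if "0 <= s" "s <= t" "t <= T" for s t
  proof (cases "w \<in> A")
   case True then show ?thesis using N(1) that by (auto simp: A_def G_def G'_def)
  next
   case False then show ?thesis using C0 by (simp add: G_def G'_def lin_app.zero_left)
  qed
  show "almost_flow T KS \<alpha> (\<alpha> + \<beta> + \<beta>') (%s t. flow_matrix (G s w) (G' s w) (\<eta> t - \<eta> s) (e2 s t))"
   by (rule almost_flow_flow_matrix) (use good order_refl in blast)+
 qed
qed

text \<open>The fundamental solution of the linear equation and its inverse, with bounds that hold for
 every \<open>w\<close>; only the local expansion refers to \<open>F\<close> itself and holds almost surely at given times.\<close>

theorem exists_fundamental_solution:
 assumes b: "1 <= b" "b < \<alpha> + \<beta> + \<beta>'"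
 obtains A B :: "real => 'a => real ^ 'n ^ 'n" and K where
  "0 < K" "!!w. A 0 w = mat 1"
  "!!t. 0 <= t ==> t <= T ==> A t \<in> borel_measurable (Fil t)" "!!t. 0 <= t ==> t <= T ==> B t \<in> borel_measurable (Fil t)"
  "!!t w. 0 <= t ==> t <= T ==> B t w ** A t w = mat 1" "!!t w. 0 <= t ==> t <= T ==> A t w ** B t w = mat 1"
  "!!t w. 0 <= t ==> t <= T ==> opn (A t w) <= K" "!!t w. 0 <= t ==> t <= T ==> opn (B t w) <= K"
  "!!s t w. 0 <= s ==> s <= t ==> t <= T ==> opn (A t w - A s w) <= K * (t - s) powr \<alpha>"
  "!!s t w. 0 <= s ==> s <= t ==> t <= T ==> opn (B t w - B s w) <= K * (t - s) powr \<alpha>"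
  "!!s t. 0 <= s ==> s <= t ==> t <= T ==> AE w in M.
    opn (A t w ** B s w - flow_matrix (F s w) (F' s w) (\<eta> t - \<eta> s) (e2 s t)) <= K * (t - s) powr b"
proof -
 obtain G G' where G: "!!t. 0 <= t ==> t <= T ==> G t \<in> borel_measurable (Fil t)" "!!t. 0 <= t ==> t <= T ==> G' t \<in> borel_measurable (Fil t)"
  "!!t. 0 <= t ==> t <= T ==> AE w in M. G t w = F t w & G' t w = F' t w"
  "!!w. almost_flow T KS \<alpha> (\<alpha> + \<beta> + \<beta>') (%s t. flow_matrix (G s w) (G' s w) (\<eta> t - \<eta> s) (e2 s t))"
  by (rule exists_regular_version) auto
 define \<mu> where "\<mu> w s t = flow_matrix (G s w) (G' s w) (\<eta> t - \<eta> s) (e2 s t)" for w s t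
 have flow: "almost_flow T KS \<alpha> (\<alpha> + \<beta> + \<beta>') (\<mu> w)" for w unfolding \<mu>_def by (rule G(4))
 interpret almost_flows T KS \<alpha> "\<alpha> + \<beta> + \<beta>'" b
  using T_pos KS_pos ex b by unfold_locales auto
 obtain K0 \<kappa> where K0: "0 < K0" "0 < \<kappa>" and sew0: "\<forall>m :: real => real => real ^ 'n ^ 'n. almost_flow T KS \<alpha> (\<alpha> + \<beta> + \<beta>') m -->
  (\<forall>s t. 0 <= s --> s <= t --> t <= T -->
   (%n. tree_prod m s t n 0 T) \<longlonglongrightarrow> mult_sewing T m s t &
   mult_sewing T m s s = mat 1 &
   opn (mult_sewing T m s t) <= K0 &
   opn (mult_sewing T m s t - m s t) <= K0 * (t - s) powr b &
   (\<forall>u. s <= u --> u <= t --> mult_sewing T m s t = mult_sewing T m u t ** mult_sewing T m s u) &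
   (\<forall>v. \<kappa> * norm v <= norm (mult_sewing T m s t *v v)))"
  using multiplicative_sewing[where 'n = 'n] by (elim exE conjE)
 have sew: "      (%n. tree_prod (\<mu> w) s t n 0 T) \<longlonglongrightarrow> mult_sewing T (\<mu> w) s t &
   mult_sewing T (\<mu> w) s s = mat 1 &
   opn (mult_sewing T (\<mu> w) s t) <= K0 &
   opn (mult_sewing T (\<mu> w) s t - \<mu> w s t) <= K0 * (t - s) powr b &
   (\<forall>u. s <= u --> u <= t --> mult_sewing T (\<mu> w) s t = mult_sewing T (\<mu> w) u t ** mult_sewing T (\<mu> w) s u) &
   (\<forall>v. \<kappa> * norm v <= norm (mult_sewing T (\<mu> w) s t *v v))" if "0 <= s" "s <= t" "t <= T" for w s t
  by (rule sew0[THEN spec, THEN mp, OF flow, THEN spec, THEN spec, THEN mp, THEN mp, THEN mp, OF that])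
 define U where "U w s t = mult_sewing T (\<mu> w) s t" for w s t
 have U_id: "U w s s = mat 1" and U_le: "opn (U w s t) <= K0"
  and U_near: "opn (U w s t - \<mu> w s t) <= K0 * (t - s) powr b"
  if "0 <= s" "s <= t" "t <= T" for w s t
  using sew[OF that, of w] unfolding U_def by - (elim conjE, assumption)+
 have U_mult: "U w s t = U w u t ** U w s u" if "0 <= s" "s <= u" "u <= t" "t <= T" for w s u t
  unfolding U_def
  by (rule sew[THEN conjunct2, THEN conjunct2, THEN conjunct2, THEN conjunct2, THEN conjunct1, THEN spec, THEN mp, THEN mp])
   (use that in auto)
 have U_low: "\<kappa> * norm v <= norm (U w s t *v v)" if "0 <= s" "s <= t" "t <= T" for w s t v
  unfolding U_def
  by (rule sew[OF that, THEN conjunct2, THEN conjunct2, THEN conjunct2, THEN conjunct2, THEN conjunct2, THEN spec])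
 define A where "A t w = U w 0 t" for t w
 define B where "B t w = cramer_inv (A t w)" for t w
 have lower: "\<kappa> * norm v <= norm (A t w *v v)" if "0 <= t" "t <= T" for t w v
  unfolding A_def using that by (intro U_low) auto
 have AB: "A t w ** B t w = mat 1" "B t w ** A t w = mat 1" "opn (B t w) <= 1 / \<kappa>" if "0 <= t" "t <= T" for t w
  using cramer_inv[OF det_nonzero_if_bounded_below[OF K0(2) lower[OF that]]] opn_cramer_inv_le[OF K0(2) lower[OF that]]
  by (auto simp: B_def)
 have AU: "A t w = U w s t ** A s w" if "0 <= s" "s <= t" "t <= T" for s t w
  unfolding A_def using that by (intro U_mult) auto
 have UAB: "A t w ** B s w = U w s t" if "0 <= s" "s <= t" "t <= T" for s t w
  using AU[OF that, of w] AB(1)[of s w] that by (simp add: matrix_mul_assoc[symmetric])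
 have U1: "opn (U w s t - mat 1) <= (K0 * T powr (b - \<alpha>) + KS) * (t - s) powr \<alpha>" if "0 <= s" "s <= t" "t <= T" for s t w
 proof -
  have "opn (U w s t - mat 1) <= opn (U w s t - \<mu> w s t) + opn (\<mu> w s t - mat 1)"
   using opn_add[of "U w s t - \<mu> w s t" "\<mu> w s t - mat 1"] by simp
  also have "... <= K0 * (t - s) powr b + KS * (t - s) powr \<alpha>"
   by (intro add_mono U_near flow_near[OF flow] that)
  also have "(t - s) powr b = (t - s) powr (b - \<alpha>) * (t - s) powr \<alpha>" by (simp add: powr_add[symmetric])
  also have "K0 * ((t - s) powr (b - \<alpha>) * (t - s) powr \<alpha>) + KS * (t - s) powr \<alpha> <= K0 * (T powr (b - \<alpha>) * (t - s) powr \<alpha>) + KS * (t - s) powr \<alpha>"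
   using K0 b ex that by (intro add_right_mono mult_left_mono mult_right_mono powr_mono2) auto
  finally show ?thesis by (simp add: distrib_right)
 qed
 define K1 where "K1 = K0 * T powr (b - \<alpha>) + KS"
 have K1: "0 <= K1" using K0 KS_pos by (simp add: K1_def)
 have Adiff: "opn (A t w - A s w) <= (K1 * K0) * (t - s) powr \<alpha>" if "0 <= s" "s <= t" "t <= T" for s t w
 proof -
  have "A t w - A s w = (U w s t - mat 1) ** A s w" using AU[OF that, of w] by (simp add: mm_diff_right)
  then have "opn (A t w - A s w) <= opn (U w s t - mat 1) * opn (A s w)" by (simp add: opn_mult)
  also have "... <= (K1 * (t - s) powr \<alpha>) * K0"
   using U1[OF that, of w] U_le[of 0 s w] that K1 by (intro mult_mono) (auto simp: K1_def A_def)
  finally show ?thesis by (simp add: mult_ac)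
 qed
 have Bdiff: "opn (B t w - B s w) <= (1 / \<kappa> * (K1 * K0) * (1 / \<kappa>)) * (t - s) powr \<alpha>" if "0 <= s" "s <= t" "t <= T" for s t w
 proof -
  have "B t w ** (A s w - A t w) ** B s w = B t w ** (A s w ** B s w) - (B t w ** A t w) ** B s w"
   by (simp add: mm_diff_left mm_diff_right matrix_mul_assoc)
  also have "... = B t w - B s w" using AB that by simp
  finally have eq: "B t w - B s w = B t w ** (A s w - A t w) ** B s w" by simp
  have "opn (B t w - B s w) <= opn (B t w ** (A s w - A t w)) * opn (B s w)"
   unfolding eq by (rule opn_mult)
  also have "... <= opn (B t w) * opn (A s w - A t w) * opn (B s w)"
   by (intro mult_right_mono opn_mult) simp
  also have "... <= (1 / \<kappa>) * ((K1 * K0) * (t - s) powr \<alpha>) * (1 / \<kappa>)"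
   using AB(3)[of t w] AB(3)[of s w] Adiff[OF that, of w] opn_minus[of "A t w - A s w"] that K0 K1
   by (intro mult_mono) auto
  finally show ?thesis by (simp add: mult_ac)
 qed
 have mA: "A t \<in> borel_measurable (Fil t)" if t: "0 <= t" "t <= T" for t
 proof -
  have "(%w. tree_prod (\<mu> w) 0 t n x y) \<in> borel_measurable (Fil t)" for n x y
  proof (induction n arbitrary: x y)
   case 0
   have "0 <= clip 0 t x" "clip 0 t x <= t" using t by (auto simp: clip_def)
   then show ?case unfolding tree_prod.simps \<mu>_def using t
    by (intro meas_flow_matrix Fil_meas_mono[OF G(1), of _ t] Fil_meas_mono[OF G(2), of _ t]) auto
  next
   case (Suc n) then show ?case by (auto intro: meas_matrix_mult)
  qed
  then show ?thesis
   unfolding A_def[abs_def] U_def mult_sewing_def by (intro borel_measurable_lim_metric)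
 qed
 define K where "K = K0 + 1 / \<kappa> + K1 * K0 + 1 / \<kappa> * (K1 * K0) * (1 / \<kappa>)"
 have K: "0 < K" "K0 <= K" "1 / \<kappa> <= K" "K1 * K0 <= K" "1 / \<kappa> * (K1 * K0) * (1 / \<kappa>) <= K"
  using K0 K1 by (auto simp: K_def intro!: add_pos_nonneg add_increasing add_increasing2 mult_nonneg_nonneg divide_nonneg_nonneg)
 show ?thesis
 proof (rule that[of K A B])
  show "0 < K" by (rule K)
  show "A 0 w = mat 1" for w using U_id[of 0 0 w] T_pos by (simp add: A_def)
  fix t assume t: "0 <= t" "t <= T"
  show "A t \<in> borel_measurable (Fil t)" by (rule mA[OF t])
  then show "B t \<in> borel_measurable (Fil t)" unfolding B_def[abs_def] by (rule meas_cramer_inv)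
  show "B t w ** A t w = mat 1" "A t w ** B t w = mat 1" for w using AB[OF t] by auto
  show "opn (A t w) <= K" for w using U_le[of 0 t w] t K by (simp add: A_def)
  show "opn (B t w) <= K" for w using AB(3)[OF t, of w] K by linarith
 next
  fix s t assume st: "0 <= s" "s <= t" "t <= T"
  show "opn (A t w - A s w) <= K * (t - s) powr \<alpha>" for w
   using Adiff[OF st, of w] mult_right_mono[OF K(4), of "(t - s) powr \<alpha>"] by simp
  show "opn (B t w - B s w) <= K * (t - s) powr \<alpha>" for w
   using Bdiff[OF st, of w] mult_right_mono[OF K(5) powr_ge_zero[of "t - s" \<alpha>]] by linarith
  have "K0 * (t - s) powr b <= K * (t - s) powr b" using K by (intro mult_right_mono) auto
  then have *: "opn (A t w ** B s w - \<mu> w s t) <= K * (t - s) powr b" for w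
   unfolding UAB[OF st] using U_near[OF st, of w] by linarith
  have "0 <= s" "s <= T" using st by auto
  from G(3)[OF this]
  show "AE w in M. opn (A t w ** B s w - flow_matrix (F s w) (F' s w) (\<eta> t - \<eta> s) (e2 s t)) <= K * (t - s) powr b"
  proof eventually_elim
   case (elim w)
   then show ?case using *[of w] by (simp add: \<mu>_def)
  qed
 qed
qed

end

section \<open>The inhomogeneous equation\<close>

text \<open>The exponents leave room for sewing: \<open>bA\<close> and \<open>bS\<close> lie between one and \<open>\<alpha> + \<beta> + \<beta>'\<close>, and \<open>aS\<close>
 between one half and \<open>\<alpha> + \<beta>\<close>, each sewing losing a little.\<close>

locale rough_affine = rough_linear M Fil T \<alpha> \<beta> \<beta>' C \<eta> e2 F F'
 for M :: "'a measure" and Fil :: "real => 'a measure" and T \<alpha> \<beta> \<beta>' C :: real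
  and \<eta> :: "real => real ^ 'd" and e2 :: "real => real => real ^ 'd ^ 'd"
  and F :: "real => 'a => real ^ 'n ^ 'd ^ 'n" and F' :: "real => 'a => real ^ 'n ^ 'd ^ 'n ^ 'd" +
 fixes f :: "real => 'a => real ^ 'n ^ 'd" and f' :: "real => 'a => real ^ 'n ^ 'd ^ 'd"
  and A B :: "real => 'a => real ^ 'n ^ 'n" and K bA bS aS :: real
 assumes f_meas: "!!t. 0 <= t ==> t <= T ==> f t \<in> borel_measurable (Fil t)"
   "!!t. 0 <= t ==> t <= T ==> f' t \<in> borel_measurable (Fil t)"
  and f_bound: "!!t. 0 <= t ==> t <= T ==> AE w in M. norm (f t w) <= C"
   "!!t. 0 <= t ==> t <= T ==> AE w in M. norm (f' t w) <= C"
  and f_incr: "!!s t. 0 <= s ==> s <= t ==> t <= T ==> AE w in M. norm (f t w - f s w) <= C * (t - s) powr \<beta>"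
   "!!s t. 0 <= s ==> s <= t ==> t <= T ==> AE w in M. norm (f' t w - f' s w) <= C * (t - s) powr \<beta>'"
  and f_rem: "!!s t. 0 <= s ==> s <= t ==> t <= T ==> AE w in M.
   norm (CE s (%w. f t w - f s w - lin_app (f' s w) (\<eta> t - \<eta> s)) w) <= C * (t - s) powr (\<beta> + \<beta>')"
  and bA: "1 < bA" "bA < \<alpha> + \<beta> + \<beta>'" and bS: "1 < bS" "bS < bA"
  and aS: "1 / 2 < aS" "aS < \<alpha> + \<beta>" "bS <= \<alpha> + aS"
  and K0: "0 < K"
  and A_meas: "!!t. 0 <= t ==> t <= T ==> A t \<in> borel_measurable (Fil t)"
  and B_meas: "!!t. 0 <= t ==> t <= T ==> B t \<in> borel_measurable (Fil t)"
  and BA: "!!t w. 0 <= t ==> t <= T ==> B t w ** A t w = mat 1"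
  and AB: "!!t w. 0 <= t ==> t <= T ==> A t w ** B t w = mat 1"
  and A_bound: "!!t w. 0 <= t ==> t <= T ==> opn (A t w) <= K"
  and B_bound: "!!t w. 0 <= t ==> t <= T ==> opn (B t w) <= K"
  and A_incr: "!!s t w. 0 <= s ==> s <= t ==> t <= T ==> opn (A t w - A s w) <= K * (t - s) powr \<alpha>"
  and B_incr: "!!s t w. 0 <= s ==> s <= t ==> t <= T ==> opn (B t w - B s w) <= K * (t - s) powr \<alpha>"
  and A_step: "!!s t. 0 <= s ==> s <= t ==> t <= T ==> AE w in M.
    opn (A t w ** B s w - flow_matrix (F s w) (F' s w) (\<eta> t - \<eta> s) (e2 s t)) <= K * (t - s) powr bA"
begin

definition src where "src s t w = source_step (F s w) (f s w) (f' s w) (\<eta> t - \<eta> s) (e2 s t)"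

definition rem_f where "rem_f s t w = f t w - f s w - lin_app (f' s w) (\<eta> t - \<eta> s)"

definition LT where "LT = (1 + T) powr 3"

lemma LT1: "1 <= LT" using T_pos by (simp add: LT_def ge_one_powr_ge_zero)

lemma powr_LT: "0 <= s ==> s <= t ==> t <= T ==> e <= e' ==> e' <= e + 3 ==> (t - s) powr e' <= LT * (t - s) powr e"
 unfolding LT_def by (rule powr_le_powr_lower) auto

lemma C0: "0 <= C" "0 < C" using C1 by auto

lemma src_bound:
 assumes st: "0 <= s" "s <= t" "t <= T"
 shows "AE w in M. norm (src s t w) <= 3 * C ^ 3 * LT * (t - s) powr \<alpha>"
proof -
 have s: "0 <= s" "s <= T" using st by auto
 show ?thesis using F_bound(1)[OF s] f_bound[OF s]
 proof eventually_elim
  case (elim w)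
  have h: "norm (f' s w + left_mult (F s w) (f s w)) <= C + C * C"
   by (rule order_trans[OF norm_triangle_ineq add_mono[OF elim(3) order_trans[OF norm_left_mult]]])
    (use elim C0 in "auto intro!: mult_mono")
  have "norm (src s t w) <= norm (f s w) * norm (\<eta> t - \<eta> s) + norm (f' s w + left_mult (F s w) (f s w)) * norm (e2 s t)"
   unfolding src_def source_step_def by (rule norm_germ)
  also have "... <= C * (C * (t - s) powr \<alpha>) + (C + C * C) * (C * (t - s) powr (2 * \<alpha>))"
   using elim h eta[OF st] e2[OF st] C0 by (intro add_mono mult_mono) auto
  also have "... <= C * (C * (LT * (t - s) powr \<alpha>)) + (C + C * C) * (C * (LT * (t - s) powr \<alpha>))"
   using ex C0 LT1 st by (intro add_mono mult_left_mono powr_LT) auto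
  also have "... = (2 * C ^ 2 + C ^ 3) * (LT * (t - s) powr \<alpha>)" by (simp add: algebra_simps eval_nat_numeral)
  also have "... <= (3 * C ^ 3) * (LT * (t - s) powr \<alpha>)"
  proof (rule mult_right_mono)
   have "C ^ 2 <= C ^ 3" using C1 by (intro power_increasing) auto
   then show "2 * C ^ 2 + C ^ 3 <= 3 * C ^ 3" by simp
  qed (use LT1 in auto)
  finally show ?case by (simp add: mult_ac)
 qed
qed

lemma src_meas: "0 <= s ==> s <= T ==> src s t \<in> borel_measurable (Fil s)"
proof -
 assume s: "0 <= s" "s <= T"
 have 1: "(%w. left_mult (F s w) (f s w)) \<in> borel_measurable (Fil s)"
  by (rule borel_measurable_continuous_Pair[OF F_meas(1)[OF s] f_meas(1)[OF s]])
   (auto simp: left_mult_def intro!: continuous_intros lin_app.continuous_on)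
 have "(%w. f' s w + left_mult (F s w) (f s w)) \<in> borel_measurable (Fil s)"
  using 1 f_meas(2)[OF s] by simp
 then have "(%w. bilin_app (f' s w + left_mult (F s w) (f s w)) (e2 s t)) \<in> borel_measurable (Fil s)"
  by (rule borel_measurable_continuous_on[of "%x. bilin_app x (e2 s t)", rotated])
   (intro continuous_intros bilin_app.continuous_on)
 moreover have "(%w. lin_app (f s w) (\<eta> t - \<eta> s)) \<in> borel_measurable (Fil s)"
  by (rule borel_measurable_continuous_on[of "%x. lin_app x (\<eta> t - \<eta> s)", OF _ f_meas(1)[OF s]])
   (intro continuous_intros lin_app.continuous_on)
 ultimately show ?thesis
  unfolding src_def[abs_def] source_step_def germ_def by simp
qed

lemma rem_f_bound:
 assumes st: "0 <= s" "s <= t" "t <= T"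
 shows "AE w in M. norm (rem_f s t w) <= 2 * C\<^sup>2 * LT * (t - s) powr \<beta>"
proof -
 have s: "0 <= s" "s <= T" using st by auto
 show ?thesis using f_bound(2)[OF s] f_incr(1)[OF st]
 proof eventually_elim
  case (elim w)
  have "norm (rem_f s t w) <= norm (f t w - f s w) + norm (lin_app (f' s w) (\<eta> t - \<eta> s))"
   unfolding rem_f_def by (rule norm_triangle_ineq4)
  also have "norm (lin_app (f' s w) (\<eta> t - \<eta> s)) <= C * (C * (t - s) powr \<alpha>)"
   using elim eta[OF st] C0 by (intro order_trans[OF norm_lin_app] mult_mono) auto
  also have "norm (f t w - f s w) + C * (C * (t - s) powr \<alpha>) <= C * (LT * (t - s) powr \<beta>) + C * (C * (LT * (t - s) powr \<beta>))"
  proof (intro add_mono mult_left_mono)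
   have "norm (f t w - f s w) <= C * (t - s) powr \<beta>" by (rule elim)
   also have "... <= C * (LT * (t - s) powr \<beta>)" using LT1 C0 by (intro mult_left_mono) (auto simp: mult_le_cancel_right1)
   finally show "norm (f t w - f s w) <= C * (LT * (t - s) powr \<beta>)" .
   show "(t - s) powr \<alpha> <= LT * (t - s) powr \<beta>" using ex st by (intro powr_LT) auto
  qed (use C0 in auto)
  also have "... = (C + C\<^sup>2) * (LT * (t - s) powr \<beta>)" by (simp add: algebra_simps power2_eq_square)
  also have "... <= (2 * C\<^sup>2) * (LT * (t - s) powr \<beta>)"
  proof (rule mult_right_mono)
   have "C ^ 1 <= C ^ 2" using C1 by (intro power_increasing) auto
   then show "C + C\<^sup>2 <= 2 * C\<^sup>2" by simp
  qed (use LT1 in auto)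
  finally show ?case by (simp add: mult_ac)
 qed
qed

lemma rem_f_meas: "0 <= s ==> s <= t ==> t <= T ==> rem_f s t \<in> borel_measurable (Fil t)"
 unfolding rem_f_def[abs_def]
 by (intro borel_measurable_diff f_meas Fil_meas_mono[OF f_meas(1), of s t] Fil_meas_mono[of _ s _ t]
   borel_measurable_continuous_on[OF _ f_meas(2), of "%x. lin_app x (\<eta> t - \<eta> s)"])
  (auto intro!: continuous_intros lin_app.continuous_on)

text \<open>The germ \<open>B t *v src s t\<close> is the solution of the equation started from zero at time \<open>s\<close>, up to
 higher order and transported back to time zero. Transporting it back from \<open>t\<close> rather than from \<open>s\<close>
 makes its defect the step error of the equation itself.\<close>

definition Xi where "Xi s t w = (if s = t then 0 else B t w *v src s t w)"

definition KD where "KD = K * (2 * C\<^sup>2 * LT) * C * LT + K * (20 * C ^ 6 * LT\<^sup>2) * LT + K * K * (3 * C ^ 3 * LT) * (LT * (1 + T) powr 3)"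

lemma KD0: "0 <= KD" using K0 C0 LT1 by (simp add: KD_def)

text \<open>Transport by \<open>B t\<close> turns the error \<open>A t ** B u - flow_matrix\<close> and the step error into terms of order
 above one; what is left is the remainder of \<open>f\<close> applied to the noise.\<close>

lemma defect_Xi:
 assumes sut: "0 <= s" "s < u" "u < t" "t <= T"
 shows "AE w in M. norm (B t w *v src s t w - B u w *v src s u w - B t w *v src u t w
   + B s w *v lin_app (rem_f s u w) (\<eta> t - \<eta> u)) <= KD * (t - s) powr bA"
proof -
 have T: "0 <= s" "s <= T" "0 <= u" "u <= T" "0 <= t" "t <= T" "s <= u" "u <= t" "s <= t" using sut by auto
 define x where "x = t - s"
 have x: "0 <= x" "x <= T" using sut by (auto simp: x_def)
 have mono: "C * (u - s) powr e <= C * x powr e" "C * (t - u) powr e <= C * x powr e" if "0 < e" for e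
  using sut that C0 by (auto simp: x_def intro!: mult_left_mono powr_mono2)
 have a: "norm (\<eta> u - \<eta> s) <= C * x powr \<alpha>" "norm (\<eta> t - \<eta> u) <= C * x powr \<alpha>"
   "norm (e2 s u) <= C * x powr (2 * \<alpha>)" "norm (e2 u t) <= C * x powr (2 * \<alpha>)"
  using eta[of s u] eta[of u t] e2[of s u] e2[of u t] sut ex mono[of \<alpha>] mono[of "2 * \<alpha>"] by auto
 show ?thesis
  using F_bound(1)[OF T(1,2)] F_bound(1)[OF T(3,4)] F_bound(2)[OF T(3,4)] F_incr(1)[OF T(1,7,4)]
   f_bound[OF T(1,2)] f_bound(1)[OF T(3,4)] f_incr[OF T(1,7,4)] A_step[OF T(3,8,6)] src_bound[OF T(1,7,4)] rem_f_bound[OF T(1,7,4)]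
 proof eventually_elim
  case (elim w)
  define D where "D = A t w ** B u w - flow_matrix (F u w) (F' u w) (\<eta> t - \<eta> u) (e2 u t)"
  define S where "S = step_error (F s w) (F' s w) (f s w) (f' s w) (F u w) (F' u w) (f u w) (f' u w) (\<eta> u - \<eta> s) (\<eta> t - \<eta> u) (e2 s u) (e2 u t)"
  define r where "r = lin_app (rem_f s u w) (\<eta> t - \<eta> u)"
  have id: "flow_step (F u w) (F' u w) (\<eta> t - \<eta> u) (e2 u t) (src s u w) + src u t w - src s t w = r + S"
  proof -
   have "\<eta> u - \<eta> s + (\<eta> t - \<eta> u) = \<eta> t - \<eta> s" by simp
   then show ?thesis
    using step_identity[OF chen[OF T(1,7,8,6)], of "F u w" "F' u w" "F s w" "f s w" "f' s w" "f u w" "f' u w"]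
    unfolding S_def r_def rem_f_def src_def by simp
  qed
  have "B u w = B t w ** (A t w ** B u w)"
   using BA[OF T(5,6), of w] by (simp add: matrix_mul_assoc)
  then have "B u w *v src s u w = B t w *v ((D + flow_matrix (F u w) (F' u w) (\<eta> t - \<eta> u) (e2 u t)) *v src s u w)"
   by (simp add: D_def matrix_vector_mul_assoc)
  then have "B t w *v src s t w - B u w *v src s u w - B t w *v src u t w
   = B t w *v (src s t w - D *v src s u w - flow_step (F u w) (F' u w) (\<eta> t - \<eta> u) (e2 u t) (src s u w) - src u t w)"
   by (simp add: matrix_vector_mult_add_rdistrib flow_matrix_apply matrix_vector_mult_diff_distrib matrix_vector_right_distrib)
  also have "src s t w - D *v src s u w - flow_step (F u w) (F' u w) (\<eta> t - \<eta> u) (e2 u t) (src s u w) - src u t w = - (r + S + D *v src s u w)"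
   unfolding id[symmetric] by simp
  finally have main: "B t w *v src s t w - B u w *v src s u w - B t w *v src u t w = B t w *v (- (r + S + D *v src s u w))" .
  have eq: "B t w *v src s t w - B u w *v src s u w - B t w *v src u t w + B s w *v r
   = - ((B t w - B s w) *v r) - B t w *v S - B t w *v (D *v src s u w)"
  proof -
   have "X *v (- v) = - (X *v v)" for X :: "real ^ 'n ^ 'n" and v
    using matrix_vector_mult_diff_distrib[of X 0 v] by simp
   then show ?thesis
    unfolding main by (simp add: matrix_vector_mult_diff_rdistrib matrix_vector_mult_diff_distrib matrix_vector_right_distrib)
  qed
  have 1: "norm ((B t w - B s w) *v r) <= K * (2 * C\<^sup>2 * LT) * C * LT * x powr bA"
  proof -
   have "norm r <= (2 * C\<^sup>2 * LT * x powr \<beta>) * (C * x powr \<alpha>)"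
    unfolding r_def
   proof (intro order_trans[OF norm_lin_app] mult_mono a)
    have "2 * C\<^sup>2 * LT * (u - s) powr \<beta> <= 2 * C\<^sup>2 * LT * x powr \<beta>"
     using sut ex LT1 by (intro mult_left_mono powr_mono2) (auto simp: x_def)
    then show "norm (rem_f s u w) <= 2 * C\<^sup>2 * LT * x powr \<beta>" using elim by linarith
   qed (use LT1 in auto)
   then have "norm ((B t w - B s w) *v r) <= (K * x powr \<alpha>) * ((2 * C\<^sup>2 * LT * x powr \<beta>) * (C * x powr \<alpha>))"
    using B_incr[OF T(1,9,6), of w] K0 by (intro order_trans[OF opn_vec] mult_mono) (auto simp: x_def)
   also have "... = K * (2 * C\<^sup>2 * LT) * C * (x powr \<alpha> * x powr \<beta> * x powr \<alpha>)" by (simp add: mult_ac)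
   also have "x powr \<alpha> * x powr \<beta> * x powr \<alpha> = x powr (\<alpha> + \<beta> + \<alpha>)" by (simp only: powr_add)
   also have "K * (2 * C\<^sup>2 * LT) * C * x powr (\<alpha> + \<beta> + \<alpha>) <= K * (2 * C\<^sup>2 * LT) * C * (LT * x powr bA)"
    using T ex bA K0 C0 LT1 unfolding x_def by (intro mult_left_mono powr_LT) auto
   finally show ?thesis by (simp add: mult_ac)
  qed
  have 2: "norm (B t w *v S) <= K * (20 * C ^ 6 * LT\<^sup>2) * LT * x powr bA"
  proof -
   have "norm S <= 20 * C ^ 6 * LT\<^sup>2 * 1 * x powr (\<alpha> + \<beta> + \<beta>')"
    unfolding S_def LT_def
   proof (rule norm_step_error_le)
    show "norm (F u w - F s w) <= C * x powr \<beta>" "norm (f u w - f s w) <= C * 1 * x powr \<beta>" "norm (f' u w - f' s w) <= C * 1 * x powr \<beta>'"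
     using elim mono[of \<beta>] mono[of \<beta>'] ex by auto
   qed (use ex C1 x elim a in auto)
   then have "norm (B t w *v S) <= K * (20 * C ^ 6 * LT\<^sup>2 * x powr (\<alpha> + \<beta> + \<beta>'))"
    using B_bound[OF T(5,6), of w] K0 by (intro order_trans[OF opn_vec] mult_mono) auto
   also have "... <= K * (20 * C ^ 6 * LT\<^sup>2 * (LT * x powr bA))"
    using T ex bA K0 C0 LT1 unfolding x_def by (intro mult_left_mono powr_LT) auto
   finally show ?thesis by (simp add: mult_ac)
  qed
  have 3: "norm (B t w *v (D *v src s u w)) <= K * K * (3 * C ^ 3 * LT) * (LT * (1 + T) powr 3) * x powr bA"
  proof -
   have D: "opn D <= K * x powr bA"
   proof -
    have "opn D <= K * (t - u) powr bA" unfolding D_def using elim by blast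
    also have "... <= K * x powr bA" using K0 sut bA by (intro mult_left_mono powr_mono2) (auto simp: x_def)
    finally show ?thesis .
   qed
   have src: "norm (src s u w) <= 3 * C ^ 3 * LT * (LT * (1 + T) powr 3)"
   proof -
    have "(u - s) powr \<alpha> <= LT * (u - s) powr 0" using T ex by (intro powr_LT) auto
    also have "... <= LT * (1 + T) powr 3" using LT1 T_pos by (intro mult_left_mono) (auto simp: ge_one_powr_ge_zero powr_def)
    finally have "3 * C ^ 3 * LT * (u - s) powr \<alpha> <= 3 * C ^ 3 * LT * (LT * (1 + T) powr 3)"
     using C0 LT1 by (intro mult_left_mono) auto
    then show ?thesis using elim by linarith
   qed
   have "norm (D *v src s u w) <= (K * x powr bA) * (3 * C ^ 3 * LT * (LT * (1 + T) powr 3))"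
    using D src K0 by (intro order_trans[OF opn_vec] mult_mono) auto
   with D src have "norm (B t w *v (D *v src s u w)) <= K * ((K * x powr bA) * (3 * C ^ 3 * LT * (LT * (1 + T) powr 3)))"
    using B_bound[OF T(5,6), of w] K0 by (intro order_trans[OF opn_vec] mult_mono) auto
   then show ?thesis by (simp add: mult_ac)
  qed
  have "norm (- ((B t w - B s w) *v r) - B t w *v S - B t w *v (D *v src s u w))
   <= norm ((B t w - B s w) *v r) + norm (B t w *v S) + norm (B t w *v (D *v src s u w))"
   by (intro order_trans[OF norm_triangle_ineq4] add_mono) auto
  also have "... <= KD * x powr bA" using 1 2 3 unfolding KD_def distrib_right by linarith
  finally show ?case using eq by (simp add: r_def x_def)
 qed
qed

lemma Xi_meas: "0 <= s ==> s <= t ==> t <= T ==> Xi s t \<in> borel_measurable (Fil t)"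
proof -
 assume st: "0 <= s" "s <= t" "t <= T"
 have "(%w. B t w *v src s t w) \<in> borel_measurable (Fil t)"
  using st by (intro meas_matrix_vector_mult B_meas Fil_meas_mono[OF src_meas, of s _ t]) auto
 then show ?thesis by (cases "s = t") (simp_all add: Xi_def[abs_def])
qed

definition KE where "KE = KD * LT + K * C * (2 * C\<^sup>2 * LT) + real CARD('n) * KD + K * C * C * LT"

lemma KE0: "0 <= KE" using KD0 K0 C0 LT1 by (simp add: KE_def)

lemma defect_Xi_bounds:
 assumes sut: "0 <= s" "s < u" "u < t" "t <= T" and p: "even p" "0 < p"
 shows "mom_le M p (KE * (t - s) powr (\<alpha> + \<beta>)) (defect Xi s u t)"
  and "mom_le M p (KE * (t - s) powr bA) (CE s (defect Xi s u t))"
proof -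
 have T: "0 <= s" "s <= T" "0 <= u" "u <= T" "0 <= t" "t <= T" "s <= u" "u <= t" "s <= t" using sut by auto
 have G: "subalgebra M (Fil s)" using T by (intro Fil_subalgebra) auto
 define x where "x = t - s"
 have mono: "(u - s) powr e <= x powr e" "(t - u) powr e <= x powr e" if "0 <= e" for e
  using sut that by (auto simp: x_def intro!: powr_mono2)
 define l where "l w v = - (B s w *v lin_app v (\<eta> t - \<eta> u))" for w and v :: "real ^ 'n ^ 'd"
 have l0: "0 <= K * C * x powr \<alpha>" using K0 C0 by simp
 have lb: "norm (l w v) <= (K * C * x powr \<alpha>) * norm v" for w v
 proof -
  have "norm (\<eta> t - \<eta> u) <= C * x powr \<alpha>" using eta[OF T(3,8,6)] mult_left_mono[OF mono(2)[of \<alpha>] C0(1)] ex by linarith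
  then have "norm (B s w *v lin_app v (\<eta> t - \<eta> u)) <= K * (norm v * (C * x powr \<alpha>))"
   using B_bound[OF T(1,2), of w] K0
   by (intro order_trans[OF opn_vec] mult_mono order_trans[OF norm_lin_app]) auto
  then show ?thesis by (simp add: l_def mult_ac)
 qed
 have ml: "(%w. l w (X w)) \<in> borel_measurable N" if "B s \<in> borel_measurable N" "X \<in> borel_measurable N" for N X
 proof -
  have "(%w. lin_app (X w) (\<eta> t - \<eta> u)) \<in> borel_measurable N"
   by (rule borel_measurable_continuous_on[OF _ that(2), of "%x. lin_app x (\<eta> t - \<eta> u)"]) (intro continuous_intros lin_app.continuous_on)
  then show ?thesis unfolding l_def by (intro borel_measurable_uminus meas_matrix_vector_mult that)
 qed
 have mrem: "rem_f s u \<in> borel_measurable M" using T by (intro Fil_meas_M[OF rem_f_meas]) auto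
 have mB: "B s \<in> borel_measurable M" using T by (intro Fil_meas_M[OF B_meas]) auto
 have mdef: "defect Xi s u t \<in> borel_measurable M"
  unfolding defect_def[abs_def] using T
  by (intro borel_measurable_diff Fil_meas_M[OF Xi_meas[of _ t]] Fil_meas_M[OF Xi_meas[of _ u]]) auto
 \<comment> \<open>Up to higher order, the defect is a linear function of the remainder of \<open>f\<close>.\<close>
 define E where "E w = defect Xi s u t w - l w (rem_f s u w)" for w
 have E: "mom_le M p (KD * x powr bA) E"
 proof (rule mom_le_bounded)
  show "E \<in> borel_measurable M" unfolding E_def[abs_def] by (intro borel_measurable_diff mdef ml mB mrem)
  show "AE w in M. norm (E w) <= KD * x powr bA"
   using defect_Xi[OF sut] by eventually_elim (use sut in "simp add: E_def defect_def Xi_def l_def x_def")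
 qed (use KD0 in simp)
 have R: "mom_le M p (2 * C\<^sup>2 * LT * (u - s) powr \<beta>) (rem_f s u)"
  by (rule mom_le_bounded[OF mrem _ rem_f_bound[OF T(1,7,4)]]) (use C0 LT1 in simp)
 have L: "mom_le M p ((K * C * x powr \<alpha>) * (2 * C\<^sup>2 * LT * (u - s) powr \<beta>)) (%w. l w (rem_f s u w))"
  by (rule mom_le_AE_bound[OF R l0 ml[OF mB mrem]]) (simp add: lb)
 have eq: "defect Xi s u t = (%w. E w + l w (rem_f s u w))" by (simp add: E_def)
 have le: "x powr bA <= LT * x powr (\<alpha> + \<beta>)" "x powr (\<alpha> + \<beta> + \<beta>') <= LT * x powr bA"
  unfolding x_def using T ex bA by (intro powr_LT; linarith)+
 show "mom_le M p (KE * (t - s) powr (\<alpha> + \<beta>)) (defect Xi s u t)"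
  unfolding eq
 proof (rule mom_le_weaken[OF mom_le_add[OF E L p]])
  have "(K * C * x powr \<alpha>) * (2 * C\<^sup>2 * LT * (u - s) powr \<beta>) <= (K * C * x powr \<alpha>) * (2 * C\<^sup>2 * LT * x powr \<beta>)"
   using mono(1)[of \<beta>] ex l0 C0 LT1 by (intro mult_left_mono) auto
  also have "... = K * C * (2 * C\<^sup>2 * LT) * x powr (\<alpha> + \<beta>)" by (simp add: powr_add)
  finally have "KD * x powr bA + (K * C * x powr \<alpha>) * (2 * C\<^sup>2 * LT * (u - s) powr \<beta>) <=
    (KD * LT + K * C * (2 * C\<^sup>2 * LT)) * x powr (\<alpha> + \<beta>)"
   using mult_left_mono[OF le(1) KD0] by (simp add: algebra_simps)
  also have "... <= KE * x powr (\<alpha> + \<beta>)"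
   using KD0 K0 C0 LT1 by (intro mult_right_mono) (auto simp: KE_def)
  finally show "KD * x powr bA + (K * C * x powr \<alpha>) * (2 * C\<^sup>2 * LT * (u - s) powr \<beta>) <= KE * (t - s) powr (\<alpha> + \<beta>)" by (simp add: x_def)
 qed
 have cR: "mom_le M p (C * x powr (\<beta> + \<beta>')) (CE s (rem_f s u))"
 proof (rule mom_le_bounded)
  show "AE w in M. norm (CE s (rem_f s u) w) <= C * x powr (\<beta> + \<beta>')"
   using f_rem[OF T(1,7,4)]
  proof eventually_elim
   case (elim w)
   then show ?case using mult_left_mono[OF mono(1)[of "\<beta> + \<beta>'"] C0(1)] ex unfolding rem_f_def[abs_def] by linarith
  qed
 qed (use C0 measurable_from_subalg[OF G meas_cond_expectation] in auto)
 have cL: "mom_le M p ((K * C * x powr \<alpha>) * (C * x powr (\<beta> + \<beta>'))) (CE s (%w. l w (rem_f s u w)))"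
 proof (rule mom_le_cond_expectation_linear_map[OF G mom_le_integrable[OF R p(2)] _ _ l0 lb cR])
  show "linear (l w)" for w
   unfolding l_def by (rule linearI) (simp_all add: lin_app.add_left lin_app.scaleR_left matrix_vector_right_distrib linear_cmul[OF matrix_vector_mul_linear])
  show "(%w. l w e) \<in> borel_measurable (Fil s)" for e by (rule ml) (use B_meas T in auto)
 qed
 show "mom_le M p (KE * (t - s) powr bA) (CE s (defect Xi s u t))"
  unfolding eq
 proof (rule mom_le_weaken[OF mom_le_cond_expectation_add[OF G p mom_le_integrable[OF E p(2)] mom_le_integrable[OF L p(2)]
     mom_le_cond_expectation[OF G p E] cL]])
  have "(K * C * x powr \<alpha>) * (C * x powr (\<beta> + \<beta>')) = K * C * C * x powr (\<alpha> + \<beta> + \<beta>')" by (simp add: powr_add)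
  also have "... <= K * C * C * (LT * x powr bA)" by (rule mult_left_mono[OF le(2)]) (use K0 C0 in auto)
  finally have "real DIM(real ^ 'n) * (KD * x powr bA) + (K * C * x powr \<alpha>) * (C * x powr (\<beta> + \<beta>')) <= (real CARD('n) * KD + K * C * C * LT) * x powr bA"
   by (simp add: algebra_simps)
  also have "... <= KE * x powr bA" using KD0 K0 C0 LT1 by (intro mult_right_mono) (auto simp: KE_def)
  finally show "real DIM(real ^ 'n) * (KD * x powr bA) + (K * C * x powr \<alpha>) * (C * x powr (\<beta> + \<beta>')) <= KE * (t - s) powr bA" by (simp add: x_def)
 qed
qed

text \<open>One process has all moments, since the limit of the dyadic sums does not depend on \<open>p\<close>.\<close>

theorem exists_transported_solution:
 obtains I :: "real => 'a => real ^ 'n" where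
  "!!w. continuous_on {0..T} (%t. I t w)" "!!t. 0 <= t ==> t <= T ==> I t \<in> borel_measurable (Fil t)"
  "AE w in M. I 0 w = 0"
  "!!p. even p ==> 2 <= p ==> \<exists>k\<ge>0. \<forall>s t. 0 <= s --> s <= t --> t <= T -->
    mom_le M p (k * (t - s) powr \<alpha>) (%w. I t w - I s w) &
    mom_le M p (k * (t - s) powr aS) (%w. I t w - I s w - B t w *v src s t w) &
    mom_le M p (k * (t - s) powr bS) (CE s (%w. I t w - I s w - B t w *v src s t w))"
proof -
 define J where "J t = vector_sewing Xi 0 t" for t
 have ex': "1 / 2 <= aS" "aS < \<alpha> + \<beta>" "1 <= bS" "bS < bA" "\<alpha> + \<beta> <= bA" "aS <= bS" using aS bS bA ex by auto
 have Xi0: "Xi u u w = 0" for u w by (simp add: Xi_def)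
 note sewing = vector_stochastic_sewing[OF _ _ ex' KE0 Xi0 Xi_meas defect_Xi_bounds]
 have two: "even (2::nat)" "2 <= (2::nat)" by auto
 have J_meas: "J t \<in> borel_measurable (Fil t)" if "0 <= t" "t <= T" for t
  unfolding J_def by (rule sewing(2)[of 2]) (use that in auto)
 have JM: "J t \<in> borel_measurable M" if "0 <= t" "t <= T" for t using Fil_meas_M[OF J_meas[OF that] that] .
 have add: "AE w in M. vector_sewing Xi s t w = vector_sewing Xi s u w + vector_sewing Xi u t w"
  if "0 <= s" "s <= u" "u <= t" "t <= T" for s u t
  by (rule sewing(4)[of 2]) (use that in auto)
 have srcM: "(%w. B t w *v src s t w) \<in> borel_measurable M" if "0 <= s" "s <= t" "t <= T" for s t
  using that by (intro meas_matrix_vector_mult Fil_meas_M[OF B_meas] Fil_meas_M[OF src_meas]) auto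
 have src_diag: "src s s w = 0" if "0 <= s" "s <= T" for s w
  using e2_diag[OF that] by (simp add: src_def source_step_def germ_def lin_app.zero_right bilin_app.zero_right)
 have Xi_eq: "Xi s t = (%w. B t w *v src s t w)" if "0 <= s" "s <= t" "t <= T" for s t
  using src_diag[of s] that by (cases "s = t") (simp_all add: Xi_def fun_eq_iff)
 have incr: "AE w in M. J t w - J s w = vector_sewing Xi s t w" if "0 <= s" "s <= t" "t <= T" for s t
  using add[of 0 s t] that by (auto simp: J_def elim: eventually_mono)
 have bounds: "\<exists>k\<ge>0. \<forall>s t. 0 <= s --> s <= t --> t <= T -->
    mom_le M p (k * (t - s) powr \<alpha>) (%w. I t w - I s w) &
    mom_le M p (k * (t - s) powr aS) (%w. I t w - I s w - B t w *v src s t w) &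
    mom_le M p (k * (t - s) powr bS) (CE s (%w. I t w - I s w - B t w *v src s t w))"
  if p: "even p" "2 <= p" and IM: "!!t. 0 <= t ==> t <= T ==> I t \<in> borel_measurable M"
   and IJ: "!!t. 0 <= t ==> t <= T ==> AE w in M. I t w = J t w" for p I
 proof -
  have p0: "0 < p" using p by simp
  have sew3: "\<exists>k\<ge>0. \<forall>s t. 0 <= s --> s <= t --> t <= T -->
    mom_le M p (k * (t - s) powr aS) (%w. vector_sewing Xi s t w - Xi s t w) &
    mom_le M p (k * (t - s) powr bS) (CE s (%w. vector_sewing Xi s t w - Xi s t w))"
   by (rule sewing(3)) (use p p0 in auto)
  obtain k where k: "0 <= k" "!!s t. 0 <= s ==> s <= t ==> t <= T ==>
    mom_le M p (k * (t - s) powr aS) (%w. vector_sewing Xi s t w - Xi s t w) &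
    mom_le M p (k * (t - s) powr bS) (CE s (%w. vector_sewing Xi s t w - Xi s t w))"
   using sew3 by blast
  define k3 where "k3 = k * LT + K * (3 * C ^ 3 * LT) + k"
  have k3: "0 <= k3" "k <= k3" "k * LT + K * (3 * C ^ 3 * LT) <= k3" using k(1) LT1 K0 C0 by (auto simp: k3_def)
  show ?thesis
  proof (intro exI[of _ k3] conjI allI impI)
   show "0 <= k3" by (rule k3)
   fix s t assume st: "0 <= s" "s <= t" "t <= T"
   have s: "0 <= s" "s <= T" and t: "0 <= t" "t <= T" using st by auto
   have G: "subalgebra M (Fil s)" by (rule Fil_subalgebra[OF s])
   let ?R = "%w. I t w - I s w - B t w *v src s t w"
   note ks = k(2)[OF st, THEN conjunct1] and kc = k(2)[OF st, THEN conjunct2]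
   have RM: "?R \<in> borel_measurable M" by (intro borel_measurable_diff IM s t srcM st)
   have eq: "AE w in M. ?R w = vector_sewing Xi s t w - Xi s t w"
    using incr[OF st] IJ[OF s] IJ[OF t] by eventually_elim (simp add: Xi_eq[OF st])
   have 1: "mom_le M p (k * (t - s) powr aS) ?R" by (rule mom_le_cong_weaken[OF ks eq RM order_refl])
   show "mom_le M p (k3 * (t - s) powr aS) ?R" by (rule mom_le_weaken[OF 1 mult_right_mono[OF k3(2) powr_ge_zero]])
   show "mom_le M p (k3 * (t - s) powr bS) (CE s ?R)"
    by (rule mom_le_cong_weaken[OF kc cond_expectation_cong[OF G eq RM mom_le_measurable[OF ks]]
      measurable_from_subalg[OF G meas_cond_expectation] mult_right_mono[OF k3(2) powr_ge_zero]])
   have 3: "mom_le M p (K * (3 * C ^ 3 * LT * (t - s) powr \<alpha>)) (%w. B t w *v src s t w)"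
   proof (rule mom_le_bounded[OF srcM[OF st]])
    show "AE w in M. norm (B t w *v src s t w) <= K * (3 * C ^ 3 * LT * (t - s) powr \<alpha>)"
     using src_bound[OF st]
    proof eventually_elim
     case (elim w)
     then show ?case using B_bound[OF t, of w] K0 by (intro order_trans[OF opn_vec] mult_mono) auto
    qed
   qed (use K0 C0 LT1 in auto)
   have 4: "mom_le M p (k * (LT * (t - s) powr \<alpha>)) ?R"
    by (rule mom_le_weaken[OF 1 mult_left_mono[OF powr_LT[OF st] k(1)]]) (use aS ex in auto)
   have "mom_le M p (k * (LT * (t - s) powr \<alpha>) + K * (3 * C ^ 3 * LT * (t - s) powr \<alpha>)) (%w. ?R w + B t w *v src s t w)"
    by (rule mom_le_add[OF 4 3 p(1) p0])
   then have "mom_le M p ((k * LT + K * (3 * C ^ 3 * LT)) * (t - s) powr \<alpha>) (%w. I t w - I s w)"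
    by (simp add: algebra_simps)
   then show "mom_le M p (k3 * (t - s) powr \<alpha>) (%w. I t w - I s w)"
    by (rule mom_le_weaken[OF _ mult_right_mono[OF k3(3) powr_ge_zero]])
  qed
 qed
 have four: "even (4::nat)" "2 <= (4::nat)" by auto
 obtain k4 where k4: "0 <= k4" "!!s t. 0 <= s ==> s <= t ==> t <= T ==> mom_le M 4 (k4 * (t - s) powr \<alpha>) (%w. J t w - J s w)"
  using bounds[of 4 J, OF four JM AE_I2[OF refl]] by blast
 obtain I where I: "!!w. continuous_on {0..T} (%t. I t w)" "!!t. 0 <= t ==> t <= T ==> I t \<in> borel_measurable (Fil t)"
  "!!t. 0 <= t ==> t <= T ==> AE w in M. I t w = J t w"
  by (rule continuous_modification[OF four _ k4(1) J_meas k4(2)]) (use ex in auto)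
 have IM: "I t \<in> borel_measurable M" if "0 <= t" "t <= T" for t using Fil_meas_M[OF I(2)[OF that] that] .
 show ?thesis
 proof (rule that[OF I(1,2) _ bounds[of _ I, OF _ _ IM I(3)]])
  have z: "0 <= (0::real)" "0 <= T" using T_pos by auto
  show "AE w in M. I 0 w = 0"
   using incr[OF z(1) z] add[OF z(1,1) z] I(3)[OF z] by eventually_elim (simp add: J_def)
 qed
qed

end

section \<open>The solution and its local expansion\<close>

locale rough_solution = rough_affine M Fil T \<alpha> \<beta> \<beta>' C \<eta> e2 F F' f f' A B K bA bS aS
 for M :: "'a measure" and Fil :: "real => 'a measure" and T \<alpha> \<beta> \<beta>' C :: real
  and \<eta> :: "real => real ^ 'd" and e2 :: "real => real => real ^ 'd ^ 'd"
  and F :: "real => 'a => real ^ 'n ^ 'd ^ 'n" and F' :: "real => 'a => real ^ 'n ^ 'd ^ 'n ^ 'd"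
  and f :: "real => 'a => real ^ 'n ^ 'd" and f' :: "real => 'a => real ^ 'n ^ 'd ^ 'd"
  and A B :: "real => 'a => real ^ 'n ^ 'n" and K bA bS aS :: real +
 fixes I :: "real => 'a => real ^ 'n"
 assumes A_0: "!!w. A 0 w = mat 1"
  and I_meas: "!!t. 0 <= t ==> t <= T ==> I t \<in> borel_measurable (Fil t)"
  and I_0: "AE w in M. I 0 w = 0"
  and I_bounds: "!!p. even p ==> 2 <= p ==> \<exists>k\<ge>0. \<forall>s t. 0 <= s --> s <= t --> t <= T -->
    mom_le M p (k * (t - s) powr \<alpha>) (%w. I t w - I s w) &
    mom_le M p (k * (t - s) powr aS) (%w. I t w - I s w - B t w *v src s t w) &
    mom_le M p (k * (t - s) powr bS) (CE s (%w. I t w - I s w - B t w *v src s t w))"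
begin

definition phi where "phi x t w = A t w *v x + A t w *v I t w"

definition local_error where
 "local_error \<psi> s t w = \<psi> t w - flow_step (F s w) (F' s w) (\<eta> t - \<eta> s) (e2 s t) (\<psi> s w) - src s t w"

definition step_gap where
 "step_gap s t w = A t w ** B s w - flow_matrix (F s w) (F' s w) (\<eta> t - \<eta> s) (e2 s t)"

definition I_err where "I_err s t w = I t w - I s w - B t w *v src s t w"

lemma M_meas:
 assumes "0 <= t" "t <= T"
 shows "I t \<in> borel_measurable M" "A t \<in> borel_measurable M" "B t \<in> borel_measurable M" "src t u \<in> borel_measurable M"
  "F t \<in> borel_measurable M" "F' t \<in> borel_measurable M"
 using assms Fil_meas_M[OF I_meas] Fil_meas_M[OF A_meas] Fil_meas_M[OF B_meas] Fil_meas_M[OF src_meas]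
  Fil_meas_M[OF F_meas(1)] Fil_meas_M[OF F_meas(2)] by auto

lemma phi_meas: "0 <= t ==> t <= T ==> phi x t \<in> borel_measurable (Fil t)"
 unfolding phi_def[abs_def]
 by (intro borel_measurable_add meas_matrix_vector_mult A_meas I_meas) auto

lemma flow_step_meas:
 assumes "F s \<in> borel_measurable G" "F' s \<in> borel_measurable G" "X \<in> borel_measurable G"
 shows "(%w. flow_step (F s w) (F' s w) a E (X w)) \<in> borel_measurable G"
 unfolding flow_matrix_apply[symmetric]
 by (intro meas_matrix_vector_mult meas_flow_matrix assms)

lemma step_gap_meas: "0 <= s ==> s <= t ==> t <= T ==> step_gap s t \<in> borel_measurable M"
 unfolding step_gap_def[abs_def]
 by (intro borel_measurable_diff meas_matrix_mult meas_flow_matrix M_meas) auto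

text \<open>The error of the flow acts on the state at time \<open>s\<close>, the error of \<open>I\<close> is carried by \<open>A t\<close>. The latter is
 split as \<open>A s + (A t - A s)\<close>, since only \<open>A s\<close> can be taken out of a conditional expectation at \<open>s\<close>.\<close>

lemma local_error_phi:
 assumes st: "0 <= s" "s <= t" "t <= T"
 shows "local_error (phi x) s t w = step_gap s t w *v phi x s w + (A s w *v I_err s t w + (A t w - A s w) *v I_err s t w)"
proof -
 have s: "0 <= s" "s <= T" "0 <= t" using st by auto
 have 1: "A t w *v (B t w *v src s t w) = src s t w"
  using AB[OF s(3) st(3), of w] by (simp add: matrix_vector_mul_assoc)
 have 2: "(A t w ** B s w) *v phi x s w = A t w *v x + A t w *v I s w"
 proof -
  have "B s w *v phi x s w = x + I s w"
   using BA[OF s(1,2), of w] by (simp add: phi_def matrix_vector_right_distrib matrix_vector_mul_assoc)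
  then show ?thesis by (simp add: matrix_vector_mul_assoc[symmetric] matrix_vector_right_distrib)
 qed
 have 3: "A s w *v I_err s t w + (A t w - A s w) *v I_err s t w = A t w *v I t w - A t w *v I s w - src s t w"
  by (simp add: I_err_def matrix_vector_mult_diff_rdistrib matrix_vector_mult_diff_distrib 1)
 show ?thesis
  unfolding 3 by (simp add: local_error_def step_gap_def matrix_vector_mult_diff_rdistrib 2 flow_matrix_apply) (simp add: phi_def)
qed

lemma local_error_meas: "0 <= s ==> s <= t ==> t <= T ==> \<psi> t \<in> borel_measurable M ==> \<psi> s \<in> borel_measurable M ==>
  local_error \<psi> s t \<in> borel_measurable M"
 unfolding local_error_def[abs_def]
 by (intro borel_measurable_diff flow_step_meas M_meas) auto

lemma mom_le_powr_LT:
 assumes X: "mom_le M p (k * (t - s) powr e') X" and st: "0 <= s" "s <= t" "t <= T" and e: "e <= e'" "e' <= e + 3" and k: "0 <= k"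
 shows "mom_le M p (k * LT * (t - s) powr e) X"
 by (rule mom_le_weaken[OF X]) (use mult_left_mono[OF powr_LT[OF st e] k] in "simp add: mult.assoc")

lemma mom_le_matrix_vector:
 fixes X :: "'a => real ^ 'n"
 assumes X: "mom_le M p k X" and Q: "Q \<in> borel_measurable M" "AE w in M. opn (Q w) <= c" and c: "0 <= c"
 shows "mom_le M p (c * k) (%w. Q w *v X w)"
proof (rule mom_le_AE_bound[OF X c])
 show "(%w. Q w *v X w) \<in> borel_measurable M"
  by (intro meas_matrix_vector_mult Q mom_le_measurable[OF X])
 show "AE w in M. norm (Q w *v X w) <= c * norm (X w)"
  using Q(2) by eventually_elim (intro order_trans[OF opn_vec] mult_right_mono; simp)
qed

lemma step_gap_bound: "0 <= s ==> s <= t ==> t <= T ==> AE w in M. opn (step_gap s t w) <= K * (t - s) powr bA"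
 unfolding step_gap_def by (rule A_step)

lemma phi_moments:
 assumes p: "even p" "2 <= p"
 shows "\<exists>k\<ge>0. \<forall>t. 0 <= t --> t <= T --> mom_le M p k (phi x t)"
proof -
 have p0: "0 < p" using p by simp
 obtain k where k: "0 <= k" "!!s t. 0 <= s ==> s <= t ==> t <= T ==> mom_le M p (k * (t - s) powr \<alpha>) (%w. I t w - I s w)"
  using I_bounds[OF p] by blast
 show ?thesis
 proof (intro exI[of _ "K * norm x + K * (k * T powr \<alpha>)"] conjI allI impI)
  show "0 <= K * norm x + K * (k * T powr \<alpha>)" using K0 k by auto
  fix t assume t: "0 <= t" "t <= T"
  have "mom_le M p (k * t powr \<alpha>) (I t)"
  proof (rule mom_le_cong[OF _ M_meas(1)[OF t]])
   show "mom_le M p (k * t powr \<alpha>) (%w. I t w - I 0 w)" using k(2)[of 0 t] t by simp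
   show "AE w in M. I t w - I 0 w = I t w" using I_0 by eventually_elim simp
  qed
  moreover have "k * t powr \<alpha> <= k * T powr \<alpha>" using t k ex by (intro mult_left_mono powr_mono2) auto
  ultimately have "mom_le M p (k * T powr \<alpha>) (I t)" by (rule mom_le_weaken)
  then have 1: "mom_le M p (K * (k * T powr \<alpha>)) (%w. A t w *v I t w)"
   using A_bound[OF t] K0 t by (intro mom_le_matrix_vector M_meas) auto
  have 2: "mom_le M p (K * norm x) (%w. A t w *v x)"
   using A_bound[OF t] K0 t by (intro mom_le_matrix_vector M_meas mom_le_bounded) auto
  show "mom_le M p (K * norm x + K * (k * T powr \<alpha>)) (phi x t)"
   unfolding phi_def[abs_def] by (rule mom_le_add[OF 2 1 p(1) p0])
 qed
qed

lemma local_error_phi_bounds: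
 assumes p: "even p" "2 <= p"
 shows "\<exists>k\<ge>0. \<forall>s t. 0 <= s --> s <= t --> t <= T -->
  mom_le M p (k * (t - s) powr aS) (local_error (phi x) s t) &
  mom_le M p (k * (t - s) powr bS) (CE s (local_error (phi x) s t))"
proof -
 have p0: "0 < p" using p by simp
 obtain k1 where k1: "0 <= k1" "!!t. 0 <= t ==> t <= T ==> mom_le M p k1 (phi x t)"
  using phi_moments[OF p] by blast
 obtain k2 where k2: "0 <= k2" and k2m: "!!s t. 0 <= s ==> s <= t ==> t <= T ==>
    mom_le M p (k2 * (t - s) powr aS) (I_err s t) &
    mom_le M p (k2 * (t - s) powr bS) (CE s (I_err s t))"
  unfolding I_err_def[abs_def] using I_bounds[OF p] by blast
 define n where "n = real DIM(real ^ 'n)"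
 have n0: "0 <= n" by (simp add: n_def)
 define k3 where "k3 = K * k1 * LT + (K * k2 + 2 * K * k2 * LT)"
 define k4 where "k4 = n * (K * k1 * LT) + (K * (n * k2) + n * (K * k2 * LT))"
 have k34: "0 <= k3" "0 <= k4" using K0 k1 k2 LT1 n0 by (auto simp: k3_def k4_def)
 show ?thesis
 proof (intro exI[of _ "k3 + k4"] conjI allI impI)
  show "0 <= k3 + k4" using k34 by simp
  fix s t assume st: "0 <= s" "s <= t" "t <= T"
  have s: "0 <= s" "s <= T" and t: "0 <= t" "t <= T" using st by auto
  have G: "subalgebra M (Fil s)" using s by (rule Fil_subalgebra)
  let ?x = "t - s"
  let ?T1 = "%w. step_gap s t w *v phi x s w" and ?T2 = "%w. A s w *v I_err s t w"
   and ?T3 = "%w. (A t w - A s w) *v I_err s t w"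
  note Im = k2m[OF st, THEN conjunct1]
  have t1: "mom_le M p ((K * ?x powr bA) * k1) ?T1"
   using K0 by (intro mom_le_matrix_vector[OF k1(2)[OF s] step_gap_meas[OF st] step_gap_bound[OF st]]) auto
  then have t1': "mom_le M p ((K * k1) * ?x powr bA) ?T1" by (simp add: mult_ac)
  have t1a: "mom_le M p (K * k1 * LT * ?x powr aS) ?T1" "mom_le M p (K * k1 * LT * ?x powr bS) ?T1"
   using K0 k1 st aS bA bS ex by (auto intro!: mom_le_powr_LT[OF t1' st])
  have t2: "mom_le M p (K * (k2 * ?x powr aS)) ?T2"
   using A_bound[OF s] K0 by (intro mom_le_matrix_vector[OF Im] M_meas s) auto
  have t3: "mom_le M p ((K * ?x powr \<alpha>) * (k2 * ?x powr aS)) ?T3"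
   using A_incr[OF st] K0 by (intro mom_le_matrix_vector[OF Im] borel_measurable_diff M_meas s t) auto
  then have t3': "mom_le M p ((K * k2) * ?x powr (\<alpha> + aS)) ?T3" by (simp add: powr_add mult_ac)
  have t3a: "mom_le M p (K * k2 * LT * ?x powr aS) ?T3" "mom_le M p (K * k2 * LT * ?x powr bS) ?T3"
   using K0 k2 st aS bA bS ex by (auto intro!: mom_le_powr_LT[OF t3' st])
  have eq: "local_error (phi x) s t = (%w. ?T1 w + (?T2 w + ?T3 w))"
   using local_error_phi[OF st] by blast
  have le: "k3 * ?x powr e <= (k3 + k4) * ?x powr e" "k4 * ?x powr e <= (k3 + k4) * ?x powr e" for e
   using k34 by (auto intro!: mult_right_mono)
  have "mom_le M p (K * k1 * LT * ?x powr aS + (K * (k2 * ?x powr aS) + K * k2 * LT * ?x powr aS)) (local_error (phi x) s t)"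
   unfolding eq by (intro mom_le_add t1a t2 t3a p p0)
  moreover have "K * k1 * LT * ?x powr aS + (K * (k2 * ?x powr aS) + K * k2 * LT * ?x powr aS) <= k3 * ?x powr aS"
   using K0 k2 LT1 by (simp add: k3_def algebra_simps)
  ultimately show "mom_le M p ((k3 + k4) * ?x powr aS) (local_error (phi x) s t)"
   using le(1)[of aS] by (auto intro: mom_le_weaken)
  note i1 = mom_le_integrable[OF t1 p0] and i2 = mom_le_integrable[OF t2 p0] and i3 = mom_le_integrable[OF t3 p0]
  have ceI: "mom_le M p (n * (k2 * ?x powr bS)) (CE s (I_err s t))"
  proof (rule mom_le_weaken[OF k2m[OF st, THEN conjunct2]])
   have "1 <= n" by (simp add: n_def Suc_le_eq)
   from mult_right_mono[OF this, of "k2 * ?x powr bS"] k2 show "k2 * ?x powr bS <= n * (k2 * ?x powr bS)" by simp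
  qed
  have c2: "mom_le M p (K * (n * (k2 * ?x powr bS))) (CE s ?T2)"
  proof (rule mom_le_cond_expectation_linear_map[OF G mom_le_integrable[OF Im p0] _ _ _ _ ceI])
   show "(%w. A s w *v e) \<in> borel_measurable (Fil s)" for e
    by (intro meas_matrix_vector_mult A_meas s) auto
   show "norm (A s w *v v) <= K * norm v" for v w
    using A_bound[OF s, of w] by (intro order_trans[OF opn_vec] mult_right_mono) auto
  qed (use K0 in auto)
  have "mom_le M p (n * (K * k1 * LT * ?x powr bS) + (K * (n * (k2 * ?x powr bS)) + n * (K * k2 * LT * ?x powr bS)))
    (CE s (local_error (phi x) s t))"
   unfolding eq n_def
   by (intro mom_le_cond_expectation_add[OF G p(1) p0] i1 i2 i3 Bochner_Integration.integrable_add c2[unfolded n_def]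
     mom_le_cond_expectation[OF G p(1) p0] t1a t3a)
  then have "mom_le M p (k4 * ?x powr bS) (CE s (local_error (phi x) s t))"
   by (simp add: k4_def algebra_simps)
  then show "mom_le M p ((k3 + k4) * ?x powr bS) (CE s (local_error (phi x) s t))"
   by (rule mom_le_weaken[OF _ le(2)])
 qed
qed

text \<open>Two processes with small local errors differ by a process whose back-transport has increments
 that are too small for it to move.\<close>

theorem uniqueness:
 assumes meas: "!!t. 0 <= t ==> t <= T ==> \<psi> t \<in> borel_measurable (Fil t)"
  and init: "AE w in M. \<psi> 0 w = x"
  and k: "0 <= k" and mom: "!!t. 0 <= t ==> t <= T ==> mom_le M 2 k (\<psi> t)"
  and ab: "1 / 2 < a" "1 < \<alpha> + a" "a <= 2" "1 < b" "b <= 2"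
  and err: "!!s t. 0 <= s ==> s <= t ==> t <= T ==> mom_le M 2 (k * (t - s) powr a) (local_error \<psi> s t)"
  and cerr: "!!s t. 0 <= s ==> s <= t ==> t <= T ==> mom_le M 2 (k * (t - s) powr b) (CE s (local_error \<psi> s t))"
  and t: "0 <= t" "t <= T"
 shows "AE w in M. \<psi> t w = phi x t w"
proof -
 have two: "even (2::nat)" "2 <= (2::nat)" "0 < (2::nat)" by auto
 obtain k1 where k1: "0 <= k1" "!!t. 0 <= t ==> t <= T ==> mom_le M 2 k1 (phi x t)"
  using phi_moments[OF two(1,2)] by blast
 obtain k2 where k2: "0 <= k2" "!!s t. 0 <= s ==> s <= t ==> t <= T ==> mom_le M 2 (k2 * (t - s) powr aS) (local_error (phi x) s t)"
  "!!s t. 0 <= s ==> s <= t ==> t <= T ==> mom_le M 2 (k2 * (t - s) powr bS) (CE s (local_error (phi x) s t))"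
  using local_error_phi_bounds[OF two(1,2)] by blast
 define n where "n = real DIM(real ^ 'n)"
 have n0: "0 <= n" by (simp add: n_def)
 define a2 where "a2 = min a aS"
 define b2 where "b2 = min (min b bS) (\<alpha> + a2)"
 have a2: "1 / 2 < a2" "a2 <= a" "a2 <= aS" "1 < \<alpha> + a2" using ab aS bS by (auto simp: a2_def)
 have b2: "1 < b2" "b2 <= b" "b2 <= bS" "b2 <= \<alpha> + a2" using ab bS a2 by (auto simp: b2_def)
 define chi where "chi t w = \<psi> t w - phi x t w" for t w
 define Dl where "Dl s t w = local_error \<psi> s t w + - local_error (phi x) s t w" for s t w
 define Y where "Y t w = B t w *v chi t w" for t w
 define k3 where "k3 = k * LT + k2 * LT"
 define k4 where "k4 = k + k1"
 define k5 where "k5 = (K * k3 + K * (K * k4) * LT) + (K * k3 + n * (K * k3 * LT) + n * (K * K * k4 * LT))"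
 have k345: "0 <= k3" "0 <= k4" "0 <= k5" using k k1 k2 LT1 K0 n0 by (auto simp: k3_def k4_def k5_def)
 have psiM: "\<psi> t \<in> borel_measurable M" if "0 <= t" "t <= T" for t using Fil_meas_M[OF meas[OF that] that] .
 have phiM: "phi x t \<in> borel_measurable M" if "0 <= t" "t <= T" for t using Fil_meas_M[OF phi_meas[OF that] that] .
 have chi_mom: "mom_le M 2 k4 (chi t)" if "0 <= t" "t <= T" for t
  unfolding chi_def[abs_def] k4_def by (rule mom_le_diff[OF mom[OF that] k1(2)[OF that] two(1,3)])
 have Y_eq: "Y t w - Y s w = B s w *v Dl s t w + ((B t w - B s w) *v Dl s t w + B t w *v (- step_gap s t w *v chi s w))"
  if st: "0 <= s" "s <= t" "t <= T" for s t w
 proof -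
  have s: "0 <= s" "s <= T" "0 <= t" using st by auto
  have lin: "flow_step G G' c E (v - w) = flow_step G G' c E v - flow_step G G' c E w" for G :: "real ^ 'n ^ 'd ^ 'n" and G' c E v w
   by (rule linear_diff[OF linear_flow_step])
  have "chi t w = flow_step (F s w) (F' s w) (\<eta> t - \<eta> s) (e2 s t) (chi s w) + Dl s t w"
   unfolding chi_def lin by (simp add: Dl_def local_error_def)
  also have "flow_step (F s w) (F' s w) (\<eta> t - \<eta> s) (e2 s t) (chi s w) = (A t w ** B s w) *v chi s w + (- step_gap s t w) *v chi s w"
   unfolding matrix_vector_mult_add_rdistrib[symmetric] by (simp add: step_gap_def flow_matrix_apply)
  finally have "B t w *v chi t w = B t w *v ((A t w ** B s w) *v chi s w) + B t w *v (- step_gap s t w *v chi s w) + B t w *v Dl s t w"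
   by (simp add: matrix_vector_right_distrib)
  also have "B t w *v ((A t w ** B s w) *v chi s w) = B s w *v chi s w"
   using BA[OF s(3) st(3), of w] by (simp add: matrix_vector_mul_assoc matrix_mul_assoc)
  finally show ?thesis by (simp add: Y_def matrix_vector_mult_diff_rdistrib)
 qed
 have Ymeas: "Y t \<in> borel_measurable (Fil t)" if "0 <= t" "t <= T" for t
  unfolding Y_def[abs_def] chi_def using that
  by (intro meas_matrix_vector_mult borel_measurable_diff meas phi_meas B_meas)
 have inc: "mom_le M 2 (k5 * (t - s) powr a2) (%w. Y t w - Y s w) &
  mom_le M 2 (k5 * (t - s) powr b2) (CE s (%w. Y t w - Y s w))"
  if st: "0 <= s" "s <= t" "t <= T" for s t
 proof -
  have s: "0 <= s" "s <= T" and t: "0 <= t" "t <= T" using st by auto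
  have G: "subalgebra M (Fil s)" using s by (rule Fil_subalgebra)
  let ?x = "t - s"
  have e1: "mom_le M 2 (k * LT * ?x powr a2) (local_error \<psi> s t)"
   by (rule mom_le_powr_LT[OF err[OF st] st]) (use a2 ab k in auto)
  have e2: "mom_le M 2 (k2 * LT * ?x powr a2) (%w. - local_error (phi x) s t w)"
   by (intro mom_le_uminus mom_le_powr_LT[OF k2(2)[OF st] st]) (use a2 aS ex k2 in auto)
  have Dm: "mom_le M 2 (k3 * ?x powr a2) (Dl s t)"
   using mom_le_add[OF e1 e2 two(1,3)] by (simp add: Dl_def[abs_def] k3_def distrib_right)
  have c1: "mom_le M 2 (k * LT * ?x powr b2) (CE s (local_error \<psi> s t))"
   by (rule mom_le_powr_LT[OF cerr[OF st] st]) (use b2 ab k in auto)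
  have c2: "mom_le M 2 (1 * (k2 * LT * ?x powr b2)) (CE s (%w. - local_error (phi x) s t w))"
  proof (rule mom_le_cond_expectation_linear_map[where L = "%_ v. - v"])
   show "mom_le M 2 (k2 * LT * ?x powr b2) (CE s (local_error (phi x) s t))"
    by (rule mom_le_powr_LT[OF k2(3)[OF st] st]) (use b2 bS bA ex k2 in auto)
   show "integrable M (local_error (phi x) s t)" by (rule mom_le_integrable[OF k2(2)[OF st] two(3)])
   show "linear (%v. - v :: real ^ 'n)" by (rule linearI) auto
  qed (use G in auto)
  have cD: "mom_le M 2 (k3 * ?x powr b2) (CE s (Dl s t))"
   using mom_le_cond_expectation_add[OF G two(1,3) mom_le_integrable[OF e1 two(3)] mom_le_integrable[OF e2 two(3)] c1 c2]
   by (simp add: Dl_def[abs_def] k3_def distrib_right)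
  let ?T1 = "%w. B s w *v Dl s t w" and ?T2 = "%w. (B t w - B s w) *v Dl s t w" and ?T3 = "%w. B t w *v (- step_gap s t w *v chi s w)"
  have t1: "mom_le M 2 (K * (k3 * ?x powr a2)) ?T1"
   using B_bound[OF s] K0 by (intro mom_le_matrix_vector[OF Dm] M_meas s) auto
  have "mom_le M 2 ((K * ?x powr \<alpha>) * (k3 * ?x powr a2)) ?T2"
   using B_incr[OF st] K0 by (intro mom_le_matrix_vector[OF Dm] borel_measurable_diff M_meas s t) auto
  then have t2: "mom_le M 2 ((K * k3) * ?x powr (\<alpha> + a2)) ?T2" by (simp add: powr_add mult_ac)
  have ns: "AE w in M. opn (- step_gap s t w) <= K * ?x powr bA" using step_gap_bound[OF st] by (simp add: opn_minus)
  have "mom_le M 2 (K * ((K * ?x powr bA) * k4)) ?T3"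
   using B_bound[OF t] K0
   by (intro mom_le_matrix_vector mom_le_matrix_vector[OF chi_mom[OF s] _ ns] M_meas t borel_measurable_uminus step_gap_meas st) auto
  then have t3: "mom_le M 2 ((K * K * k4) * ?x powr bA) ?T3" by (simp add: mult_ac)
  have a2u: "a2 <= 1" using a2 aS ex by linarith
  have b2u: "b2 <= bA" using b2 bS by linarith
  have t2a: "mom_le M 2 (K * k3 * LT * ?x powr a2) ?T2" "mom_le M 2 (K * k3 * LT * ?x powr b2) ?T2"
   using K0 k345 ex a2 b2 a2u by (auto intro!: mom_le_powr_LT[OF t2 st])
  have t3a: "mom_le M 2 (K * K * k4 * LT * ?x powr a2) ?T3" "mom_le M 2 (K * K * k4 * LT * ?x powr b2) ?T3"
   using K0 k345 ex a2 b2 a2u b2u bA by (auto intro!: mom_le_powr_LT[OF t3 st])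
  have eq: "(%w. Y t w - Y s w) = (%w. ?T1 w + (?T2 w + ?T3 w))" using Y_eq[OF st] by blast
  note i1 = mom_le_integrable[OF t1 two(3)] and i2 = mom_le_integrable[OF t2 two(3)] and i3 = mom_le_integrable[OF t3 two(3)]
  have "mom_le M 2 (K * (k3 * ?x powr a2) + (K * k3 * LT * ?x powr a2 + K * K * k4 * LT * ?x powr a2)) (%w. Y t w - Y s w)"
   unfolding eq by (intro mom_le_add t1 t2a t3a two)
  moreover have "K * (k3 * ?x powr a2) + (K * k3 * LT * ?x powr a2 + K * K * k4 * LT * ?x powr a2) <= k5 * ?x powr a2"
  proof -
   have n1: "1 <= n" by (simp add: n_def Suc_le_eq)
   have "K * k3 * LT <= n * (K * k3 * LT)" using mult_right_mono[OF n1, of "K * k3 * LT"] K0 k345 LT1 by simp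
   moreover have "0 <= K * k3" "0 <= n * (K * K * k4 * LT)" using n0 K0 k345 LT1 by auto
   ultimately have "K * k3 + K * k3 * LT + K * K * k4 * LT <= k5" by (simp add: k5_def mult.assoc)
   from mult_right_mono[OF this, of "?x powr a2"] show ?thesis by (simp add: algebra_simps)
  qed
  ultimately have 1: "mom_le M 2 (k5 * ?x powr a2) (%w. Y t w - Y s w)" by (rule mom_le_weaken)
  have cT1: "mom_le M 2 (K * (k3 * ?x powr b2)) (CE s ?T1)"
  proof (rule mom_le_cond_expectation_linear_map[OF G mom_le_integrable[OF Dm two(3)] _ _ _ _ cD])
   show "(%w. B s w *v e) \<in> borel_measurable (Fil s)" for e
    by (intro meas_matrix_vector_mult B_meas s) auto
   show "norm (B s w *v v) <= K * norm v" for v w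
    using B_bound[OF s, of w] by (intro order_trans[OF opn_vec] mult_right_mono) auto
  qed (use K0 in auto)
  have "mom_le M 2 (K * (k3 * ?x powr b2) + (n * (K * k3 * LT * ?x powr b2) + n * (K * K * k4 * LT * ?x powr b2)))
    (CE s (%w. Y t w - Y s w))"
   unfolding eq n_def
   by (intro mom_le_cond_expectation_add[OF G two(1,3)] i1 i2 i3 Bochner_Integration.integrable_add cT1
     mom_le_cond_expectation[OF G two(1,3)] t2a t3a)
  moreover have "K * (k3 * ?x powr b2) + (n * (K * k3 * LT * ?x powr b2) + n * (K * K * k4 * LT * ?x powr b2)) <= k5 * ?x powr b2"
  proof -
   have "0 <= K * k3 + K * (K * k4) * LT" using K0 k345 LT1 by auto
   then have "K * k3 + (n * (K * k3 * LT) + n * (K * K * k4 * LT)) <= k5" unfolding k5_def by linarith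
   from mult_right_mono[OF this, of "?x powr b2"] show ?thesis by (simp add: algebra_simps)
  qed
  ultimately show ?thesis using 1 by (auto intro: mom_le_weaken)
 qed
 have "AE w in M. \<forall>b\<in>Basis. Y t w \<bullet> b = 0"
 proof (rule AE_finite_allI[OF finite_Basis])
  fix e :: "real ^ 'n" assume e: "e \<in> Basis"
  show "AE w in M. Y t w \<bullet> e = 0"
  proof (rule zero_if_small_increments[OF two(1,2) a2(1) b2(1) _ k345(3)])
   show "a2 <= b2" using a2 aS b2 ex by linarith
   show "(%w. Y u w \<bullet> e) \<in> borel_measurable (Fil u)" if "0 <= u" "u <= T" for u using Ymeas[OF that] by simp
   have "AE w in M. phi x 0 w = x" using I_0 by eventually_elim (simp add: phi_def A_0)
   then show "AE w in M. Y 0 w \<bullet> e = 0" using init by eventually_elim (simp add: Y_def chi_def)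
   fix s u assume su: "0 <= s" "s < u" "u <= T"
   then have su': "s <= u" by simp
   from mom_le_inner[OF inc[OF su(1) su' su(3), THEN conjunct1] e]
   show "mom_le M 2 (k5 * (u - s) powr a2) (%w. Y u w \<bullet> e - Y s w \<bullet> e)" by (simp add: inner_diff_left)
   from mom_le_inner[OF inc[OF su(1) su' su(3), THEN conjunct2] e]
   show "mom_le M 2 (k5 * (u - s) powr b2) (RCE s (%w. Y u w \<bullet> e - Y s w \<bullet> e))"
    unfolding cond_expectation_inner[OF e] by (simp add: inner_diff_left)
  qed (use t in auto)
 qed
 then show ?thesis
 proof eventually_elim
  case (elim w)
  then have "Y t w = 0" by (simp add: euclidean_all_zero_iff)
  then have "A t w *v (B t w *v chi t w) = 0" by (simp add: Y_def)
  then show ?case using AB[OF t, of w] by (simp add: matrix_vector_mul_assoc chi_def)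
 qed
qed

end

lemma meas_lin_app:
 fixes z :: "'a => 'v::euclidean_space ^ 'd"
 assumes "z \<in> borel_measurable N" "x \<in> borel_measurable N"
 shows "(%w. lin_app (z w) (x w)) \<in> borel_measurable N"
 by (rule borel_measurable_continuous_Pair[OF assms]) (intro continuous_intros lin_app.continuous_on)

lemma meas_bilin_app:
 fixes z :: "'a => 'v::euclidean_space ^ 'd ^ 'd"
 assumes "z \<in> borel_measurable N" "x \<in> borel_measurable N"
 shows "(%w. bilin_app (z w) (x w)) \<in> borel_measurable N"
 by (rule borel_measurable_continuous_Pair[OF assms]) (intro continuous_intros bilin_app.continuous_on)

lemma meas_left_mult:
 fixes F :: "'a => real ^ 'n ^ 'd ^ 'n"
 assumes "F \<in> borel_measurable N" "f \<in> borel_measurable N"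
 shows "(%w. left_mult (F w) (f w)) \<in> borel_measurable N"
 by (rule borel_measurable_continuous_Pair[OF assms])
  (auto simp: left_mult_def intro!: continuous_intros lin_app.continuous_on)

lemma meas_apply_deriv:
 fixes F' :: "'a => real ^ 'n ^ 'd ^ 'n ^ 'd"
 assumes "F' \<in> borel_measurable N" "v \<in> borel_measurable N"
 shows "(%w. apply_deriv (F' w) (v w)) \<in> borel_measurable N"
 by (rule borel_measurable_continuous_Pair[OF assms])
  (auto simp: apply_deriv_def intro!: continuous_intros lin_app.continuous_on)

lemma meas_germ:
 fixes z :: "'a => 'v::euclidean_space ^ 'd"
 assumes "z \<in> borel_measurable N" "z' \<in> borel_measurable N"
 shows "(%w. germ (z w) (z' w) a E) \<in> borel_measurable N"
 unfolding germ_def using assms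
 by (intro borel_measurable_add meas_lin_app meas_bilin_app) auto

context prob_space begin

text \<open>Limits in probability and almost sure limits agree; tested with the bounded metric
 \<open>min 1 (norm (x - y))\<close> and Fatou's lemma.\<close>

lemma AE_eq_if_limits:
 fixes X :: "nat => 'a => 'v::euclidean_space"
 assumes X: "!!n. X n \<in> borel_measurable M" and Y: "Y \<in> borel_measurable M" and J: "J \<in> borel_measurable M"
  and ae: "AE w in M. (%n. X n w) \<longlonglongrightarrow> J w"
  and pr: "!!eps \<theta>. 0 < eps ==> 0 < \<theta> ==> \<exists>N. \<forall>n\<ge>N. measure M {w \<in> space M. norm (X n w - Y w) > eps} < \<theta>"
 shows "AE w in M. J w = Y w"
proof -
 note [measurable] = X Y J
 have small: "(\<integral>\<^sup>+w. ennreal (min 1 (norm (J w - Y w))) \<partial>M) <= ennreal (2 * eps)" if eps: "0 < eps" for eps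
 proof -
  have "(\<integral>\<^sup>+w. ennreal (min 1 (norm (J w - Y w))) \<partial>M) = (\<integral>\<^sup>+w. liminf (%n. ennreal (min 1 (norm (X n w - Y w)))) \<partial>M)"
  proof (rule nn_integral_cong_AE, use ae in eventually_elim)
   fix w assume "(%n. X n w) \<longlonglongrightarrow> J w"
   then have "(%n. ennreal (min 1 (norm (X n w - Y w)))) \<longlonglongrightarrow> ennreal (min 1 (norm (J w - Y w)))"
    by (intro tendsto_intros)
   then show "ennreal (min 1 (norm (J w - Y w))) = liminf (%n. ennreal (min 1 (norm (X n w - Y w))))"
    by (intro lim_imp_Liminf[symmetric]) auto
  qed
  also have "... <= liminf (%n. \<integral>\<^sup>+w. ennreal (min 1 (norm (X n w - Y w))) \<partial>M)"
   by (rule nn_integral_liminf) measurable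
  also have "... <= liminf (%n. ennreal (2 * eps))"
  proof (rule Liminf_mono)
   obtain N where N: "!!n. n \<ge> N ==> measure M {w \<in> space M. norm (X n w - Y w) > eps} < eps"
    using pr[OF eps eps] by blast
   have "(\<integral>\<^sup>+w. ennreal (min 1 (norm (X n w - Y w))) \<partial>M) <= ennreal (2 * eps)" if "n \<ge> N" for n
   proof -
    let ?A = "{w \<in> space M. norm (X n w - Y w) > eps}"
    have "(\<integral>\<^sup>+w. ennreal (min 1 (norm (X n w - Y w))) \<partial>M) <= (\<integral>\<^sup>+w. ennreal eps + indicator ?A w \<partial>M)"
    proof (rule nn_integral_mono)
     fix w assume w: "w \<in> space M"
     show "ennreal (min 1 (norm (X n w - Y w))) <= ennreal eps + indicator ?A w"
     proof (cases "w \<in> ?A")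
      case True
      have "ennreal (min 1 (norm (X n w - Y w))) <= ennreal 1" by (intro ennreal_leI) simp
      also have "... <= ennreal eps + 1" by (simp add: add_increasing)
      finally show ?thesis using True by simp
     next
      case False
      then have "norm (X n w - Y w) <= eps" using w by simp
      then show ?thesis using False by (simp add: ennreal_leI)
     qed
    qed
    also have "... = ennreal eps + emeasure M ?A"
     by (simp add: nn_integral_add emeasure_space_1)
    also have "... <= ennreal eps + ennreal eps"
     using N[OF that] by (intro add_left_mono) (simp add: emeasure_eq_measure ennreal_leI)
    also have "... = ennreal (2 * eps)" using eps by (simp add: ennreal_plus[symmetric] del: ennreal_plus)
    finally show ?thesis .
   qed
   then show "\<forall>\<^sub>F n in sequentially. (\<integral>\<^sup>+w. ennreal (min 1 (norm (X n w - Y w))) \<partial>M) <= ennreal (2 * eps)"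
    by (auto simp: eventually_sequentially)
  qed
  also have "... = ennreal (2 * eps)" by (simp add: Liminf_const)
  finally show ?thesis .
 qed
 have "(\<integral>\<^sup>+w. ennreal (min 1 (norm (J w - Y w))) \<partial>M) <= 0 + ennreal e" if "0 < e" for e
  using small[of "e / 2"] that by simp
 then have "(\<integral>\<^sup>+w. ennreal (min 1 (norm (J w - Y w))) \<partial>M) <= 0"
  by (rule ennreal_le_epsilon)
 then have "(\<integral>\<^sup>+w. ennreal (min 1 (norm (J w - Y w))) \<partial>M) = 0" by (rule le_zero_eq[THEN iffD1])
 then have "AE w in M. ennreal (min 1 (norm (J w - Y w))) = 0" by (subst (asm) nn_integral_0_iff_AE) auto
 then show ?thesis
 proof eventually_elim
  case (elim w)
  then have "\<not> 0 < min 1 (norm (J w - Y w))" by (simp only: ennreal_eq_0_iff not_less)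
  then show ?case unfolding min_less_iff_conj by simp
 qed
qed

lemma chebyshev_moment:
 fixes X :: "'a => 'v::{real_normed_vector, second_countable_topology}"
 assumes X: "mom_le M 2 c X" and eps: "0 < eps"
 shows "measure M {w \<in> space M. norm (X w) > eps} <= c\<^sup>2 / eps\<^sup>2"
proof -
 note [measurable] = mom_le_measurable[OF X]
 let ?A = "{w \<in> space M. norm (X w) > eps}"
 have "ennreal (eps\<^sup>2) * emeasure M ?A = (\<integral>\<^sup>+w. ennreal (eps\<^sup>2) * indicator ?A w \<partial>M)"
  by (rule nn_integral_cmult_indicator[symmetric]) measurable
 also have "... <= (\<integral>\<^sup>+w. ennreal (norm (X w) ^ 2) \<partial>M)"
  using eps by (intro nn_integral_mono) (auto simp: indicator_def intro!: ennreal_leI power_mono)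
 also have "... <= ennreal (c\<^sup>2)" using X by (simp add: mom_le_def)
 finally have "ennreal (eps\<^sup>2 * measure M ?A) <= ennreal (c\<^sup>2)"
  by (simp add: emeasure_eq_measure ennreal_mult)
 then have "eps\<^sup>2 * measure M ?A <= c\<^sup>2" by simp
 then show ?thesis using eps by (simp add: field_simps)
qed

end

section \<open>Rough integrals and local expansions\<close>

context rough_linear begin

definition increment_error where
 "increment_error \<psi> Z Z' s t w = \<psi> t w - \<psi> s w - germ (Z s w) (Z' s w) (\<eta> t - \<eta> s) (e2 s t)"

text \<open>The difference between the increment and the compensated sum over a partition is the sum of the
 local errors, which \<open>mom_le_partition_sum\<close> bounds by a power of the mesh.\<close>

theorem has_rough_integral_of_expansion:
 fixes \<psi> :: "real => 'a => real ^ 'n" and Z :: "real => 'a => real ^ 'n ^ 'd"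
 assumes \<eta>2: "!!s t. 0 <= s ==> s < t ==> t <= T ==> \<eta>2 s t = e2 s t"
  and meas: "!!t. 0 <= t ==> t <= T ==> \<psi> t \<in> borel_measurable (Fil t)" "!!t. 0 <= t ==> t <= T ==> Z t \<in> borel_measurable (Fil t)"
   "!!t. 0 <= t ==> t <= T ==> Z' t \<in> borel_measurable (Fil t)"
  and ab: "1 / 2 < a" "a <= 1" "1 < b" and k: "0 <= k"
  and err: "!!s t. 0 <= s ==> s <= t ==> t <= T ==> mom_le M 2 (k * (t - s) powr a) (increment_error \<psi> Z Z' s t)"
  and cerr: "!!s t. 0 <= s ==> s <= t ==> t <= T ==>
   mom_le M 2 (k * (t - s) powr b) (CE s (increment_error \<psi> Z Z' s t))"
  and t: "0 <= t" "t <= T"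
 shows "has_rough_integral M \<eta> \<eta>2 Z Z' t (%w. \<psi> t w - \<psi> 0 w)"
proof -
 have two: "even (2::nat)" "2 <= (2::nat)" "0 < (2::nat)" by auto
 have MM: "\<psi> u \<in> borel_measurable M" "Z u \<in> borel_measurable M" "Z' u \<in> borel_measurable M" if "0 <= u" "u <= T" for u
  using Fil_meas_M[OF meas(1)[OF that] that] Fil_meas_M[OF meas(2)[OF that] that] Fil_meas_M[OF meas(3)[OF that] that] .
 define n where "n = real DIM(real ^ 'n)"
 define c1 where "c1 = n * (k * T powr 1)"
 define c2 where "c2 = n * (sqrt (2 ^ (2 + 2)) * (k * (1 + T powr (b - a))) * T powr (1 / 2))"
 show ?thesis
  unfolding has_rough_integral_def
 proof (intro conjI allI impI)
  show "(%w. \<psi> t w - \<psi> 0 w) \<in> borel_measurable M"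
   using MM(1)[OF t] MM(1)[of 0] T_pos by simp
  fix eps \<theta> :: real assume eps: "0 < eps" and \<theta>: "0 < \<theta>"
  have "0 < eps * sqrt \<theta>" using eps \<theta> by simp
  then obtain h where h: "0 < h" "c1 * h powr (b - 1) + c2 * h powr (a - 1 / 2) < eps * sqrt \<theta>"
   using exists_small_powr[of "b - 1" "a - 1 / 2" "eps * sqrt \<theta>" c1 c2] ab by auto
  show "\<exists>h>0. \<forall>m tau. tau 0 = 0 & tau m = t & (\<forall>k<m. tau k < tau (Suc k) & tau (Suc k) - tau k < h) -->
    measure M {w \<in> space M. eps < norm (rough_sum \<eta> \<eta>2 Z Z' m tau w - (\<psi> t w - \<psi> 0 w))} < \<theta>"
  proof (intro exI[of _ h] conjI allI impI)
   fix m and tau :: "nat => real"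
   assume *: "tau 0 = 0 & tau m = t & (\<forall>k<m. tau k < tau (Suc k) & tau (Suc k) - tau k < h)"
   then have tau: "tau 0 = 0" "tau m = t" "!!k. k < m ==> tau k < tau (Suc k)" "!!k. k < m ==> tau (Suc k) - tau k <= h"
    by (auto intro: less_imp_le)
   have mono: "tau i <= tau j" if "i <= j" "j <= m" for i j
    using that by (induction rule: dec_induct) (auto intro: order_trans[OF _ less_imp_le[OF tau(3)]])
   have tauT: "0 <= tau j" "tau j <= T" if "j <= m" for j
    using mono[of 0 j] mono[of j m] that t tau by auto
   define D where "D j = increment_error \<psi> Z Z' (tau j) (tau (Suc j))" for j
   have sum: "rough_sum \<eta> \<eta>2 Z Z' m tau w - (\<psi> t w - \<psi> 0 w) = - (\<Sum>j<m. D j w)" for w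
   proof -
    have "rough_sum \<eta> \<eta>2 Z Z' m tau w = (\<Sum>j<m. germ (Z (tau j) w) (Z' (tau j) w) (\<eta> (tau (Suc j)) - \<eta> (tau j)) (e2 (tau j) (tau (Suc j))))"
     unfolding rough_sum_def germ_def
     by (intro sum.cong refl) (use tauT tau(3) \<eta>2 in "simp add: Suc_le_eq")
    moreover have "\<psi> t w - \<psi> 0 w = (\<Sum>j<m. \<psi> (tau (Suc j)) w - \<psi> (tau j) w)"
     using sum_lessThan_telescope[of "%j. \<psi> (tau j) w" m] tau by simp
    ultimately show ?thesis by (simp add: D_def increment_error_def sum_subtractf)
   qed
   have Dmeas: "D j \<in> borel_measurable (Fil (tau (Suc j)))" if j: "j < m" for j
    unfolding D_def increment_error_def[abs_def] using tauT[of j] tauT[of "Suc j"] tau(3)[OF j] j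
    by (intro borel_measurable_diff meas_germ meas Fil_meas_mono[OF meas(1), of "tau j"]
     Fil_meas_mono[OF meas(2), of "tau j"] Fil_meas_mono[OF meas(3), of "tau j"]) auto
   define c where "c = k * T powr 1 * h powr (b - 1) + sqrt (2 ^ (2 + 2)) * (k * (1 + T powr (b - a))) * T powr (1 / 2) * h powr (a - 1 / 2)"
   have comp: "mom_le M 2 c (%w. (\<Sum>j<m. D j w) \<bullet> e)" if e: "e \<in> Basis" for e
   proof -
    have "mom_le M 2 (k * (tau m - tau 0) powr 1 * h powr (b - 1) +
     sqrt (2 ^ (2 + 2)) * (k * (1 + T powr (b - a))) * (tau m - tau 0) powr (1 / 2) * h powr (a - 1 / 2)) (%w. \<Sum>j<m. D j w \<bullet> e)"
    proof (rule mom_le_partition_sum[OF two(1,2)])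
     fix j assume j: "j < m"
     have jj: "0 <= tau j" "tau j <= tau (Suc j)" "tau (Suc j) <= T" using tauT[of j] tauT[of "Suc j"] tau(3)[OF j] j by auto
     show "mom_le M 2 (k * (tau (Suc j) - tau j) powr a) (%w. D j w \<bullet> e)"
      unfolding D_def by (rule mom_le_inner[OF err[OF jj] e])
     from mom_le_inner[OF cerr[OF jj] e]
     show "mom_le M 2 (k * (tau (Suc j) - tau j) powr b) (real_cond_exp M (Fil (tau j)) (%w. D j w \<bullet> e))"
      unfolding D_def cond_expectation_inner[OF e] .
     show "(%w. D j w \<bullet> e) \<in> borel_measurable (Fil (tau (Suc j)))" using Dmeas[OF j] by simp
     show "tau j <= tau (Suc j)" "tau (Suc j) - tau j <= h" using tau(3,4)[OF j] by auto
    qed (use ab k tau t in auto)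
    then have "mom_le M 2 (k * t powr 1 * h powr (b - 1) +
     sqrt (2 ^ (2 + 2)) * (k * (1 + T powr (b - a))) * t powr (1 / 2) * h powr (a - 1 / 2)) (%w. (\<Sum>j<m. D j w) \<bullet> e)"
     by (simp add: tau inner_sum_left)
    moreover have "k * t powr 1 * h powr (b - 1) + sqrt (2 ^ (2 + 2)) * (k * (1 + T powr (b - a))) * t powr (1 / 2) * h powr (a - 1 / 2) <= c"
     unfolding c_def using k t by (intro add_mono mult_right_mono mult_left_mono powr_mono2) auto
    ultimately show ?thesis by (rule mom_le_weaken)
   qed
   have "mom_le M 2 (n * c) (%w. \<Sum>j<m. D j w)"
    unfolding n_def
   proof (rule mom_le_euclidean[OF two(1,3) _ comp])
    show "(%w. \<Sum>j<m. D j w) \<in> borel_measurable M"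
     using Dmeas tauT by (intro borel_measurable_sum Fil_meas_M[OF Dmeas]) auto
   qed
   then have "measure M {w \<in> space M. norm (\<Sum>j<m. D j w) > eps} <= (n * c)\<^sup>2 / eps\<^sup>2"
    using eps by (rule chebyshev_moment)
   also have "... < \<theta>"
   proof -
    have "n * c = c1 * h powr (b - 1) + c2 * h powr (a - 1 / 2)"
     by (simp add: c_def c1_def c2_def algebra_simps)
    then have "n * c < eps * sqrt \<theta>" using h(2) by simp
    moreover have "0 <= n * c" using k by (simp add: n_def c_def)
    ultimately have "(n * c)\<^sup>2 < (eps * sqrt \<theta>)\<^sup>2" by (intro power_strict_mono) auto
    also have "... = eps\<^sup>2 * \<theta>" using \<theta> by (simp add: power_mult_distrib)
    finally show ?thesis using eps by (simp add: field_simps)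
   qed
   finally show "measure M {w \<in> space M. eps < norm (rough_sum \<eta> \<eta>2 Z Z' m tau w - (\<psi> t w - \<psi> 0 w))} < \<theta>"
    unfolding sum norm_minus_cancel .
  qed (rule h)
 qed
qed

lemma powr_LT_lin: "0 <= s ==> s <= t ==> t <= T ==> e <= e' ==> e' <= e + 3 ==> (t - s) powr e' <= (1 + T) powr 3 * (t - s) powr e"
 by (rule powr_le_powr_lower) auto

text \<open>Conversely, a process that is a rough integral of a controlled process has the corresponding
 local expansion: the dyadic sums of the sewing lemma are compensated sums over partitions.\<close>

theorem expansion_of_rough_integral:
 fixes Z :: "real => 'a => real ^ 'n ^ 'd" and J :: "real => 'a => real ^ 'n"
 assumes \<eta>2: "!!s t. 0 <= s ==> s < t ==> t <= T ==> \<eta>2 s t = e2 s t"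
  and meas: "!!t. 0 <= t ==> t <= T ==> Z t \<in> borel_measurable (Fil t)"
   "!!t. 0 <= t ==> t <= T ==> Z' t \<in> borel_measurable (Fil t)"
  and g: "0 < \<gamma>'" "\<gamma>' <= \<gamma>" "\<gamma> <= \<alpha>" "1 / 2 < \<alpha> + \<gamma>" "1 < \<alpha> + \<gamma> + \<gamma>'" and k: "0 <= k"
  and Z: "!!s t. 0 <= s ==> s <= t ==> t <= T ==> mom_le M 2 (k * (t - s) powr \<gamma>) (%w. Z t w - Z s w)"
   "!!s t. 0 <= s ==> s <= t ==> t <= T ==> mom_le M 2 (k * (t - s) powr \<gamma>') (%w. Z' t w - Z' s w)"
   "!!t. 0 <= t ==> t <= T ==> mom_le M 2 k (Z' t)"
   "!!s t. 0 <= s ==> s <= t ==> t <= T ==> mom_le M 2 (k * (t - s) powr (\<gamma> + \<gamma>'))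
     (CE s (remainder \<eta> Z Z' s t))"
  and J: "!!t. 0 <= t ==> t <= T ==> has_rough_integral M \<eta> \<eta>2 Z Z' t (J t)"
 shows "(AE w in M. J 0 w = 0) & (\<exists>k'\<ge>0. \<exists>a b. 1 / 2 < a & 1 < \<alpha> + a & a <= 2 & 1 < b & b <= 2 &
   (\<forall>s t. 0 <= s --> s <= t --> t <= T --> mom_le M 2 (k' * (t - s) powr a) (increment_error J Z Z' s t) &
    mom_le M 2 (k' * (t - s) powr b) (CE s (increment_error J Z Z' s t))))"
proof -
 have two: "even (2::nat)" "2 <= (2::nat)" "0 < (2::nat)" by auto
 define L where "L = (1 + T) powr 3"
 have L1: "1 <= L" using T_pos by (simp add: L_def ge_one_powr_ge_zero)
 have C0: "0 <= C" using C1 by simp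
 define n where "n = real DIM(real ^ 'n)"
 have n1: "1 <= n" by (simp add: n_def Suc_le_eq)
 have MM: "Z u \<in> borel_measurable M" "Z' u \<in> borel_measurable M" if "0 <= u" "u <= T" for u
  using Fil_meas_M[OF meas(1)[OF that] that] Fil_meas_M[OF meas(2)[OF that] that] .
 define G where "G s t w = germ (Z s w) (Z' s w) (\<eta> t - \<eta> s) (e2 s t)" for s t w
 have Gm: "G s t \<in> borel_measurable (Fil s)" if "0 <= s" "s <= T" for s t
  unfolding G_def[abs_def] by (intro meas_germ meas that)
 have Gdiag: "G s s w = 0" if "0 <= s" "s <= T" for s w
  using e2_diag[OF that] by (simp add: G_def germ_def lin_app.zero_right bilin_app.zero_right)
 define a0 where "a0 = \<alpha> + \<gamma>"
 define b0 where "b0 = \<alpha> + \<gamma> + \<gamma>'"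
 define a where "a = (max (1 / 2) (1 - \<alpha>) + a0) / 2"
 define b where "b = (1 + b0) / 2"
 have mx: "max (1 / 2) (1 - \<alpha>) < a0" using g by (auto simp: a0_def)
 have ab: "1 / 2 < a" "1 - \<alpha> < a" "a < a0" "1 < b" "b < b0" "a0 <= b0" "a <= b" "a0 <= 1" "b0 <= 2"
  using mx g ex by (auto simp: a_def b_def a0_def b0_def)
 have DG: "defect G s u t = (%w. - lin_app (remainder \<eta> Z Z' s u w) (\<eta> t - \<eta> u) + - bilin_app (Z' u w - Z' s w) (e2 u t))"
  if sut: "0 <= s" "s <= u" "u <= t" "t <= T" for s u t
 proof (rule ext)
  fix w
  have "\<eta> t - \<eta> s = (\<eta> u - \<eta> s) + (\<eta> t - \<eta> u)" by simp
  then have "G s t w = lin_app (Z s w) (\<eta> u - \<eta> s) + lin_app (Z s w) (\<eta> t - \<eta> u) + (bilin_app (Z' s w) (e2 s u) + bilin_app (Z' s w) (e2 u t)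
    + lin_app (lin_app (Z' s w) (\<eta> u - \<eta> s)) (\<eta> t - \<eta> u))"
   unfolding G_def germ_def chen[OF sut] by (simp only: lin_app.add_right bilin_app.add_right bilin_app_tensor)
  then show "defect G s u t w = - lin_app (remainder \<eta> Z Z' s u w) (\<eta> t - \<eta> u) + - bilin_app (Z' u w - Z' s w) (e2 u t)"
   by (simp add: defect_def G_def germ_def remainder_def incr_def lin_app.diff_left bilin_app.diff_left)
 qed
 define k1 where "k1 = k * L + C * k * L"
 have k1: "0 <= k1" using k C0 L1 by (simp add: k1_def)
 have rem: "mom_le M 2 (k1 * (t - s) powr \<gamma>) (remainder \<eta> Z Z' s t)" if st: "0 <= s" "s <= t" "t <= T" for s t
 proof -
  have s: "0 <= s" "s <= T" using st by auto
  have "mom_le M 2 ((C * (t - s) powr \<alpha>) * k) (%w. lin_app (Z' s w) (\<eta> t - \<eta> s))"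
  proof (rule mom_le_AE_bound[OF Z(3)[OF s]])
   show "AE w in M. norm (lin_app (Z' s w) (\<eta> t - \<eta> s)) <= C * (t - s) powr \<alpha> * norm (Z' s w)"
   proof (rule AE_I2)
    fix w
    have "norm (lin_app (Z' s w) (\<eta> t - \<eta> s)) <= norm (Z' s w) * norm (\<eta> t - \<eta> s)" by (rule norm_lin_app)
    also have "... <= norm (Z' s w) * (C * (t - s) powr \<alpha>)" using eta[OF st] by (intro mult_left_mono) auto
    finally show "norm (lin_app (Z' s w) (\<eta> t - \<eta> s)) <= C * (t - s) powr \<alpha> * norm (Z' s w)" by (simp add: mult.commute)
   qed
  qed (use C0 MM[OF s] in "auto intro!: meas_lin_app")
  then have "mom_le M 2 (k * (t - s) powr \<gamma> + (C * (t - s) powr \<alpha>) * k) (remainder \<eta> Z Z' s t)"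
   unfolding remainder_def[abs_def] incr_def by (rule mom_le_diff[OF Z(1)[OF st] _ two(1,3)])
  moreover have "k * (t - s) powr \<gamma> + (C * (t - s) powr \<alpha>) * k <= k1 * (t - s) powr \<gamma>"
  proof -
   have "(t - s) powr \<alpha> <= L * (t - s) powr \<gamma>" unfolding L_def by (rule powr_LT_lin[OF st]) (use g ex in linarith)+
   then have "(C * k) * (t - s) powr \<alpha> <= (C * k) * (L * (t - s) powr \<gamma>)" using C0 k by (intro mult_left_mono) auto
   moreover have "k * 1 * (t - s) powr \<gamma> <= k * L * (t - s) powr \<gamma>" using k L1 by (intro mult_right_mono mult_left_mono) auto
   ultimately show ?thesis by (simp add: k1_def algebra_simps)
  qed
  ultimately show ?thesis by (rule mom_le_weaken)
 qed
 define k2 where "k2 = k1 * C + k * C * L + C * k + n * (k * C * L)"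
 have k2: "0 <= k2" using k k1 C0 L1 n1 by (simp add: k2_def)
 have dG: "mom_le M 2 (k2 * (t - s) powr a0) (defect G s u t) &
   mom_le M 2 (k2 * (t - s) powr b0) (CE s (defect G s u t))"
  if sut: "0 <= s" "s < u" "u < t" "t <= T" for s u t
 proof -
  have T: "0 <= s" "s <= T" "0 <= u" "u <= T" "0 <= t" "s <= u" "u <= t" "s <= t" using sut by auto
  have Fs: "subalgebra M (Fil s)" using T by (intro Fil_subalgebra) auto
  define x where "x = t - s"
  have mono: "(u - s) powr e <= x powr e" "(t - u) powr e <= x powr e" if "0 <= e" for e
   using sut that by (auto simp: x_def intro!: powr_mono2)
  have bb: "norm (\<eta> t - \<eta> u) <= C * x powr \<alpha>" "norm (e2 u t) <= C * x powr (2 * \<alpha>)"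
   using eta[of u t] e2[of u t] sut ex mult_left_mono[OF mono(2)[of \<alpha>] C0] mult_left_mono[OF mono(2)[of "2 * \<alpha>"] C0] by auto
  let ?X1 = "%w. - lin_app (remainder \<eta> Z Z' s u w) (\<eta> t - \<eta> u)" and ?X2 = "%w. - bilin_app (Z' u w - Z' s w) (e2 u t)"
  have lin1: "linear (%v. - lin_app v (\<eta> t - \<eta> u) :: real ^ 'n)"
   by (rule linearI) (simp_all add: lin_app.add_left lin_app.scaleR_left)
  have n1b: "norm (- lin_app v (\<eta> t - \<eta> u) :: real ^ 'n) <= (C * x powr \<alpha>) * norm v" for v
  proof -
   have "norm (lin_app v (\<eta> t - \<eta> u)) <= norm v * norm (\<eta> t - \<eta> u)" by (rule norm_lin_app)
   also have "... <= norm v * (C * x powr \<alpha>)" using bb by (intro mult_left_mono) auto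
   finally show ?thesis by (simp add: mult.commute)
  qed
  note R = rem[OF T(1,6,4)]
  have m1: "mom_le M 2 ((C * x powr \<alpha>) * (k1 * (u - s) powr \<gamma>)) ?X1"
   using n1b C0 mom_le_measurable[OF R]
   by (intro mom_le_AE_bound[OF R]) (auto intro!: borel_measurable_uminus meas_lin_app)
  have m2: "mom_le M 2 ((C * x powr (2 * \<alpha>)) * (k * (u - s) powr \<gamma>')) ?X2"
  proof (rule mom_le_AE_bound[OF Z(2)[OF T(1,6,4)]])
   show "AE w in M. norm (?X2 w) <= (C * x powr (2 * \<alpha>)) * norm (Z' u w - Z' s w)"
   proof (rule AE_I2)
    fix w
    have "norm (bilin_app (Z' u w - Z' s w) (e2 u t)) <= norm (Z' u w - Z' s w) * norm (e2 u t)" by (rule norm_bilin_app)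
    also have "... <= norm (Z' u w - Z' s w) * (C * x powr (2 * \<alpha>))" using bb by (intro mult_left_mono) auto
    finally show "norm (?X2 w) <= (C * x powr (2 * \<alpha>)) * norm (Z' u w - Z' s w)" by (simp add: mult.commute)
   qed
   show "?X2 \<in> borel_measurable M" using MM[OF T(1,2)] MM[OF T(3,4)]
    by (intro borel_measurable_uminus meas_bilin_app borel_measurable_diff) auto
  qed (use C0 in auto)
  have m2': "mom_le M 2 (k * C * x powr (2 * \<alpha> + \<gamma>')) ?X2"
  proof (rule mom_le_weaken[OF m2])
   have "(C * x powr (2 * \<alpha>)) * (k * (u - s) powr \<gamma>') <= (C * x powr (2 * \<alpha>)) * (k * x powr \<gamma>')"
    using C0 k g mono[of \<gamma>'] by (intro mult_left_mono) auto
   then show "(C * x powr (2 * \<alpha>)) * (k * (u - s) powr \<gamma>') <= k * C * x powr (2 * \<alpha> + \<gamma>')" by (simp add: powr_add mult_ac)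
  qed
  have m1': "mom_le M 2 (k1 * C * x powr a0) ?X1"
  proof (rule mom_le_weaken[OF m1])
   have "(C * x powr \<alpha>) * (k1 * (u - s) powr \<gamma>) <= (C * x powr \<alpha>) * (k1 * x powr \<gamma>)"
    using C0 k1 g mono[of \<gamma>] by (intro mult_left_mono) auto
   then show "(C * x powr \<alpha>) * (k1 * (u - s) powr \<gamma>) <= k1 * C * x powr a0" by (simp add: a0_def powr_add mult_ac)
  qed
  have le: "k * C * x powr (2 * \<alpha> + \<gamma>') <= k * C * (L * x powr a0)" "k * C * x powr (2 * \<alpha> + \<gamma>') <= k * C * (L * x powr b0)"
   unfolding x_def L_def a0_def b0_def by (rule mult_left_mono[OF powr_LT_lin]; use T sut g ex k C0 in auto)+
  have "mom_le M 2 (k1 * C * x powr a0 + k * C * (L * x powr a0)) (defect G s u t)"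
   unfolding DG[OF T(1,6,7) sut(4)] by (rule mom_le_add[OF m1' mom_le_weaken[OF m2' le(1)] two(1,3)])
  moreover have "k1 * C * x powr a0 + k * C * (L * x powr a0) <= k2 * x powr a0"
  proof -
   have "k1 * C + k * C * L <= k2" using k C0 n1 L1 by (simp add: k2_def)
   from mult_right_mono[OF this, of "x powr a0"] show ?thesis by (simp add: algebra_simps)
  qed
  ultimately have A: "mom_le M 2 (k2 * x powr a0) (defect G s u t)" by (rule mom_le_weaken)
  have "mom_le M 2 ((C * x powr \<alpha>) * (k * (u - s) powr (\<gamma> + \<gamma>'))) (CE s ?X1)"
   by (rule mom_le_cond_expectation_linear_map[where L = "%_ v. - lin_app v (\<eta> t - \<eta> u)", OF Fs mom_le_integrable[OF R two(3)] lin1 _ _ n1b Z(4)[OF T(1,6,4)]])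
    (use C0 in auto)
  then have c1: "mom_le M 2 (C * k * x powr b0) (CE s ?X1)"
  proof (rule mom_le_weaken)
   have "(C * x powr \<alpha>) * (k * (u - s) powr (\<gamma> + \<gamma>')) <= (C * x powr \<alpha>) * (k * x powr (\<gamma> + \<gamma>'))"
    using C0 k g mono[of "\<gamma> + \<gamma>'"] by (intro mult_left_mono) auto
   then show "(C * x powr \<alpha>) * (k * (u - s) powr (\<gamma> + \<gamma>')) <= C * k * x powr b0" by (simp add: b0_def powr_add mult_ac)
  qed
  have c2: "mom_le M 2 (n * (k * C * (L * x powr b0))) (CE s ?X2)"
   unfolding n_def by (rule mom_le_cond_expectation[OF Fs two(1,3) mom_le_weaken[OF m2' le(2)]])
  have "mom_le M 2 (C * k * x powr b0 + n * (k * C * (L * x powr b0))) (CE s (defect G s u t))"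
   unfolding DG[OF T(1,6,7) sut(4)]
   by (rule mom_le_cond_expectation_add[OF Fs two(1,3) mom_le_integrable[OF m1 two(3)] mom_le_integrable[OF m2 two(3)] c1 c2])
  moreover have "C * k * x powr b0 + n * (k * C * (L * x powr b0)) <= k2 * x powr b0"
  proof -
   have "C * k + n * (k * C * L) <= k2" using k C0 k1 L1 by (simp add: k2_def)
   from mult_right_mono[OF this, of "x powr b0"] show ?thesis by (simp add: algebra_simps)
  qed
  ultimately show ?thesis using A by (auto simp: x_def intro: mom_le_weaken)
 qed
 define X where "X s t w = (if s = t then 0 else G s t w)" for s t w
 have X_eq: "X s t = G s t" if "0 <= s" "s <= T" for s t
  using Gdiag[OF that] by (cases "s = t") (auto simp: X_def)
 have Xm: "X s t \<in> borel_measurable (Fil t)" if "0 <= s" "s <= t" "t <= T" for s t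
  unfolding X_eq[OF that(1) order_trans[OF that(2,3)]] using that by (intro Fil_meas_mono[OF Gm]) auto
 have Xd: "defect X s u t = defect G s u t" if "0 <= s" "s < u" "u < t" "t <= T" for s u t
  using that by (auto simp: defect_def X_eq)
 have Xb: "mom_le M 2 (k2 * (t - s) powr a0) (defect X s u t)"
  "mom_le M 2 (k2 * (t - s) powr b0) (CE s (defect X s u t))"
  if sut: "0 <= s" "s < u" "u < t" "t <= T" for s u t
  using dG[OF sut] unfolding Xd[OF sut] by simp_all
 have X0: "X u u w = 0" for u w by (simp add: X_def)
 note sew = vector_stochastic_sewing[OF two(1,2) less_imp_le[OF ab(1)] ab(3) less_imp_le[OF ab(4)] ab(5,6,7) k2 X0 Xm Xb]
 let ?Q = "vector_sewing X"
 have sew1: "AE w in M. (%l. dyadic_sum T X s t l w) \<longlonglongrightarrow> ?Q s t w" and sew2: "?Q s t \<in> borel_measurable M"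
  if "0 <= s" "s <= t" "t <= T" for s t
 proof -
  show "AE w in M. (%l. dyadic_sum T X s t l w) \<longlonglongrightarrow> ?Q s t w" by (rule sew(1)) (use that in auto)
  have "?Q s t \<in> borel_measurable (Fil t)" by (rule sew(2)) (use that in auto)
  then show "?Q s t \<in> borel_measurable M" by (rule Fil_meas_M) (use that in auto)
 qed
 have sew3: "\<exists>K\<ge>0. \<forall>s t. 0 <= s --> s <= t --> t <= T -->
   mom_le M 2 (K * (t - s) powr a) (%w. ?Q s t w - X s t w) &
   mom_le M 2 (K * (t - s) powr b) (CE s (%w. ?Q s t w - X s t w))"
  by (rule sew(3)) auto
 have sew4: "AE w in M. ?Q s t w = ?Q s u w + ?Q u t w" if "0 <= s" "s <= u" "u <= t" "t <= T" for s u t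
  by (rule sew(4)) (use that in auto)
 define S where "S t l w = dyadic_sum T G 0 t l w" for t l w
 have Sm: "S t l \<in> borel_measurable M" if t: "0 <= t" "t <= T" for t l
  unfolding S_def[abs_def] dyadic_sum_def
 proof (intro borel_measurable_sum)
  fix j
  have "0 <= clip 0 t (dyadic T l j)" "clip 0 t (dyadic T l j) <= T" using t by (auto simp: clip_def)
  then show "G (clip 0 t (dyadic T l j)) (clip 0 t (dyadic T l (Suc j))) \<in> borel_measurable M"
   by (intro Fil_meas_M[OF Gm]) auto
 qed
 have conv: "AE w in M. (%l. S t l w) \<longlonglongrightarrow> ?Q 0 t w" if t: "0 <= t" "t <= T" for t
 proof -
  have "dyadic_sum T X 0 t l w = S t l w" for l w
   unfolding S_def dyadic_sum_def by (intro sum.cong refl) (use t in "simp add: X_eq clip_def")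
  then show ?thesis using sew1[of 0 t] t by simp
 qed
 have JQ: "AE w in M. ?Q 0 t w = J t w" if t: "0 <= t" "t <= T" for t
 proof (rule AE_eq_if_limits[OF Sm[OF t] _ sew2 conv[OF t]])
  show "J t \<in> borel_measurable M" using J[OF t] by (simp add: has_rough_integral_def)
  fix eps \<theta> :: real assume eps\<theta>: "0 < eps" "0 < \<theta>"
  from J[OF t, unfolded has_rough_integral_def, THEN conjunct2, rule_format, OF this]
  obtain h where h: "0 < h" "!!m tau. tau 0 = 0 & tau m = t & (\<forall>k<m. tau k < tau (Suc k) & tau (Suc k) - tau k < h) ==>
    measure M {w \<in> space M. norm (rough_sum \<eta> \<eta>2 Z Z' m tau w - J t w) > eps} < \<theta>"
   by (elim exE conjE) blast
  obtain N :: nat where N: "T / h < 2 ^ N" using real_arch_pow[of 2 "T / h"] by auto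
  show "\<exists>N. \<forall>l\<ge>N. measure M {w \<in> space M. norm (S t l w - J t w) > eps} < \<theta>"
  proof (intro exI[of _ N] allI impI)
   fix l assume l: "N <= l"
   have Tl: "T / 2 ^ l < h"
   proof -
    have "(2::real) ^ N <= 2 ^ l" using l by (intro power_increasing) auto
    then have "T / h < 2 ^ l" using N by linarith
    then show ?thesis using h(1) by (simp add: field_simps)
   qed
   define tau where "tau j = clip 0 t (dyadic T l j)" for j
   define m where "m = (LEAST j. t <= dyadic T l j)"
   have ex_m: "t <= dyadic T l (2 ^ l)" using t by (simp add: dyadic_ends)
   have m1: "t <= dyadic T l m" unfolding m_def by (rule LeastI[where P = "%j. t <= dyadic T l j", OF ex_m])
   have m2: "dyadic T l j < t" if "j < m" for j
    using not_less_Least[of j "%j. t <= dyadic T l j"] that unfolding m_def by (simp add: not_le)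
   have mle: "m <= 2 ^ l" unfolding m_def by (rule Least_le[where P = "%j. t <= dyadic T l j", OF ex_m])
   have d0: "0 <= dyadic T l j" for j using T_pos by (simp add: dyadic_def)
   have dlt: "dyadic T l j < dyadic T l (Suc j)" for j by (simp add: dyadic_less_iff)
   have part: "tau 0 = 0 & tau m = t & (\<forall>k<m. tau k < tau (Suc k) & tau (Suc k) - tau k < h)"
   proof (intro conjI allI impI)
    show "tau 0 = 0" using t by (simp add: tau_def clip_def dyadic_ends)
    show "tau m = t" using m1 t by (simp add: tau_def clip_def)
    fix j assume j: "j < m"
    show "tau j < tau (Suc j)" using m2[OF j] d0[of j] dlt[of j] by (auto simp: tau_def clip_def)
    have "tau (Suc j) - tau j <= dyadic T l (Suc j) - dyadic T l j"
     unfolding tau_def by (rule clip_lipschitz) (use dlt[of j] in simp)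
    then show "tau (Suc j) - tau j < h" using Tl by (simp add: dyadic_step)
   qed
   have "S t l w = rough_sum \<eta> \<eta>2 Z Z' m tau w" for w
   proof -
    have "S t l w = (\<Sum>j<2 ^ l. G (tau j) (tau (Suc j)) w)" by (simp add: S_def dyadic_sum_def tau_def)
    also have "... = (\<Sum>j<m. G (tau j) (tau (Suc j)) w)"
    proof (rule sum.mono_neutral_right)
     show "\<forall>j\<in>{..<2 ^ l} - {..<m}. G (tau j) (tau (Suc j)) w = 0"
     proof
      fix j assume "j \<in> {..<(2::nat) ^ l} - {..<m}"
      then have "dyadic T l m <= dyadic T l j" using T_pos by (intro dyadic_mono) auto
      then have "tau j = t" "tau (Suc j) = t" using m1 dlt[of j] t by (auto simp: tau_def clip_def)
      then show "G (tau j) (tau (Suc j)) w = 0" using Gdiag[OF t] by simp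
     qed
    qed (use mle in auto)
    also have "... = rough_sum \<eta> \<eta>2 Z Z' m tau w"
     unfolding rough_sum_def G_def germ_def
    proof (intro sum.cong refl)
     fix j assume "j \<in> {..<m}"
     then have "0 <= tau j" "tau j < tau (Suc j)" "tau (Suc j) <= T" using part t by (auto simp: tau_def clip_def)
     then show "lin_app (Z (tau j) w) (\<eta> (tau (Suc j)) - \<eta> (tau j)) + bilin_app (Z' (tau j) w) (e2 (tau j) (tau (Suc j))) =
      lin_app (Z (tau j) w) (\<eta> (tau (Suc j)) - \<eta> (tau j)) + bilin_app (Z' (tau j) w) (\<eta>2 (tau j) (tau (Suc j)))"
      by (simp add: \<eta>2)
    qed
    finally show ?thesis .
   qed
   then show "measure M {w \<in> space M. norm (S t l w - J t w) > eps} < \<theta>" using h(2)[OF part] by simp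
  qed
 qed (use t in auto)
 have Jinc: "AE w in M. J t w - J s w = ?Q s t w" if st: "0 <= s" "s <= t" "t <= T" for s t
 proof -
  have s: "0 <= s" "s <= T" and t: "0 <= t" "t <= T" using st by auto
  show ?thesis using sew4[OF order_refl st] JQ[OF s] JQ[OF t] by eventually_elim simp
 qed
 have z: "0 <= (0::real)" "0 <= T" using T_pos by auto
 have J0: "AE w in M. J 0 w = 0"
  using Jinc[OF z(1) z] JQ[OF z] by eventually_elim simp
 obtain q where q: "0 <= q" "!!s t. 0 <= s ==> s <= t ==> t <= T ==>
   mom_le M 2 (q * (t - s) powr a) (%w. ?Q s t w - X s t w) &
   mom_le M 2 (q * (t - s) powr b) (CE s (%w. ?Q s t w - X s t w))"
  using sew3 by blast
 have fin: "mom_le M 2 (q * (t - s) powr a) (increment_error J Z Z' s t) &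
    mom_le M 2 (q * (t - s) powr b) (CE s (increment_error J Z Z' s t))"
  if st: "0 <= s" "s <= t" "t <= T" for s t
 proof -
  have s: "0 <= s" "s <= T" and t: "0 <= t" "t <= T" using st by auto
  have Fs: "subalgebra M (Fil s)" using s by (rule Fil_subalgebra)
  have JM: "J u \<in> borel_measurable M" if "0 <= u" "u <= T" for u using J[OF that] by (simp add: has_rough_integral_def)
  have EM: "increment_error J Z Z' s t \<in> borel_measurable M"
   unfolding increment_error_def[abs_def]
   by (intro borel_measurable_diff meas_germ JM MM s t)
  note qs = q(2)[OF st, THEN conjunct1] and qc = q(2)[OF st, THEN conjunct2]
  have eq: "AE w in M. increment_error J Z Z' s t w = ?Q s t w - X s t w"
   using Jinc[OF st] by eventually_elim (simp add: increment_error_def G_def X_eq[OF s])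
  show ?thesis
   using mom_le_cong_weaken[OF qs eq EM order_refl]
    mom_le_cong_weaken[OF qc cond_expectation_cong[OF Fs eq EM mom_le_measurable[OF qs]]
     measurable_from_subalg[OF Fs meas_cond_expectation] order_refl] by simp
 qed
 have fin': "1 / 2 < a & 1 < \<alpha> + a & a <= 2 & 1 < b & b <= 2 & (\<forall>s t. 0 <= s --> s <= t --> t <= T -->
   mom_le M 2 (q * (t - s) powr a) (increment_error J Z Z' s t) &
   mom_le M 2 (q * (t - s) powr b) (CE s (increment_error J Z Z' s t)))"
 proof (intro conjI allI impI)
  fix s t assume st: "0 <= s" "s <= t" "t <= T"
  show "mom_le M 2 (q * (t - s) powr a) (increment_error J Z Z' s t)"
   "mom_le M 2 (q * (t - s) powr b) (CE s (increment_error J Z Z' s t))"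
   using fin[OF st] by auto
 qed (use ab in linarith)+
 show ?thesis using fin' J0 q(1) by blast
qed

end

section \<open>Moment orders\<close>

context filtered_prob_space begin

text \<open>The diagonal is excluded because \<open>0 powr 0 = 0\<close> would force bounded processes to vanish there.\<close>

definition mom_order :: "nat => real => (real => real => 'a => 'v::real_normed_vector) => bool" where
 "mom_order p e X \<longleftrightarrow> (\<exists>k\<ge>0. \<forall>s t. 0 <= s --> s < t --> t <= T --> mom_le M p (k * (t - s) powr e) (X s t))"

lemma mom_orderI:
 assumes "0 <= k" "!!s t. 0 <= s ==> s < t ==> t <= T ==> mom_le M p (k * (t - s) powr e) (X s t)"
 shows "mom_order p e X"
 unfolding mom_order_def using assms by blast

lemma mom_order_measurable: "mom_order p e X ==> 0 <= s ==> s < t ==> t <= T ==> X s t \<in> borel_measurable M"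
 unfolding mom_order_def using mom_le_measurable by blast

lemma mom_order_integrable:
 fixes X :: "real => real => 'a => 'v::euclidean_space"
 shows "mom_order p e X ==> 0 < p ==> 0 <= s ==> s < t ==> t <= T ==> integrable M (X s t)"
 unfolding mom_order_def using mom_le_integrable by blast

lemma mom_order_cong:
 assumes "mom_order p e X" "!!s t. 0 <= s ==> s < t ==> t <= T ==> AE w in M. Y s t w = X s t w"
  "!!s t. 0 <= s ==> s < t ==> t <= T ==> Y s t \<in> borel_measurable M"
 shows "mom_order p e Y"
proof -
 obtain k where k: "0 <= k" "!!s t. 0 <= s ==> s < t ==> t <= T ==> mom_le M p (k * (t - s) powr e) (X s t)"
  using assms(1) unfolding mom_order_def by blast
 show ?thesis by (rule mom_orderI[OF k(1)]) (rule mom_le_cong_weaken[OF k(2) assms(2,3) order_refl])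
qed

lemma mom_order_add:
 fixes X Y :: "real => real => 'a => 'v::{real_normed_vector, second_countable_topology}"
 assumes p: "even p" "0 < p" and "mom_order p e X" "mom_order p e Y"
 shows "mom_order p e (%s t w. X s t w + Y s t w)"
proof -
 obtain k where k: "0 <= k" "!!s t. 0 <= s ==> s < t ==> t <= T ==> mom_le M p (k * (t - s) powr e) (X s t)"
  using assms(3) unfolding mom_order_def by blast
 obtain l where l: "0 <= l" "!!s t. 0 <= s ==> s < t ==> t <= T ==> mom_le M p (l * (t - s) powr e) (Y s t)"
  using assms(4) unfolding mom_order_def by blast
 show ?thesis
  by (rule mom_orderI[of "k + l"]) (use k(1) l(1) mom_le_add[OF k(2) l(2) p] in "auto simp: distrib_right")
qed

lemma mom_order_dominated:
 assumes X: "mom_order p e X" and c: "0 <= c"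
  and meas: "!!s t. 0 <= s ==> s < t ==> t <= T ==> Y s t \<in> borel_measurable M"
  and dom: "!!s t. 0 <= s ==> s < t ==> t <= T ==> AE w in M. norm (Y s t w) <= c * (t - s) powr d * norm (X s t w)"
 shows "mom_order p (d + e) Y"
proof -
 obtain k where k: "0 <= k" "!!s t. 0 <= s ==> s < t ==> t <= T ==> mom_le M p (k * (t - s) powr e) (X s t)"
  using X unfolding mom_order_def by blast
 show ?thesis
 proof (rule mom_orderI[of "c * k"])
  fix s t assume st: "0 <= s" "s < t" "t <= T"
  have "mom_le M p ((c * (t - s) powr d) * (k * (t - s) powr e)) (Y s t)"
   using c by (intro mom_le_AE_bound[OF k(2)[OF st] _ meas[OF st] dom[OF st]]) auto
  then show "mom_le M p (c * k * (t - s) powr (d + e)) (Y s t)" by (simp add: powr_add mult_ac)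
 qed (use c k in auto)
qed

lemma mom_order_bounded:
 fixes Y :: "real => real => 'a => 'v::{real_normed_vector, second_countable_topology}"
 assumes c: "0 <= c"
  and meas: "!!s t. 0 <= s ==> s < t ==> t <= T ==> Y s t \<in> borel_measurable M"
  and dom: "!!s t. 0 <= s ==> s < t ==> t <= T ==> AE w in M. norm (Y s t w) <= c * (t - s) powr e"
 shows "mom_order p e Y"
 by (rule mom_orderI[OF c]) (use c in "auto intro!: mom_le_bounded meas dom")

lemma mom_order_bilinear:
 assumes X: "mom_order p e X" and c: "0 <= c" and H: "!!a b. norm (H a b) <= norm a * norm b"
  and meas: "!!g x. g \<in> borel_measurable M ==> x \<in> borel_measurable M ==> (%w. H (g w) (x w)) \<in> borel_measurable M"
  and G: "!!s t. 0 <= s ==> s < t ==> t <= T ==> G s t \<in> borel_measurable M"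
   "!!s t. 0 <= s ==> s < t ==> t <= T ==> AE w in M. norm (G s t w) <= c * (t - s) powr d"
 shows "mom_order p (d + e) (%s t w. H (G s t w) (X s t w))"
proof (rule mom_order_dominated[OF X c])
 fix s t assume st: "0 <= s" "s < t" "t <= T"
 show "(%w. H (G s t w) (X s t w)) \<in> borel_measurable M"
  by (rule meas[OF G(1)[OF st] mom_order_measurable[OF X st]])
 show "AE w in M. norm (H (G s t w) (X s t w)) <= c * (t - s) powr d * norm (X s t w)"
  using G(2)[OF st] by eventually_elim (rule order_trans[OF H mult_right_mono[OF _ norm_ge_zero]])
qed

lemma mom_order_weaken:
 assumes "mom_order p e' X" "e <= e'" "e' <= e + 3"
 shows "mom_order p e X"
proof -
 obtain k where k: "0 <= k" "!!s t. 0 <= s ==> s < t ==> t <= T ==> mom_le M p (k * (t - s) powr e') (X s t)"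
  using assms(1) unfolding mom_order_def by blast
 show ?thesis
 proof (rule mom_orderI[of "k * (1 + T) powr 3"])
  fix s t assume st: "0 <= s" "s < t" "t <= T"
  have "(t - s) powr e' <= (1 + T) powr 3 * (t - s) powr e" using st assms by (intro powr_le_powr_lower) auto
  from mult_left_mono[OF this k(1)]
  show "mom_le M p (k * (1 + T) powr 3 * (t - s) powr e) (X s t)"
   by (intro mom_le_weaken[OF k(2)[OF st]]) (simp add: mult.assoc)
 qed (use k in simp)
qed

lemma mom_order_cond_expectation:
 fixes X :: "real => real => 'a => 'v::euclidean_space"
 assumes p: "even p" "0 < p" and X: "mom_order p e X"
 shows "mom_order p e (%s t. CE s (X s t))"
proof -
 obtain k where k: "0 <= k" "!!s t. 0 <= s ==> s < t ==> t <= T ==> mom_le M p (k * (t - s) powr e) (X s t)"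
  using X unfolding mom_order_def by blast
 show ?thesis
 proof (rule mom_orderI[of "real DIM('v) * k"])
  fix s t assume st: "0 <= s" "s < t" "t <= T"
  have "subalgebra M (Fil s)" using st by (intro Fil_subalgebra) auto
  from mom_le_cond_expectation[OF this p k(2)[OF st]]
  show "mom_le M p (real DIM('v) * k * (t - s) powr e) (CE s (X s t))" by (simp add: mult.assoc)
 qed (use k in simp)
qed

lemma mom_order_cond_expectation_add:
 fixes X Y :: "real => real => 'a => 'v::euclidean_space"
 assumes p: "even p" "0 < p" and i: "mom_order p d X" "mom_order p d' Y"
  and m: "mom_order p e (%s t. CE s (X s t))" "mom_order p e (%s t. CE s (Y s t))"
 shows "mom_order p e (%s t. CE s (%w. X s t w + Y s t w))"
proof (rule mom_order_cong[OF mom_order_add[OF p m]])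
 fix s t assume st: "0 <= s" "s < t" "t <= T"
 have G: "subalgebra M (Fil s)" using st by (intro Fil_subalgebra) auto
 show "AE w in M. CE s (%w. X s t w + Y s t w) w =
   CE s (X s t) w + CE s (Y s t) w"
  by (rule cond_expectation_add[OF G mom_order_integrable[OF i(1) p(2) st] mom_order_integrable[OF i(2) p(2) st]])
 show "CE s (%w. X s t w + Y s t w) \<in> borel_measurable M"
  by (rule measurable_from_subalg[OF G meas_cond_expectation])
qed

end

section \<open>Regularity of the solution\<close>

context rough_solution begin

abbreviation "integrand_phi x \<equiv> integrand F f (phi x)"
abbreviation "deriv_phi x \<equiv> integrand_deriv F F' f f' (phi x)"

lemma integrand_deriv_eq:
 "integrand_deriv F F' f f' \<psi> t w = apply_deriv (F' t w) (\<psi> t w) + left_mult (F t w) (integrand F f \<psi> t w) + f' t w"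
 by (simp add: integrand_deriv_def apply_deriv_def left_mult_def vec_eq_iff)

lemma local_error_eq: "local_error \<psi> s t = increment_error \<psi> (integrand F f \<psi>) (integrand_deriv F F' f f' \<psi>) s t"
 by (rule ext) (simp add: increment_error_def local_error_def germ_integrand src_def)

lemma f_measM: "0 <= t ==> t <= T ==> f t \<in> borel_measurable M" "0 <= t ==> t <= T ==> f' t \<in> borel_measurable M"
 using Fil_meas_M[OF f_meas(1)] Fil_meas_M[OF f_meas(2)] by auto

lemma integrand_meas:
 assumes "\<psi> t \<in> borel_measurable G" "F t \<in> borel_measurable G" "f t \<in> borel_measurable G"
 shows "integrand F f \<psi> t \<in> borel_measurable G"
 unfolding integrand_def[abs_def] by (intro borel_measurable_add meas_lin_app assms)

lemma integrand_deriv_meas: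
 assumes "\<psi> t \<in> borel_measurable G" "F t \<in> borel_measurable G" "f t \<in> borel_measurable G" "F' t \<in> borel_measurable G" "f' t \<in> borel_measurable G"
 shows "integrand_deriv F F' f f' \<psi> t \<in> borel_measurable G"
 unfolding integrand_deriv_eq[abs_def]
 by (intro borel_measurable_add meas_apply_deriv meas_left_mult integrand_meas assms)

lemma phi_measM: "0 <= t ==> t <= T ==> phi x t \<in> borel_measurable M"
 using Fil_meas_M[OF phi_meas] by auto

lemmas phi_process_meas = phi_measM integrand_meas[OF phi_measM M_meas(5) f_measM(1)]
 integrand_deriv_meas[OF phi_measM M_meas(5) f_measM(1) M_meas(6) f_measM(2)]

lemmas lin_order = mom_order_bilinear[where H = lin_app, OF _ C0(1) norm_lin_app meas_lin_app]
 and left_order = mom_order_bilinear[where H = left_mult, OF _ C0(1) norm_left_mult meas_left_mult]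
 and deriv_order = mom_order_bilinear[where H = apply_deriv, OF _ C0(1) norm_apply_deriv meas_apply_deriv]

lemma phi_order_0:
 assumes p: "even p" "2 <= p"
 shows "mom_order p 0 (%s t. phi x s)" "mom_order p 0 (%s t. phi x t)"
proof -
 obtain k where k: "0 <= k" "!!t. 0 <= t ==> t <= T ==> mom_le M p k (phi x t)"
  using phi_moments[OF p, of x] by blast
 show "mom_order p 0 (%s t. phi x s)" "mom_order p 0 (%s t. phi x t)"
  by (rule mom_orderI[OF k(1)], use k(2) in simp)+
qed

lemma integrand_order_0:
 assumes p: "even p" "2 <= p"
 shows "mom_order p 0 (%s t. integrand_phi x s)" "mom_order p 0 (%s t. deriv_phi x s)"
proof -
 have p0: "0 < p" using p by simp
 have "mom_order p (0 + 0) (%s t w. lin_app (F s w) (phi x s w))"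
  by (rule lin_order[OF phi_order_0(1)[OF p]]) (use M_meas F_bound F_incr in auto)
 moreover have "mom_order p 0 (%s t. f s)"
  by (rule mom_order_bounded[OF C0(1)]) (use f_measM f_bound(1) in auto)
 ultimately show 1: "mom_order p 0 (%s t. integrand_phi x s)"
  unfolding integrand_def[abs_def] using mom_order_add[OF p(1) p0] by simp
 have "mom_order p (0 + 0) (%s t w. apply_deriv (F' s w) (phi x s w))"
  by (rule deriv_order[OF phi_order_0(1)[OF p]]) (use M_meas F_bound F_incr in auto)
 then have a1: "mom_order p 0 (%s t w. apply_deriv (F' s w) (phi x s w))" by simp
 have "mom_order p (0 + 0) (%s t w. left_mult (F s w) (integrand_phi x s w))"
  by (rule left_order[OF 1]) (use M_meas F_bound F_incr in auto)
 then have a2: "mom_order p 0 (%s t w. left_mult (F s w) (integrand_phi x s w))" by simp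
 have a3: "mom_order p 0 (%s t. f' s)"
  by (rule mom_order_bounded[OF C0(1)]) (use f_measM f_bound(2) in auto)
 show "mom_order p 0 (%s t. deriv_phi x s)"
  unfolding integrand_deriv_eq[abs_def] by (intro mom_order_add p p0 a1 a2 a3)
qed

lemma local_error_orders:
 assumes p: "even p" "2 <= p"
 shows "mom_order p aS (local_error (phi x))"
  "mom_order p bS (%s t. CE s (local_error (phi x) s t))"
proof -
 obtain k where k: "0 <= k" "!!s t. 0 <= s ==> s <= t ==> t <= T ==> mom_le M p (k * (t - s) powr aS) (local_error (phi x) s t)"
  "!!s t. 0 <= s ==> s <= t ==> t <= T ==> mom_le M p (k * (t - s) powr bS) (CE s (local_error (phi x) s t))"
  using local_error_phi_bounds[OF p, of x] by blast
 show "mom_order p aS (local_error (phi x))"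
  "mom_order p bS (%s t. CE s (local_error (phi x) s t))"
  by (rule mom_orderI[OF k(1)], use k(2,3) in simp)+
qed

lemma germ_orders:
 assumes p: "even p" "2 <= p"
 shows "mom_order p \<alpha> (%s t w. lin_app (integrand_phi x s w) (\<eta> t - \<eta> s))"
  "mom_order p (2 * \<alpha>) (%s t w. bilin_app (deriv_phi x s w) (e2 s t))"
proof -
 have "mom_order p (\<alpha> + 0) (%s t w. lin_app (integrand_phi x s w) (\<eta> t - \<eta> s))"
 proof (rule mom_order_dominated[OF integrand_order_0(1)[OF p] C0(1)])
  fix s t assume st: "0 <= s" "s < t" "t <= T"
  have "norm (lin_app (integrand_phi x s w) (\<eta> t - \<eta> s)) <= norm (integrand_phi x s w) * (C * (t - s) powr \<alpha>)" for w
   using eta[of s t] st by (intro order_trans[OF norm_lin_app] mult_left_mono) auto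
  then show "AE w in M. norm (lin_app (integrand_phi x s w) (\<eta> t - \<eta> s)) <= C * (t - s) powr \<alpha> * norm (integrand_phi x s w)"
   by (intro AE_I2) (simp add: mult.commute)
  show "(%w. lin_app (integrand_phi x s w) (\<eta> t - \<eta> s)) \<in> borel_measurable M"
   using st by (intro meas_lin_app phi_process_meas) auto
 qed
 then show "mom_order p \<alpha> (%s t w. lin_app (integrand_phi x s w) (\<eta> t - \<eta> s))" by simp
 have "mom_order p (2 * \<alpha> + 0) (%s t w. bilin_app (deriv_phi x s w) (e2 s t))"
 proof (rule mom_order_dominated[OF integrand_order_0(2)[OF p] C0(1)])
  fix s t assume st: "0 <= s" "s < t" "t <= T"
  have "norm (bilin_app (deriv_phi x s w) (e2 s t)) <= norm (deriv_phi x s w) * (C * (t - s) powr (2 * \<alpha>))" for w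
   using e2[of s t] st by (intro order_trans[OF norm_bilin_app] mult_left_mono) auto
  then show "AE w in M. norm (bilin_app (deriv_phi x s w) (e2 s t)) <= C * (t - s) powr (2 * \<alpha>) * norm (deriv_phi x s w)"
   by (intro AE_I2) (simp add: mult.commute)
  show "(%w. bilin_app (deriv_phi x s w) (e2 s t)) \<in> borel_measurable M"
   using st by (intro meas_bilin_app phi_process_meas) auto
 qed
 then show "mom_order p (2 * \<alpha>) (%s t w. bilin_app (deriv_phi x s w) (e2 s t))" by simp
qed

lemma remainder_phi: "remainder \<eta> (phi x) (integrand_phi x) s t w = local_error (phi x) s t w + bilin_app (deriv_phi x s w) (e2 s t)"
 by (simp add: local_error_eq increment_error_def germ_def remainder_def incr_def)

lemma incr_phi: "incr (phi x) s t w = local_error (phi x) s t w + (lin_app (integrand_phi x s w) (\<eta> t - \<eta> s) + bilin_app (deriv_phi x s w) (e2 s t))"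
 by (simp add: local_error_eq increment_error_def germ_def incr_def)

lemma phi_order:
 assumes p: "even p" "2 <= p"
 shows "mom_order p \<alpha> (incr (phi x))"
  "mom_order p (\<alpha> + \<beta>) (%s t. CE s (remainder \<eta> (phi x) (integrand_phi x) s t))"
  "mom_order p \<alpha> (remainder \<eta> (phi x) (integrand_phi x))"
proof -
 have p0: "0 < p" using p by simp
 have 0: "mom_order p \<alpha> (%s t w. bilin_app (deriv_phi x s w) (e2 s t))" "mom_order p \<alpha> (local_error (phi x))"
  by (rule mom_order_weaken[OF germ_orders(2)[OF p]] mom_order_weaken[OF local_error_orders(1)[OF p]], use ex aS in "linarith, linarith")+
 show "mom_order p \<alpha> (incr (phi x))"
  unfolding incr_phi[abs_def] by (intro mom_order_add p p0 0 germ_orders(1))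
 show "mom_order p \<alpha> (remainder \<eta> (phi x) (integrand_phi x))"
  unfolding remainder_phi[abs_def] by (intro mom_order_add p p0 0)
 have 1: "mom_order p (\<alpha> + \<beta>) (%s t. CE s (%w. bilin_app (deriv_phi x s w) (e2 s t)))"
  using mom_order_cond_expectation[OF p(1) p0 germ_orders(2)[OF p, of x]]
  by (rule mom_order_weaken) (use ex in linarith)+
 have 2: "mom_order p (\<alpha> + \<beta>) (%s t. CE s (local_error (phi x) s t))"
  by (rule mom_order_weaken[OF local_error_orders(2)[OF p]]) (use ex bS bA in linarith)+
 show "mom_order p (\<alpha> + \<beta>) (%s t. CE s (remainder \<eta> (phi x) (integrand_phi x) s t))"
  unfolding remainder_phi[abs_def] by (rule mom_order_cond_expectation_add[OF p(1) p0 0(2,1) 2 1])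
qed

lemma integrand_order:
 assumes p: "even p" "2 <= p"
 shows "mom_order p \<beta> (incr (integrand_phi x))"
  "mom_order p \<beta>' (incr (deriv_phi x))"
proof -
 have p0: "0 < p" using p by simp
 have "mom_order p (0 + \<alpha>) (%s t w. lin_app (F t w) (incr (phi x) s t w))"
  by (rule lin_order[OF phi_order(1)[OF p]]) (use M_meas F_bound F_incr in auto)
 then have z1: "mom_order p \<beta> (%s t w. lin_app (F t w) (incr (phi x) s t w))"
  by (rule mom_order_weaken) (use ex in linarith)+
 have z2: "mom_order p (\<beta> + 0) (%s t w. lin_app (F t w - F s w) (phi x s w))"
  by (rule lin_order[OF phi_order_0(1)[OF p]]) (use M_meas F_bound F_incr in auto)
 have z3: "mom_order p \<beta> (%s t w. f t w - f s w)"
  by (rule mom_order_bounded[OF C0(1)]) (use f_measM f_incr(1) in auto)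
 have eq: "incr (integrand_phi x) = (%s t w. lin_app (F t w) (incr (phi x) s t w) + (lin_app (F t w - F s w) (phi x s w) + (f t w - f s w)))"
  by (intro ext) (simp add: incr_def integrand_def lin_app.diff_left lin_app.diff_right)
 show Z: "mom_order p \<beta> (incr (integrand_phi x))"
  unfolding eq by (intro mom_order_add p p0 z1 z3 z2[simplified])
 have "mom_order p (0 + \<alpha>) (%s t w. apply_deriv (F' t w) (incr (phi x) s t w))"
  by (rule deriv_order[OF phi_order(1)[OF p]]) (use M_meas F_bound F_incr in auto)
 then have d1: "mom_order p \<beta>' (%s t w. apply_deriv (F' t w) (incr (phi x) s t w))"
  by (rule mom_order_weaken) (use ex in linarith)+
 have d2: "mom_order p (\<beta>' + 0) (%s t w. apply_deriv (F' t w - F' s w) (phi x s w))"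
  by (rule deriv_order[OF phi_order_0(1)[OF p]]) (use M_meas F_bound F_incr in auto)
 have "mom_order p (0 + \<beta>) (%s t w. left_mult (F t w) (incr (integrand_phi x) s t w))"
  by (rule left_order[OF Z]) (use M_meas F_bound F_incr in auto)
 then have d3: "mom_order p \<beta>' (%s t w. left_mult (F t w) (incr (integrand_phi x) s t w))"
  by (rule mom_order_weaken) (use ex in linarith)+
 have "mom_order p (\<beta> + 0) (%s t w. left_mult (F t w - F s w) (integrand_phi x s w))"
  by (rule left_order[OF integrand_order_0(1)[OF p]]) (use M_meas F_bound F_incr in auto)
 then have d4: "mom_order p \<beta>' (%s t w. left_mult (F t w - F s w) (integrand_phi x s w))"
  by (rule mom_order_weaken) (use ex in linarith)+
 have d5: "mom_order p \<beta>' (%s t w. f' t w - f' s w)"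
  by (rule mom_order_bounded[OF C0(1)]) (use f_measM f_incr(2) in auto)
 have eq: "incr (deriv_phi x) = (%s t w. apply_deriv (F' t w) (incr (phi x) s t w) + (apply_deriv (F' t w - F' s w) (phi x s w) +
   (left_mult (F t w) (incr (integrand_phi x) s t w) + (left_mult (F t w - F s w) (integrand_phi x s w) + (f' t w - f' s w)))))"
  by (intro ext) (simp add: incr_def integrand_deriv_eq left_mult_linear apply_deriv_linear)
 show "mom_order p \<beta>' (incr (deriv_phi x))"
  unfolding eq by (intro mom_order_add p p0 d1 d3 d4 d5 d2[simplified])
qed

text \<open>The remainder of \<open>F \<phi> + f\<close> obeys a product rule; only the term \<open>F R\<close> with the remainder
 \<open>R\<close> of \<open>\<phi>\<close> requires the conditional expectation, and there \<open>F\<close> can be taken out.\<close>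

lemma remainder_integrand:
 "remainder \<eta> (integrand_phi x) (deriv_phi x) s t w = lin_app (F t w - F s w) (incr (phi x) s t w) +
  (lin_app (F t w - F s w - lin_app (F' s w) (\<eta> t - \<eta> s)) (phi x s w) +
  (rem_f s t w + lin_app (F s w) (remainder \<eta> (phi x) (integrand_phi x) s t w)))"
proof -
 have 1: "lin_app (deriv_phi x s w) (\<eta> t - \<eta> s) = lin_app (lin_app (F' s w) (\<eta> t - \<eta> s)) (phi x s w) +
   lin_app (F s w) (lin_app (integrand_phi x s w) (\<eta> t - \<eta> s)) + lin_app (f' s w) (\<eta> t - \<eta> s)"
  by (simp only: integrand_deriv_eq lin_app.add_left lin_app_apply_deriv lin_app_left_mult)
 have 2: "integrand_phi x t w - integrand_phi x s w = lin_app (F t w - F s w) (phi x t w - phi x s w) +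
   lin_app (F t w - F s w) (phi x s w) + lin_app (F s w) (phi x t w - phi x s w) + (f t w - f s w)"
  by (simp add: integrand_def lin_app.diff_left lin_app.diff_right)
 have 3: "lin_app (F t w - F s w - lin_app (F' s w) (\<eta> t - \<eta> s)) (phi x s w) =
   lin_app (F t w - F s w) (phi x s w) - lin_app (lin_app (F' s w) (\<eta> t - \<eta> s)) (phi x s w)"
  by (rule lin_app.diff_left)
 have 4: "lin_app (F s w) (phi x t w - phi x s w - lin_app (integrand_phi x s w) (\<eta> t - \<eta> s)) =
   lin_app (F s w) (phi x t w - phi x s w) - lin_app (F s w) (lin_app (integrand_phi x s w) (\<eta> t - \<eta> s))"
  by (rule lin_app.diff_right)
 show ?thesis
  unfolding remainder_def incr_def rem_f_def 1 2 3 4 by (simp add: algebra_simps)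
qed

lemma remainder_integrand_order:
 assumes p: "even p" "2 <= p"
 shows "mom_order p (\<beta> + \<beta>') (%s t. CE s (remainder \<eta> (integrand_phi x) (deriv_phi x) s t))"
proof -
 have p0: "0 < p" using p by simp
 let ?R = "remainder \<eta> (phi x) (integrand_phi x)"
 have "mom_order p (\<beta> + \<alpha>) (%s t w. lin_app (F t w - F s w) (incr (phi x) s t w))"
  by (rule lin_order[OF phi_order(1)[OF p]]) (use M_meas F_bound F_incr in auto)
 then have r1: "mom_order p (\<beta> + \<beta>') (%s t w. lin_app (F t w - F s w) (incr (phi x) s t w))"
  by (rule mom_order_weaken) (use ex in linarith)+
 have "mom_order p ((\<beta> + \<beta>') + 0) (%s t w. lin_app (F t w - F s w - lin_app (F' s w) (\<eta> t - \<eta> s)) (phi x s w))"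
  by (rule lin_order[OF phi_order_0(1)[OF p]]) (use M_meas F_rem in "auto intro!: borel_measurable_diff meas_lin_app")
 then have r2: "mom_order p (\<beta> + \<beta>') (%s t w. lin_app (F t w - F s w - lin_app (F' s w) (\<eta> t - \<eta> s)) (phi x s w))" by simp
 have fM: "rem_f s t \<in> borel_measurable M" if "0 <= s" "s < t" "t <= T" for s t
  using that by (intro Fil_meas_M[OF rem_f_meas]) auto
 have r3: "mom_order p 0 (%s t. rem_f s t)"
 proof (rule mom_order_bounded[of "2 * C + C * (C * (1 + T))", OF _ fM])
  show "0 <= 2 * C + C * (C * (1 + T))" using C0 T_pos by auto
  fix s t assume st: "0 <= s" "s < t" "t <= T"
  then have s: "0 <= s" "s <= T" and t: "0 <= t" "t <= T" by auto
  have e: "norm (\<eta> t - \<eta> s) <= C * (1 + T)"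
  proof -
   have "(t - s) powr \<alpha> <= (1 + T) powr \<alpha>" using st ex by (intro powr_mono2) auto
   also have "... <= (1 + T) powr 1" using T_pos ex by (intro powr_mono) auto
   finally have "C * (t - s) powr \<alpha> <= C * (1 + T)" using C0 T_pos by (intro mult_left_mono) auto
   then show ?thesis using eta[of s t] st by auto
  qed
  show "AE w in M. norm (rem_f s t w) <= (2 * C + C * (C * (1 + T))) * (t - s) powr 0"
   using f_bound(1)[OF s] f_bound(1)[OF t] f_bound(2)[OF s]
  proof eventually_elim
   case (elim w)
   have "norm (lin_app (f' s w) (\<eta> t - \<eta> s)) <= C * (C * (1 + T))"
    by (rule order_trans[OF norm_lin_app]) (use elim e C0 in "auto intro!: mult_mono")
   then have "norm (rem_f s t w) <= 2 * C + C * (C * (1 + T))"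
    unfolding rem_f_def using elim norm_triangle_ineq4[of "f t w - f s w" "lin_app (f' s w) (\<eta> t - \<eta> s)"]
     norm_triangle_ineq4[of "f t w" "f s w"] by linarith
   then show ?case using st by simp
  qed
 qed
 have c3: "mom_order p (\<beta> + \<beta>') (%s t. CE s (rem_f s t))"
 proof (rule mom_order_bounded[OF C0(1)])
  fix s t assume st: "0 <= s" "s < t" "t <= T"
  show "AE w in M. norm (CE s (rem_f s t) w) <= C * (t - s) powr (\<beta> + \<beta>')"
   using f_rem[of s t] st unfolding rem_f_def[abs_def] by simp
  show "CE s (rem_f s t) \<in> borel_measurable M"
   using st by (intro measurable_from_subalg[OF Fil_subalgebra meas_cond_expectation]) auto
 qed
 define Fb where "Fb s w = (if norm (F s w) <= C then F s w else 0)" for s w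
 have Fb: "norm (Fb s w) <= C" for s w using C0 by (simp add: Fb_def)
 have FbF: "AE w in M. Fb s w = F s w" if "0 <= s" "s <= T" for s
  using F_bound(1)[OF that] by eventually_elim (simp add: Fb_def)
 have Fbm: "Fb s \<in> borel_measurable (Fil s)" if "0 <= s" "s <= T" for s
 proof -
  note [measurable] = F_meas(1)[OF that]
  show ?thesis unfolding Fb_def[abs_def] by measurable
 qed
 have r4: "mom_order p (0 + \<alpha>) (%s t w. lin_app (F s w) (?R s t w))"
  by (rule lin_order[OF phi_order(3)[OF p]]) (use M_meas F_bound F_incr in auto)
 have "mom_order p (0 + (\<alpha> + \<beta>)) (%s t. CE s (%w. lin_app (F s w) (?R s t w)))"
 proof (rule mom_order_dominated[OF phi_order(2)[OF p] C0(1)])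
  fix s t assume st: "0 <= s" "s < t" "t <= T"
  then have s: "0 <= s" "s <= T" by auto
  have G: "subalgebra M (Fil s)" using s by (rule Fil_subalgebra)
  show "CE s (%w. lin_app (F s w) (?R s t w)) \<in> borel_measurable M"
   by (rule measurable_from_subalg[OF G meas_cond_expectation])
  have RM: "?R s t \<in> borel_measurable M" by (rule mom_order_measurable[OF phi_order(3)[OF p] st])
  have "AE w in M. lin_app (F s w) (?R s t w) = lin_app (Fb s w) (?R s t w)"
   using FbF[OF s] by eventually_elim simp
  then have e1: "AE w in M. CE s (%w. lin_app (F s w) (?R s t w)) w = CE s (%w. lin_app (Fb s w) (?R s t w)) w"
   by (rule cond_expectation_cong[OF G]) (intro meas_lin_app RM M_meas(5)[OF s] Fil_meas_M[OF Fbm[OF s] s])+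
  have e2: "AE w in M. CE s (%w. lin_app (Fb s w) (?R s t w)) w = lin_app (Fb s w) (CE s (?R s t) w)"
  proof (rule cond_expectation_linear_map[where L = "%w. lin_app (Fb s w)" and c = C, OF G mom_order_integrable[OF phi_order(3)[OF p] p0 st]])
   show "linear (lin_app (Fb s w))" for w by (rule linearI) (simp_all add: lin_app.add_right lin_app.scaleR_right)
   show "(%w. lin_app (Fb s w) e) \<in> borel_measurable (Fil s)" for e
    by (intro meas_lin_app Fbm[OF s]) simp
   show "norm (lin_app (Fb s w) v) <= C * norm v" for v w
    by (rule order_trans[OF norm_lin_app mult_right_mono[OF Fb norm_ge_zero]])
  qed
  show "AE w in M. norm (CE s (%w. lin_app (F s w) (?R s t w)) w) <= C * (t - s) powr 0 * norm (CE s (?R s t) w)"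
   using e1 e2
  proof eventually_elim
   case (elim w)
   show ?case unfolding elim using st order_trans[OF norm_lin_app mult_right_mono[OF Fb norm_ge_zero]] by simp
  qed
 qed
 then have c4: "mom_order p (\<beta> + \<beta>') (%s t. CE s (%w. lin_app (F s w) (?R s t w)))"
  by (rule mom_order_weaken) (use ex in linarith)+
 have r34: "mom_order p 0 (%s t w. rem_f s t w + lin_app (F s w) (?R s t w))"
  by (rule mom_order_add[OF p(1) p0 r3 mom_order_weaken[OF r4]]) (use ex in linarith)+
 have r234: "mom_order p 0 (%s t w. lin_app (F t w - F s w - lin_app (F' s w) (\<eta> t - \<eta> s)) (phi x s w) + (rem_f s t w + lin_app (F s w) (?R s t w)))"
  by (rule mom_order_add[OF p(1) p0 mom_order_weaken[OF r2] r34]) (use ex in linarith)+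
 show ?thesis
  unfolding remainder_integrand[abs_def]
  by (intro mom_order_cond_expectation_add[OF p(1) p0 r1 r234] mom_order_cond_expectation_add[OF p(1) p0 r2 r34]
    mom_order_cond_expectation_add[OF p(1) p0 r3 r4] c3 c4 mom_order_cond_expectation[OF p(1) p0] r1 r2)
qed

end

section \<open>Norms of two-parameter processes\<close>

lemma sup_quotientD:
 assumes "(SUP (s, t) \<in> simplex2 T. N s t / ennreal ((t - s) powr \<gamma>)) < \<infinity>"
 obtains c where "0 <= c" "!!s t. 0 <= s ==> s < t ==> t <= T ==> N s t <= ennreal (c * (t - s) powr \<gamma>)"
proof -
 let ?S = "SUP (s, t) \<in> simplex2 T. N s t / ennreal ((t - s) powr \<gamma>)"
 define c where "c = enn2real ?S"
 have c: "?S = ennreal c" using assms by (simp add: c_def less_top)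
 have "N s t <= ennreal (c * (t - s) powr \<gamma>)" if st: "0 <= s" "s < t" "t <= T" for s t
 proof -
  have mem: "(s, t) \<in> simplex2 T" using st by (simp add: simplex2_def)
  let ?x = "ennreal ((t - s) powr \<gamma>)"
  have x: "?x \<noteq> 0" "?x \<noteq> top" using st by auto
  have "N s t / ?x <= ennreal c" using SUP_upper[OF mem, of "%(s, t). N s t / ennreal ((t - s) powr \<gamma>)"] c by simp
  then have "N s t / ?x * ?x <= ennreal c * ?x" by (rule mult_right_mono) simp
  moreover have "N s t / ?x * ?x = N s t" using x by (simp add: ennreal_divide_times ennreal_divide_self less_top)
  ultimately show ?thesis by (simp add: ennreal_mult c_def)
 qed
 then show ?thesis using that[of c] by (simp add: c_def)
qed

lemma sup_quotientI:
 assumes c: "0 <= c" and N: "!!s t. 0 <= s ==> s < t ==> t <= T ==> N s t <= ennreal (c * (t - s) powr \<gamma>)"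
 shows "(SUP (s, t) \<in> simplex2 T. N s t / ennreal ((t - s) powr \<gamma>)) < \<infinity>"
proof -
 have "(SUP (s, t) \<in> simplex2 T. N s t / ennreal ((t - s) powr \<gamma>)) <= ennreal c"
 proof (rule SUP_least)
  fix st assume "st \<in> simplex2 T"
  then obtain s t where st: "st = (s, t)" "0 <= s" "s < t" "t <= T" by (auto simp: simplex2_def)
  have "N s t / ennreal ((t - s) powr \<gamma>) <= ennreal (c * (t - s) powr \<gamma>) / ennreal ((t - s) powr \<gamma>)"
   by (rule divide_right_mono_ennreal[OF N[OF st(2-)]])
  also have "... = ennreal c" using c st by (simp add: divide_ennreal)
  finally show "(case st of (s, t) => N s t / ennreal ((t - s) powr \<gamma>)) <= ennreal c" by (simp add: st(1))
 qed
 then show ?thesis using order_le_less_trans[OF _ ennreal_less_top] by simp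
qed

lemma holder_normD:
 assumes "holder_norm T \<gamma> A < \<infinity>"
 obtains c where "0 <= c" "!!s t. 0 <= s ==> s < t ==> t <= T ==> norm (A s t) <= c * (t - s) powr \<gamma>"
proof -
 have "(SUP (s, t) \<in> simplex2 T. ennreal (norm (A s t)) / ennreal ((t - s) powr \<gamma>)) = holder_norm T \<gamma> A"
  unfolding holder_norm_def by (intro SUP_cong) (auto simp: simplex2_def divide_ennreal)
 with assms have "(SUP (s, t) \<in> simplex2 T. ennreal (norm (A s t)) / ennreal ((t - s) powr \<gamma>)) < \<infinity>" by simp
 then obtain c where c: "0 <= c" "!!s t. 0 <= s ==> s < t ==> t <= T ==> ennreal (norm (A s t)) <= ennreal (c * (t - s) powr \<gamma>)"
  by (rule sup_quotientD) blast
 show ?thesis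
 proof (rule that[OF c(1)])
  fix s t assume "0 <= s" "s < t" "t <= T"
  from c(2)[OF this] c(1) show "norm (A s t) <= c * (t - s) powr \<gamma>" by simp
 qed
qed

lemma Lp_norm_infinityD:
 assumes "Lp_norm M \<infinity> X <= ennreal c" "0 <= c"
 shows "AE w in M. norm (X w) <= c"
proof -
 have "AE w in M. ennreal (norm (X w)) <= esssup M (%w. ennreal (norm (X w)))" by (rule esssup_AE)
 then show ?thesis
 proof eventually_elim
  case (elim w)
  then have "ennreal (norm (X w)) <= ennreal c" using assms(1) by (simp add: Lp_norm_def)
  then show ?case using assms(2) by simp
 qed
qed

lemma Lp_norm_infinityI:
 fixes X :: "'a => 'v::real_normed_vector"
 assumes X: "X \<in> borel_measurable M" and "AE w in M. norm (X w) <= c"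
 shows "Lp_norm M \<infinity> X <= ennreal c"
proof -
 have "AE w in M. ennreal (norm (X w)) <= ennreal c" using assms(2) by eventually_elim (rule ennreal_leI)
 moreover have "(%w. ennreal (norm (X w))) \<in> borel_measurable M" using X by simp
 ultimately show ?thesis unfolding Lp_norm_def by (simp add: esssup_I)
qed

lemma ennreal_add_mult: "0 <= a ==> 0 <= b ==> 0 <= y ==> ennreal (a + b * y) = ennreal a + ennreal b * ennreal y"
 by (simp add: ennreal_mult)

context prob_space begin

text \<open>Instead of Hoelder's inequality, \<open>x powr m \<le> c powr m * (1 + (x / c) ^ p)\<close> is integrated; this
 costs the factor two.\<close>

lemma Lp_norm_le_moment:
 fixes X :: "'a => 'v::real_normed_vector"
 assumes X: "mom_le M p c X" and m: "1 <= m" "m <= real p"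
 shows "Lp_norm M (ennreal m) X <= ennreal (2 * c)"
proof -
 note [measurable] = mom_le_measurable[OF X]
 have c0: "0 <= c" by (rule mom_le_nonneg[OF X])
 have p0: "0 < p" using m by (cases p) auto
 let ?I = "\<integral>\<^sup>+ w. ennreal (norm (X w) powr m) \<partial>M"
 have I: "?I <= ennreal (2 * c powr m)"
 proof (cases "c = 0")
  case True
  with X p0 have "AE w in M. X w = 0" by (intro mom_le_0_AE) auto
  then have "?I = (\<integral>\<^sup>+ w. 0 \<partial>M)" by (intro nn_integral_cong_AE, eventually_elim) simp
  then show ?thesis by simp
 next
  case False
  then have c: "0 < c" using c0 by simp
  have pw: "y powr m <= c powr m + c powr m / c ^ p * y ^ p" if y: "0 <= y" for y
  proof (cases "y <= c")
   case True
   then have "y powr m <= c powr m" using y m by (intro powr_mono2) auto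
   moreover have "0 <= c powr m / c ^ p * y ^ p" using y c by simp
   ultimately show ?thesis by linarith
  next
   case False
   have "(y / c) powr m <= (y / c) powr real p" using False c m by (intro powr_mono) (auto simp: field_simps)
   also have "... = (y / c) ^ p" using False c y by (intro powr_realpow) auto
   finally have "c powr m * (y / c) powr m <= c powr m * (y / c) ^ p" by (intro mult_left_mono) auto
   moreover have "c powr m * (y / c) powr m = y powr m" using c y by (simp add: powr_mult[symmetric])
   ultimately show ?thesis by (simp add: power_divide add_increasing)
  qed
  have "?I <= (\<integral>\<^sup>+ w. ennreal (c powr m) + ennreal (c powr m / c ^ p) * ennreal (norm (X w) ^ p) \<partial>M)"
  proof (rule nn_integral_mono)
   fix w
   have "ennreal (norm (X w) powr m) <= ennreal (c powr m + c powr m / c ^ p * norm (X w) ^ p)"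
    by (intro ennreal_leI pw) simp
   also have "... = ennreal (c powr m) + ennreal (c powr m / c ^ p) * ennreal (norm (X w) ^ p)"
    using c by (intro ennreal_add_mult) auto
   finally show "ennreal (norm (X w) powr m) <= ..." .
  qed
  also have "... = ennreal (c powr m) + ennreal (c powr m / c ^ p) * (\<integral>\<^sup>+ w. ennreal (norm (X w) ^ p) \<partial>M)"
   by (simp add: nn_integral_add nn_integral_cmult emeasure_space_1)
  also have "... <= ennreal (c powr m) + ennreal (c powr m / c ^ p) * ennreal (c ^ p)"
   using X by (intro add_left_mono mult_left_mono) (auto simp: mom_le_def)
  also have "... = ennreal (2 * c powr m)"
   using c by (simp add: ennreal_mult[symmetric] ennreal_plus[symmetric] del: ennreal_plus)
  finally show ?thesis .
 qed
 then have "enn2real ?I <= 2 * c powr m" by (intro enn2real_leI) auto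
 then have "enn2real ?I powr (1 / m) <= (2 * c powr m) powr (1 / m)" using m by (intro powr_mono2) auto
 also have "... = 2 powr (1 / m) * c" using c0 m by (simp add: powr_mult powr_powr)
 also have "... <= 2 powr 1 * c" using c0 m by (intro mult_right_mono powr_mono) auto
 finally have "ennreal (enn2real ?I powr (1 / m)) <= ennreal (2 * c)" by (intro ennreal_leI) simp
 moreover have "?I \<noteq> \<infinity>" using I by (auto simp: top_unique)
 ultimately show ?thesis using m by (simp add: Lp_norm_def Let_def)
qed

lemma mom_le_if_Lp_norm_le:
 fixes X :: "'a => 'v::real_normed_vector"
 assumes L: "Lp_norm M (ennreal m) X <= ennreal c" and c0: "0 <= c" and m: "2 <= m" and X: "X \<in> borel_measurable M"
 shows "mom_le M 2 (2 * c) X"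
proof -
 note [measurable] = X
 let ?I = "\<integral>\<^sup>+ w. ennreal (norm (X w) powr m) \<partial>M"
 have fin: "?I \<noteq> \<infinity>" using L m by (auto simp: Lp_norm_def Let_def top_unique)
 then have "ennreal (enn2real ?I powr (1 / m)) <= ennreal c" using L m by (simp add: Lp_norm_def Let_def)
 then have "enn2real ?I powr (1 / m) <= c" using c0 by simp
 then have "(enn2real ?I powr (1 / m)) powr m <= c powr m" using m by (intro powr_mono2) auto
 moreover have "(enn2real ?I powr (1 / m)) powr m = enn2real ?I" using m by (simp add: powr_powr)
 ultimately have "enn2real ?I <= c powr m" by simp
 moreover have "?I = ennreal (enn2real ?I)" using fin by (simp add: less_top)
 ultimately have I: "?I <= ennreal (c powr m)" by (metis ennreal_leI)
 have "(\<integral>\<^sup>+ w. ennreal (norm (X w) ^ 2) \<partial>M) <= ennreal ((2 * c)\<^sup>2)"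
 proof (cases "c = 0")
  case True
  then have "?I = 0" using I m by (simp add: powr_def)
  then have "AE w in M. ennreal (norm (X w) powr m) = 0" by (subst (asm) nn_integral_0_iff_AE) auto
  then have "AE w in M. ennreal (norm (X w) ^ 2) = 0"
  proof eventually_elim
   case (elim w)
   have "\<not> 0 < norm (X w)"
   proof
    assume "0 < norm (X w)"
    then have "0 < norm (X w) powr m" by simp
    with elim show False by (simp add: ennreal_eq_0_iff)
   qed
   then show ?case by simp
  qed
  then have "(\<integral>\<^sup>+ w. ennreal (norm (X w) ^ 2) \<partial>M) = 0" by (subst nn_integral_0_iff_AE) auto
  then show ?thesis by simp
 next
  case False
  then have c: "0 < c" using c0 by simp
  have pw: "y\<^sup>2 <= c\<^sup>2 + c\<^sup>2 / c powr m * y powr m" if y: "0 <= y" for y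
  proof (cases "y <= c")
   case True
   then have "y\<^sup>2 <= c\<^sup>2" using y by (intro power_mono) auto
   moreover have "0 <= c\<^sup>2 / c powr m * y powr m" by simp
   ultimately show ?thesis by linarith
  next
   case False
   have "(y / c)\<^sup>2 = (y / c) powr 2" using False c y by (simp add: powr_numeral)
   also have "... <= (y / c) powr m" using False c m by (intro powr_mono) (auto simp: field_simps)
   finally have "c\<^sup>2 * (y / c)\<^sup>2 <= c\<^sup>2 * (y / c) powr m" by (intro mult_left_mono) auto
   moreover have "c\<^sup>2 * (y / c)\<^sup>2 = y\<^sup>2" using c by (simp add: power_divide)
   moreover have "(y / c) powr m = y powr m / c powr m" using c y by (simp add: powr_divide)
   ultimately show ?thesis by (simp add: add_increasing)
  qed
  have "(\<integral>\<^sup>+ w. ennreal (norm (X w) ^ 2) \<partial>M) <= (\<integral>\<^sup>+ w. ennreal (c\<^sup>2) + ennreal (c\<^sup>2 / c powr m) * ennreal (norm (X w) powr m) \<partial>M)"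
  proof (rule nn_integral_mono)
   fix w
   have "ennreal (norm (X w) ^ 2) <= ennreal (c\<^sup>2 + c\<^sup>2 / c powr m * norm (X w) powr m)"
    by (intro ennreal_leI pw) simp
   also have "... = ennreal (c\<^sup>2) + ennreal (c\<^sup>2 / c powr m) * ennreal (norm (X w) powr m)"
    using c by (intro ennreal_add_mult) auto
   finally show "ennreal (norm (X w) ^ 2) <= ..." .
  qed
  also have "... = ennreal (c\<^sup>2) + ennreal (c\<^sup>2 / c powr m) * ?I"
   by (simp add: nn_integral_add nn_integral_cmult emeasure_space_1)
  also have "... <= ennreal (c\<^sup>2) + ennreal (c\<^sup>2 / c powr m) * ennreal (c powr m)"
   using I by (intro add_left_mono mult_left_mono) auto
  also have "... = ennreal (2 * c\<^sup>2)"
   using c by (simp add: ennreal_mult[symmetric] ennreal_plus[symmetric] del: ennreal_plus)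
  also have "... <= ennreal ((2 * c)\<^sup>2)" by (intro ennreal_leI) (simp add: power_mult_distrib)
  finally show ?thesis .
 qed
 then show ?thesis using X c0 by (simp add: mom_le_def)
qed

end

context filtered_prob_space begin

lemma mom_order_two_param:
 fixes A :: "real => real => 'a => 'v::real_normed_vector"
 assumes "mom_order p \<gamma> A" "1 <= m" "m <= real p"
 shows "two_param_norm M T \<gamma> (ennreal m) A < \<infinity>"
proof -
 obtain k where k: "0 <= k" "!!s t. 0 <= s ==> s < t ==> t <= T ==> mom_le M p (k * (t - s) powr \<gamma>) (A s t)"
  using assms(1) unfolding mom_order_def by blast
 show ?thesis
  unfolding two_param_norm_def
  by (rule sup_quotientI[of "2 * k"]) (use k(1) Lp_norm_le_moment[OF k(2) assms(2,3)] in "auto simp: mult.assoc")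
qed

lemma two_param_mom_order:
 fixes A :: "real => real => 'a => 'v::real_normed_vector"
 assumes "two_param_norm M T \<gamma> (ennreal m) A < \<infinity>" "2 <= m"
  and A: "!!s t. 0 <= s ==> s < t ==> t <= T ==> A s t \<in> borel_measurable M"
 shows "mom_order 2 \<gamma> A"
proof -
 obtain c where c: "0 <= c" "!!s t. 0 <= s ==> s < t ==> t <= T ==> Lp_norm M (ennreal m) (A s t) <= ennreal (c * (t - s) powr \<gamma>)"
  using assms(1) unfolding two_param_norm_def by (rule sup_quotientD) blast
 show ?thesis
  by (rule mom_orderI[of "2 * c"])
   (use c(1) mom_le_if_Lp_norm_le[OF c(2) _ assms(2) A] in "auto simp: mult.assoc")
qed

lemma two_param_AE:
 fixes A :: "real => real => 'a => 'v::real_normed_vector"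
 assumes "two_param_norm M T \<gamma> \<infinity> A < \<infinity>"
 obtains c where "0 <= c" "!!s t. 0 <= s ==> s < t ==> t <= T ==> AE w in M. norm (A s t w) <= c * (t - s) powr \<gamma>"
proof -
 obtain c where c: "0 <= c" "!!s t. 0 <= s ==> s < t ==> t <= T ==> Lp_norm M \<infinity> (A s t) <= ennreal (c * (t - s) powr \<gamma>)"
  using assms unfolding two_param_norm_def by (rule sup_quotientD) blast
 show ?thesis by (rule that[OF c(1)]) (rule Lp_norm_infinityD[OF c(2)], use c(1) in auto)
qed

lemma AE_two_param:
 fixes A :: "real => real => 'a => 'v::real_normed_vector"
 assumes "0 <= c" "!!s t. 0 <= s ==> s < t ==> t <= T ==> A s t \<in> borel_measurable M"
  "!!s t. 0 <= s ==> s < t ==> t <= T ==> AE w in M. norm (A s t w) <= c * (t - s) powr \<gamma>"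
 shows "two_param_norm M T \<gamma> \<infinity> A < \<infinity>"
 unfolding two_param_norm_def by (rule sup_quotientI[OF assms(1)]) (rule Lp_norm_infinityI[OF assms(2,3)])

lemma controlled_adapted:
 assumes "controlled M Fil T \<eta> \<gamma> \<gamma>' q Z Z'" "0 <= t" "t <= T"
 shows "Z t \<in> borel_measurable (Fil t)" "Z' t \<in> borel_measurable (Fil t)" "Z t \<in> borel_measurable M" "Z' t \<in> borel_measurable M"
proof -
 have p: "progressive T Fil Z" "progressive T Fil Z'" using assms(1) unfolding controlled_def by simp_all
 show a: "Z t \<in> borel_measurable (Fil t)" by (rule progressive_adapted[OF p(1) assms(2,3)])
 show b: "Z' t \<in> borel_measurable (Fil t)" by (rule progressive_adapted[OF p(2) assms(2,3)])
 show "Z t \<in> borel_measurable M" by (rule Fil_meas_M[OF a assms(2,3)])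
 show "Z' t \<in> borel_measurable M" by (rule Fil_meas_M[OF b assms(2,3)])
qed

lemma controlled_moment:
 assumes "progressive T Fil Z" "progressive T Fil Z'"
  and "mom_le M p k (Z 0)" "mom_le M p k' (Z' 0)"
  and "mom_order p \<gamma> (incr Z)" "mom_order p \<gamma>' (incr Z')"
  and "mom_order p (\<gamma> + \<gamma>') (%s t. CE s (remainder \<eta> Z Z' s t))"
  and m: "1 <= m" "m <= real p"
 shows "controlled M Fil T \<eta> \<gamma> \<gamma>' (ennreal m) Z Z'"
 unfolding controlled_def
 using assms(1,2) order_le_less_trans[OF Lp_norm_le_moment[OF assms(3) m] ennreal_less_top]
  order_le_less_trans[OF Lp_norm_le_moment[OF assms(4) m] ennreal_less_top]
  mom_order_two_param[OF assms(5) m] mom_order_two_param[OF assms(6) m] mom_order_two_param[OF assms(7) m]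
 by simp

lemma cond_expectation_0:
 assumes "subalgebra M G"
 shows "AE w in M. cond_expectation M G (%w. 0 :: 'v::euclidean_space) w = 0"
proof -
 have "mom_le M 2 (real DIM('v) * 0) (cond_expectation M G (%w. 0 :: 'v))"
  by (rule mom_le_cond_expectation[OF assms]) (auto intro!: mom_le_bounded)
 then show ?thesis by (intro mom_le_0_AE[where p = 2]) auto
qed

lemma remainder_diag: "remainder \<eta> Z Z' s s = (%w. 0)"
 by (rule ext) (simp add: remainder_def incr_def lin_app.zero_right)

text \<open>The bounds at time zero and on the increments add up to a bound at all times.\<close>

lemma controlled_bounded:
 fixes Z :: "real => 'a => 'v::euclidean_space" and Z' :: "real => 'a => 'v ^ 'd"
 assumes ctrl: "controlled M Fil T \<eta> \<gamma> \<gamma>' \<infinity> Z Z'" and g: "0 < \<gamma>" "0 < \<gamma>'"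
 obtains c where "0 <= c"
  "!!t. 0 <= t ==> t <= T ==> AE w in M. norm (Z t w) <= c"
  "!!t. 0 <= t ==> t <= T ==> AE w in M. norm (Z' t w) <= c"
  "!!s t. 0 <= s ==> s <= t ==> t <= T ==> AE w in M. norm (Z t w - Z s w) <= c * (t - s) powr \<gamma>"
  "!!s t. 0 <= s ==> s <= t ==> t <= T ==> AE w in M. norm (Z' t w - Z' s w) <= c * (t - s) powr \<gamma>'"
  "!!s t. 0 <= s ==> s <= t ==> t <= T ==> AE w in M. norm (CE s (remainder \<eta> Z Z' s t) w) <= c * (t - s) powr (\<gamma> + \<gamma>')"
proof -
 note ctrl' = ctrl[unfolded controlled_def]
 have fin: "two_param_norm M T \<gamma> \<infinity> (incr Z) < \<infinity>" "two_param_norm M T \<gamma>' \<infinity> (incr Z') < \<infinity>"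
  "two_param_norm M T (\<gamma> + \<gamma>') \<infinity> (%s t. CE s (remainder \<eta> Z Z' s t)) < \<infinity>"
  "Lp_norm M \<infinity> (Z 0) < \<infinity>" "Lp_norm M \<infinity> (Z' 0) < \<infinity>"
  using ctrl' by simp_all
 obtain c1 where c1: "0 <= c1" "!!s t. 0 <= s ==> s < t ==> t <= T ==> AE w in M. norm (incr Z s t w) <= c1 * (t - s) powr \<gamma>"
  by (rule two_param_AE[OF fin(1)]) blast
 obtain c2 where c2: "0 <= c2" "!!s t. 0 <= s ==> s < t ==> t <= T ==> AE w in M. norm (incr Z' s t w) <= c2 * (t - s) powr \<gamma>'"
  by (rule two_param_AE[OF fin(2)]) blast
 obtain c3 where c3: "0 <= c3" "!!s t. 0 <= s ==> s < t ==> t <= T ==> AE w in M. norm (CE s (remainder \<eta> Z Z' s t) w) <= c3 * (t - s) powr (\<gamma> + \<gamma>')"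
  by (rule two_param_AE[OF fin(3)]) blast
 have "AE w in M. norm (Z 0 w) <= enn2real (Lp_norm M \<infinity> (Z 0))" "AE w in M. norm (Z' 0 w) <= enn2real (Lp_norm M \<infinity> (Z' 0))"
  by (rule Lp_norm_infinityD, use fin(4,5) in "simp add: less_top, simp")+
 then obtain c4 c5 where c4: "0 <= c4" "AE w in M. norm (Z 0 w) <= c4" and c5: "0 <= c5" "AE w in M. norm (Z' 0 w) <= c5"
  using enn2real_nonneg by blast
 define c where "c = c1 + c2 + c3 + (c4 + c1 * T powr \<gamma>) + (c5 + c2 * T powr \<gamma>')"
 have c: "0 <= c" "c1 <= c" "c2 <= c" "c3 <= c" "c4 + c1 * T powr \<gamma> <= c" "c5 + c2 * T powr \<gamma>' <= c" "c4 <= c" "c5 <= c"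
  using c1(1) c2(1) c3(1) c4(1) c5(1) by (auto simp: c_def)
 have le: "AE w in M. norm (X w) <= c * x powr e" if "AE w in M. norm (X w) <= c' * x powr e" "c' <= c"
  for X :: "'a => 'w::real_normed_vector" and c' x e
  using that(1) by eventually_elim (use mult_right_mono[OF that(2), of "x powr e"] in "auto intro: order_trans")
 have sup: "AE w in M. norm (X t w) <= c"
  if "AE w in M. norm (X 0 w) <= a" "!!s t. 0 <= s ==> s < t ==> t <= T ==> AE w in M. norm (incr X s t w) <= b * (t - s) powr e"
   "a + b * T powr e <= c" "a <= c" "0 < e" "0 <= b" "0 <= t" "t <= T" for X :: "real => 'a => 'w::real_normed_vector" and a b e t
 proof (cases "t = 0")
  case True
  show ?thesis using that(1) unfolding True by eventually_elim (use that(4) in simp)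
 next
  case False
  then have "AE w in M. norm (incr X 0 t w) <= b * (t - 0) powr e" using that by (intro that(2)) auto
  with that(1) show ?thesis
  proof eventually_elim
   case (elim w)
   have "norm (X t w) <= norm (X 0 w) + norm (incr X 0 t w)" using norm_triangle_ineq[of "X 0 w" "incr X 0 t w"] by (simp add: incr_def)
   moreover have "b * (t - 0) powr e <= b * T powr e" using that by (intro mult_left_mono powr_mono2) auto
   ultimately show ?case using elim that(3) by linarith
  qed
 qed
 show ?thesis
 proof (rule that[OF c(1)])
  fix t assume t: "0 <= t" "t <= T"
  show "AE w in M. norm (Z t w) <= c" by (rule sup[OF c4(2) c1(2) c(5) c(7) g(1) c1(1) t])
  show "AE w in M. norm (Z' t w) <= c" by (rule sup[OF c5(2) c2(2) c(6) c(8) g(2) c2(1) t])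
 next
  fix s t assume st: "0 <= s" "s <= t" "t <= T"
  show "AE w in M. norm (Z t w - Z s w) <= c * (t - s) powr \<gamma>"
   using le[OF c1(2)[of s t] c(2)] st by (cases "s = t") (auto simp: incr_def)
  show "AE w in M. norm (Z' t w - Z' s w) <= c * (t - s) powr \<gamma>'"
   using le[OF c2(2)[of s t] c(3)] st by (cases "s = t") (auto simp: incr_def)
  show "AE w in M. norm (CE s (remainder \<eta> Z Z' s t) w) <= c * (t - s) powr (\<gamma> + \<gamma>')"
  proof (cases "s = t")
   case True
   have "subalgebra M (Fil t)" using st by (intro Fil_subalgebra) auto
   from cond_expectation_0[OF this] show ?thesis unfolding True remainder_diag by eventually_elim simp
  next
   case False then show ?thesis using le[OF c3(2)[of s t] c(4)] st by auto
  qed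
 qed
qed

end

section \<open>The augmented filtration\<close>

lemma augmented_filtration:
 fixes W :: "real => 'a => real ^ 'w"
 assumes "prob_space M" "0 < T" and W: "!!t. t \<in> {0..T} ==> W t \<in> borel_measurable M"
 shows "filtered_prob_space M (augmented_filtration M W) T"
proof -
 interpret prob_space M by fact
 define G where "G t = {W s -` B \<inter> space M | s B. s \<in> {0..t} & B \<in> sets borel} \<union> null_sets M" for t
 have Gs: "G t \<subseteq> sets M" if "t <= T" for t
  using that W by (auto simp: G_def intro!: measurable_sets)
 have Gp: "G t \<subseteq> Pow (space M)" for t
  using sets.sets_into_space by (auto simp: G_def null_sets_def dest: sets.sets_into_space)
 have sets: "sets (augmented_filtration M W t) = sigma_sets (space M) (G t)" for t
  unfolding augmented_filtration_def G_def[symmetric] by (rule sets_measure_of[OF Gp])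
 have sp: "space (augmented_filtration M W t) = space M" for t
  unfolding augmented_filtration_def G_def[symmetric] by (rule space_measure_of[OF Gp])
 show ?thesis
 proof unfold_locales
  show "0 < T" by fact
  fix t assume t: "0 <= t" "t <= T"
  show "subalgebra M (augmented_filtration M W t)"
   unfolding subalgebra_def sets sp using sets.sigma_sets_subset[OF Gs[OF t(2)]] by simp
  show "null_sets M \<subseteq> sets (augmented_filtration M W t)"
   unfolding sets by (auto simp: G_def intro: sigma_sets.Basic)
 next
  fix s t :: real assume "0 <= s" "s <= t" "t <= T"
  then have "G s \<subseteq> G t" unfolding G_def by (intro Un_mono Collect_mono) (auto 0 4)
  then show "sets (augmented_filtration M W s) \<subseteq> sets (augmented_filtration M W t)"
   unfolding sets by (rule sigma_sets_mono')
 qed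
qed

section \<open>The fundamental solution and its inverse as controlled processes\<close>

definition coeff_matrix :: "real ^ 'n ^ 'd ^ 'n => 'd => real ^ 'n ^ 'n" where
 "coeff_matrix F i = (\<chi> r c. F $ c $ i $ r)"

definition noise_matrix :: "real ^ 'n ^ 'd ^ 'n => real ^ 'd => real ^ 'n ^ 'n" where
 "noise_matrix F a = lin_app (\<chi> i. coeff_matrix F i) a"

definition left_deriv :: "real ^ 'n ^ 'd ^ 'n => real ^ 'n ^ 'n => real ^ 'n ^ 'n ^ 'd" where
 "left_deriv F X = (\<chi> i. coeff_matrix F i ** X)"

definition right_deriv :: "real ^ 'n ^ 'd ^ 'n => real ^ 'n ^ 'n => real ^ 'n ^ 'n ^ 'd" where
 "right_deriv F X = (\<chi> i. (- X) ** coeff_matrix F i)"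

lemma coeff_matrix_apply: "coeff_matrix F i *v v = lin_app F v $ i"
 by (simp add: vec_eq_iff matrix_vector_mult_def coeff_matrix_def lin_app_def mult.commute)

lemma lin_app_matrix_vector: "lin_app Z a *v v = lin_app (\<chi> i. Z $ i *v v) a" for Z :: "real ^ 'n ^ 'n ^ 'd"
 by (simp add: lin_app_def vec_eq_iff matrix_vector_mult_def sum_distrib_right sum_distrib_left mult.assoc) (intro allI, rule sum.swap)

lemma matrix_vector_lin_app: "X *v lin_app z a = lin_app (\<chi> i. X *v z $ i) a" for z :: "real ^ 'n ^ 'd"
 by (simp add: lin_app_def linear_sum[OF matrix_vector_mul_linear] linear_cmul[OF matrix_vector_mul_linear])

lemma noise_matrix_apply: "noise_matrix F a *v v = lin_app (lin_app F v) a"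
 by (simp add: noise_matrix_def lin_app_matrix_vector coeff_matrix_apply)

lemma lin_app_left_deriv: "lin_app (left_deriv F X) a = noise_matrix F a ** X"
 by (simp add: matrix_eq lin_app_matrix_vector left_deriv_def noise_matrix_apply matrix_vector_mul_assoc[symmetric] coeff_matrix_apply)

lemma lin_app_right_deriv: "lin_app (right_deriv F X) a = (- X) ** noise_matrix F a"
 by (simp add: matrix_eq lin_app_matrix_vector right_deriv_def noise_matrix_apply matrix_vector_mul_assoc[symmetric] coeff_matrix_apply matrix_vector_lin_app)

lemma bounded_bilinear_left_deriv: "bounded_bilinear left_deriv"
 unfolding bilinear_conv_bounded_bilinear[symmetric] bilinear_def
 by (auto intro!: linearI simp: vec_eq_iff left_deriv_def coeff_matrix_def matrix_matrix_mult_def sum.distrib[symmetric] algebra_simps sum_distrib_left)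

lemma bounded_bilinear_right_deriv: "bounded_bilinear right_deriv"
 unfolding bilinear_conv_bounded_bilinear[symmetric] bilinear_def
 by (auto intro!: linearI simp: vec_eq_iff right_deriv_def coeff_matrix_def matrix_matrix_mult_def sum.distrib[symmetric] sum_negf[symmetric] algebra_simps sum_distrib_left)

lemma norm_noise_matrix_apply: "norm (noise_matrix F a *v v) <= (norm F * norm a) * norm v"
proof -
 have "norm (lin_app (lin_app F v) a) <= (norm F * norm v) * norm a"
  by (rule order_trans[OF norm_lin_app mult_right_mono[OF norm_lin_app norm_ge_zero]])
 then show ?thesis by (simp add: noise_matrix_apply mult_ac)
qed

lemma continuous_if_holder:
 fixes X :: "real => 'v::real_normed_vector"
 assumes X: "!!s t. 0 <= s ==> s <= t ==> t <= T ==> norm (X t - X s) <= k * (t - s) powr a" and a: "0 < a"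
 shows "continuous_on {0..T} X"
 unfolding continuous_on_sequentially comp_def
proof (intro ballI allI impI, elim conjE)
 fix r t assume t: "t \<in> {0..T}" and r: "\<forall>n. r n \<in> {0..T}" "r \<longlonglongrightarrow> t"
 have "norm (X (r n) - X t) <= k * \<bar>r n - t\<bar> powr a" for n
  using X[of t "r n"] X[of "r n" t] t r(1)[rule_format, of n]
  by (cases "t <= r n") (auto simp: norm_minus_commute abs_minus_commute)
 moreover have "(%n. k * \<bar>r n - t\<bar> powr a) \<longlonglongrightarrow> 0"
 proof (rule tendsto_mult_right_zero)
  have "(%n. \<bar>r n - t\<bar>) \<longlonglongrightarrow> 0" using r(2) by (simp add: LIM_zero tendsto_rabs_zero)
  then show "(%n. \<bar>r n - t\<bar> powr a) \<longlonglongrightarrow> 0"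
   using tendsto_powr'[of "%n. \<bar>r n - t\<bar>" 0 sequentially "%_. a" a] a by auto
 qed
 ultimately have "(%n. X (r n) - X t) \<longlonglongrightarrow> 0"
  by (intro Lim_null_comparison[of "%n. X (r n) - X t"] always_eventually) auto
 then show "(%n. X (r n)) \<longlonglongrightarrow> X t" by (simp add: LIM_zero_cancel)
qed

lemma progressiveD: "progressive T Fil X ==> t \<in> {0..T} ==>
  (%x. X (fst x) (snd x)) \<in> borel_measurable (restrict_space borel {0..t} \<Otimes>\<^sub>M Fil t)"
 by (simp add: progressive_def case_prod_beta')

lemma progressiveI: "(!!t. t \<in> {0..T} ==>
  (%x. X (fst x) (snd x)) \<in> borel_measurable (restrict_space borel {0..t} \<Otimes>\<^sub>M Fil t)) ==> progressive T Fil X"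
 by (simp add: progressive_def case_prod_beta')

context rough_linear begin

text \<open>If the derivative is a bounded bilinear expression in \<open>F\<close> and \<open>X\<close>, its increments are controlled
 automatically, and only the remainder has to be estimated.\<close>

lemma strongly_controlled_product:
 fixes X :: "real => 'a => 'v::euclidean_space" and D :: "real ^ 'n ^ 'd ^ 'n => 'v => 'v ^ 'd"
 assumes D: "bounded_bilinear D" and F: "progressive T Fil F"
  and X: "!!t. 0 <= t ==> t <= T ==> X t \<in> borel_measurable (Fil t)" and k: "0 <= k"
  and b: "!!t w. 0 <= t ==> t <= T ==> norm (X t w) <= k"
  and i: "!!s t w. 0 <= s ==> s <= t ==> t <= T ==> norm (X t w - X s w) <= k * (t - s) powr \<alpha>"
  and r: "!!s t. 0 <= s ==> s <= t ==> t <= T ==>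
   AE w in M. norm (remainder \<eta> X (%t w. D (F t w) (X t w)) s t w) <= k * (t - s) powr (\<alpha> + \<beta>)"
 shows "strongly_controlled M Fil T \<eta> \<alpha> \<beta> \<infinity> X (%t w. D (F t w) (X t w))"
proof -
 interpret D: bounded_bilinear D by (rule D)
 obtain d where d: "0 < d" "!!a b. norm (D a b) <= norm a * norm b * d" using D.pos_bounded by blast
 let ?X' = "%t w. D (F t w) (X t w)"
 have C0: "0 <= C" using C1 by simp
 have a0: "0 < \<alpha>" using ex by linarith
 have Dm: "(%x. D (g x) (h x)) \<in> borel_measurable N" if "g \<in> borel_measurable N" "h \<in> borel_measurable N" for g h and N :: "'z measure"
  by (rule borel_measurable_continuous_Pair[OF that]) (intro continuous_intros D.continuous_on)
 have pX: "progressive T Fil X"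
  by (rule continuous_adapted_progressive[OF continuous_if_holder[OF i a0] X])
 have pX': "progressive T Fil ?X'"
  by (rule progressiveI, rule Dm, erule progressiveD[OF F], erule progressiveD[OF pX])
 have XM: "X t \<in> borel_measurable M" "?X' t \<in> borel_measurable M" if "0 <= t" "t <= T" for t
  using Fil_meas_M[OF X[OF that] that] Fil_meas_M[OF progressive_adapted[OF pX' that] that] .
 have RM: "remainder \<eta> X ?X' s t \<in> borel_measurable M" if "0 <= s" "s < t" "t <= T" for s t
  unfolding remainder_def[abs_def] incr_def using that
  by (intro borel_measurable_diff meas_lin_app XM) auto
 have z: "0 <= (0::real)" "0 <= T" using T_pos by auto
 have "AE w in M. norm (?X' 0 w) <= C * k * d"
  using F_bound(1)[OF z]
 proof eventually_elim
  case (elim w)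
  show ?case by (rule order_trans[OF d(2)]) (use elim b[OF z, of w] d(1) C0 k in "auto intro!: mult_mono")
 qed
 from Lp_norm_infinityI[OF XM(2)[OF z] this] have X'0: "Lp_norm M \<infinity> (?X' 0) < \<infinity>"
  using order_le_less_trans[OF _ ennreal_less_top] by simp
 have "AE w in M. norm (X 0 w) <= k" using b[OF z] by simp
 from Lp_norm_infinityI[OF XM(1)[OF z] this] have X0: "Lp_norm M \<infinity> (X 0) < \<infinity>"
  using order_le_less_trans[OF _ ennreal_less_top] by simp
 have iX: "two_param_norm M T \<alpha> \<infinity> (incr X) < \<infinity>"
  by (rule AE_two_param[OF k]) (use XM(1) i in "auto simp: incr_def[abs_def]")
 have iX': "two_param_norm M T \<beta> \<infinity> (incr ?X') < \<infinity>"
 proof (rule AE_two_param)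
  define c where "c = C * k * (1 + T) powr 3 * d + C * k * d"
  show "0 <= c" using C0 k d by (simp add: c_def)
  fix s t assume st: "0 <= s" "s < t" "t <= T"
  then have s: "0 <= s" "s <= T" and t: "0 <= t" "t <= T" and st': "s <= t" by auto
  show "incr ?X' s t \<in> borel_measurable M" using XM(2)[OF s] XM(2)[OF t] by (simp add: incr_def[abs_def])
  show "AE w in M. norm (incr ?X' s t w) <= c * (t - s) powr \<beta>"
   using F_bound(1)[OF t] F_incr(1)[OF st(1) st' st(3)]
  proof eventually_elim
   case (elim w)
   have "incr ?X' s t w = D (F t w) (X t w - X s w) + D (F t w - F s w) (X s w)"
    by (simp add: incr_def D.diff_left D.diff_right)
   then have "norm (incr ?X' s t w) <= norm (F t w) * norm (X t w - X s w) * d + norm (F t w - F s w) * norm (X s w) * d"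
    using order_trans[OF norm_triangle_ineq add_mono[OF d(2) d(2)]] by simp
   also have "... <= C * (k * ((1 + T) powr 3 * (t - s) powr \<beta>)) * d + (C * (t - s) powr \<beta>) * k * d"
   proof (intro add_mono mult_right_mono mult_mono)
    have "(t - s) powr \<alpha> <= (1 + T) powr 3 * (t - s) powr \<beta>" using st ex by (intro powr_le_powr_lower) auto
    from order_trans[OF i[OF st(1) st' st(3)] mult_left_mono[OF this k]]
    show "norm (X t w - X s w) <= k * ((1 + T) powr 3 * (t - s) powr \<beta>)" .
   qed (use elim b[OF s] C0 k d in auto)
   also have "... = c * (t - s) powr \<beta>" by (simp add: c_def algebra_simps)
   finally show ?case .
  qed
 qed
 have R: "two_param_norm M T (\<alpha> + \<beta>) \<infinity> (remainder \<eta> X ?X') < \<infinity>"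
  by (rule AE_two_param[OF k RM]) (use r in auto)
 have cR: "two_param_norm M T (\<alpha> + \<beta>) \<infinity> (%s t. CE s (remainder \<eta> X ?X' s t)) < \<infinity>"
 proof (rule AE_two_param[of "real DIM('v) * k"])
  fix s t assume st: "0 <= s" "s < t" "t <= T"
  have G: "subalgebra M (Fil s)" using st by (intro Fil_subalgebra) auto
  show "CE s (remainder \<eta> X ?X' s t) \<in> borel_measurable M"
   by (rule measurable_from_subalg[OF G meas_cond_expectation])
  have "AE w in M. \<forall>b\<in>Basis. \<bar>RCE s (%w. remainder \<eta> X ?X' s t w \<bullet> b) w\<bar> <= k * (t - s) powr (\<alpha> + \<beta>)"
  proof (rule AE_finite_allI[OF finite_Basis])
   fix b :: 'v assume b: "b \<in> Basis"
   have "AE w in M. \<bar>remainder \<eta> X ?X' s t w \<bullet> b\<bar> <= k * (t - s) powr (\<alpha> + \<beta>)"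
    using r[OF st(1) less_imp_le[OF st(2)] st(3)] by eventually_elim (rule order_trans[OF Basis_le_norm[OF b]])
   then show "AE w in M. \<bar>RCE s (%w. remainder \<eta> X ?X' s t w \<bullet> b) w\<bar> <= k * (t - s) powr (\<alpha> + \<beta>)"
    by (intro cond_exp_abs_le[OF G]) (use RM[OF st] in auto)
  qed
  then show "AE w in M. norm (CE s (remainder \<eta> X ?X' s t) w) <= real DIM('v) * k * (t - s) powr (\<alpha> + \<beta>)"
  proof eventually_elim
   case (elim w)
   have "norm (CE s (remainder \<eta> X ?X' s t) w) <=
     (\<Sum>b\<in>Basis. \<bar>CE s (remainder \<eta> X ?X' s t) w \<bullet> b\<bar>)" by (rule norm_le_l1)
   also have "... <= (\<Sum>b\<in>(Basis::'v set). k * (t - s) powr (\<alpha> + \<beta>))"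
    by (rule sum_mono) (use elim in "simp add: cond_expectation_inner")
   finally show ?case by simp
  qed
 qed (use k in simp)
 show ?thesis unfolding strongly_controlled_def controlled_def using pX pX' X0 X'0 iX iX' R cR by simp
qed

end

context rough_solution begin

text \<open>The error of the expansion of the flow that keeps the first-order term only. It is of the order
 \<open>\<alpha> + \<beta>\<close> that controlled rough paths require.\<close>

definition first_order_error where
 "first_order_error s t w = A t w ** B s w - mat 1 - noise_matrix (F s w) (\<eta> t - \<eta> s)"

definition KF where "KF = K * LT + (C + C * C) * C * LT"

lemma KF0: "0 <= KF" using K0 C0 LT1 by (simp add: KF_def)

lemma first_order_error_bound:
 assumes st: "0 <= s" "s <= t" "t <= T"
 shows "AE w in M. opn (first_order_error s t w) <= KF * (t - s) powr (\<alpha> + \<beta>)"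
proof -
 have s: "0 <= s" "s <= T" using st by auto
 let ?x = "(t - s) powr (\<alpha> + \<beta>)"
 show ?thesis using step_gap_bound[OF st] F_bound(1)[OF s] F_bound(2)[OF s]
 proof eventually_elim
  case (elim w)
  show ?case
  proof (rule opn_leI)
   show "0 <= KF * ?x" using KF0 by simp
   fix v
   have e1: "first_order_error s t w *v v = step_gap s t w *v v + bilin_app (second_order (F s w) (F' s w) v) (e2 s t)"
    by (simp add: first_order_error_def step_gap_def matrix_vector_mult_diff_rdistrib flow_matrix_apply flow_step_def germ_def noise_matrix_apply)
   have e2': "norm (step_gap s t w *v v) <= (K * LT * ?x) * norm v"
   proof -
    have "(t - s) powr bA <= LT * ?x" using bA bS ex by (intro powr_LT st) linarith+
    from mult_left_mono[OF this less_imp_le[OF K0]] elim(1) have "opn (step_gap s t w) <= K * LT * ?x" by (simp add: mult.assoc)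
    then show ?thesis by (intro order_trans[OF opn_vec] mult_right_mono) auto
   qed
   have e3: "norm (bilin_app (second_order (F s w) (F' s w) v) (e2 s t)) <= ((C + C * C) * norm v) * (C * (LT * ?x))"
   proof (rule order_trans[OF norm_bilin_app], rule mult_mono)
    have "norm (F' s w) + norm (F s w) * norm (F s w) <= C + C * C" using elim C0 by (intro add_mono mult_mono) auto
    then show "norm (second_order (F s w) (F' s w) v) <= (C + C * C) * norm v"
     by (intro order_trans[OF norm_second_order] mult_right_mono) auto
    have "(t - s) powr (2 * \<alpha>) <= LT * ?x" using ex by (intro powr_LT st) linarith+
    from order_trans[OF e2[OF st] mult_left_mono[OF this C0(1)]] show "norm (e2 s t) <= C * (LT * ?x)" .
   qed (use C0 in auto)
   have "norm (first_order_error s t w *v v) <= (K * LT * ?x) * norm v + ((C + C * C) * norm v) * (C * (LT * ?x))"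
    unfolding e1 by (rule order_trans[OF norm_triangle_ineq add_mono[OF e2' e3]])
   then show "norm (first_order_error s t w *v v) <= KF * ?x * norm v" by (simp add: KF_def algebra_simps)
  qed
 qed
qed

lemma remainder_A: "0 <= s ==> s <= T ==>
  remainder \<eta> A (%t w. left_deriv (F t w) (A t w)) s t w = first_order_error s t w ** A s w"
 by (simp add: remainder_def incr_def lin_app_left_deriv first_order_error_def mm_diff_right matrix_mul_assoc[symmetric] BA)

text \<open>Since \<open>B t - B s = - B t ** (A t ** B s - 1)\<close>, the inverse is controlled with the derivative
 \<open>- B F\<close>.\<close>

lemma remainder_B:
 assumes "0 <= s" "s <= t" "t <= T"
 shows "remainder \<eta> B (%t w. right_deriv (F t w) (B t w)) s t w =
  - ((B t w - B s w) ** noise_matrix (F s w) (\<eta> t - \<eta> s)) - B t w ** first_order_error s t w"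
proof -
 let ?N = "noise_matrix (F s w) (\<eta> t - \<eta> s)"
 have "B t w ** (A t w ** B s w) = B s w" using BA[of t w] assms by (simp add: matrix_mul_assoc)
 then have "B t w ** first_order_error s t w = B s w - B t w - B t w ** ?N"
  by (simp add: first_order_error_def mm_diff_left)
 moreover have "(- B s w) ** ?N = - (B s w ** ?N)" using mm_diff_right[of 0 "B s w" ?N] by simp
 ultimately show ?thesis by (simp add: remainder_def incr_def lin_app_right_deriv mm_diff_right)
qed

lemma norm_le_if_opn_le: "opn (X :: real ^ 'n ^ 'n) <= c ==> norm X <= (real CARD('n))\<^sup>2 * c"
 by (rule order_trans[OF norm_le_opn mult_left_mono]) auto

theorem A_controlled:
 assumes F: "progressive T Fil F"
 shows "strongly_controlled M Fil T \<eta> \<alpha> \<beta> \<infinity> A (%t w. left_deriv (F t w) (A t w))"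
proof -
 define n where "n = (real CARD('n))\<^sup>2"
 define k where "k = n * K + n * (KF * K)"
 have n: "0 <= n" by (simp add: n_def)
 have k: "0 <= k" "n * K <= k" "n * (KF * K) <= k" using n K0 KF0 by (auto simp: k_def)
 show ?thesis
 proof (rule strongly_controlled_product[OF bounded_bilinear_left_deriv F A_meas k(1)])
  fix t w assume t: "0 <= t" "t <= T"
  show "norm (A t w) <= k" using norm_le_if_opn_le[OF A_bound[OF t], of w] k(2) by (simp add: n_def)
 next
  fix s t w assume st: "0 <= s" "s <= t" "t <= T"
  have "norm (A t w - A s w) <= (n * K) * (t - s) powr \<alpha>" using norm_le_if_opn_le[OF A_incr[OF st], of w] by (simp add: n_def mult.assoc)
  also have "... <= k * (t - s) powr \<alpha>" by (rule mult_right_mono[OF k(2) powr_ge_zero])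
  finally show "norm (A t w - A s w) <= k * (t - s) powr \<alpha>" .
 next
  fix s t assume st: "0 <= s" "s <= t" "t <= T"
  then have s: "0 <= s" "s <= T" by auto
  show "AE w in M. norm (remainder \<eta> A (%t w. left_deriv (F t w) (A t w)) s t w) <= k * (t - s) powr (\<alpha> + \<beta>)"
   using first_order_error_bound[OF st]
  proof eventually_elim
   case (elim w)
   have "opn (first_order_error s t w ** A s w) <= (KF * (t - s) powr (\<alpha> + \<beta>)) * K"
    by (rule order_trans[OF opn_mult mult_mono]) (use elim A_bound[OF s] KF0 in auto)
   from norm_le_if_opn_le[OF this] have "norm (first_order_error s t w ** A s w) <= (n * (KF * K)) * (t - s) powr (\<alpha> + \<beta>)"
    by (simp add: n_def mult_ac)
   also have "... <= k * (t - s) powr (\<alpha> + \<beta>)" by (rule mult_right_mono[OF k(3) powr_ge_zero])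
   finally show ?case unfolding remainder_A[OF s] .
  qed
 qed auto
qed

theorem B_controlled:
 assumes F: "progressive T Fil F"
 shows "strongly_controlled M Fil T \<eta> \<alpha> \<beta> \<infinity> B (%t w. right_deriv (F t w) (B t w))"
proof -
 define n where "n = (real CARD('n))\<^sup>2"
 define k3 where "k3 = K * (C * C) * LT + K * KF"
 define k where "k = n * K + n * k3"
 have n: "0 <= n" by (simp add: n_def)
 have k: "0 <= k" "n * K <= k" "n * k3 <= k" using n K0 KF0 C0 LT1 by (auto simp: k_def k3_def)
 show ?thesis
 proof (rule strongly_controlled_product[OF bounded_bilinear_right_deriv F B_meas k(1)])
  fix t w assume t: "0 <= t" "t <= T"
  show "norm (B t w) <= k" using norm_le_if_opn_le[OF B_bound[OF t], of w] k(2) by (simp add: n_def)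
 next
  fix s t w assume st: "0 <= s" "s <= t" "t <= T"
  have "norm (B t w - B s w) <= (n * K) * (t - s) powr \<alpha>" using norm_le_if_opn_le[OF B_incr[OF st], of w] by (simp add: n_def mult.assoc)
  also have "... <= k * (t - s) powr \<alpha>" by (rule mult_right_mono[OF k(2) powr_ge_zero])
  finally show "norm (B t w - B s w) <= k * (t - s) powr \<alpha>" .
 next
  fix s t assume st: "0 <= s" "s <= t" "t <= T"
  then have s: "0 <= s" "s <= T" and t: "0 <= t" by auto
  let ?x = "(t - s) powr (\<alpha> + \<beta>)"
  show "AE w in M. norm (remainder \<eta> B (%t w. right_deriv (F t w) (B t w)) s t w) <= k * (t - s) powr (\<alpha> + \<beta>)"
   using first_order_error_bound[OF st] F_bound(1)[OF s]
  proof eventually_elim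
   case (elim w)
   let ?N = "noise_matrix (F s w) (\<eta> t - \<eta> s)"
   have N: "opn ?N <= C * (C * (t - s) powr \<alpha>)"
   proof (rule opn_leI)
    show "norm (?N *v v) <= C * (C * (t - s) powr \<alpha>) * norm v" for v
     by (rule order_trans[OF norm_noise_matrix_apply mult_right_mono[OF mult_mono]]) (use elim eta[OF st] C0 in auto)
   qed (use C0 in auto)
   have "opn ((B t w - B s w) ** ?N) <= (K * (t - s) powr \<alpha>) * (C * (C * (t - s) powr \<alpha>))"
    by (rule order_trans[OF opn_mult mult_mono]) (use N B_incr[OF st] K0 in auto)
   also have "... = K * (C * C) * ((t - s) powr (\<alpha> + \<alpha>))" unfolding powr_add by (simp only: mult_ac)
   also have "... <= K * (C * C) * (LT * ?x)"
    by (rule mult_left_mono[OF powr_LT[OF st]]) (use K0 C0 ex in auto)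
   finally have 1: "opn ((B t w - B s w) ** ?N) <= K * (C * C) * LT * ?x" by (simp add: mult.assoc)
   have 2: "opn (B t w ** first_order_error s t w) <= K * (KF * ?x)"
    by (rule order_trans[OF opn_mult mult_mono]) (use elim B_bound[OF t st(3)] K0 in auto)
   have "opn (- ((B t w - B s w) ** ?N) - B t w ** first_order_error s t w) <= k3 * ?x"
    using opn_diff[of "- ((B t w - B s w) ** ?N)" "B t w ** first_order_error s t w"] 1 2
    by (simp add: opn_minus k3_def algebra_simps)
   from norm_le_if_opn_le[OF this]
   have "norm (- ((B t w - B s w) ** ?N) - B t w ** first_order_error s t w) <= (n * k3) * ?x" by (simp add: n_def mult.assoc)
   also have "... <= k * ?x" by (rule mult_right_mono[OF k(3) powr_ge_zero])
   finally show ?case unfolding remainder_B[OF st] .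
  qed
 qed auto
qed

end

section \<open>Existence and uniqueness\<close>

context filtered_prob_space begin

lemma mom_order_closed:
 assumes X: "mom_order p e X" and diag: "!!s. 0 <= s ==> s <= T ==> mom_le M p 0 (X s s)"
 shows "\<exists>k\<ge>0. \<forall>s t. 0 <= s --> s <= t --> t <= T --> mom_le M p (k * (t - s) powr e) (X s t)"
proof -
 obtain k where k: "0 <= k" "!!s t. 0 <= s ==> s < t ==> t <= T ==> mom_le M p (k * (t - s) powr e) (X s t)"
  using X unfolding mom_order_def by blast
 have "mom_le M p (k * (t - s) powr e) (X s t)" if "0 <= s" "s <= t" "t <= T" for s t
  using k(2)[of s t] diag[of t] that by (cases "s = t") auto
 with k(1) show ?thesis by blast
qed

lemma mom_le_zero: "mom_le M p 0 (%w. 0)"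
 by (rule mom_le_bounded) auto

lemma incr_diag: "incr X s s = (%w. 0)"
 by (simp add: incr_def[abs_def])

lemma moment_bounded_process:
 fixes X :: "real => 'a => 'v::{real_normed_vector, second_countable_topology}"
 assumes X: "mom_order 2 e (incr X)" and e: "0 <= e" and X0: "mom_le M 2 k0 (X 0)"
 shows "\<exists>k\<ge>0. \<forall>t. 0 <= t --> t <= T --> mom_le M 2 k (X t)"
proof -
 obtain k where k: "0 <= k" "!!s t. 0 <= s ==> s <= t ==> t <= T ==> mom_le M 2 (k * (t - s) powr e) (incr X s t)"
  using mom_order_closed[OF X] mom_le_zero unfolding incr_diag by blast
 have k0: "0 <= k0" by (rule mom_le_nonneg[OF X0])
 show ?thesis
 proof (intro exI[of _ "k0 + k * T powr e"] conjI allI impI)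
  fix t assume t: "0 <= t" "t <= T"
  have "mom_le M 2 (k0 + k * (t - 0) powr e) (%w. X 0 w + incr X 0 t w)"
   by (rule mom_le_add[OF X0 k(2)]) (use t in auto)
  then have "mom_le M 2 (k0 + k * (t - 0) powr e) (X t)" by (simp add: incr_def)
  then show "mom_le M 2 (k0 + k * T powr e) (X t)"
   by (rule mom_le_weaken) (use t e k in "auto intro!: mult_left_mono powr_mono2")
 qed (use k k0 in auto)
qed

lemma mom_le_if_Lp_finite:
 fixes X :: "'a => 'v::real_normed_vector"
 assumes "Lp_norm M (ennreal m) X < \<infinity>" "2 <= m" "X \<in> borel_measurable M"
 shows "mom_le M 2 (2 * enn2real (Lp_norm M (ennreal m) X)) X"
 by (rule mom_le_if_Lp_norm_le[OF _ _ assms(2,3)]) (use assms(1) in "auto simp: less_top")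

end

lemma continuous_on_matrix_vector:
 fixes X :: "real => real ^ 'n ^ 'n" and v :: "real => real ^ 'n"
 shows "continuous_on S X ==> continuous_on S v ==> continuous_on S (%t. X t *v v t)"
 unfolding matrix_vector_mult_def by (intro continuous_intros)

context rough_solution begin

lemma progressive_integrand:
 assumes "progressive T Fil F" "progressive T Fil f" "progressive T Fil \<psi>"
 shows "progressive T Fil (integrand F f \<psi>)"
 unfolding integrand_def[abs_def]
 by (rule progressiveI, intro borel_measurable_add meas_lin_app)
  (erule progressiveD[OF assms(1)] progressiveD[OF assms(2)] progressiveD[OF assms(3)])+

lemma progressive_integrand_deriv:
 assumes "progressive T Fil F" "progressive T Fil F'" "progressive T Fil f" "progressive T Fil f'" "progressive T Fil \<psi>"
 shows "progressive T Fil (integrand_deriv F F' f f' \<psi>)"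
 unfolding integrand_deriv_eq[abs_def]
 by (rule progressiveI, intro borel_measurable_add meas_apply_deriv meas_left_mult)
  (erule progressiveD[OF assms(1)] progressiveD[OF assms(2)] progressiveD[OF assms(4)] progressiveD[OF assms(5)]
   progressiveD[OF progressive_integrand[OF assms(1,3,5)]])+

lemma phi_continuous:
 assumes "!!w. continuous_on {0..T} (%t. I t w)"
 shows "continuous_on {0..T} (%t. phi x t w)"
proof -
 have "continuous_on {0..T} (%t. A t w)"
 proof (rule continuous_if_holder)
  fix s t assume "0 <= s" "s <= t" "t <= T"
  from norm_le_if_opn_le[OF A_incr[OF this]]
  show "norm (A t w - A s w) <= ((real CARD('n))\<^sup>2 * K) * (t - s) powr \<alpha>" by (simp add: mult.assoc)
 qed (use ex in linarith)
 then show ?thesis unfolding phi_def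
  by (intro continuous_on_add continuous_on_matrix_vector assms continuous_on_const)
qed

lemma phi_initial: "AE w in M. phi x 0 w = x"
 using I_0 by eventually_elim (simp add: phi_def A_0)

lemma phi_controlled:
 assumes F: "progressive T Fil F" "progressive T Fil F'" and f: "progressive T Fil f" "progressive T Fil f'"
  and I: "!!w. continuous_on {0..T} (%t. I t w)" and m: "2 <= m"
 shows "controlled M Fil T \<eta> \<alpha> \<beta> (ennreal m) (phi x) (integrand_phi x)"
  "controlled M Fil T \<eta> \<beta> \<beta>' (ennreal m) (integrand_phi x) (deriv_phi x)"
proof -
 define p where "p = 2 * nat \<lceil>m\<rceil>"
 have p: "even p" "2 <= p" "1 <= m" "m <= real p" using m by (auto simp: p_def) linarith+
 have pr: "progressive T Fil (phi x)"
  by (rule continuous_adapted_progressive[OF phi_continuous[OF I] phi_meas])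
 have T: "0 <= (0::real)" "0 < T" "T <= T" using T_pos by auto
 obtain k0 where k0: "mom_le M p k0 (phi x 0)" using phi_moments[OF p(1,2), of x] T_pos by fastforce
 obtain k1 where k1: "mom_le M p k1 (integrand_phi x 0)"
  using integrand_order_0(1)[OF p(1,2), of x] T unfolding mom_order_def by blast
 obtain k2 where k2: "mom_le M p k2 (deriv_phi x 0)"
  using integrand_order_0(2)[OF p(1,2), of x] T unfolding mom_order_def by blast
 show "controlled M Fil T \<eta> \<alpha> \<beta> (ennreal m) (phi x) (integrand_phi x)"
  by (rule controlled_moment[OF pr progressive_integrand[OF F(1) f(1) pr] k0 k1 phi_order(1)[OF p(1,2)]
     integrand_order(1)[OF p(1,2)] phi_order(2)[OF p(1,2)] p(3,4)])
 show "controlled M Fil T \<eta> \<beta> \<beta>' (ennreal m) (integrand_phi x) (deriv_phi x)"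
  by (rule controlled_moment[OF progressive_integrand[OF F(1) f(1) pr] progressive_integrand_deriv[OF F f pr] k1 k2
     integrand_order(1)[OF p(1,2)] integrand_order(2)[OF p(1,2)] remainder_integrand_order[OF p(1,2)] p(3,4)])
qed

theorem phi_solves:
 assumes \<eta>2: "!!s t. 0 <= s ==> s < t ==> t <= T ==> \<eta>2 s t = e2 s t"
  and F: "progressive T Fil F" "progressive T Fil F'" and f: "progressive T Fil f" "progressive T Fil f'"
  and I: "!!w. continuous_on {0..T} (%t. I t w)" and m: "2 <= m"
 shows "solves_linear_eq M Fil T \<alpha> \<beta> m \<eta> \<eta>2 F F' f f' x (phi x)"
proof -
 have two: "even (2::nat)" "2 <= (2::nat)" by auto
 obtain k where k: "0 <= k" "!!s t. 0 <= s ==> s <= t ==> t <= T ==> mom_le M 2 (k * (t - s) powr aS) (local_error (phi x) s t)"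
  "!!s t. 0 <= s ==> s <= t ==> t <= T ==> mom_le M 2 (k * (t - s) powr bS) (CE s (local_error (phi x) s t))"
  using local_error_phi_bounds[OF two, of x] by blast
 have "\<exists>J. has_rough_integral M \<eta> \<eta>2 (integrand_phi x) (deriv_phi x) t J & (AE w in M. phi x t w = x + J w)"
  if t: "0 <= t" "t <= T" for t
 proof (intro exI conjI)
  show "has_rough_integral M \<eta> \<eta>2 (integrand_phi x) (deriv_phi x) t (%w. phi x t w - phi x 0 w)"
  proof (rule has_rough_integral_of_expansion[OF \<eta>2 phi_meas _ _ aS(1) _ bS(1) k(1) k(2,3)[unfolded local_error_eq] t])
   fix u assume u: "0 <= u" "u <= T"
   show "integrand_phi x u \<in> borel_measurable (Fil u)" "deriv_phi x u \<in> borel_measurable (Fil u)"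
    by (intro integrand_meas integrand_deriv_meas phi_meas F_meas f_meas u)+
  qed (use aS ex in auto)
  show "AE w in M. phi x t w = x + (phi x t w - phi x 0 w)"
   using phi_initial[of x] by eventually_elim simp
 qed
 then show ?thesis
  unfolding solves_linear_eq_def using phi_controlled[OF F f I m, of x] ex
  by (intro conjI exI[of _ \<beta>] exI[of _ \<beta>']) auto
qed

text \<open>For a solution, choosing an integral at each time gives a process with the required expansion, to
 which \<open>uniqueness\<close> applies.\<close>

theorem solution_unique:
 assumes \<eta>2: "!!s t. 0 <= s ==> s < t ==> t <= T ==> \<eta>2 s t = e2 s t"
  and sol: "solves_linear_eq M Fil T \<alpha> \<beta> m \<eta> \<eta>2 F F' f f' x \<psi>" and m: "2 <= m" and t: "0 <= t" "t <= T"
 shows "AE w in M. \<psi> t w = phi x t w"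
proof -
 have two: "even (2::nat)" "2 <= (2::nat)" "0 < (2::nat)" by auto
 have z: "0 <= (0::real)" "0 <= T" using T_pos by auto
 let ?Z = "integrand F f \<psi>" and ?Z' = "integrand_deriv F F' f f' \<psi>"
 have c\<psi>: "controlled M Fil T \<eta> \<alpha> \<beta> (ennreal m) \<psi> ?Z" using sol by (simp add: solves_linear_eq_def)
 obtain \<gamma> \<gamma>' where g: "0 < \<gamma>" "\<gamma> <= \<alpha>" "0 < \<gamma>'" "\<gamma>' <= \<gamma>" "1 / 2 < \<alpha> + \<gamma>" "1 < \<alpha> + \<gamma> + \<gamma>'"
  and cZ: "controlled M Fil T \<eta> \<gamma> \<gamma>' (ennreal m) ?Z ?Z'"
  using sol by (auto simp: solves_linear_eq_def)
 define J where "J u = (SOME I. has_rough_integral M \<eta> \<eta>2 ?Z ?Z' u I & (AE w in M. \<psi> u w = x + I w))" for u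
 have J: "has_rough_integral M \<eta> \<eta>2 ?Z ?Z' u (J u)" "AE w in M. \<psi> u w = x + J u w" if u: "0 <= u" "u <= T" for u
 proof -
  have "\<exists>I. has_rough_integral M \<eta> \<eta>2 ?Z ?Z' u I & (AE w in M. \<psi> u w = x + I w)"
   using sol u by (simp add: solves_linear_eq_def)
  from someI_ex[OF this]
  show "has_rough_integral M \<eta> \<eta>2 ?Z ?Z' u (J u)" "AE w in M. \<psi> u w = x + J u w" unfolding J_def by simp_all
 qed
 note \<psi>m = controlled_adapted[OF c\<psi>] and Zm = controlled_adapted[OF cZ]
 have incM: "incr X s u \<in> borel_measurable M" if "X s \<in> borel_measurable M" "X u \<in> borel_measurable M"
  for X :: "real => 'a => 'w::euclidean_space" and s u using that by (simp add: incr_def[abs_def])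
 have o\<psi>: "mom_order 2 \<alpha> (incr \<psi>)"
  by (rule two_param_mom_order[OF _ m incM]) (use c\<psi> \<psi>m(3) in "auto simp: controlled_def")
 have oZ: "mom_order 2 \<gamma> (incr ?Z)"
  by (rule two_param_mom_order[OF _ m incM]) (use cZ Zm(3) in "auto simp: controlled_def")
 have oZ': "mom_order 2 \<gamma>' (incr ?Z')"
  by (rule two_param_mom_order[OF _ m incM]) (use cZ Zm(4) in "auto simp: controlled_def")
 have oR: "mom_order 2 (\<gamma> + \<gamma>') (%s t. CE s (remainder \<eta> ?Z ?Z' s t))"
  by (rule two_param_mom_order[OF _ m])
   (use cZ in "auto simp: controlled_def intro!: measurable_from_subalg[OF Fil_subalgebra meas_cond_expectation]")
 have z0: "mom_le M 2 (2 * enn2real (Lp_norm M (ennreal m) (\<psi> 0))) (\<psi> 0)"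
  "mom_le M 2 (2 * enn2real (Lp_norm M (ennreal m) (?Z' 0))) (?Z' 0)"
  using c\<psi> cZ \<psi>m(3)[OF z] Zm(4)[OF z] by (intro mom_le_if_Lp_finite m; simp add: controlled_def)+
 have a0: "0 <= \<alpha>" "0 <= \<gamma>'" using ex g by linarith+
 obtain k1 where k1: "0 <= k1" "!!u. 0 <= u ==> u <= T ==> mom_le M 2 k1 (\<psi> u)"
  using moment_bounded_process[OF o\<psi> a0(1) z0(1)] by blast
 obtain k2 where k2: "0 <= k2" "!!u. 0 <= u ==> u <= T ==> mom_le M 2 k2 (?Z' u)"
  using moment_bounded_process[OF oZ' a0(2) z0(2)] by blast
 obtain k3 where k3: "0 <= k3" "!!s u. 0 <= s ==> s <= u ==> u <= T ==> mom_le M 2 (k3 * (u - s) powr \<gamma>) (incr ?Z s u)"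
  using mom_order_closed[OF oZ] mom_le_zero unfolding incr_diag by blast
 obtain k4 where k4: "0 <= k4" "!!s u. 0 <= s ==> s <= u ==> u <= T ==> mom_le M 2 (k4 * (u - s) powr \<gamma>') (incr ?Z' s u)"
  using mom_order_closed[OF oZ'] mom_le_zero unfolding incr_diag by blast
 have "mom_le M 2 0 (CE s (remainder \<eta> ?Z ?Z' s s))" if s: "0 <= s" "s <= T" for s
  unfolding remainder_diag
 proof (rule mom_le_bounded)
  show "AE w in M. norm (CE s (%w. 0 :: real ^ 'n ^ 'd) w) <= 0"
   using cond_expectation_0[OF Fil_subalgebra[OF s], where 'v = "real ^ 'n ^ 'd"] by eventually_elim simp
 qed (auto intro: measurable_from_subalg[OF Fil_subalgebra[OF s] meas_cond_expectation])
 from mom_order_closed[OF oR this]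
 obtain k5 where k5: "0 <= k5" "!!s u. 0 <= s ==> s <= u ==> u <= T ==>
   mom_le M 2 (k5 * (u - s) powr (\<gamma> + \<gamma>')) (CE s (remainder \<eta> ?Z ?Z' s u))" by blast
 define k where "k = k2 + k3 + k4 + k5"
 have k: "0 <= k" "k2 <= k" "k3 <= k" "k4 <= k" "k5 <= k" using k2(1) k3(1) k4(1) k5(1) by (auto simp: k_def)
 have exp: "(AE w in M. J 0 w = 0) & (\<exists>k'\<ge>0. \<exists>a b. 1 / 2 < a & 1 < \<alpha> + a & a <= 2 & 1 < b & b <= 2 &
   (\<forall>s t. 0 <= s --> s <= t --> t <= T --> mom_le M 2 (k' * (t - s) powr a) (increment_error J ?Z ?Z' s t) &
    mom_le M 2 (k' * (t - s) powr b) (CE s (increment_error J ?Z ?Z' s t))))"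
 proof (rule expansion_of_rough_integral[OF \<eta>2 Zm(1,2) g(3,4,2,5,6) k(1) _ _ _ _ J(1)])
  fix s u assume su: "0 <= s" "s <= u" "u <= T"
  show "mom_le M 2 (k * (u - s) powr \<gamma>) (%w. ?Z u w - ?Z s w)"
   by (rule mom_le_weaken[OF k3(2)[OF su, unfolded incr_def[abs_def]] mult_right_mono[OF k(3) powr_ge_zero]])
  show "mom_le M 2 (k * (u - s) powr \<gamma>') (%w. ?Z' u w - ?Z' s w)"
   by (rule mom_le_weaken[OF k4(2)[OF su, unfolded incr_def[abs_def]] mult_right_mono[OF k(4) powr_ge_zero]])
  show "mom_le M 2 (k * (u - s) powr (\<gamma> + \<gamma>')) (CE s (remainder \<eta> ?Z ?Z' s u))"
   by (rule mom_le_weaken[OF k5(2)[OF su] mult_right_mono[OF k(5) powr_ge_zero]])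
 next
  fix u assume "0 <= u" "u <= T"
  from mom_le_weaken[OF k2(2)[OF this] k(2)] show "mom_le M 2 k (?Z' u)" .
 qed
 then have J0: "AE w in M. J 0 w = 0" by (rule conjunct1)
 obtain k' a b where k': "0 <= k'" and ab: "1 / 2 < a" "1 < \<alpha> + a" "a <= 2" "1 < b" "b <= 2"
  and err: "!!s t. 0 <= s ==> s <= t ==> t <= T ==> mom_le M 2 (k' * (t - s) powr a) (increment_error J ?Z ?Z' s t)"
  "!!s t. 0 <= s ==> s <= t ==> t <= T ==> mom_le M 2 (k' * (t - s) powr b) (CE s (increment_error J ?Z ?Z' s t))"
  using exp[THEN conjunct2] by blast
 define q where "q = k' + k1"
 have q: "0 <= q" "k' <= q" "k1 <= q" using k' k1(1) by (auto simp: q_def)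
 show ?thesis
 proof (rule uniqueness[OF \<psi>m(1) _ q(1) _ ab _ _ t])
  show "AE w in M. \<psi> 0 w = x" using J(2)[OF z] J0 by eventually_elim simp
  fix u assume u: "0 <= u" "u <= T"
  from mom_le_weaken[OF k1(2)[OF u] q(3)] show "mom_le M 2 q (\<psi> u)" .
 next
  fix s u assume su: "0 <= s" "s <= u" "u <= T"
  then have s: "0 <= s" "s <= T" and u: "0 <= u" "u <= T" by auto
  have G: "subalgebra M (Fil s)" by (rule Fil_subalgebra[OF s])
  have eq: "AE w in M. local_error \<psi> s u w = increment_error J ?Z ?Z' s u w"
   using J(2)[OF s] J(2)[OF u] by eventually_elim (simp add: local_error_eq increment_error_def)
  have lm: "local_error \<psi> s u \<in> borel_measurable M" by (rule local_error_meas[OF su \<psi>m(3)[OF u] \<psi>m(3)[OF s]])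
  show "mom_le M 2 (q * (u - s) powr a) (local_error \<psi> s u)"
   by (rule mom_le_cong_weaken[OF err(1)[OF su] eq lm mult_right_mono[OF q(2) powr_ge_zero]])
  show "mom_le M 2 (q * (u - s) powr b) (CE s (local_error \<psi> s u))"
   by (rule mom_le_cong_weaken[OF err(2)[OF su] cond_expectation_cong[OF G eq lm mom_le_measurable[OF err(1)[OF su]]]
     measurable_from_subalg[OF G meas_cond_expectation] mult_right_mono[OF q(2) powr_ge_zero]])
 qed
qed

end

lemma affine_inverse:
 fixes X Y :: "real ^ 'n ^ 'n"
 assumes YX: "Y ** X = mat 1" and XY: "X ** Y = mat 1"
 shows "affine_map (%x. X *v x + z)" "bij (%x. X *v x + z)" "inv (%x. X *v x + z) y = Y *v y - Y *v z"
proof -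
 show "affine_map (%x. X *v x + z)" unfolding affine_map_def by (intro exI[of _ "(*v) X"] exI[of _ z]) simp
 have 1: "(%x. X *v x + z) \<circ> (%y. Y *v y - Y *v z) = id"
  by (rule ext) (simp add: matrix_vector_mult_diff_distrib matrix_vector_mul_assoc XY)
 have 2: "(%y. Y *v y - Y *v z) \<circ> (%x. X *v x + z) = id"
  by (rule ext) (simp add: matrix_vector_right_distrib matrix_vector_mul_assoc YX)
 show "bij (%x. X *v x + z)" by (rule o_bij[OF 2 1])
 show "inv (%x. X *v x + z) y = Y *v y - Y *v z" by (simp add: inv_unique_comp[OF 1 2])
qed

theorem lemma4p3:
  fixes M :: "'a measure" and W :: "real \<Rightarrow> 'a \<Rightarrow> real ^ 'w"
    and T \<alpha> \<beta> \<beta>' :: real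
    and \<eta> :: "real \<Rightarrow> real ^ 'd" and \<eta>2 :: "real \<Rightarrow> real \<Rightarrow> real ^ 'd ^ 'd"
    and F :: "real \<Rightarrow> 'a \<Rightarrow> real ^ 'n ^ 'd ^ 'n" and F' :: "real \<Rightarrow> 'a \<Rightarrow> real ^ 'n ^ 'd ^ 'n ^ 'd"
    and f :: "real \<Rightarrow> 'a \<Rightarrow> real ^ 'n ^ 'd" and f' :: "real \<Rightarrow> 'a \<Rightarrow> real ^ 'n ^ 'd ^ 'd"
  assumes "prob_space M" and "0 < T" and "brownian_motion M T W"
    and "1 / 3 < \<alpha>" and "\<alpha> < 1 / 2"
    and "geometric_rough_path T \<alpha> \<eta> \<eta>2"
    and "1 / 4 < \<beta>" and "\<beta> \<le> \<alpha>" and "0 < \<beta>'" and "\<beta>' \<le> \<beta>"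
    and "\<alpha> + \<beta> > 1 / 2" and "\<alpha> + \<beta> + \<beta>' > 1"
    and "strongly_controlled M (augmented_filtration M W) T \<eta> \<beta> \<beta>' \<infinity> F F'"
    and "controlled M (augmented_filtration M W) T \<eta> \<beta> \<beta>' \<infinity> f f'"
  shows "\<exists>(\<phi> :: real ^ 'n \<Rightarrow> real \<Rightarrow> 'a \<Rightarrow> real ^ 'n)
      (A :: real \<Rightarrow> 'a \<Rightarrow> real ^ 'n ^ 'n) (A' :: real \<Rightarrow> 'a \<Rightarrow> real ^ 'n ^ 'n ^ 'd)
      (Ainv :: real \<Rightarrow> 'a \<Rightarrow> real ^ 'n ^ 'n) (Ainv' :: real \<Rightarrow> 'a \<Rightarrow> real ^ 'n ^ 'n ^ 'd)
      (\<zeta> :: real \<Rightarrow> 'a \<Rightarrow> real ^ 'n) (\<zeta>' :: real \<Rightarrow> 'a \<Rightarrow> real ^ 'n ^ 'd).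
    (\<forall>x. (AE \<omega> in M. continuous_on {0..T} (\<lambda>t. \<phi> x t \<omega>)) \<and>
      (\<forall>m\<ge>2.
        solves_linear_eq M (augmented_filtration M W) T \<alpha> \<beta> m \<eta> \<eta>2 F F' f f' x (\<phi> x) \<and>
        (\<forall>\<psi>. solves_linear_eq M (augmented_filtration M W) T \<alpha> \<beta> m \<eta> \<eta>2 F F' f f' x \<psi> \<longrightarrow>
          (\<forall>t\<in>{0..T}. AE \<omega> in M. \<psi> t \<omega> = \<phi> x t \<omega>)))) \<and>
    (AE \<omega> in M. \<forall>t\<in>{0..T}. affine_map (\<lambda>x. \<phi> x t \<omega>) \<and> bij (\<lambda>x. \<phi> x t \<omega>)) \<and>
    strongly_controlled M (augmented_filtration M W) T \<eta> \<alpha> \<beta> \<infinity> A A' \<and>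
    (\<forall>m\<ge>2. controlled M (augmented_filtration M W) T \<eta> \<alpha> \<beta> (ennreal m) \<zeta> \<zeta>') \<and>
    (AE \<omega> in M. \<forall>t\<in>{0..T}. \<forall>x.
      \<phi> x t \<omega> = A t \<omega> *v x + \<zeta> t \<omega> \<and>
      inv (\<lambda>y. \<phi> y t \<omega>) x = Ainv t \<omega> *v x - Ainv t \<omega> *v \<zeta> t \<omega>) \<and>
    strongly_controlled M (augmented_filtration M W) T \<eta> \<alpha> \<beta> \<infinity> Ainv Ainv' \<and>
    (AE \<omega> in M. \<forall>t\<in>{0..T}. Ainv t \<omega> ** A t \<omega> = mat 1)"
proof -
 let ?Fil = "augmented_filtration M W"
 note hyp = assms
 interpret filtered_prob_space M ?Fil T
  by (rule augmented_filtration[OF hyp(1,2)]) (use hyp(3) in "simp add: brownian_motion_def")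
 have ex0: "0 < \<alpha>" "0 < \<beta>" using hyp by linarith+
 have rp: "rough_path T \<alpha> \<eta> \<eta>2" using hyp(6) by (simp add: geometric_rough_path_def)
 obtain c1 where c1: "0 <= c1" "!!s t. 0 <= s ==> s < t ==> t <= T ==> norm (\<eta> t - \<eta> s) <= c1 * (t - s) powr \<alpha>"
  using rp unfolding rough_path_def by (elim conjE holder_normD) blast
 obtain c2 where c2: "0 <= c2" "!!s t. 0 <= s ==> s < t ==> t <= T ==> norm (\<eta>2 s t) <= c2 * (t - s) powr (2 * \<alpha>)"
 proof -
  have "holder_norm T (2 * \<alpha>) \<eta>2 < \<infinity>" using rp by (simp add: rough_path_def)
  then show ?thesis by (rule holder_normD) (rule that)
 qed
 have chen: "\<eta>2 s t = \<eta>2 s u + \<eta>2 u t + tensor (\<eta> u - \<eta> s) (\<eta> t - \<eta> u)" if "0 <= s" "s < u" "u < t" "t <= T" for s u t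
 proof -
  have "\<eta>2 s t - \<eta>2 s u - \<eta>2 u t = tensor (\<eta> u - \<eta> s) (\<eta> t - \<eta> u)" using rp that by (simp add: rough_path_def)
  then show ?thesis by (simp add: algebra_simps)
 qed
 have sF: "strongly_controlled M ?Fil T \<eta> \<beta> \<beta>' \<infinity> F F'" and cf: "controlled M ?Fil T \<eta> \<beta> \<beta>' \<infinity> f f'" by (fact hyp)+
 then have cF: "controlled M ?Fil T \<eta> \<beta> \<beta>' \<infinity> F F'" and rF: "two_param_norm M T (\<beta> + \<beta>') \<infinity> (remainder \<eta> F F') < \<infinity>"
  by (simp_all add: strongly_controlled_def)
 have pF: "progressive T ?Fil F" "progressive T ?Fil F'" and pf: "progressive T ?Fil f" "progressive T ?Fil f'"
  using cF cf by (simp_all add: controlled_def)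
 obtain c3 where c3: "0 <= c3"
  "!!t. 0 <= t ==> t <= T ==> AE w in M. norm (F t w) <= c3" "!!t. 0 <= t ==> t <= T ==> AE w in M. norm (F' t w) <= c3"
  "!!s t. 0 <= s ==> s <= t ==> t <= T ==> AE w in M. norm (F t w - F s w) <= c3 * (t - s) powr \<beta>"
  "!!s t. 0 <= s ==> s <= t ==> t <= T ==> AE w in M. norm (F' t w - F' s w) <= c3 * (t - s) powr \<beta>'"
  by (rule controlled_bounded[OF cF ex0(2) hyp(9)]) blast
 obtain c4 where c4: "0 <= c4" "!!s t. 0 <= s ==> s < t ==> t <= T ==> AE w in M. norm (remainder \<eta> F F' s t w) <= c4 * (t - s) powr (\<beta> + \<beta>')"
  by (rule two_param_AE[OF rF]) blast
 obtain c5 where c5: "0 <= c5"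
  "!!t. 0 <= t ==> t <= T ==> AE w in M. norm (f t w) <= c5" "!!t. 0 <= t ==> t <= T ==> AE w in M. norm (f' t w) <= c5"
  "!!s t. 0 <= s ==> s <= t ==> t <= T ==> AE w in M. norm (f t w - f s w) <= c5 * (t - s) powr \<beta>"
  "!!s t. 0 <= s ==> s <= t ==> t <= T ==> AE w in M. norm (f' t w - f' s w) <= c5 * (t - s) powr \<beta>'"
  "!!s t. 0 <= s ==> s <= t ==> t <= T ==> AE w in M. norm (cond_expectation M (?Fil s) (remainder \<eta> f f' s t) w) <= c5 * (t - s) powr (\<beta> + \<beta>')"
  by (rule controlled_bounded[OF cf ex0(2) hyp(9)]) blast
 define C where "C = 1 + c1 + c2 + c3 + c4 + c5"
 have C: "1 <= C" "c1 <= C" "c2 <= C" "c3 <= C" "c4 <= C" "c5 <= C" using c1(1) c2(1) c3(1) c4(1) c5(1) by (auto simp: C_def)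
 have up: "AE w in M. norm (X w) <= C" if "AE w in M. norm (X w) <= c" "c <= C" for X :: "'a => 'v::real_normed_vector" and c
  using that(1) by eventually_elim (use that(2) in simp)
 have upx: "AE w in M. norm (X w) <= C * x powr e" if "AE w in M. norm (X w) <= c * x powr e" "c <= C"
  for X :: "'a => 'v::real_normed_vector" and c x e
  using that(1) by eventually_elim (rule order_trans[OF _ mult_right_mono[OF that(2) powr_ge_zero]])
 \<comment> \<open>The second level is extended by zero to the diagonal, so that degenerate steps are allowed.\<close>
 define e2 where "e2 s t = (if s < t then \<eta>2 s t else 0)" for s t
 have RL: "rough_linear M ?Fil T \<alpha> \<beta> \<beta>' C \<eta> e2 F F'"
 proof (unfold_locales, goal_cases)
  case (8 s t)
  show ?case
  proof (cases "s = t")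
   case False
   then show ?thesis using c1(2)[of s t] 8 mult_right_mono[OF C(2) powr_ge_zero[of "t - s" \<alpha>]] by linarith
  qed simp
 next
  case (9 s t)
  show ?case
  proof (cases "s = t")
   case False
   then have "norm (\<eta>2 s t) <= C * (t - s) powr (2 * \<alpha>)"
    using c2(2)[of s t] 9 mult_right_mono[OF C(3) powr_ge_zero[of "t - s" "2 * \<alpha>"]] by linarith
   then show ?thesis using False 9 by (simp add: e2_def)
  qed (simp add: e2_def)
 next
  case (10 s u t)
  have t0: "tensor a 0 = 0" "tensor 0 a = 0" for a :: "real ^ 'd" by (simp_all add: tensor_def vec_eq_iff)
  show ?case
  proof (cases "s = u \<or> u = t")
   case True
   then show ?thesis by (auto simp: e2_def t0)
  next
   case False
   then show ?thesis using chen[of s u t] 10 by (simp add: e2_def)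
  qed
 next
  case (11 t) then show ?case by (rule controlled_adapted(1)[OF cF])
 next
  case (12 t) then show ?case by (rule controlled_adapted(2)[OF cF])
 next
  case (13 t) then show ?case by (intro up[OF c3(2) C(4)])
 next
  case (14 t) then show ?case by (intro up[OF c3(3) C(4)])
 next
  case (15 s t) then show ?case by (intro upx[OF c3(4) C(4)])
 next
  case (16 s t) then show ?case by (intro upx[OF c3(5) C(4)])
 next
  case (17 s t)
  show ?case
  proof (cases "s = t")
   case True then show ?thesis by (simp add: lin_app.zero_right)
  next
   case False
   then show ?thesis using upx[OF c4(2)[of s t] C(5)] 17 by (simp add: remainder_def incr_def)
  qed
 qed (use hyp C in auto)
 \<comment> \<open>Any exponents with enough room would do; the excess of \<open>b\<close> over one is shared out in quarters.\<close>
 define b where "b = \<alpha> + \<beta> + \<beta>'"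
 define bA where "bA = 1 + (b - 1) / 2"
 define bS where "bS = 1 + (b - 1) / 4"
 define aS where "aS = max ((1 / 2 + \<alpha> + \<beta>) / 2) (\<alpha> + \<beta> - (b - 1) / 4)"
 have b1: "1 < b" using hyp by (simp add: b_def)
 have bA: "1 < bA" "bA < \<alpha> + \<beta> + \<beta>'" and bS: "1 < bS" "bS < bA" using b1 by (simp_all add: bA_def bS_def b_def field_simps)
 have aS: "1 / 2 < aS" "aS < \<alpha> + \<beta>" using hyp(11) b1 by (auto simp: aS_def less_max_iff_disj)
 have baS: "bS <= \<alpha> + aS"
 proof -
  have "\<alpha> + \<beta> - (b - 1) / 4 <= aS" by (simp add: aS_def)
  moreover have "b <= \<alpha> + (\<alpha> + \<beta>)" using hyp by (simp add: b_def)
  ultimately show ?thesis using b1 unfolding bS_def diff_divide_distrib by linarith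
 qed
 obtain A B K where AB: "0 < K" "!!w. A 0 w = mat 1"
  "!!t. 0 <= t ==> t <= T ==> A t \<in> borel_measurable (?Fil t)" "!!t. 0 <= t ==> t <= T ==> B t \<in> borel_measurable (?Fil t)"
  "!!t w. 0 <= t ==> t <= T ==> B t w ** A t w = mat 1" "!!t w. 0 <= t ==> t <= T ==> A t w ** B t w = mat 1"
  "!!t w. 0 <= t ==> t <= T ==> opn (A t w) <= K" "!!t w. 0 <= t ==> t <= T ==> opn (B t w) <= K"
  "!!s t w. 0 <= s ==> s <= t ==> t <= T ==> opn (A t w - A s w) <= K * (t - s) powr \<alpha>"
  "!!s t w. 0 <= s ==> s <= t ==> t <= T ==> opn (B t w - B s w) <= K * (t - s) powr \<alpha>"
  "!!s t. 0 <= s ==> s <= t ==> t <= T ==> AE w in M.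
    opn (A t w ** B s w - flow_matrix (F s w) (F' s w) (\<eta> t - \<eta> s) (e2 s t)) <= K * (t - s) powr bA"
  by (rule rough_linear.exists_fundamental_solution[OF RL less_imp_le[OF bA(1)] bA(2)]) blast
 have rem_f: "(%w. f t w - f s w - lin_app (f' s w) (\<eta> t - \<eta> s)) = remainder \<eta> f f' s t" for s t
  by (simp add: remainder_def[abs_def] incr_def)
 have RA: "rough_affine M ?Fil T \<alpha> \<beta> \<beta>' C \<eta> e2 F F' f f' A B K bA bS aS"
 proof (rule rough_affine.intro[OF RL], unfold_locales, goal_cases)
  case (1 t) then show ?case by (rule controlled_adapted(1)[OF cf])
 next
  case (2 t) then show ?case by (rule controlled_adapted(2)[OF cf])
 next
  case (3 t) then show ?case by (intro up[OF c5(2) C(6)])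
 next
  case (4 t) then show ?case by (intro up[OF c5(3) C(6)])
 next
  case (5 s t) then show ?case by (intro upx[OF c5(4) C(6)])
 next
  case (6 s t) then show ?case by (intro upx[OF c5(5) C(6)])
 next
  case (7 s t) then show ?case unfolding rem_f by (intro upx[OF c5(6) C(6)])
 qed (fact bA bS aS baS AB | rule AB; assumption)+
 obtain I where I: "!!w. continuous_on {0..T} (%t. I t w)" "!!t. 0 <= t ==> t <= T ==> I t \<in> borel_measurable (?Fil t)"
  "AE w in M. I 0 w = 0"
  "!!p. even p ==> 2 <= p ==> \<exists>k\<ge>0. \<forall>s t. 0 <= s --> s <= t --> t <= T -->
    mom_le M p (k * (t - s) powr \<alpha>) (%w. I t w - I s w) &
    mom_le M p (k * (t - s) powr aS) (%w. I t w - I s w - B t w *v rough_affine.src \<eta> e2 F f f' s t w) &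
    mom_le M p (k * (t - s) powr bS) (cond_expectation M (?Fil s) (%w. I t w - I s w - B t w *v rough_affine.src \<eta> e2 F f f' s t w))"
  by (rule rough_affine.exists_transported_solution[OF RA]) blast
 interpret RS: rough_solution M ?Fil T \<alpha> \<beta> \<beta>' C \<eta> e2 F F' f f' A B K bA bS aS I
  by (rule rough_solution.intro[OF RA], rule rough_solution_axioms.intro) (fact AB I | rule AB I; assumption)+
 have \<eta>2: "!!s t. 0 <= s ==> s < t ==> t <= T ==> \<eta>2 s t = e2 s t" by (simp add: e2_def)
 have phi: "RS.phi x t w = A t w *v x + RS.phi 0 t w" for x t w by (simp add: RS.phi_def)
 have aff: "affine_map (%x. RS.phi x t w)" "bij (%x. RS.phi x t w)" "inv (%y. RS.phi y t w) x = B t w *v x - B t w *v RS.phi 0 t w"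
  if t: "t \<in> {0..T}" for x t w
 proof -
  have t': "0 <= t" "t <= T" using t by auto
  have eq: "(%x. RS.phi x t w) = (%x. A t w *v x + RS.phi 0 t w)" by (rule ext) (rule phi)
  show "affine_map (%x. RS.phi x t w)" "bij (%x. RS.phi x t w)" "inv (%y. RS.phi y t w) x = B t w *v x - B t w *v RS.phi 0 t w"
   unfolding eq by (rule affine_inverse[OF AB(5)[OF t'] AB(6)[OF t']])+
 qed
 show ?thesis
 proof (rule exI[of _ RS.phi], rule exI[of _ A], rule exI[of _ "%t w. left_deriv (F t w) (A t w)"], rule exI[of _ B],
   rule exI[of _ "%t w. right_deriv (F t w) (B t w)"], rule exI[of _ "RS.phi 0"], rule exI[of _ "integrand F f (RS.phi 0)"],
   intro conjI allI impI ballI)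
  show "AE w in M. continuous_on {0..T} (%t. RS.phi x t w)" for x by (rule AE_I2) (rule RS.phi_continuous[OF I(1)])
  show "solves_linear_eq M ?Fil T \<alpha> \<beta> m \<eta> \<eta>2 F F' f f' x (RS.phi x)" if "2 <= m" for x m
   by (rule RS.phi_solves[OF \<eta>2 pF pf I(1) that])
  show "AE w in M. \<psi> t w = RS.phi x t w"
   if "2 <= m" "solves_linear_eq M ?Fil T \<alpha> \<beta> m \<eta> \<eta>2 F F' f f' x \<psi>" "t \<in> {0..T}" for x m \<psi> t
   by (rule RS.solution_unique[OF \<eta>2 that(2,1)]) (use that(3) in auto)
  show "AE w in M. \<forall>t\<in>{0..T}. affine_map (%x. RS.phi x t w) & bij (%x. RS.phi x t w)"
   by (rule AE_I2) (use aff in blast)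
  show "strongly_controlled M ?Fil T \<eta> \<alpha> \<beta> \<infinity> A (%t w. left_deriv (F t w) (A t w))" by (rule RS.A_controlled[OF pF(1)])
  show "strongly_controlled M ?Fil T \<eta> \<alpha> \<beta> \<infinity> B (%t w. right_deriv (F t w) (B t w))" by (rule RS.B_controlled[OF pF(1)])
  show "controlled M ?Fil T \<eta> \<alpha> \<beta> (ennreal m) (RS.phi 0) (integrand F f (RS.phi 0))" if "2 <= m" for m
   by (rule RS.phi_controlled(1)[OF pF pf I(1) that])
  show "AE w in M. \<forall>t\<in>{0..T}. \<forall>x. RS.phi x t w = A t w *v x + RS.phi 0 t w &
    inv (%y. RS.phi y t w) x = B t w *v x - B t w *v RS.phi 0 t w"
   by (rule AE_I2) (use phi aff(3) in blast)
  show "AE w in M. \<forall>t\<in>{0..T}. B t w ** A t w = mat 1" by (rule AE_I2) (use AB(5) in simp)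
 qed
qed

end
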